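(* Let $K$ be an algebraically closed field of characteristic $p\geq 3$ and let $m\geq 2$ be an integer. Then the smooth quadric hypersurface $Q_{2m}\subset\mathbb{P}^{2m+1}_K$ (of even dimension $2m$) is not $D$-affine.
   Context: For a smooth projective variety $X$ over an algebraically closed field $K$, the sheaf $\mathscr{D}_X$ of $K$-linear (Grothendieck) differential operators is $\mathscr{D}_X=\bigcup_{k\ge 0}\mathscr{D}_X^{\le k}\subset \mathscr{E}nd_K(\mathscr{O}_X)$, where $\mathscr{D}_X^{\le -1}=0$ and $\mathscr{D}_X^{\le k}=\{\varphi\in\mathscr{E}nd_K(\mathscr{O}_X): \varphi a-a\varphi\in \mathscr{D}_X^{\le k-1}\text{ for all }a\in\mathscr{O}_X\}$ (with $a\in\mathscr{O}_X$ acting by multiplication). A $D$-module is a left $\mathscr{D}_X$-module that is quasi-coherent as a left $\mathscr{O}_X$-module. $X$ is $D$-quasi-affine if every $D$-module is generated, as a $\mathscr{D}_X$-module, by its global sections. $X$ is $D$-affine if it is $D$-quasi-affine and $H^i(X,M)=0$ for all $i>0$ and all $D$-modules $M$. A smooth quadric hypersurface $Q_n\subset\mathbb{P}^{n+1}_K$ is a smooth hypersurface cut out by a section of $\mathscr{O}_{\mathbb{P}^{n+1}}(2)$; it is unique up to isomorphism. *)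

theory Defs
  imports
    "HOL-Analysis.Abstract_Topology"
    "HOL-Computational_Algebra.Polynomial"
    "HOL-Algebra.Elementary_Groups"
    "HOL-Algebra.Module"
begin

section \<open>Sheaves of abelian groups\<close>

locale ab_sheaf =
  fixes T :: "'p topology"
    and F :: "'p set \<Rightarrow> ('c, 'm) monoid_scheme"
    and r :: "'p set \<Rightarrow> 'p set \<Rightarrow> 'c \<Rightarrow> 'c"
  assumes comm_group_sections: "openin T U \<Longrightarrow> comm_group (F U)"
    and res_hom: "\<lbrakk>openin T U; openin T V; V \<subseteq> U\<rbrakk> \<Longrightarrow> r U V \<in> hom (F U) (F V)"
    and res_id: "\<lbrakk>openin T U; s \<in> carrier (F U)\<rbrakk> \<Longrightarrow> r U U s = s"
    and res_res: "\<lbrakk>openin T U; openin T V; openin T W; W \<subseteq> V; V \<subseteq> U; s \<in> carrier (F U)\<rbrakk>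
        \<Longrightarrow> r V W (r U V s) = r U W s"
    and gluing: "\<lbrakk>\<And>V. V \<in> \<U> \<Longrightarrow> openin T V;
          \<And>V. V \<in> \<U> \<Longrightarrow> \<sigma> V \<in> carrier (F V);
          \<And>V W. \<lbrakk>V \<in> \<U>; W \<in> \<U>\<rbrakk> \<Longrightarrow> r V (V \<inter> W) (\<sigma> V) = r W (V \<inter> W) (\<sigma> W)\<rbrakk>
        \<Longrightarrow> \<exists>!s. s \<in> carrier (F (\<Union>\<U>)) \<and> (\<forall>V\<in>\<U>. r (\<Union>\<U>) V s = \<sigma> V)"


section \<open>Sheaf cohomology\<close>

text \<open>
  Cohomology is computed from Godement's canonical flasque resolution
  \<open>0 \<rightarrow> F \<rightarrow> C\<^sup>0 \<rightarrow> C\<^sup>1 \<rightarrow> \<dots>\<close>.  Here \<open>C\<^sup>0(U)\<close> is the product of the stalks of \<open>F\<close> at the points of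
  \<open>U\<close>, and \<open>C\<^sup>n\<^sup>+\<^sup>1(U)\<close> is the product over \<open>x \<in> U\<close> of the stalks at \<open>x\<close> of the cokernel of the
  previous map, i.e. of \<open>C\<^sup>n\<^sub>x\<close> modulo the image of \<open>C\<^sup>n\<^sup>-\<^sup>1\<^sub>x\<close> (of \<open>F\<^sub>x\<close> if \<open>n = 0\<close>).

  All these sheaves have to live in a single type.  A germ is therefore represented by a chosen
  pair \<open>(V, s)\<close> consisting of an open neighbourhood and a section, and the following datatype
  collects the sections of \<open>F\<close> (constructor \<open>Base\<close>) and, recursively, families of germs
  (constructor \<open>Fam\<close>).
\<close>

datatype ('p, 'c) cochain =
    Base (the_base: 'c)
  | Fam (the_fam: "'p \<Rightarrow> 'p set \<times> ('p, 'c) cochain")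

text \<open>
  One stage of the resolution: a presheaf of groups with its restriction maps, together with the
  subpresheaf \<open>im\<close> given by the image of the preceding stage.
\<close>

record ('p, 'c) stage =
  grp :: "'p set \<Rightarrow> 'c monoid"
  res :: "'p set \<Rightarrow> 'p set \<Rightarrow> 'c \<Rightarrow> 'c"
  im :: "'p set \<Rightarrow> 'c set"

definition germ_eq :: "'p topology \<Rightarrow> ('p, 'c) stage \<Rightarrow> 'p \<Rightarrow> 'p set \<times> 'c \<Rightarrow> 'p set \<times> 'c \<Rightarrow> bool" where
  "germ_eq T S x = (\<lambda>(V, s) (W, t). \<exists>N. openin T N \<and> x \<in> N \<and> N \<subseteq> V \<inter> W \<and>
     res S V N s \<otimes>\<^bsub>grp S N\<^esub> inv\<^bsub>grp S N\<^esub> (res S W N t) \<in> im S N)"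

definition local_sections :: "'p topology \<Rightarrow> ('p, 'c) stage \<Rightarrow> 'p \<Rightarrow> ('p set \<times> 'c) set" where
  "local_sections T S x = {(V, s). openin T V \<and> x \<in> V \<and> s \<in> carrier (grp S V)}"

definition germ :: "'p topology \<Rightarrow> ('p, 'c) stage \<Rightarrow> 'p \<Rightarrow> 'p set \<times> 'c \<Rightarrow> 'p set \<times> 'c" where
  "germ T S x a = (SOME b. b \<in> local_sections T S x \<and> germ_eq T S x a b)"

definition stalk_mult :: "'p topology \<Rightarrow> ('p, 'c) stage \<Rightarrow> 'p
    \<Rightarrow> 'p set \<times> 'c \<Rightarrow> 'p set \<times> 'c \<Rightarrow> 'p set \<times> 'c" where
  "stalk_mult T S x = (\<lambda>(V, s) (W, t).
     germ T S x (V \<inter> W, res S V (V \<inter> W) s \<otimes>\<^bsub>grp S (V \<inter> W)\<^esub> res S W (V \<inter> W) t))"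

definition germ_family :: "'p topology \<Rightarrow> ('p, ('p, 'c) cochain) stage
    \<Rightarrow> 'p set \<Rightarrow> ('p, 'c) cochain \<Rightarrow> ('p, 'c) cochain" where
  "germ_family T S U s = Fam (\<lambda>x\<in>U. germ T S x (U, s))"

definition next_stage :: "'p topology \<Rightarrow> ('p, ('p, 'c) cochain) stage
    \<Rightarrow> ('p, ('p, 'c) cochain) stage" where
  "next_stage T S =
     \<lparr>grp = (\<lambda>U. \<lparr>carrier = Fam ` (\<Pi>\<^sub>E x\<in>U. germ T S x ` local_sections T S x),
                  monoid.mult = (\<lambda>f g. Fam (\<lambda>x\<in>U. stalk_mult T S x (the_fam f x) (the_fam g x))),
                  one = germ_family T S U \<one>\<^bsub>grp S U\<^esub>\<rparr>),
      res = (\<lambda>U V f. Fam (restrict (the_fam f) V)),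
      im = (\<lambda>U. germ_family T S U ` carrier (grp S U))\<rparr>"

definition base_stage :: "('p set \<Rightarrow> ('c, 'm) monoid_scheme) \<Rightarrow> ('p set \<Rightarrow> 'p set \<Rightarrow> 'c \<Rightarrow> 'c)
    \<Rightarrow> ('p, ('p, 'c) cochain) stage" where
  "base_stage F r =
     \<lparr>grp = (\<lambda>U. \<lparr>carrier = Base ` carrier (F U),
                  monoid.mult = (\<lambda>a b. Base (the_base a \<otimes>\<^bsub>F U\<^esub> the_base b)),
                  one = Base \<one>\<^bsub>F U\<^esub>\<rparr>),
      res = (\<lambda>U V a. Base (r U V (the_base a))),
      im = (\<lambda>U. {Base \<one>\<^bsub>F U\<^esub>})\<rparr>"

definition godement :: "'p topology \<Rightarrow> ('p set \<Rightarrow> ('c, 'm) monoid_scheme)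
    \<Rightarrow> ('p set \<Rightarrow> 'p set \<Rightarrow> 'c \<Rightarrow> 'c) \<Rightarrow> nat \<Rightarrow> ('p, ('p, 'c) cochain) stage" where
  "godement T F r n = (next_stage T ^^ Suc n) (base_stage F r)"

text \<open>
  \<open>H\<^sup>n(X, F)\<close> is the \<open>n\<close>-th cohomology group of the complex of global sections of
  \<open>C\<^sup>0 \<rightarrow> C\<^sup>1 \<rightarrow> \<dots>\<close>.  The differential of \<open>C\<^sup>n\<close> is \<open>germ_family T (godement T F r n)\<close>; the incoming
  map of \<open>C\<^sup>0\<close> in this complex is zero.
\<close>

definition cohomology :: "'p topology \<Rightarrow> ('p set \<Rightarrow> ('c, 'm) monoid_scheme)
    \<Rightarrow> ('p set \<Rightarrow> 'p set \<Rightarrow> 'c \<Rightarrow> 'c) \<Rightarrow> nat \<Rightarrow> ('p, 'c) cochain set monoid" where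
  "cohomology T F r n =
    (let X = topspace T;
         C = (\<lambda>i. grp (godement T F r i) X);
         Z = kernel (C n) (C (Suc n)) (germ_family T (godement T F r n) X);
         B = (if n = 0 then {\<one>\<^bsub>C n\<^esub>} else im (godement T F r n) X)
     in (C n)\<lparr>carrier := Z\<rparr> Mod B)"


section \<open>Differential operators\<close>

text \<open>
  Throughout, \<open>\<O>\<close> is a sheaf of \<open>'k\<close>-valued functions on \<open>T\<close>: \<open>\<O> U\<close> is the set of sections over
  \<open>U\<close>, and sections are extended by zero outside \<open>U\<close>, so that distinct sections over \<open>U\<close> are
  distinct functions.
\<close>

definition fres :: "'p set \<Rightarrow> ('p \<Rightarrow> 'k::field) \<Rightarrow> 'p \<Rightarrow> 'k" where
  "fres V f = (\<lambda>p. if p \<in> V then f p else 0)"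

text \<open>
  A section over \<open>U\<close> of the sheaf of endomorphisms of \<open>\<O>\<close> is a family of maps \<open>\<O> V \<rightarrow> \<O> V\<close>, one
  for each open \<open>V \<subseteq> U\<close>.  Again such families are extended by zero.
\<close>

type_synonym ('p, 'k) oper = "'p set \<Rightarrow> ('p \<Rightarrow> 'k) \<Rightarrow> 'p \<Rightarrow> 'k"

definition op_ext :: "'p topology \<Rightarrow> ('p set \<Rightarrow> ('p \<Rightarrow> 'k::field) set) \<Rightarrow> 'p set
    \<Rightarrow> ('p, 'k) oper \<Rightarrow> ('p, 'k) oper" where
  "op_ext T \<O> U \<phi> = (\<lambda>V f. if openin T V \<and> V \<subseteq> U \<and> f \<in> \<O> V then \<phi> V f else (\<lambda>_. 0))"

definition op_res :: "'p set \<Rightarrow> ('p, 'k::field) oper \<Rightarrow> ('p, 'k) oper" where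
  "op_res W \<phi> = (\<lambda>V f. if V \<subseteq> W then \<phi> V f else (\<lambda>_. 0))"

definition op_scalar :: "'p topology \<Rightarrow> ('p set \<Rightarrow> ('p \<Rightarrow> 'k::field) set) \<Rightarrow> 'p set
    \<Rightarrow> ('p \<Rightarrow> 'k) \<Rightarrow> ('p, 'k) oper" where
  "op_scalar T \<O> U a = op_ext T \<O> U (\<lambda>V f p. a p * f p)"

definition End_sheaf :: "'p topology \<Rightarrow> ('p set \<Rightarrow> ('p \<Rightarrow> 'k::field) set) \<Rightarrow> 'p set
    \<Rightarrow> ('p, 'k) oper set" where
  "End_sheaf T \<O> U = {\<phi>. op_ext T \<O> U \<phi> = \<phi> \<and>
     (\<forall>V. openin T V \<and> V \<subseteq> U \<longrightarrow>
        (\<forall>f\<in>\<O> V. \<phi> V f \<in> \<O> V) \<and>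
        (\<forall>f\<in>\<O> V. \<forall>g\<in>\<O> V. \<phi> V (\<lambda>p. f p + g p) = (\<lambda>p. \<phi> V f p + \<phi> V g p)) \<and>
        (\<forall>c. \<forall>f\<in>\<O> V. \<phi> V (\<lambda>p. c * f p) = (\<lambda>p. c * \<phi> V f p)) \<and>
        (\<forall>W. openin T W \<and> W \<subseteq> V \<longrightarrow> (\<forall>f\<in>\<O> V. \<phi> W (fres W f) = fres W (\<phi> V f))))}"

definition commutator :: "('p, 'k::field) oper \<Rightarrow> ('p, 'k) oper \<Rightarrow> ('p, 'k) oper" where
  "commutator \<phi> \<psi> = (\<lambda>V f p. \<phi> V (\<psi> V f) p - \<psi> V (\<phi> V f) p)"

text \<open>\<open>diffop_lt T \<O> k U\<close> is the set of sections over \<open>U\<close> of the operators of order \<open>\<le> k - 1\<close>.\<close>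

primrec diffop_lt :: "'p topology \<Rightarrow> ('p set \<Rightarrow> ('p \<Rightarrow> 'k::field) set) \<Rightarrow> nat \<Rightarrow> 'p set
    \<Rightarrow> ('p, 'k) oper set" where
  "diffop_lt T \<O> 0 U = {\<lambda>V f p. 0}"
| "diffop_lt T \<O> (Suc k) U = {\<phi> \<in> End_sheaf T \<O> U.
     \<forall>V. openin T V \<and> V \<subseteq> U \<longrightarrow>
       (\<forall>a\<in>\<O> V. commutator (op_res V \<phi>) (op_scalar T \<O> V a) \<in> diffop_lt T \<O> k V)}"

text \<open>The union over all orders is taken in the category of sheaves.\<close>

definition diffops :: "'p topology \<Rightarrow> ('p set \<Rightarrow> ('p \<Rightarrow> 'k::field) set) \<Rightarrow> 'p set
    \<Rightarrow> ('p, 'k) oper set" where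
  "diffops T \<O> U = {\<phi> \<in> End_sheaf T \<O> U.
     \<forall>x\<in>U. \<exists>V k. openin T V \<and> x \<in> V \<and> V \<subseteq> U \<and> op_res V \<phi> \<in> diffop_lt T \<O> k V}"

definition diff_ring :: "'p topology \<Rightarrow> ('p set \<Rightarrow> ('p \<Rightarrow> 'k::field) set) \<Rightarrow> 'p set
    \<Rightarrow> ('p, 'k) oper ring" where
  "diff_ring T \<O> U =
     \<lparr>carrier = diffops T \<O> U,
      monoid.mult = (\<lambda>\<phi> \<psi> V f. \<phi> V (\<psi> V f)),
      one = op_ext T \<O> U (\<lambda>V f. f),
      zero = (\<lambda>V f p. 0),
      add = (\<lambda>\<phi> \<psi> V f p. \<phi> V f p + \<psi> V f p)\<rparr>"


section \<open>D-modules\<close>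

text \<open>The library's module locale is restricted to commutative rings.\<close>

locale left_module =
  fixes R :: "('r, 'm) ring_scheme" and M :: "('r, 'b, 'n) module_scheme"
  assumes ring: "ring R"
    and abelian_group: "abelian_group M"
    and smult_closed: "\<lbrakk>P \<in> carrier R; s \<in> carrier M\<rbrakk> \<Longrightarrow> P \<odot>\<^bsub>M\<^esub> s \<in> carrier M"
    and smult_l_distr: "\<lbrakk>P \<in> carrier R; Q \<in> carrier R; s \<in> carrier M\<rbrakk>
        \<Longrightarrow> (P \<oplus>\<^bsub>R\<^esub> Q) \<odot>\<^bsub>M\<^esub> s = (P \<odot>\<^bsub>M\<^esub> s) \<oplus>\<^bsub>M\<^esub> (Q \<odot>\<^bsub>M\<^esub> s)"
    and smult_r_distr: "\<lbrakk>P \<in> carrier R; s \<in> carrier M; t \<in> carrier M\<rbrakk>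
        \<Longrightarrow> P \<odot>\<^bsub>M\<^esub> (s \<oplus>\<^bsub>M\<^esub> t) = (P \<odot>\<^bsub>M\<^esub> s) \<oplus>\<^bsub>M\<^esub> (P \<odot>\<^bsub>M\<^esub> t)"
    and smult_assoc: "\<lbrakk>P \<in> carrier R; Q \<in> carrier R; s \<in> carrier M\<rbrakk>
        \<Longrightarrow> (P \<otimes>\<^bsub>R\<^esub> Q) \<odot>\<^bsub>M\<^esub> s = P \<odot>\<^bsub>M\<^esub> (Q \<odot>\<^bsub>M\<^esub> s)"
    and smult_one: "s \<in> carrier M \<Longrightarrow> \<one>\<^bsub>R\<^esub> \<odot>\<^bsub>M\<^esub> s = s"

text \<open>
  Sections over \<open>V\<close> of the free \<open>\<O>\<close>-module with basis \<open>S\<close>, and their images under the morphism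
  to \<open>M\<close> that sends the basis element \<open>g \<in> S\<close> to the section \<open>g\<close> of \<open>M\<close> over \<open>U \<supseteq> V\<close>.
\<close>

definition free_sections :: "('p set \<Rightarrow> ('p \<Rightarrow> 'k::field) set) \<Rightarrow> 'b set \<Rightarrow> 'p set
    \<Rightarrow> ('b \<Rightarrow> 'p \<Rightarrow> 'k) set" where
  "free_sections \<O> S V =
     {a. (\<forall>g\<in>S. a g \<in> \<O> V) \<and> (\<forall>g. g \<notin> S \<longrightarrow> a g = (\<lambda>_. 0)) \<and> finite {g. a g \<noteq> (\<lambda>_. 0)}}"

definition lincomb :: "'p topology \<Rightarrow> ('p set \<Rightarrow> ('p \<Rightarrow> 'k::field) set)
    \<Rightarrow> ('p set \<Rightarrow> (('p, 'k) oper, 'b, 'n) module_scheme) \<Rightarrow> ('p set \<Rightarrow> 'p set \<Rightarrow> 'b \<Rightarrow> 'b)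
    \<Rightarrow> 'p set \<Rightarrow> 'p set \<Rightarrow> ('b \<Rightarrow> 'p \<Rightarrow> 'k) \<Rightarrow> 'b" where
  "lincomb T \<O> M r U V a =
     (\<Oplus>\<^bsub>M V\<^esub>g\<in>{g. a g \<noteq> (\<lambda>_. 0)}. op_scalar T \<O> V (a g) \<odot>\<^bsub>M V\<^esub> r U V g)"

text \<open>
  Quasi-coherence: every point has an open neighbourhood \<open>U\<close> with an exact sequence
  \<open>\<O>\<^sup>(\<^sup>R\<^sup>) \<rightarrow> \<O>\<^sup>(\<^sup>S\<^sup>) \<rightarrow> M \<rightarrow> 0\<close> of sheaves on \<open>U\<close>.  Without loss of generality the index sets are sets
  of sections (repeated generators can be removed).  The three clauses say that the composition
  is zero, that the second map is surjective, and that the kernel of the second map is contained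
  in the image of the first.  Sections of free modules are families of finite support, which is
  correct since every open subset of a Noetherian space is quasi-compact.
\<close>

definition quasi_coherent :: "'p topology \<Rightarrow> ('p set \<Rightarrow> ('p \<Rightarrow> 'k::field) set)
    \<Rightarrow> ('p set \<Rightarrow> (('p, 'k) oper, 'b, 'n) module_scheme) \<Rightarrow> ('p set \<Rightarrow> 'p set \<Rightarrow> 'b \<Rightarrow> 'b)
    \<Rightarrow> bool" where
  "quasi_coherent T \<O> M r \<longleftrightarrow>
     (\<forall>x\<in>topspace T. \<exists>U. openin T U \<and> x \<in> U \<and>
       (\<exists>S R. S \<subseteq> carrier (M U) \<and> R \<subseteq> free_sections \<O> S U \<and>
          (\<forall>c\<in>R. lincomb T \<O> M r U U c = \<zero>\<^bsub>M U\<^esub>) \<and>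
          (\<forall>V s y. openin T V \<and> V \<subseteq> U \<and> s \<in> carrier (M V) \<and> y \<in> V \<longrightarrow>
             (\<exists>W a. openin T W \<and> y \<in> W \<and> W \<subseteq> V \<and> a \<in> free_sections \<O> S W \<and>
                r V W s = lincomb T \<O> M r U W a)) \<and>
          (\<forall>V a y. openin T V \<and> V \<subseteq> U \<and> a \<in> free_sections \<O> S V \<and>
                   lincomb T \<O> M r U V a = \<zero>\<^bsub>M V\<^esub> \<and> y \<in> V \<longrightarrow>
             (\<exists>W b. openin T W \<and> y \<in> W \<and> W \<subseteq> V \<and> b \<in> free_sections \<O> R W \<and>
                (\<forall>g. fres W (a g) = (\<lambda>p. \<Sum>c\<in>{c. b c \<noteq> (\<lambda>_. 0)}. b c p * c g p))))))"

locale D_module =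
  fixes T :: "'p topology"
    and \<O> :: "'p set \<Rightarrow> ('p \<Rightarrow> 'k::field) set"
    and M :: "'p set \<Rightarrow> (('p, 'k) oper, 'b) module"
    and r :: "'p set \<Rightarrow> 'p set \<Rightarrow> 'b \<Rightarrow> 'b"
  assumes sheaf: "ab_sheaf T (\<lambda>U. add_monoid (M U)) r"
    and left_module: "openin T U \<Longrightarrow> left_module (diff_ring T \<O> U) (M U)"
    and res_smult: "\<lbrakk>openin T U; openin T V; V \<subseteq> U; P \<in> diffops T \<O> U; s \<in> carrier (M U)\<rbrakk>
        \<Longrightarrow> r U V (P \<odot>\<^bsub>M U\<^esub> s) = op_res V P \<odot>\<^bsub>M V\<^esub> r U V s"
    and quasi_coherent: "quasi_coherent T \<O> M r"

definition globally_generated :: "'p topology \<Rightarrow> ('p set \<Rightarrow> ('p \<Rightarrow> 'k::field) set)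
    \<Rightarrow> ('p set \<Rightarrow> (('p, 'k) oper, 'b) module) \<Rightarrow> ('p set \<Rightarrow> 'p set \<Rightarrow> 'b \<Rightarrow> 'b) \<Rightarrow> bool" where
  "globally_generated T \<O> M r \<longleftrightarrow>
     (\<forall>U s x. openin T U \<and> s \<in> carrier (M U) \<and> x \<in> U \<longrightarrow>
       (\<exists>V G P. openin T V \<and> x \<in> V \<and> V \<subseteq> U \<and>
          finite G \<and> G \<subseteq> carrier (M (topspace T)) \<and> (\<forall>g\<in>G. P g \<in> diffops T \<O> V) \<and>
          r U V s = (\<Oplus>\<^bsub>M V\<^esub>g\<in>G. P g \<odot>\<^bsub>M V\<^esub> r (topspace T) V g)))"

text \<open>
  The type argument \<open>'b\<close> is the universe in which the sections of the D-modules live.  For a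
  variety over \<open>K\<close> the notions below do not depend on \<open>'b\<close> as soon as \<open>K\<close> embeds into it: every
  D-module is the filtered union of its submodules generated by a coherent \<open>\<O>\<close>-submodule, these
  have at most as many sections as \<open>K\<close> has elements, and both conditions can be tested on them
  because cohomology on a Noetherian space commutes with filtered unions.
\<close>

definition D_quasi_affine :: "'b itself \<Rightarrow> 'p topology \<Rightarrow> ('p set \<Rightarrow> ('p \<Rightarrow> 'k::field) set) \<Rightarrow> bool" where
  "D_quasi_affine _ T \<O> \<longleftrightarrow>
     (\<forall>(M :: 'p set \<Rightarrow> (('p, 'k) oper, 'b) module) r.
        D_module T \<O> M r \<longrightarrow> globally_generated T \<O> M r)"

definition D_affine :: "'b itself \<Rightarrow> 'p topology \<Rightarrow> ('p set \<Rightarrow> ('p \<Rightarrow> 'k::field) set) \<Rightarrow> bool" where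
  "D_affine _ T \<O> \<longleftrightarrow> D_quasi_affine TYPE('b) T \<O> \<and>
     (\<forall>(M :: 'p set \<Rightarrow> (('p, 'k) oper, 'b) module) r i.
        D_module T \<O> M r \<and> i > 0 \<longrightarrow>
          trivial_group (cohomology T (\<lambda>U. add_monoid (M U)) r i))"


section \<open>Projective varieties and quadrics\<close>

text \<open>
  Over an algebraically closed field a variety is given by its closed points, the Zariski
  topology and the sheaf of regular functions.  Vectors of \<open>K\<^sup>n\<^sup>+\<^sup>1\<close> are functions vanishing at all
  indices \<open>> n\<close>; a point of projective space is the set of its homogeneous coordinate vectors.
\<close>

definition coord_space :: "nat \<Rightarrow> (nat \<Rightarrow> 'k::field) set" where
  "coord_space n = {v. \<forall>i>n. v i = 0}"

definition proj_space :: "nat \<Rightarrow> (nat \<Rightarrow> 'k::field) set set" where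
  "proj_space n = {{\<lambda>i. c * v i | c. c \<noteq> 0} | v. v \<in> coord_space n \<and> v \<noteq> (\<lambda>_. 0)}"

definition homogeneous_polys :: "nat \<Rightarrow> nat \<Rightarrow> ((nat \<Rightarrow> 'k::field) \<Rightarrow> 'k) set" where
  "homogeneous_polys n d =
     {\<lambda>v. \<Sum>\<alpha>\<in>A. c \<alpha> * (\<Prod>i\<le>n. v i ^ \<alpha> i) | A (c :: (nat \<Rightarrow> nat) \<Rightarrow> 'k).
        finite A \<and> (\<forall>\<alpha>\<in>A. (\<Sum>i\<le>n. \<alpha> i) = d)}"

definition zariski_open :: "nat \<Rightarrow> (nat \<Rightarrow> 'k::field) set set \<Rightarrow> (nat \<Rightarrow> 'k) set set \<Rightarrow> bool" where
  "zariski_open n X U \<longleftrightarrow>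
     (\<exists>S \<subseteq> (\<Union>d. homogeneous_polys n d). U = {p \<in> X. \<exists>f\<in>S. \<forall>v\<in>p. f v \<noteq> 0})"

definition zariski :: "nat \<Rightarrow> (nat \<Rightarrow> 'k::field) set set \<Rightarrow> (nat \<Rightarrow> 'k) set topology" where
  "zariski n X = topology (zariski_open n X)"

lemma istopology_zariski_open: "istopology (zariski_open n (X :: (nat \<Rightarrow> 'k::field) set set))"
proof -
  have mult: "\<exists>d. (\<lambda>v. f v * g v) \<in> homogeneous_polys n d"
    if fg: "f \<in> homogeneous_polys n d1" "g \<in> homogeneous_polys n d2" for f g :: "(nat \<Rightarrow> 'k) \<Rightarrow> 'k" and d1 d2
  proof -
    obtain A c where f: "f = (\<lambda>v. \<Sum>\<alpha>\<in>A. c \<alpha> * (\<Prod>i\<le>n. v i ^ \<alpha> i))" "finite A" "\<forall>\<alpha>\<in>A. (\<Sum>i\<le>n. \<alpha> i) = d1"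
      using fg unfolding homogeneous_polys_def by blast
    obtain B e where g: "g = (\<lambda>v. \<Sum>\<alpha>\<in>B. e \<alpha> * (\<Prod>i\<le>n. v i ^ \<alpha> i))" "finite B" "\<forall>\<alpha>\<in>B. (\<Sum>i\<le>n. \<alpha> i) = d2"
      using fg unfolding homogeneous_polys_def by blast
    define s where "s = (\<lambda>(\<alpha>::nat\<Rightarrow>nat,\<beta>::nat\<Rightarrow>nat) i. \<alpha> i + \<beta> i)"
    define k where "k \<gamma> = (\<Sum>z\<in>{z\<in>A\<times>B. s z = \<gamma>}. c (fst z) * e (snd z))" for \<gamma>
    have "f v * g v = (\<Sum>\<gamma>\<in>s ` (A\<times>B). k \<gamma> * (\<Prod>i\<le>n. v i ^ \<gamma> i))" for v
    proof -
      have "f v * g v = (\<Sum>z\<in>A\<times>B. (c (fst z) * e (snd z)) * (\<Prod>i\<le>n. v i ^ s z i))"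
        by (simp add: f g sum_product sum.cartesian_product s_def case_prod_unfold power_add prod.distrib mult_ac)
      also have "\<dots> = (\<Sum>\<gamma>\<in>s ` (A\<times>B). \<Sum>z\<in>{z\<in>A\<times>B. s z = \<gamma>}. (c (fst z) * e (snd z)) * (\<Prod>i\<le>n. v i ^ s z i))"
        by (rule sum.image_gen) (use f g in simp)
      also have "\<dots> = (\<Sum>\<gamma>\<in>s ` (A\<times>B). k \<gamma> * (\<Prod>i\<le>n. v i ^ \<gamma> i))"
        by (simp add: k_def sum_distrib_right)
      finally show ?thesis .
    qed
    then have "(\<lambda>v. f v * g v) = (\<lambda>v. \<Sum>\<gamma>\<in>s ` (A\<times>B). k \<gamma> * (\<Prod>i\<le>n. v i ^ \<gamma> i))" by blast
    moreover have "finite (s ` (A\<times>B))" "\<forall>\<gamma>\<in>s ` (A\<times>B). (\<Sum>i\<le>n. \<gamma> i) = d1 + d2"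
      using f g by (auto simp: s_def sum.distrib)
    ultimately have "(\<lambda>v. f v * g v) \<in> homogeneous_polys n (d1+d2)"
      unfolding homogeneous_polys_def by blast
    then show ?thesis by blast
  qed
  show ?thesis unfolding istopology_def
  proof (intro conjI allI impI)
    fix U V assume "zariski_open n X U" "zariski_open n X V"
    then obtain S R where S: "S \<subseteq> (\<Union>d. homogeneous_polys n d)" "U = {p \<in> X. \<exists>f\<in>S. \<forall>v\<in>p. f v \<noteq> 0}"
     and R: "R \<subseteq> (\<Union>d. homogeneous_polys n d)" "V = {p \<in> X. \<exists>f\<in>R. \<forall>v\<in>p. f v \<noteq> 0}"
      unfolding zariski_open_def by blast
    let ?S = "{\<lambda>v. f v * g v | f g. f \<in> S \<and> g \<in> R}"
    have "?S \<subseteq> (\<Union>d. homogeneous_polys n d)"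
    proof
      fix k assume "k \<in> ?S"
      then obtain f g where k: "k = (\<lambda>v. f v * g v)" "f \<in> S" "g \<in> R" by blast
      then obtain d1 d2 where "f \<in> homogeneous_polys n d1" "g \<in> homogeneous_polys n d2" using S(1) R(1) by fast
      then show "k \<in> (\<Union>d. homogeneous_polys n d)" using mult k(1) by simp
    qed
    moreover have "U \<inter> V = {p \<in> X. \<exists>f\<in>?S. \<forall>v\<in>p. f v \<noteq> 0}"
    proof (intro equalityI subsetI)
      fix p assume "p \<in> U \<inter> V"
      then obtain f g where fg: "p \<in> X" "f \<in> S" "\<forall>v\<in>p. f v \<noteq> 0" "g \<in> R" "\<forall>v\<in>p. g v \<noteq> 0"
        using S(2) R(2) by blast
      have "(\<lambda>v. f v * g v) \<in> ?S" using fg(2,4) by blast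
      moreover have "\<forall>v\<in>p. f v * g v \<noteq> 0" using fg(3,5) by simp
      ultimately have "\<exists>f\<in>?S. \<forall>v\<in>p. f v \<noteq> 0"
        by (intro bexI[of _ "\<lambda>v. f v * g v"])
      with fg(1) show "p \<in> {p \<in> X. \<exists>f\<in>?S. \<forall>v\<in>p. f v \<noteq> 0}" by (intro CollectI conjI)
    next
      fix p assume "p \<in> {p \<in> X. \<exists>f\<in>?S. \<forall>v\<in>p. f v \<noteq> 0}"
      then obtain f g where fg: "p \<in> X" "f \<in> S" "g \<in> R" "\<forall>v\<in>p. f v * g v \<noteq> 0" by blast
      from fg(4) have "\<forall>v\<in>p. f v \<noteq> 0" "\<forall>v\<in>p. g v \<noteq> 0" by simp_all
      then show "p \<in> U \<inter> V" unfolding S(2) R(2) using fg(1-3) by blast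
    qed
    ultimately show "zariski_open n X (U \<inter> V)"
      unfolding zariski_open_def by (intro exI[of _ ?S] conjI)
  next
    fix \<K> assume a: "\<forall>K\<in>\<K>. zariski_open n X K"
    let ?S = "{f \<in> (\<Union>d. homogeneous_polys n d). {p\<in>X. \<forall>v\<in>p. f v \<noteq> 0} \<subseteq> \<Union>\<K>}"
    have "\<Union>\<K> = {p \<in> X. \<exists>f\<in>?S. \<forall>v\<in>p. f v \<noteq> 0}"
    proof (intro equalityI subsetI)
      fix p assume "p \<in> \<Union>\<K>"
      then obtain K where K: "K \<in> \<K>" "p \<in> K" by blast
      have "zariski_open n X K" using a K(1) by (rule bspec)
      then obtain S where S: "S \<subseteq> (\<Union>d. homogeneous_polys n d)" "K = {p \<in> X. \<exists>f\<in>S. \<forall>v\<in>p. f v \<noteq> 0}"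
        unfolding zariski_open_def by (elim exE conjE)
      have "p \<in> X \<and> (\<exists>f\<in>S. \<forall>v\<in>p. f v \<noteq> 0)" using K(2) unfolding S(2) by (rule CollectD)
      then obtain f where f: "f \<in> S" "\<forall>v\<in>p. f v \<noteq> 0" "p \<in> X" by (elim conjE bexE)
      have "{p \<in> X. \<forall>v\<in>p. f v \<noteq> 0} \<subseteq> K" unfolding S(2) using f(1) by fast
      then have "{p \<in> X. \<forall>v\<in>p. f v \<noteq> 0} \<subseteq> \<Union>\<K>" using K(1) by (rule order_trans[OF _ Union_upper])
      moreover have "f \<in> (\<Union>d. homogeneous_polys n d)" using f(1) S(1) by (rule rev_subsetD)
      ultimately have "f \<in> ?S" by (intro CollectI conjI)
      then have "\<exists>f\<in>?S. \<forall>v\<in>p. f v \<noteq> 0" using f(2) by (intro bexI[of _ f])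
      with f(3) show "p \<in> {p \<in> X. \<exists>f\<in>?S. \<forall>v\<in>p. f v \<noteq> 0}" by (intro CollectI conjI)
    next
      fix p assume "p \<in> {p \<in> X. \<exists>f\<in>?S. \<forall>v\<in>p. f v \<noteq> 0}"
      then have "p \<in> X" "\<exists>f\<in>?S. \<forall>v\<in>p. f v \<noteq> 0" by (auto simp only: mem_Collect_eq)
      then show "p \<in> \<Union>\<K>" by fast
    qed
    moreover have "?S \<subseteq> (\<Union>d. homogeneous_polys n d)" by (rule Collect_restrict)
    ultimately show "zariski_open n X (\<Union>\<K>)"
      unfolding zariski_open_def by (intro exI[of _ ?S] conjI)
  qed
qed

lemma openin_zariski: "openin (zariski n X) U \<longleftrightarrow> zariski_open n X U"
  by (simp add: zariski_def istopology_zariski_open)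

definition regular_functions :: "nat \<Rightarrow> (nat \<Rightarrow> 'k::field) set set \<Rightarrow> (nat \<Rightarrow> 'k) set set
    \<Rightarrow> ((nat \<Rightarrow> 'k) set \<Rightarrow> 'k) set" where
  "regular_functions n X U =
     {f. (\<forall>p. p \<notin> U \<longrightarrow> f p = 0) \<and>
         (\<forall>p\<in>U. \<exists>V d. \<exists>g\<in>homogeneous_polys n d. \<exists>h\<in>homogeneous_polys n d.
            openin (zariski n X) V \<and> p \<in> V \<and> V \<subseteq> U \<and>
            (\<forall>q\<in>V. \<forall>v\<in>q. h v \<noteq> 0 \<and> f q = g v / h v))}"

text \<open>
  A section \<open>\<Sum>\<^sub>i\<^sub>\<le>\<^sub>j a\<^sub>i\<^sub>j x\<^sub>i x\<^sub>j\<close> of \<open>\<O>(2)\<close> on projective \<open>(n + 1)\<close>-space, its zero locus, and its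
  formal partial derivatives.
\<close>

definition quadratic_form :: "nat \<Rightarrow> (nat \<Rightarrow> nat \<Rightarrow> 'k::field) \<Rightarrow> (nat \<Rightarrow> 'k) \<Rightarrow> 'k" where
  "quadratic_form n a v = (\<Sum>j\<le>n+1. \<Sum>i\<le>j. a i j * v i * v j)"

definition quadratic_form_deriv :: "nat \<Rightarrow> (nat \<Rightarrow> nat \<Rightarrow> 'k::field) \<Rightarrow> nat \<Rightarrow> (nat \<Rightarrow> 'k) \<Rightarrow> 'k" where
  "quadratic_form_deriv n a k v =
     (\<Sum>j\<le>n+1. \<Sum>i\<le>j. a i j * ((if i = k then v j else 0) + (if j = k then v i else 0)))"

definition quadric :: "nat \<Rightarrow> (nat \<Rightarrow> nat \<Rightarrow> 'k::field) \<Rightarrow> (nat \<Rightarrow> 'k) set set" where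
  "quadric n a = {p \<in> proj_space (n+1). \<forall>v\<in>p. quadratic_form n a v = 0}"

text \<open>Jacobian criterion; it also forces the form to be nonzero and the scheme to be reduced.\<close>

definition smooth_quadric :: "nat \<Rightarrow> (nat \<Rightarrow> nat \<Rightarrow> 'k::field) \<Rightarrow> bool" where
  "smooth_quadric n a \<longleftrightarrow>
     (\<forall>p\<in>quadric n a. \<forall>v\<in>p. \<exists>k\<le>n+1. quadratic_form_deriv n a k v \<noteq> 0)"

end

theory Submission
  imports Defs "HOL-Library.Equipollence"
begin

text \<open>
  In hyperbolic coordinates the quadric is \<open>y\<^sub>0 x\<^sub>0 + \<dots> + y\<^sub>m x\<^sub>m = 0\<close>.  Let \<open>C\<^sub>i\<close> be the
  localization of \<open>\<O>\<close> at the product of the \<open>y\<^sub>j\<close> with \<open>j \<noteq> i\<close>, and let \<open>N\<close> be the kernel of the sum map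
  from the direct sum of the \<open>C\<^sub>i\<close> to the functions on the locus where no \<open>y\<^sub>j\<close> vanishes; \<open>N\<close> is a
  D-module.  If \<open>H\<^sup>1(N) = 0\<close>, then every function that is locally a sum of sections of the \<open>C\<^sub>i\<close> is
  so globally.  Take a power \<open>q \<ge> m + 2\<close> of \<open>p\<close>, put \<open>e = 2 q - m - 2\<close> and let
  \<open>F = (x\<^sub>1 x\<^sub>2)\<^sup>q\<^sup>-\<^sup>1 / (y\<^sub>0\<^sup>e y\<^sub>1 \<dots> y\<^sub>m)\<close>.  Locally \<open>F\<close> is such a sum: where \<open>y\<^sub>i \<noteq> 0\<close> it is a section
  of \<open>C\<^sub>i\<close>, and where \<open>x\<^sub>i \<noteq> 0\<close> the function \<open>y\<^sub>i\<close> is a combination of the other \<open>y\<^sub>j\<close>, so that a power of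
  it lies in the ideal generated by their \<open>e\<close>-th powers.  Globally it is not: in the chart \<open>y\<^sub>0 = 1\<close>
  the monomial \<open>(x\<^sub>1 x\<^sub>2)\<^sup>q\<^sup>-\<^sup>1 / (y\<^sub>1 \<dots> y\<^sub>m)\<close> is missing from the global sections of \<open>C\<^sub>i\<close> for \<open>i > 0\<close>, where
  \<open>y\<^sub>i\<close> occurs without negative powers, and in those of \<open>C\<^sub>0\<close> it only arises from powers
  \<open>(y\<^sub>1 x\<^sub>1 + y\<^sub>2 x\<^sub>2)\<^sup>a\<close> with \<open>q \<le> a \<le> 2 q - 2\<close>, with a coefficient divisible by \<open>a choose (q - 1)\<close>,
  which is zero in characteristic \<open>p\<close>.
\<close>

section \<open>Laurent polynomials and regular functions on a box\<close>

text \<open>Let \<open>Z\<close> be the linear subspace of the quadric where all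
  \<open>y\<^sub>j\<close> vanish. The sum map is the last map of the Cech complex of
  \<open>y\<^sub>0, ..., y\<^sub>m\<close>, and its cokernel is the local cohomology of
  \<open>\<O>\<close> along \<open>Z\<close> in degree \<open>m + 1\<close>. As a sheaf it is zero,
  because \<open>Z\<close> has codimension \<open>m\<close> and near each of its points one of the
  equations is redundant; no single equation is redundant everywhere, and \<open>N\<close> turns
  this discrepancy into first cohomology. The constants are forced: \<open>F\<close> has degree 0
  exactly when \<open>2 * (q - 1) = e + m\<close>, and \<open>q \<ge> m + 2\<close> is what keeps
  the exponents \<open>a\<close> at least \<open>q\<close>. Two obstacles shape the formal part. The
  sections of a D-module must lie in \<open>'b\<close>, of which only an injection from the field is
  known; so \<open>N\<close> is transported along injections that exist because a section is
  determined by finitely many homogeneous polynomials. And cohomology is given by the Godement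
  resolution, so its vanishing is exploited through an explicit cocycle instead of an exact
  sequence.\<close>

inductive_set polyfun :: "((nat \<Rightarrow> 'k::field) \<Rightarrow> 'k) set" where
  const [intro, simp]: "(\<lambda>_. c) \<in> polyfun"
| coord [intro, simp]: "(\<lambda>z. z i) \<in> polyfun"
| add [intro]: "\<lbrakk>f \<in> polyfun; g \<in> polyfun\<rbrakk> \<Longrightarrow> (\<lambda>z. f z + g z) \<in> polyfun"
| mult [intro]: "\<lbrakk>f \<in> polyfun; g \<in> polyfun\<rbrakk> \<Longrightarrow> (\<lambda>z. f z * g z) \<in> polyfun"

lemma polyfun_sum: "(\<And>i. i \<in> A \<Longrightarrow> f i \<in> polyfun) \<Longrightarrow> (\<lambda>z. \<Sum>i\<in>A. f i z) \<in> polyfun"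
  by (induction A rule: infinite_finite_induct) auto

lemma polyfun_prod: "(\<And>i. i \<in> A \<Longrightarrow> f i \<in> polyfun) \<Longrightarrow> (\<lambda>z. \<Prod>i\<in>A. f i z) \<in> polyfun"
  by (induction A rule: infinite_finite_induct) auto

lemma polyfun_power: "f \<in> polyfun \<Longrightarrow> (\<lambda>z. f z ^ n) \<in> polyfun"
  by (induction n) auto

lemma polyfun_uminus: "f \<in> polyfun \<Longrightarrow> (\<lambda>z. - f z) \<in> polyfun"
  using polyfun.mult[of "\<lambda>_. -1" f] by simp

lemma polyfun_diff: "\<lbrakk>f \<in> polyfun; g \<in> polyfun\<rbrakk> \<Longrightarrow> (\<lambda>z. f z - g z) \<in> polyfun"
  using polyfun.add[OF _ polyfun_uminus, of f g] by simp

lemma polyfun_subst: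
  assumes "f \<in> polyfun" "\<And>i. (\<lambda>z. \<phi> z i) \<in> polyfun"
  shows "(\<lambda>z. f (\<phi> z)) \<in> polyfun"
  using assms by (induction rule: polyfun.induct) auto

lemma polyfun_line:
  assumes "f \<in> polyfun"
  shows "\<exists>p. \<forall>t. f (\<lambda>i. a i + t * b i) = poly p t"
  using assms
proof induction
  case (const c)
  show ?case by (intro exI[of _ "[:c:]"]) simp
next
  case (coord i)
  show ?case by (intro exI[of _ "[:a i, b i:]"]) simp
next
  case (add f g)
  then show ?case by (metis poly_add)
next
  case (mult f g)
  then show ?case by (metis poly_mult)
qed

text \<open>The bound \<open>D\<close> is uniform in the remaining coordinates; it later fixes one
  number of interpolation nodes that is enough for all slices.\<close>

lemma polyfun_update:
  assumes "f \<in> polyfun"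
  shows "\<exists>D. \<forall>z. \<exists>p. degree p \<le> D \<and> (\<forall>t. f (z(j := t)) = poly p t)"
  using assms
proof induction
  case (const c)
  show ?case by (intro exI[of _ 0] allI exI[of _ "[:c:]"]) simp
next
  case (coord i)
  show ?case
  proof (cases "i = j")
    case True
    then show ?thesis by (intro exI[of _ 1] allI exI[of _ "[:0, 1:]"]) simp
  next
    case False
    have "\<exists>p. degree p \<le> 0 \<and> (\<forall>t. (z(j := t)) i = poly p t)" for z :: "nat \<Rightarrow> 'a"
      using False by (intro exI[of _ "[:z i:]"]) simp
    then show ?thesis by blast
  qed
next
  case (add f g)
  then obtain D E where D: "\<And>z. \<exists>p. degree p \<le> D \<and> (\<forall>t. f (z(j := t)) = poly p t)"
    and E: "\<And>z. \<exists>p. degree p \<le> E \<and> (\<forall>t. g (z(j := t)) = poly p t)"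
    by blast
  have "\<exists>p. degree p \<le> max D E \<and> (\<forall>t. f (z(j := t)) + g (z(j := t)) = poly p t)" for z
  proof -
    obtain p q where "degree p \<le> D" "\<And>t. f (z(j := t)) = poly p t"
      "degree q \<le> E" "\<And>t. g (z(j := t)) = poly q t"
      using D E by metis
    then show ?thesis by (intro exI[of _ "p + q"]) (auto intro: degree_add_le)
  qed
  then show ?case by blast
next
  case (mult f g)
  then obtain D E where D: "\<And>z. \<exists>p. degree p \<le> D \<and> (\<forall>t. f (z(j := t)) = poly p t)"
    and E: "\<And>z. \<exists>p. degree p \<le> E \<and> (\<forall>t. g (z(j := t)) = poly p t)"
    by blast
  have "\<exists>p. degree p \<le> D + E \<and> (\<forall>t. f (z(j := t)) * g (z(j := t)) = poly p t)" for z
  proof -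
    obtain p q where "degree p \<le> D" "\<And>t. f (z(j := t)) = poly p t"
      "degree q \<le> E" "\<And>t. g (z(j := t)) = poly q t"
      using D E by metis
    then show ?thesis
      by (intro exI[of _ "p * q"]) (auto intro: order_trans[OF degree_mult_le])
  qed
  then show ?case by blast
qed

text \<open>Over a finite field the polynomial 1 plus the product of all \<open>X - a\<close> takes
  the value 1 everywhere and so has no root.\<close>

lemma infinite_alg_closed: "infinite (UNIV :: 'k::alg_closed_field set)"
proof
  assume fin: "finite (UNIV :: 'k set)"
  define p :: "'k poly" where "p = 1 + (\<Prod>a\<in>UNIV. [:-a, 1:])"
  have "degree (\<Prod>a\<in>(UNIV::'k set). [:-a, 1:]) = card (UNIV :: 'k set)"
    by (subst degree_prod_eq_sum_degree) auto
  moreover have "card (UNIV :: 'k set) > 0"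
    using fin by (simp add: finite_UNIV_card_ge_0)
  ultimately have "degree p > 0"
    unfolding p_def by (subst degree_add_eq_right) auto
  then obtain x where "poly p x = 0"
    using alg_closed_imp_poly_has_root by blast
  moreover have "(\<Prod>a\<in>(UNIV::'k set). x - a) = 0"
    using fin by (subst prod_zero_iff) auto
  ultimately show False
    by (simp add: p_def poly_prod)
qed

text \<open>On the line through \<open>a\<close> and \<open>b\<close> both functions restrict to
  nonzero polynomials in one variable, whose product has finitely many roots. This is the density
  argument behind all later comparisons; \<open>J\<close> keeps the line inside a coordinate
  subspace.\<close>

lemma polyfun_mult_nonzero:
  fixes f g :: "(nat \<Rightarrow> 'k::field) \<Rightarrow> 'k"
  assumes inf: "infinite (UNIV :: 'k set)" and "f \<in> polyfun" "g \<in> polyfun"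
    and ab: "\<forall>j. j \<notin> J \<longrightarrow> a j = 0" "\<forall>j. j \<notin> J \<longrightarrow> b j = 0" and nz: "f a \<noteq> 0" "g b \<noteq> 0"
  shows "\<exists>z. (\<forall>j. j \<notin> J \<longrightarrow> z j = 0) \<and> f z \<noteq> 0 \<and> g z \<noteq> 0"
proof -
  define l where "l t = (\<lambda>i. a i + t * (b i - a i))" for t
  obtain p q where p: "\<And>t. f (l t) = poly p t" and q: "\<And>t. g (l t) = poly q t"
    unfolding l_def using polyfun_line[of f a "\<lambda>i. b i - a i"] polyfun_line[of g a "\<lambda>i. b i - a i"]
      assms(2,3) by auto
  have "l 0 = a" "l 1 = b" by (auto simp: l_def)
  then have "p \<noteq> 0" "q \<noteq> 0" using p[of 0] q[of 1] nz by auto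
  then have "finite {t. poly (p * q) t = 0}" by (intro poly_roots_finite) auto
  then obtain t where "poly (p * q) t \<noteq> 0"
    using inf by (metis (mono_tags, lifting) finite_subset mem_Collect_eq subsetI)
  then show ?thesis
    using p[of t] q[of t] ab by (intro exI[of _ "l t"]) (auto simp: l_def)
qed

section \<open>Functions of one variable that are locally quotients of polynomials\<close>

text \<open>\<open>B c\<close> is the line, or the punctured line if \<open>c\<close> holds. The
  roots of the denominator \<open>h\<close> are removed one at a time: a root in the domain is also
  a root of \<open>g\<close>, by comparison with a quotient that is valid there, and the root 0 of
  the punctured case is absorbed by a power of the variable. The degree is tracked because
  interpolation will need a bound.\<close>

lemma rational_slice:
  fixes f :: "'k::alg_closed_field \<Rightarrow> 'k"
  defines "B c \<equiv> {t. c \<longrightarrow> t \<noteq> 0}"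
  assumes "\<And>t. t \<in> B c \<Longrightarrow> \<exists>g h. poly h t \<noteq> 0 \<and> (\<forall>s\<in>B c. poly h s \<noteq> 0 \<longrightarrow> f s * poly h s = poly g s)"
    and "h \<noteq> 0" "\<And>s. s \<in> B c \<Longrightarrow> poly h s \<noteq> 0 \<Longrightarrow> f s * poly h s = poly g s"
  shows "\<exists>p. degree p \<le> degree g + (if c then degree h else 0) \<and>
           (\<forall>t\<in>B c. t ^ (if c then degree h else 0) * f t = poly p t)"
  using assms(2-)
proof (induction "degree h" arbitrary: f g h rule: less_induct)
  case less
  have inf: "infinite (UNIV :: 'k set)" by (rule infinite_alg_closed)
  show ?case
  proof (cases "degree h = 0")
    case True
    then obtain b where h: "h = [:b:]" by (meson degree_eq_zeroE)
    then have b: "b \<noteq> 0" using less.prems by auto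
    have "f t = poly (Polynomial.smult (1 / b) g) t" if "t \<in> B c" for t
      using less.prems(3)[OF that] b by (simp add: h field_simps)
    then show ?thesis using True by (intro exI[of _ "Polynomial.smult (1 / b) g"]) auto
  next
    case False
    then obtain r where r: "poly h r = 0" using alg_closed_imp_poly_has_root by blast
    then obtain h' where h': "h = [:-r, 1:] * h'" by (metis dvdE poly_eq_0_iff_dvd)
    with less.prems have h'0: "h' \<noteq> 0" by auto
    have deg: "degree h = Suc (degree h')" unfolding h' using h'0 by (subst degree_mult_eq) auto
    show ?thesis
    proof (cases "r \<in> B c")
      case True
      obtain g1 h1 where g1: "poly h1 r \<noteq> 0" "\<And>s. s \<in> B c \<Longrightarrow> poly h1 s \<noteq> 0 \<Longrightarrow> f s * poly h1 s = poly g1 s"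
        using less.prems(1)[OF True] by blast
      have h10: "h1 \<noteq> 0" using g1 by auto
      have eq: "g * h1 = g1 * h"
      proof -
        let ?d = "g * h1 - g1 * h"
        \<comment> \<open>The two quotients are known to agree only where \<open>h\<close>,
          \<open>h1\<close> and possibly the variable are nonzero. Multiplying by these factors
          gives a polynomial that vanishes at every point of an infinite field.\<close>
        have "?d * (h * h1 * [:0, 1:]) = 0"
        proof (rule ccontr)
          assume "?d * (h * h1 * [:0, 1:]) \<noteq> 0"
          then have "finite {t. poly (?d * (h * h1 * [:0, 1:])) t = 0}" by (rule poly_roots_finite)
          moreover have "poly (?d * (h * h1 * [:0, 1:])) t = 0" for t
          proof (cases "poly h t = 0 \<or> poly h1 t = 0 \<or> t = 0")
            case F: False
            then have "t \<in> B c" by (auto simp: B_def)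
            then have "f t * poly h t = poly g t" "f t * poly h1 t = poly g1 t"
              using F less.prems(3) g1(2) by auto
            then have "poly ?d t = 0" by (simp flip: \<open>f t * poly h t = poly g t\<close>)
            then show ?thesis by simp
          qed auto
          then have "{t. poly (?d * (h * h1 * [:0, 1:])) t = 0} = UNIV" by blast
          ultimately show False using inf by (simp only:)
        qed
        then show ?thesis using less.prems(2) h10 by auto
      qed
      then have "poly g r * poly h1 r = 0" using r by (metis mult_zero_right poly_mult)
      then have "poly g r = 0" using g1(1) by simp
      then obtain g' where g': "g = [:-r, 1:] * g'" by (metis dvdE poly_eq_0_iff_dvd)
      have "[:-r, 1:] * (g' * h1) = [:-r, 1:] * (g1 * h')"
        using eq by (simp only: g' h' mult_ac)
      then have eq': "g' * h1 = g1 * h'"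
        by (subst (asm) mult_cancel_left) auto
      have "f s * poly h' s = poly g' s" if s: "s \<in> B c" "poly h' s \<noteq> 0" for s
      proof (cases "s = r")
        case True
        have "poly g' r * poly h1 r = (f r * poly h1 r) * poly h' r"
          using eq' g1(2)[OF \<open>r \<in> B c\<close> g1(1)] by (metis poly_mult)
        then show ?thesis using g1(1) True by simp
      next
        case False
        then have "f s * poly h s = poly g s" using s by (intro less.prems(3)) (auto simp: h')
        then have "(s - r) * (f s * poly h' s) = (s - r) * poly g' s"
          unfolding g' h' by (simp add: algebra_simps)
        then show ?thesis using False by (subst (asm) mult_cancel_left) auto
      qed
      from less.hyps[OF _ less.prems(1) h'0 this] deg obtain p where
        p: "degree p \<le> degree g' + (if c then degree h' else 0)"
          "\<And>t. t \<in> B c \<Longrightarrow> t ^ (if c then degree h' else 0) * f t = poly p t"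
        by auto
      have "degree g = Suc (degree g')" if "g' \<noteq> 0"
        unfolding g' using that by (subst degree_mult_eq) auto
      then have g'g: "degree g' \<le> degree g" by (cases "g' = 0") auto
      show ?thesis
      proof (cases c)
        case True
        \<comment> \<open>The required exponent \<open>degree h\<close> is one more than the
          induction hypothesis supplies; one further factor of the variable makes up for it.\<close>
        have "degree (pCons 0 p) \<le> Suc (degree p)" by (rule degree_pCons_le)
        then show ?thesis using p g'g True deg
          by (intro exI[of _ "pCons 0 p"]) (auto simp flip: p(2))
      next
        case False
        then show ?thesis using p g'g by (intro exI[of _ p]) auto
      qed
    next
      case False
      then have c: "c" and r0: "r = 0" by (auto simp: B_def)
      have hh: "h = [:0, 1:] * h'" using h' r0 by simp
      \<comment> \<open>The factor \<open>X\<close> of the denominator is moved into the function: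
        the induction hypothesis is applied to \<open>t * f t\<close> and \<open>h'\<close>.\<close>
      have "\<exists>p. degree p \<le> degree g + (if c then degree h' else 0) \<and>
           (\<forall>t\<in>B c. t ^ (if c then degree h' else 0) * (t * f t) = poly p t)"
      proof (rule less.hyps)
        show "degree h' < degree h" using deg by simp
        show "h' \<noteq> 0" by (rule h'0)
        fix t assume t: "t \<in> B c"
        {
          from less.prems(1)[OF t] obtain g1 h1 where
            "poly h1 t \<noteq> 0" "\<forall>s\<in>B c. poly h1 s \<noteq> 0 \<longrightarrow> f s * poly h1 s = poly g1 s" by blast
          then show "\<exists>g h. poly h t \<noteq> 0 \<and> (\<forall>s\<in>B c. poly h s \<noteq> 0 \<longrightarrow> s * f s * poly h s = poly g s)"
            by (intro exI[of _ "pCons 0 g1"] exI[of _ h1]) (auto simp: mult.assoc)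
        next
          assume "poly h' t \<noteq> 0"
          then show "t * f t * poly h' t = poly g t"
            using less.prems(3)[OF t] t c unfolding hh by (simp add: B_def mult_ac)
        }
      qed
      then obtain p where "degree p \<le> degree g + degree h'"
        "\<And>t. t \<in> B c \<Longrightarrow> t ^ degree h' * (t * f t) = poly p t" using c by auto
      then show ?thesis using c deg by (intro exI[of _ p]) (auto simp: mult_ac)
    qed
  qed
qed

text \<open>The order of the quantifiers matters: one family \<open>L\<close>, depending on the
  nodes alone, serves all \<open>p\<close>. Interpolating a function of several variables in one of
  them thus has constant coefficients.\<close>

lemma lagrange_interpolation:
  assumes "finite (T :: 'k::field set)"
  shows "\<exists>L. \<forall>p. degree p < card T \<longrightarrow> p = (\<Sum>t\<in>T. Polynomial.smult (poly p t) (L t))"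
proof -
  define W where "W t = (\<Prod>s\<in>T - {t}. [:-s, 1:])" for t
  define L where "L t = Polynomial.smult (1 / poly (W t) t) (W t)" for t
  have W0: "poly (W t) t \<noteq> 0" if "t \<in> T" for t
    using assms by (auto simp: W_def poly_prod)
  have W1: "poly (W t) s = 0" if "s \<in> T" "s \<noteq> t" for s t
    using assms that by (auto simp: W_def poly_prod intro!: prod_zero bexI[of _ s])
  have degW: "degree (W t) < card T" if "t \<in> T" for t
  proof -
    have "degree (W t) = card (T - {t})"
      unfolding W_def by (subst degree_prod_eq_sum_degree) auto
    then show ?thesis
      using assms that card_gt_0_iff[of T] by fastforce
  qed
  have "p = (\<Sum>t\<in>T. Polynomial.smult (poly p t) (L t))" if "degree p < card T" for p
  proof (rule poly_eqI_degree[of T])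
    fix s assume s: "s \<in> T"
    have "poly (\<Sum>t\<in>T. Polynomial.smult (poly p t) (L t)) s = (\<Sum>t\<in>T. if t = s then poly p s else 0)"
      unfolding poly_sum using W0[OF s] W1 s by (intro sum.cong) (auto simp: L_def)
    then show "poly p s = poly (\<Sum>t\<in>T. Polynomial.smult (poly p t) (L t)) s"
      using s assms by simp
  next
    have "degree (\<Sum>t\<in>T. Polynomial.smult (poly p t) (L t)) \<le> card T - 1"
    proof (rule degree_sum_le[OF assms])
      fix t assume "t \<in> T"
      then show "degree (Polynomial.smult (poly p t) (L t)) \<le> card T - 1"
        using degW[of t] by (auto simp: L_def)
    qed
    then show "degree (\<Sum>t\<in>T. Polynomial.smult (poly p t) (L t)) < card T"
      using that by linarith
  qed (rule that)
  then show ?thesis by blast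
qed

text \<open>Agreement is demanded on \<open>B\<close> only, since a regular function on a box is
  arbitrary elsewhere. With \<open>B = UNIV\<close> the same notion later describes homogeneous
  polynomials.\<close>

definition lspan :: "('i \<Rightarrow> 'z \<Rightarrow> 'k::field) \<Rightarrow> 'i set \<Rightarrow> 'z set \<Rightarrow> ('z \<Rightarrow> 'k) set" where
  "lspan \<chi> S B = {f. \<exists>A c. finite A \<and> A \<subseteq> S \<and> (\<forall>z\<in>B. f z = (\<Sum>\<alpha>\<in>A. c \<alpha> * \<chi> \<alpha> z))}"

lemma lspan_cong: "\<lbrakk>f \<in> lspan \<chi> S B; \<And>z. z \<in> B \<Longrightarrow> g z = f z\<rbrakk> \<Longrightarrow> g \<in> lspan \<chi> S B"
  by (auto simp: lspan_def)

lemma lspanE: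
  assumes "f \<in> lspan \<chi> S B"
  obtains A c where "finite A" "A \<subseteq> S" "\<And>z. z \<in> B \<Longrightarrow> f z = (\<Sum>\<alpha>\<in>A. c \<alpha> * \<chi> \<alpha> z)"
  using assms unfolding lspan_def mem_Collect_eq
  by (elim exE conjE) (rule that, assumption+, simp)

lemma lspan_zero: "(\<lambda>_. 0) \<in> lspan \<chi> S B"
  unfolding lspan_def by (intro CollectI exI[of _ "{}"]) auto

lemma lspan_base: "\<alpha> \<in> S \<Longrightarrow> (\<lambda>z. c * \<chi> \<alpha> z) \<in> lspan \<chi> S B"
  unfolding lspan_def by (intro CollectI exI[of _ "{\<alpha>}"] exI[of _ "\<lambda>_. c"]) auto

lemma lspan_scale:
  assumes "f \<in> lspan \<chi> S B" shows "(\<lambda>z. c * f z) \<in> lspan \<chi> S B"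
proof -
  obtain A e where A: "finite A" "A \<subseteq> S" "\<And>z. z \<in> B \<Longrightarrow> f z = (\<Sum>\<alpha>\<in>A. e \<alpha> * \<chi> \<alpha> z)"
    using assms by (auto simp: lspan_def)
  then show ?thesis unfolding lspan_def
    by (intro CollectI exI[of _ A] exI[of _ "\<lambda>\<alpha>. c * e \<alpha>"]) (auto simp: sum_distrib_left mult.assoc)
qed

lemma lspan_add:
  assumes "f \<in> lspan \<chi> S B" "g \<in> lspan \<chi> S B" shows "(\<lambda>z. f z + g z) \<in> lspan \<chi> S B"
proof -
  obtain A a where A: "finite A" "A \<subseteq> S" "\<And>z. z \<in> B \<Longrightarrow> f z = (\<Sum>\<alpha>\<in>A. a \<alpha> * \<chi> \<alpha> z)"
    using assms by (auto simp: lspan_def)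
  obtain E e where E: "finite E" "E \<subseteq> S" "\<And>z. z \<in> B \<Longrightarrow> g z = (\<Sum>\<alpha>\<in>E. e \<alpha> * \<chi> \<alpha> z)"
    using assms by (auto simp: lspan_def)
  define d where "d \<alpha> = (if \<alpha> \<in> A then a \<alpha> else 0) + (if \<alpha> \<in> E then e \<alpha> else 0)" for \<alpha>
  have "f z + g z = (\<Sum>\<alpha>\<in>A \<union> E. d \<alpha> * \<chi> \<alpha> z)" if "z \<in> B" for z
  proof -
    have "f z = (\<Sum>\<alpha>\<in>A \<union> E. (if \<alpha> \<in> A then a \<alpha> else 0) * \<chi> \<alpha> z)"
      unfolding A(3)[OF that] using A(1) E(1) by (intro sum.mono_neutral_cong_left) auto
    moreover have "g z = (\<Sum>\<alpha>\<in>A \<union> E. (if \<alpha> \<in> E then e \<alpha> else 0) * \<chi> \<alpha> z)"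
      unfolding E(3)[OF that] using A(1) E(1) by (intro sum.mono_neutral_cong_left) auto
    ultimately show ?thesis by (simp add: d_def sum.distrib distrib_right)
  qed
  then show ?thesis unfolding lspan_def using A E
    by (intro CollectI exI[of _ "A \<union> E"] exI[of _ d]) auto
qed

lemma lspan_mono: "\<lbrakk>f \<in> lspan \<chi> S B; S \<subseteq> S'; B' \<subseteq> B\<rbrakk> \<Longrightarrow> f \<in> lspan \<chi> S' B'"
  unfolding lspan_def by (fastforce)

lemma lspan_sum: "(\<And>i. i \<in> I \<Longrightarrow> f i \<in> lspan \<chi> S B) \<Longrightarrow> (\<lambda>z. \<Sum>i\<in>I. f i z) \<in> lspan \<chi> S B"
  by (induction I rule: infinite_finite_induct) (auto intro: lspan_zero lspan_add)

text \<open>A product of lines and punctured lines: \<open>J\<close> indexes the coordinates of the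
  affine space, modelled by sequences that vanish outside \<open>J\<close>, and \<open>P\<close> the
  coordinates that are inverted.\<close>

definition box :: "nat set \<Rightarrow> nat set \<Rightarrow> (nat \<Rightarrow> 'k::field) set" where
  "box J P = {z. (\<forall>j\<in>P. z j \<noteq> 0) \<and> (\<forall>j. j \<notin> J \<longrightarrow> z j = 0)}"

definition zpow :: "nat set \<Rightarrow> (nat \<Rightarrow> int) \<Rightarrow> (nat \<Rightarrow> 'k::field) \<Rightarrow> 'k" where
  "zpow J \<alpha> z = (\<Prod>j\<in>J. z j powi \<alpha> j)"

text \<open>Exponents are normalised to 0 outside \<open>J\<close>, so that different exponents
  always give different characters of the torus \<open>box J J\<close>.\<close>

definition exponents :: "nat set \<Rightarrow> nat set \<Rightarrow> (nat \<Rightarrow> int) set" where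
  "exponents J P = {\<alpha>. (\<forall>j. j \<notin> J \<longrightarrow> \<alpha> j = 0) \<and> (\<forall>j\<in>J - P. \<alpha> j \<ge> 0)}"

definition regular_on_box :: "nat set \<Rightarrow> nat set \<Rightarrow> ((nat \<Rightarrow> 'k::field) \<Rightarrow> 'k) \<Rightarrow> bool" where
  "regular_on_box J P f \<longleftrightarrow> (\<forall>z\<in>box J P. \<exists>g\<in>polyfun. \<exists>h\<in>polyfun. h z \<noteq> 0 \<and>
     (\<forall>y\<in>box J P. h y \<noteq> 0 \<longrightarrow> f y * h y = g y))"

lemma regular_on_boxE:
  assumes "regular_on_box J P f" "z \<in> box J P"
  obtains g h where "g \<in> polyfun" "h \<in> polyfun" "h z \<noteq> 0"
    "\<And>y. \<lbrakk>y \<in> box J P; h y \<noteq> 0\<rbrakk> \<Longrightarrow> f y * h y = g y"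
  using bspec[OF assms(1)[unfolded regular_on_box_def] assms(2)]
  by (elim bexE conjE) (rule that, assumption+, simp)

lemma powi_nonneg_eq: "k \<ge> 0 \<Longrightarrow> (x::'k::field) powi k = x ^ nat k"
  by (simp add: power_int_def)

text \<open>With \<open>N\<close> at least the negative of every exponent that occurs, no negative
  power survives. The polynomial form is what the density argument of the next theorem can
  compare.\<close>

lemma laurent_clear_denominators:
  fixes f :: "(nat \<Rightarrow> 'k::field) \<Rightarrow> 'k"
  assumes "finite J" "P \<subseteq> J" "f \<in> lspan (zpow J) (exponents J P) (box J P)"
  shows "\<exists>N::nat. \<exists>G\<in>polyfun. \<forall>z\<in>box J P. f z * (\<Prod>j\<in>P. z j ^ N) = G z"
proof -
  obtain A c where A: "finite A" "A \<subseteq> exponents J P"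
    "\<And>z. z \<in> box J P \<Longrightarrow> f z = (\<Sum>\<alpha>\<in>A. c \<alpha> * zpow J \<alpha> z)"
    by (rule lspanE[OF assms(3)]) (rule that)
  have finP: "finite P" using assms finite_subset by auto
  obtain N :: nat where N: "\<And>\<alpha> j. \<lbrakk>\<alpha> \<in> A; j \<in> P\<rbrakk> \<Longrightarrow> - \<alpha> j \<le> int N"
  proof -
    define N where "N = nat (Max (insert 0 ((\<lambda>(\<alpha>, j). - \<alpha> j) ` (A \<times> P))))"
    have "- \<alpha> j \<le> int N" if "\<alpha> \<in> A" "j \<in> P" for \<alpha> j
    proof -
      have "- \<alpha> j \<le> Max (insert 0 ((\<lambda>(\<alpha>, j). - \<alpha> j) ` (A \<times> P)))"
        using that A(1) finP by (intro Max_ge) force+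
      then show ?thesis by (simp add: N_def)
    qed
    then show ?thesis using that by blast
  qed
  define G where "G z = (\<Sum>\<alpha>\<in>A. c \<alpha> * (\<Prod>j\<in>J. z j ^ nat (\<alpha> j + (if j \<in> P then int N else 0))))" for z :: "nat \<Rightarrow> 'k"
  have "G \<in> polyfun"
    unfolding G_def by (intro polyfun_sum polyfun.mult polyfun.const polyfun_prod polyfun_power polyfun.coord)
  moreover have "f z * (\<Prod>j\<in>P. z j ^ N) = G z" if z: "z \<in> box J P" for z
  proof -
    have "zpow J \<alpha> z * (\<Prod>j\<in>P. z j ^ N) = (\<Prod>j\<in>J. z j ^ nat (\<alpha> j + (if j \<in> P then int N else 0)))"
      if \<alpha>: "\<alpha> \<in> A" for \<alpha>
    proof -
      have "(\<Prod>j\<in>P. z j ^ N) = (\<Prod>j\<in>J. if j \<in> P then z j ^ N else 1)"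
        using assms by (intro prod.mono_neutral_cong_left) auto
      then have "zpow J \<alpha> z * (\<Prod>j\<in>P. z j ^ N) = (\<Prod>j\<in>J. z j powi \<alpha> j * (if j \<in> P then z j ^ N else 1))"
        by (simp add: zpow_def prod.distrib)
      also have "\<dots> = (\<Prod>j\<in>J. z j ^ nat (\<alpha> j + (if j \<in> P then int N else 0)))"
      proof (intro prod.cong refl)
        fix j assume j: "j \<in> J"
        show "z j powi \<alpha> j * (if j \<in> P then z j ^ N else 1)
          = z j ^ nat (\<alpha> j + (if j \<in> P then int N else 0))"
        proof (cases "j \<in> P")
          case True
          then have "z j \<noteq> 0" using z by (auto simp: box_def)
          then have "z j powi \<alpha> j * z j ^ N = z j powi (\<alpha> j + int N)"
            by (simp add: power_int_add)
          then show ?thesis using True N[OF \<alpha> True] by (simp add: powi_nonneg_eq)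
        next
          case False
          then have "\<alpha> j \<ge> 0" using j \<alpha> A(2) by (auto simp: exponents_def)
          then show ?thesis using False by (simp add: powi_nonneg_eq)
        qed
      qed
      finally show ?thesis .
    qed
    then show ?thesis
      by (simp add: A(3)[OF z] G_def sum_distrib_right mult.assoc)
  qed
  ultimately show ?thesis by blast
qed

text \<open>Induction on the coordinates. Slices in the direction \<open>j\<close> are Laurent
  polynomials of bounded degree, so interpolation at fixed nodes writes \<open>f\<close> as a
  combination of powers of \<open>z j\<close> whose coefficients are the values
  \<open>f (z(j := t))\<close>, regular on the smaller box. This is first obtained where one fixed
  denominator is nonzero, and then extended to the whole box by density.\<close>

theorem regular_on_box_laurent:
  fixes f :: "(nat \<Rightarrow> 'k::alg_closed_field) \<Rightarrow> 'k"
  assumes "finite J" "P \<subseteq> J" "regular_on_box J P f"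
  shows "f \<in> lspan (zpow J) (exponents J P) (box J P)"
  using assms
proof (induction J arbitrary: P f rule: finite_induct)
  case empty
  have "f z = f (\<lambda>_. 0) * zpow {} (\<lambda>_. 0) z" if "z \<in> box {} P" for z
  proof -
    have "z = (\<lambda>_. 0)" using that by (auto simp: box_def)
    then show ?thesis by (simp add: zpow_def)
  qed
  then show ?case
    by (rule lspan_cong[OF lspan_base[of "\<lambda>_. 0" "exponents {} P" "f (\<lambda>_. 0)"], rotated])
      (auto simp: exponents_def)
next
  case (insert j J)
  define P' where "P' = P - {j}"
  define B where "B = {t::'k. j \<in> P \<longrightarrow> t \<noteq> 0}"
  have P': "P' \<subseteq> J" using insert.prems by (auto simp: P'_def)
  have upd: "z(j := t) \<in> box (insert j J) P" if "z(j := 0) \<in> box J P'" "t \<in> B" for z :: "nat \<Rightarrow> 'k" and t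
    using that insert.hyps by (auto simp: box_def B_def P'_def split: if_splits)
  have upd': "z(j := 0) \<in> box J P'" "z j \<in> B" if "z \<in> box (insert j J) P" for z :: "nat \<Rightarrow> 'k"
    using that insert.hyps by (auto simp: box_def B_def P'_def)
  \<comment> \<open>Any point of the box will do; the quotient \<open>g / h\<close> found there is
    kept for the rest of the proof, and its degrees in the direction \<open>j\<close> bound all
    slices.\<close>
  define z0 where "z0 = (\<lambda>i. if i \<in> insert j J then 1 else (0::'k))"
  have z0: "z0 \<in> box (insert j J) P" using insert.prems by (auto simp: box_def z0_def)
  obtain g h where gh: "g \<in> polyfun" "h \<in> polyfun" "h z0 \<noteq> 0"
    "\<And>y. \<lbrakk>y \<in> box (insert j J) P; h y \<noteq> 0\<rbrakk> \<Longrightarrow> f y * h y = g y"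
    by (rule regular_on_boxE[OF insert.prems(2) z0]) (rule that)
  obtain Dg where Dg: "\<And>z. \<exists>p. degree p \<le> Dg \<and> (\<forall>t. g (z(j := t)) = poly p t)"
    using polyfun_update[OF gh(1)] by blast
  obtain Dh where Dh: "\<And>z. \<exists>p. degree p \<le> Dh \<and> (\<forall>t. h (z(j := t)) = poly p t)"
    using polyfun_update[OF gh(2)] by blast
  define D where "D = (if j \<in> P then Dh else 0)"
  have slice: "\<exists>p. degree p \<le> Dg + D \<and> (\<forall>t\<in>B. t ^ D * f (z(j := t)) = poly p t)"
    if z: "z \<in> box (insert j J) P" "h z \<noteq> 0" for z
  proof -
    obtain pg ph where pg: "degree pg \<le> Dg" "\<And>t. g (z(j := t)) = poly pg t"
      and ph: "degree ph \<le> Dh" "\<And>t. h (z(j := t)) = poly ph t"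
      using Dg Dh by metis
    have "poly ph (z j) \<noteq> 0" using z ph(2)[of "z j"] by simp
    then have "ph \<noteq> 0" by auto
    have "\<exists>p. degree p \<le> degree pg + (if j \<in> P then degree ph else 0) \<and>
       (\<forall>t\<in>{t. j \<in> P \<longrightarrow> t \<noteq> 0}. t ^ (if j \<in> P then degree ph else 0) * f (z(j := t)) = poly p t)"
    proof (rule rational_slice)
      fix t :: 'k assume t: "t \<in> {t. j \<in> P \<longrightarrow> t \<noteq> 0}"
      then have zt: "z(j := t) \<in> box (insert j J) P" using upd upd'(1)[OF z(1)] by (auto simp: B_def)
      obtain g1 h1 where g1: "g1 \<in> polyfun" "h1 \<in> polyfun" "h1 (z(j := t)) \<noteq> 0"
        "\<And>y. \<lbrakk>y \<in> box (insert j J) P; h1 y \<noteq> 0\<rbrakk> \<Longrightarrow> f y * h1 y = g1 y"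
        by (rule regular_on_boxE[OF insert.prems(2) zt]) (rule that)
      obtain pg1 ph1 where pg1: "\<And>t. g1 (z(j := t)) = poly pg1 t" "\<And>t. h1 (z(j := t)) = poly ph1 t"
        using polyfun_update[OF g1(1)] polyfun_update[OF g1(2)] by metis
      have "f (z(j := s)) * poly ph1 s = poly pg1 s" if "s \<in> {t. j \<in> P \<longrightarrow> t \<noteq> 0}" "poly ph1 s \<noteq> 0" for s
        using that upd upd'(1)[OF z(1)] g1(4)[of "z(j := s)"] by (auto simp: B_def pg1)
      then show "\<exists>g h. poly h t \<noteq> 0 \<and>
          (\<forall>s\<in>{t. j \<in> P \<longrightarrow> t \<noteq> 0}. poly h s \<noteq> 0 \<longrightarrow> f (z(j := s)) * poly h s = poly g s)"
        using g1(3) pg1(2) by (intro exI[of _ pg1] exI[of _ ph1]) auto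
    next
      show "ph \<noteq> 0" by fact
    next
      fix s :: 'k assume "s \<in> {t. j \<in> P \<longrightarrow> t \<noteq> 0}" "poly ph s \<noteq> 0"
      then show "f (z(j := s)) * poly ph s = poly pg s"
        using upd upd'(1)[OF z(1)] gh(4)[of "z(j := s)"] by (auto simp: B_def pg ph)
    qed
    then obtain p where p: "degree p \<le> degree pg + (if j \<in> P then degree ph else 0)"
      "\<And>t. t \<in> B \<Longrightarrow> t ^ (if j \<in> P then degree ph else 0) * f (z(j := t)) = poly p t"
      unfolding B_def by blast
    \<comment> \<open>The exponent \<open>degree ph\<close> varies with the slice; the additional
      power of the variable raises it to the uniform exponent \<open>D\<close>.\<close>
    define q where "q = p * [:0, 1:] ^ (D - (if j \<in> P then degree ph else 0))"
    have "degree q \<le> degree p + (D - (if j \<in> P then degree ph else 0))"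
      unfolding q_def by (rule order_trans[OF degree_mult_le]) (simp add: degree_linear_power)
    also have "\<dots> \<le> Dg + D" using p(1) pg(1) ph(1) by (auto simp: D_def)
    finally have "degree q \<le> Dg + D" .
    moreover have "t ^ D * f (z(j := t)) = poly q t" if "t \<in> B" for t
    proof -
      have "t ^ D = t ^ (if j \<in> P then degree ph else 0) * t ^ (D - (if j \<in> P then degree ph else 0))"
        using ph(1) by (simp add: D_def flip: power_add)
      then show ?thesis using p(2)[OF that] by (simp add: q_def poly_power mult_ac)
    qed
    ultimately show ?thesis by blast
  qed
  \<comment> \<open>\<open>Dg + D + 1\<close> nodes determine a polynomial of degree at most
    \<open>Dg + D\<close>; avoiding 0 keeps every node in the punctured line.\<close>
  obtain T :: "'k set" where T: "finite T" "card T = Suc (Dg + D)" "T \<subseteq> UNIV - {0}"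
    using infinite_arbitrarily_large[of "UNIV - {0::'k}"] infinite_alg_closed
    by (metis infinite_remove)
  obtain L where L: "\<And>p :: 'k poly. degree p < card T \<Longrightarrow> p = (\<Sum>t\<in>T. Polynomial.smult (poly p t) (L t))"
    using lagrange_interpolation[OF T(1)] by blast
  have TB: "t \<in> B" if "t \<in> T" for t using that T(3) by (auto simp: B_def)
  \<comment> \<open>The interpolation formula for \<open>z j ^ D * f z\<close>, divided by
    \<open>z j ^ D\<close>.\<close>
  define F where "F z = (\<Sum>t\<in>T. \<Sum>k\<le>degree (L t).
      t ^ D * coeff (L t) k * (f (z(j := t)) * z j powi (int k - int D)))" for z
  have F_eq: "f z = F z" if z: "z \<in> box (insert j J) P" "h z \<noteq> 0" for z
  proof -
    obtain p where p: "degree p \<le> Dg + D" "\<And>t. t \<in> B \<Longrightarrow> t ^ D * f (z(j := t)) = poly p t"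
      using slice[OF z] by blast
    have "z j ^ D * f z = poly p (z j)" using p(2)[of "z j"] upd'(2)[OF z(1)] by simp
    also have "\<dots> = (\<Sum>t\<in>T. (t ^ D * f (z(j := t))) * poly (L t) (z j))"
      using p(2) TB by (subst L[of p]) (use p(1) T in \<open>auto simp: poly_sum\<close>)
    also have "\<dots> = (\<Sum>t\<in>T. \<Sum>k\<le>degree (L t). t ^ D * coeff (L t) k * (f (z(j := t)) * z j ^ k))"
      by (simp add: poly_altdef sum_distrib_left mult_ac)
    finally have *: "z j ^ D * f z
      = (\<Sum>t\<in>T. \<Sum>k\<le>degree (L t). t ^ D * coeff (L t) k * (f (z(j := t)) * z j ^ k))" .
    show ?thesis
    proof (cases "j \<in> P")
      case True
      then have zj: "z j \<noteq> 0" using z by (auto simp: box_def)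
      have "z j ^ D * z j powi (int k - int D) = z j ^ k" for k
        using zj by (simp add: power_int_diff)
      then have "z j ^ D * (a * (b * z j powi (int k - int D))) = a * (b * z j ^ k)" for a b k
        by (metis mult.left_commute)
      then have "z j ^ D * F z = z j ^ D * f z"
        unfolding F_def sum_distrib_left * by (intro sum.cong refl)
      then show ?thesis using zj by simp
    next
      case False
      then show ?thesis using * by (simp add: F_def D_def)
    qed
  qed
  have F_laurent: "F \<in> lspan (zpow (insert j J)) (exponents (insert j J) P) (box (insert j J) P)"
    unfolding F_def
  proof (intro lspan_sum lspan_scale)
    fix t k assume t: "t \<in> T"
    have "regular_on_box J P' (\<lambda>z. f (z(j := t)))"
      unfolding regular_on_box_def
    proof
      fix z :: "nat \<Rightarrow> 'k" assume z: "z \<in> box J P'"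
      have "z(j := 0) = z" using z insert.hyps by (auto simp: box_def)
      then have zt: "z(j := t) \<in> box (insert j J) P" using z TB[OF t] upd[of z t] by simp
      obtain g1 h1 where g1: "g1 \<in> polyfun" "h1 \<in> polyfun" "h1 (z(j := t)) \<noteq> 0"
        "\<And>y. \<lbrakk>y \<in> box (insert j J) P; h1 y \<noteq> 0\<rbrakk> \<Longrightarrow> f y * h1 y = g1 y"
        by (rule regular_on_boxE[OF insert.prems(2) zt]) (rule that)
      have sub: "(\<lambda>z. f1 (z(j := t))) \<in> polyfun" if "f1 \<in> polyfun" for f1
      proof (rule polyfun_subst[OF that])
        show "(\<lambda>z. (z(j := t)) i) \<in> polyfun" for i by (cases "i = j") auto
      qed
      show "\<exists>g\<in>polyfun. \<exists>h\<in>polyfun. h z \<noteq> 0 \<and> (\<forall>y\<in>box J P'. h y \<noteq> 0 \<longrightarrow> f (y(j := t)) * h y = g y)"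
      proof (rule bexI[of _ "\<lambda>z. g1 (z(j := t))"], rule bexI[of _ "\<lambda>z. h1 (z(j := t))"],
          intro conjI ballI impI)
        fix y :: "nat \<Rightarrow> 'k" assume y: "y \<in> box J P'" "h1 (y(j := t)) \<noteq> 0"
        have "y(j := 0) = y" using y insert.hyps by (auto simp: box_def)
        then show "f (y(j := t)) * h1 (y(j := t)) = g1 (y(j := t))"
          using y TB[OF t] upd[of y t] by (intro g1(4)) auto
      qed (use g1 sub in auto)
    qed
    note IH = insert.IH[OF P' this]
    obtain A c where A: "finite A" "A \<subseteq> exponents J P'"
      "\<And>z. z \<in> box J P' \<Longrightarrow> f (z(j := t)) = (\<Sum>\<alpha>\<in>A. c \<alpha> * zpow J \<alpha> z)"
        by (rule lspanE[OF IH]) (rule that)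
    have "(\<lambda>z. \<Sum>\<alpha>\<in>A. c \<alpha> * zpow (insert j J) (\<alpha>(j := int k - int D)) z)
       \<in> lspan (zpow (insert j J)) (exponents (insert j J) P) (box (insert j J) P)"
    proof (intro lspan_sum lspan_base)
      fix \<alpha> assume "\<alpha> \<in> A"
      then show "\<alpha>(j := int k - int D) \<in> exponents (insert j J) P"
        using A(2) by (force simp: exponents_def P'_def D_def)
    qed
    then show "(\<lambda>z. f (z(j := t)) * z j powi (int k - int D))
       \<in> lspan (zpow (insert j J)) (exponents (insert j J) P) (box (insert j J) P)"
    proof (rule lspan_cong)
      fix z :: "nat \<Rightarrow> 'k" assume z: "z \<in> box (insert j J) P"
      have "zpow (insert j J) (\<alpha>(j := int k - int D)) z = z j powi (int k - int D) * zpow J \<alpha> (z(j := 0))" for \<alpha>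
        using insert.hyps by (simp add: zpow_def) (intro disjI2 prod.cong, auto)
      moreover have "f (z(j := t)) = (\<Sum>\<alpha>\<in>A. c \<alpha> * zpow J \<alpha> (z(j := 0)))"
        using A(3)[OF upd'(1)[OF z]] by simp
      ultimately show "f (z(j := t)) * z j powi (int k - int D)
        = (\<Sum>\<alpha>\<in>A. c \<alpha> * zpow (insert j J) (\<alpha>(j := int k - int D)) z)"
        by (simp add: sum_distrib_left sum_distrib_right mult_ac)
    qed
  qed
  obtain N G where G: "G \<in> polyfun"
    "\<And>z. z \<in> box (insert j J) P \<Longrightarrow> F z * (\<Prod>j\<in>P. z j ^ N) = G z"
    using laurent_clear_denominators[OF _ insert.prems(1) F_laurent] insert.hyps
    by (metis finite_insert)
  show ?case
  proof (rule lspan_cong[OF F_laurent])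
    fix z :: "nat \<Rightarrow> 'k" assume z: "z \<in> box (insert j J) P"
    obtain g1 h1 where g1: "g1 \<in> polyfun" "h1 \<in> polyfun" "h1 z \<noteq> 0"
      "\<And>y. \<lbrakk>y \<in> box (insert j J) P; h1 y \<noteq> 0\<rbrakk> \<Longrightarrow> f y * h1 y = g1 y"
      by (rule regular_on_boxE[OF insert.prems(2) z]) (rule that)
    have finP: "finite P" using insert.prems insert.hyps finite_subset by blast
    define mon where "mon y = (\<Prod>j\<in>P. y j ^ N)" for y :: "nat \<Rightarrow> 'k"
    have mon: "mon \<in> polyfun" unfolding mon_def by (intro polyfun_prod polyfun_power polyfun.coord)
    have mon0: "mon y \<noteq> 0" if "y \<in> box (insert j J) P" for y
      using that finP by (auto simp: mon_def box_def)
    \<comment> \<open>Both sides are polynomials and agree wherever \<open>h\<close>,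
      \<open>h1\<close> and the coordinates in \<open>P\<close> are nonzero. A point of disagreement
      could be moved into that set along a line.\<close>
    have "g1 z * mon z = G z * h1 z"
    proof (rule ccontr)
      assume "g1 z * mon z \<noteq> G z * h1 z"
      then have a: "(g1 z * mon z - G z * h1 z) * (h1 z * mon z) \<noteq> 0"
        using g1(3) mon0[OF z] by simp
      define m1 where "m1 y = h y * (\<Prod>j\<in>P. y j)" for y :: "nat \<Rightarrow> 'k"
      have "z0 \<in> box (insert j J) P" using insert.prems by (auto simp: box_def z0_def)
      then have m1: "m1 z0 \<noteq> 0" using gh(3) finP by (auto simp: m1_def box_def)
      have "\<exists>y. (\<forall>i. i \<notin> insert j J \<longrightarrow> y i = 0) \<and>
          (g1 y * mon y - G y * h1 y) * (h1 y * mon y) \<noteq> 0 \<and> m1 y \<noteq> 0"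
      proof (rule polyfun_mult_nonzero[where a = z and b = z0])
        show "(g1 z * mon z - G z * h1 z) * (h1 z * mon z) \<noteq> 0" by (rule a)
        show "m1 z0 \<noteq> 0" by (rule m1)
        show "infinite (UNIV :: 'k set)" by (rule infinite_alg_closed)
        show "(\<lambda>y. (g1 y * mon y - G y * h1 y) * (h1 y * mon y)) \<in> polyfun"
          using g1 mon G by (intro polyfun.mult polyfun_diff)
        show "m1 \<in> polyfun" unfolding m1_def
          using gh by (intro polyfun.mult polyfun_prod polyfun.coord)
      qed (use z in \<open>auto simp: box_def z0_def\<close>)
      then obtain y where y: "\<forall>i. i \<notin> insert j J \<longrightarrow> y i = 0"
        "g1 y * mon y \<noteq> G y * h1 y" "h1 y \<noteq> 0" "m1 y \<noteq> 0" by auto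
      have yb: "y \<in> box (insert j J) P" "h y \<noteq> 0" using y finP by (auto simp: box_def m1_def)
      have f1: "f y * h1 y = g1 y" using yb(1) y(3) by (rule g1(4))
      have f2: "f y * mon y = G y" using F_eq[OF yb] G(2)[OF yb(1)] by (simp add: mon_def)
      have "g1 y * mon y = G y * h1 y" unfolding f1[symmetric] f2[symmetric] by (simp only: mult_ac)
      then show False using y(2) by contradiction
    qed
    moreover have "F z * mon z = G z" using G(2)[OF z] by (simp add: mon_def)
    ultimately have "(f z * h1 z) * mon z = (F z * mon z) * h1 z"
      using g1(4)[OF z g1(3)] by (simp only:)
    then have "f z * (h1 z * mon z) = F z * (h1 z * mon z)" by (simp only: mult_ac)
    moreover have "h1 z * mon z \<noteq> 0" using g1(3) mon0[OF z] by simp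
    ultimately show "f z = F z" by simp
  qed
qed

text \<open>Dedekind's independence of characters, applied to the characters of a torus.\<close>

lemma zpow_independent:
  fixes c :: "(nat \<Rightarrow> int) \<Rightarrow> 'k::field"
  assumes inf: "infinite (UNIV :: 'k set)" and J: "finite J" and "finite A" "A \<subseteq> exponents J J"
    and "\<And>z. z \<in> box J J \<Longrightarrow> (\<Sum>\<alpha>\<in>A. c \<alpha> * zpow J \<alpha> z) = 0" and "\<alpha> \<in> A"
  shows "c \<alpha> = 0"
  using assms(3-)
proof (induction "card A" arbitrary: A c \<alpha> rule: less_induct)
  case less
  have mult: "zpow J \<gamma> (\<lambda>j. y j * z j) = zpow J \<gamma> y * zpow J \<gamma> z" for \<gamma> and y z :: "nat \<Rightarrow> 'k"
    by (simp add: zpow_def power_int_mult_distrib prod.distrib)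
  have other: "c \<beta> = 0" if \<beta>: "\<beta> \<in> A" "\<beta> \<noteq> \<alpha>" for \<beta>
  proof -
    obtain j where j: "\<alpha> j \<noteq> \<beta> j" using \<beta> by fastforce
    have "\<alpha> \<in> exponents J J" "\<beta> \<in> exponents J J" using less.prems(2,4) \<beta> by blast+
    then have "j \<notin> J \<Longrightarrow> \<alpha> j = \<beta> j" by (simp add: exponents_def)
    then have jJ: "j \<in> J" using j by blast
    \<comment> \<open>The two powers agree only for roots of unity of order dividing the difference
      of the exponents, and there are finitely many of those.\<close>
    obtain t :: 'k where t: "t \<noteq> 0" "t powi \<alpha> j \<noteq> t powi \<beta> j"
    proof -
      define n where "n = nat \<bar>\<alpha> j - \<beta> j\<bar>"
      have "n > 0" using j by (simp add: n_def)
      then have "coeff (Polynomial.monom 1 n - (1 :: 'k poly)) n = 1" by simp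
      then have "Polynomial.monom 1 n - 1 \<noteq> (0 :: 'k poly)" by (metis coeff_0 zero_neq_one)
      then have "finite (insert 0 {t::'k. poly (Polynomial.monom 1 n - 1) t = 0})"
        unfolding finite_insert by (rule poly_roots_finite)
      then obtain t where "t \<notin> insert 0 {t::'k. poly (Polynomial.monom 1 n - 1) t = 0}"
        using inf by (metis ex_new_if_finite)
      then have t: "t \<noteq> 0" "t ^ n \<noteq> 1" by (auto simp: poly_monom)
      have "t powi \<alpha> j \<noteq> t powi \<beta> j"
      proof
        assume "t powi \<alpha> j = t powi \<beta> j"
        then have 1: "t powi (\<alpha> j - \<beta> j) = 1" "t powi (\<beta> j - \<alpha> j) = 1" using t by (simp_all add: power_int_diff)
        then have "t powi int n = 1" by (cases "\<alpha> j \<le> \<beta> j") (auto simp: n_def)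
        then show False using t by simp
      qed
      then show ?thesis using that t by blast
    qed
    define y where "y i = (if i = j then t else if i \<in> J then 1 else 0)" for i
    have y: "zpow J \<gamma> y = t powi \<gamma> j" for \<gamma>
    proof -
      have "zpow J \<gamma> y = (\<Prod>i\<in>J. if i = j then t powi \<gamma> j else 1)"
        unfolding zpow_def by (intro prod.cong) (auto simp: y_def)
      then show ?thesis using J jJ by simp
    qed
    \<comment> \<open>Evaluating the relation at \<open>y * z\<close> and subtracting
      \<open>t powi \<alpha> j\<close> times the relation at \<open>z\<close> eliminates \<alpha>
      and leaves a shorter relation.\<close>
    define d where "d \<gamma> = c \<gamma> * (t powi \<gamma> j - t powi \<alpha> j)" for \<gamma>
    have "d \<beta> = 0"
    proof (rule less.hyps)
      show "card (A - {\<alpha>}) < card A" using less.prems(1,4) by (rule card_Diff1_less)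
      show "finite (A - {\<alpha>})" "A - {\<alpha>} \<subseteq> exponents J J" "\<beta> \<in> A - {\<alpha>}" using less.prems \<beta> by auto
      fix z :: "nat \<Rightarrow> 'k" assume z: "z \<in> box J J"
      then have "(\<lambda>i. y i * z i) \<in> box J J" using t jJ by (auto simp: box_def y_def)
      from less.prems(3)[OF this] have 1: "(\<Sum>\<gamma>\<in>A. c \<gamma> * (t powi \<gamma> j) * zpow J \<gamma> z) = 0"
        by (simp add: mult y mult.assoc)
      have "(\<Sum>\<gamma>\<in>A. d \<gamma> * zpow J \<gamma> z)
        = (\<Sum>\<gamma>\<in>A. c \<gamma> * (t powi \<gamma> j) * zpow J \<gamma> z) - t powi \<alpha> j * (\<Sum>\<gamma>\<in>A. c \<gamma> * zpow J \<gamma> z)"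
        by (simp add: d_def algebra_simps sum_subtractf sum_distrib_left)
      also have "\<dots> = 0" using 1 less.prems(3)[OF z] by simp
      finally show "(\<Sum>\<gamma>\<in>A - {\<alpha>}. d \<gamma> * zpow J \<gamma> z) = 0"
        using less.prems by (simp add: sum_diff1 d_def)
    qed
    then show ?thesis using t by (simp add: d_def)
  qed
  define z where "z i = (if i \<in> J then 1 else 0::'k)" for i
  have z: "z \<in> box J J" "zpow J \<alpha> z = 1" by (auto simp: box_def z_def zpow_def)
  have "(\<Sum>\<gamma>\<in>A. c \<gamma> * zpow J \<gamma> z) = (\<Sum>\<gamma>\<in>A. if \<gamma> = \<alpha> then c \<alpha> else 0)"
    using other z by (intro sum.cong) auto
  then show ?case using less.prems(1,4) less.prems(3)[OF z(1)] by simp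
qed

lemma zpow_notin_span:
  assumes inf: "infinite (UNIV :: 'k::field set)" and J: "finite J"
    and "\<beta> \<in> exponents J J"
  shows "(zpow J \<beta> :: (nat \<Rightarrow> 'k) \<Rightarrow> 'k) \<notin> lspan (zpow J) (exponents J J - {\<beta>}) (box J J)"
proof
  assume "(zpow J \<beta> :: (nat \<Rightarrow> 'k) \<Rightarrow> 'k) \<in> lspan (zpow J) (exponents J J - {\<beta>}) (box J J)"
  then obtain A and c :: "(nat \<Rightarrow> int) \<Rightarrow> 'k" where A: "finite A" "A \<subseteq> exponents J J - {\<beta>}"
    "\<And>z. z \<in> box J J \<Longrightarrow> zpow J \<beta> z = (\<Sum>\<alpha>\<in>A. c \<alpha> * zpow J \<alpha> z)"
    by (rule lspanE) (rule that)
  have "\<beta> \<notin> A" using A by auto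
  have "(c(\<beta> := -1)) \<beta> = 0"
  proof (rule zpow_independent[OF inf J, where A = "insert \<beta> A" and c = "c(\<beta> := -1)"])
    show "finite (insert \<beta> A)" "insert \<beta> A \<subseteq> exponents J J" "\<beta> \<in> insert \<beta> A" using A assms by auto
    fix z :: "nat \<Rightarrow> 'k" assume "z \<in> box J J"
    moreover have "(\<Sum>\<alpha>\<in>A. (c(\<beta> := -1)) \<alpha> * zpow J \<alpha> z) = (\<Sum>\<alpha>\<in>A. c \<alpha> * zpow J \<alpha> z)"
      using \<open>\<beta> \<notin> A\<close> by (intro sum.cong) auto
    ultimately show "(\<Sum>\<alpha>\<in>insert \<beta> A. (c(\<beta> := -1)) \<alpha> * zpow J \<alpha> z) = 0"
      using A(1,3) \<open>\<beta> \<notin> A\<close> by (simp add: sum.insert)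
  qed
  then show False by simp
qed

section \<open>Hyperbolic coordinates\<close>

definition linear_functional :: "((nat \<Rightarrow> 'k::field) \<Rightarrow> 'k) \<Rightarrow> bool" where
  "linear_functional \<phi> \<longleftrightarrow> (\<forall>u v. \<phi> (\<lambda>i. u i + v i) = \<phi> u + \<phi> v) \<and> (\<forall>c v. \<phi> (\<lambda>i. c * v i) = c * \<phi> v)"

lemma linear_functional_add: "linear_functional \<phi> \<Longrightarrow> \<phi> (\<lambda>i. u i + v i) = \<phi> u + \<phi> v"
  and linear_functional_scale: "linear_functional \<phi> \<Longrightarrow> \<phi> (\<lambda>i. c * v i) = c * \<phi> v"
  unfolding linear_functional_def by blast+

lemma linear_functional_zero: "linear_functional \<phi> \<Longrightarrow> \<phi> (\<lambda>_. 0) = 0"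
  using linear_functional_scale[of \<phi> 0 "\<lambda>_. 0"] by simp

lemma linear_functional_sum:
  assumes "linear_functional \<phi>"
  shows "\<phi> (\<lambda>k. \<Sum>i\<in>A. c i * E i k) = (\<Sum>i\<in>A. c i * \<phi> (E i))"
proof (induction A rule: infinite_finite_induct)
  case (insert x F)
  then show ?case using assms unfolding linear_functional_def by simp
qed (use linear_functional_zero[OF assms] in auto)

text \<open>Gaussian elimination: if the last functional is nonzero on a unit vector
  \<open>un s\<close>, projecting along \<open>un s\<close> onto its kernel removes one equation
  together with one unknown.\<close>

lemma common_zero_of_functionals:
  fixes \<phi> :: "nat \<Rightarrow> (nat \<Rightarrow> 'k::field) \<Rightarrow> 'k"
  assumes "\<And>i. i < k \<Longrightarrow> linear_functional (\<phi> i)" "finite J" "k < card J"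
  shows "\<exists>v. v \<noteq> (\<lambda>_. 0) \<and> (\<forall>j. j \<notin> J \<longrightarrow> v j = 0) \<and> (\<forall>i<k. \<phi> i v = 0)"
  using assms
proof (induction k arbitrary: J \<phi>)
  case 0
  then obtain j where "j \<in> J" by fastforce
  then show ?case by (intro exI[of _ "\<lambda>i. if i = j then 1 else 0"]) (auto simp: fun_eq_iff)
next
  case (Suc k)
  define un :: "nat \<Rightarrow> nat \<Rightarrow> 'k" where "un s = (\<lambda>i. if i = s then 1 else 0)" for s
  have lin: "linear_functional (\<phi> i)" if "i < Suc k" for i using Suc.prems(1) that by simp
  show ?case
  proof (cases "\<exists>s\<in>J. \<phi> k (un s) \<noteq> 0")
    case False
    obtain v where v: "v \<noteq> (\<lambda>_. 0)" "\<forall>j. j \<notin> J \<longrightarrow> v j = 0" "\<forall>i<k. \<phi> i v = 0"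
      using Suc.IH[of \<phi> J] Suc.prems by auto
    have "v = (\<lambda>k. \<Sum>s\<in>J. v s * un s k)"
      using v(2) Suc.prems(2) by (auto simp: un_def fun_eq_iff if_distrib cong: if_cong)
    then have "\<phi> k v = (\<Sum>s\<in>J. v s * \<phi> k (un s))"
      using linear_functional_sum[OF lin[of k], of v un J] by simp
    then have "\<phi> k v = 0" using False by simp
    then show ?thesis using v by (auto simp: less_Suc_eq)
  next
    case True
    then obtain s where s: "s \<in> J" "\<phi> k (un s) \<noteq> 0" by blast
    define pr where "pr v = (\<lambda>i. v i + (- (\<phi> k v / \<phi> k (un s))) * un s i)" for v
    have pr_eval: "\<phi> i (pr v) = \<phi> i v - \<phi> k v / \<phi> k (un s) * \<phi> i (un s)" if "i < Suc k" for i v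
      unfolding pr_def linear_functional_add[OF lin[OF that], of v]
        linear_functional_scale[OF lin[OF that]] by simp
    have lin': "linear_functional (\<lambda>v. \<phi> i (pr v))" if "i < k" for i
    proof -
      have "i < Suc k" using that by simp
      then show ?thesis
        using lin[of i] lin[of k] unfolding linear_functional_def pr_eval[OF \<open>i < Suc k\<close>]
        by (simp add: algebra_simps add_divide_distrib)
    qed
    have "card (J - {s}) = card J - 1" using s Suc.prems by simp
    then have "k < card (J - {s})" using Suc.prems(3) by linarith
    then obtain v where v: "v \<noteq> (\<lambda>_. 0)" "\<forall>j. j \<notin> J - {s} \<longrightarrow> v j = 0" "\<forall>i<k. \<phi> i (pr v) = 0"
      using Suc.IH[of "\<lambda>i v. \<phi> i (pr v)" "J - {s}"] lin' Suc.prems by auto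
    obtain j where j: "v j \<noteq> 0" using v(1) by (auto simp: fun_eq_iff)
    then have "j \<noteq> s" using v(2) by auto
    then have "pr v j \<noteq> 0" using j by (simp add: pr_def un_def)
    moreover have "\<phi> k (pr v) = 0" using pr_eval[of k v] s by simp
    moreover have "\<forall>j. j \<notin> J \<longrightarrow> pr v j = 0" using v(2) s by (auto simp: pr_def un_def)
    ultimately show ?thesis using v(3) by (intro exI[of _ "pr v"]) (auto simp: less_Suc_eq)
  qed
qed

lemma sum_lessThan_add: "(\<Sum>c<r + s. g c) = (\<Sum>i<r. g i) + (\<Sum>i<s. g (r + i :: nat))"
  for g :: "nat \<Rightarrow> 'a::comm_monoid_add"
  by (induction s) (simp_all add: add.assoc)

section \<open>Nondegenerate quadratic forms over an algebraically closed field\<close>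

locale nondegenerate_form =
  fixes N :: nat and q :: "(nat \<Rightarrow> 'k::alg_closed_field) \<Rightarrow> 'k" and B
  assumes lin: "linear_functional (\<lambda>u. B u v)"
    and B_sym: "B u v = B v u"
    and q_add: "q (\<lambda>i. u i + v i) = q u + q v + B u v"
    and q_scale: "q (\<lambda>i. c * v i) = c\<^sup>2 * q v"
    and nondegenerate: "\<lbrakk>v \<noteq> (\<lambda>_. 0); \<And>i. i \<ge> N \<Longrightarrow> v i = 0\<rbrakk> \<Longrightarrow> \<exists>w. (\<forall>i\<ge>N. w i = 0) \<and> B v w \<noteq> 0"
begin

definition hyperbolic_system :: "nat \<Rightarrow> (nat \<Rightarrow> nat \<Rightarrow> 'k) \<Rightarrow> (nat \<Rightarrow> nat \<Rightarrow> 'k) \<Rightarrow> bool" where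
  "hyperbolic_system r e f \<longleftrightarrow> (\<forall>i<r. (\<forall>k\<ge>N. e i k = 0 \<and> f i k = 0) \<and> q (e i) = 0 \<and> q (f i) = 0) \<and>
    (\<forall>i<r. \<forall>j<r. B (e i) (e j) = 0 \<and> B (f i) (f j) = 0 \<and> B (e i) (f j) = (if i = j then 1 else 0))"

lemma B_add: "B (\<lambda>i. u i + v i) w = B u w + B v w"
  using lin[of w] by (simp add: linear_functional_def)

lemma B_scale: "B (\<lambda>i. c * u i) w = c * B u w"
  using lin[of w] by (simp add: linear_functional_def)

lemma B_sum: "B (\<lambda>k. \<Sum>i\<in>A. c i * E i k) w = (\<Sum>i\<in>A. c i * B (E i) w)"
  by (rule linear_functional_sum[OF lin])

lemma B_self: "q v = 0 \<Longrightarrow> B v v = 0"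
  using q_add[of v v] q_scale[of 2 v] by simp

text \<open>The conditions leave a space of dimension at least 2, spanned by or containing
  \<open>w1\<close> and \<open>w2\<close>. On it a zero of the form is either \<open>w2\<close> or
  \<open>w1 + t * w2\<close>, where \<open>t\<close> is a root of a quadratic polynomial.\<close>

lemma isotropic_vector:
  assumes k: "k + 2 \<le> N"
  shows "\<exists>w. w \<noteq> (\<lambda>_. 0) \<and> (\<forall>i\<ge>N. w i = 0) \<and> q w = 0 \<and> (\<forall>i<k. B w (E i) = 0)"
proof -
  obtain w1 where w1: "w1 \<noteq> (\<lambda>_. 0)" "\<forall>j. j \<notin> {..<N} \<longrightarrow> w1 j = 0" "\<forall>i<k. B w1 (E i) = 0"
    using common_zero_of_functionals[of k "\<lambda>i u. B u (E i)" "{..<N}"] lin k by auto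
  obtain s where s: "w1 s \<noteq> 0" using w1(1) by (auto simp: fun_eq_iff)
  \<comment> \<open>The extra condition that coordinate \<open>s\<close> vanishes, while
    \<open>w1 s\<close> does not, makes \<open>w2\<close> independent of \<open>w1\<close>.\<close>
  define \<phi> where "\<phi> i = (if i < k then (\<lambda>u. B u (E i)) else (\<lambda>u. u s))" for i
  have "linear_functional (\<phi> i)" for i
    using lin by (auto simp: \<phi>_def linear_functional_def)
  then obtain w2 where w2: "w2 \<noteq> (\<lambda>_. 0)" "\<forall>j. j \<notin> {..<N} \<longrightarrow> w2 j = 0" "\<forall>i<Suc k. \<phi> i w2 = 0"
    using common_zero_of_functionals[of "Suc k" \<phi> "{..<N}"] k by auto
  have w2s: "w2 s = 0" "\<forall>i<k. B w2 (E i) = 0"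
    using w2(3) by (auto simp: \<phi>_def less_Suc_eq)
  show ?thesis
  proof (cases "q w2 = 0")
    case True
    then show ?thesis using w2 w2s by (intro exI[of _ w2]) auto
  next
    case False
    then have "degree [:q w1, B w1 w2, q w2:] > 0" by simp
    then obtain t where t: "poly [:q w1, B w1 w2, q w2:] t = 0"
      using alg_closed_imp_poly_has_root by blast
    define w where "w = (\<lambda>i. w1 i + t * w2 i)"
    have "q w = q w1 + t * B w1 w2 + t\<^sup>2 * q w2"
      unfolding w_def q_add[of w1 "\<lambda>i. t * w2 i"] q_scale
      using B_sym[of w1 "\<lambda>i. t * w2 i"] B_scale[of t w2 w1] B_sym[of w1 w2] by simp
    then have "q w = 0" using t by (simp add: algebra_simps power2_eq_square)
    moreover have "w s \<noteq> 0" using s w2s by (simp add: w_def)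
    then have "w \<noteq> (\<lambda>_. 0)" by auto
    moreover have "\<forall>i<k. B w (E i) = 0"
      using w1(3) w2s(2) B_add[of w1 "\<lambda>i. t * w2 i"] B_scale by (simp add: w_def)
    ultimately show ?thesis using w1(2) w2(2)
      by (intro exI[of _ w]) (simp add: w_def)
  qed
qed

text \<open>A new pair starts with an isotropic \<open>w\<close> orthogonal to the old pairs.
  Nondegeneracy gives a partner, which is normalised (\<open>v1\<close>), made orthogonal to the old
  pairs (\<open>v2\<close>), and finally made isotropic by adding a multiple of \<open>w\<close>
  (\<open>g\<close>).\<close>

lemma hyperbolic_pairs:
  assumes "2 * r \<le> N"
  shows "\<exists>e f. hyperbolic_system r e f"
  using assms
proof (induction r)
  case 0
  show ?case by (simp add: hyperbolic_system_def)
next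
  case (Suc r)
  then obtain e f where H: "hyperbolic_system r e f" by auto
  then have supp: "\<And>i k. \<lbrakk>i < r; k \<ge> N\<rbrakk> \<Longrightarrow> e i k = 0 \<and> f i k = 0"
    and iso: "\<And>i. i < r \<Longrightarrow> q (e i) = 0 \<and> q (f i) = 0"
    and gram: "\<And>i j. \<lbrakk>i < r; j < r\<rbrakk> \<Longrightarrow> B (e i) (e j) = 0 \<and> B (f i) (f j) = 0 \<and> B (e i) (f j) = (if i = j then 1 else 0)"
    by (simp_all add: hyperbolic_system_def)
  define E where "E i = (if i < r then e i else f (i - r))" for i
  obtain w where w: "w \<noteq> (\<lambda>_. 0)" "\<forall>i\<ge>N. w i = 0" "q w = 0" "\<forall>i<2 * r. B w (E i) = 0"
    using isotropic_vector[of "2 * r" E] Suc.prems by auto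
  have we: "B w (e i) = 0" "B w (f i) = 0" if "i < r" for i
    using w(4)[rule_format, of i] w(4)[rule_format, of "i + r"] that by (auto simp: E_def)
  obtain v0 where v0: "\<forall>i\<ge>N. v0 i = 0" "B w v0 \<noteq> 0"
    using nondegenerate[OF w(1)] w(2) by blast
  define v1 where "v1 = (\<lambda>k. (1 / B w v0) * v0 k)"
  define x where "x = (\<lambda>k. \<Sum>i<r. (- B v1 (f i)) * e i k)"
  define y where "y = (\<lambda>k. \<Sum>i<r. (- B v1 (e i)) * f i k)"
  define v2 where "v2 = (\<lambda>k. v1 k + (x k + y k))"
  have Bv2: "B v2 u = B v1 u + ((\<Sum>i<r. (- B v1 (f i)) * B (e i) u) + (\<Sum>i<r. (- B v1 (e i)) * B (f i) u))" for u
    unfolding v2_def B_add[of v1 "\<lambda>k. x k + y k"] B_add[of x y] unfolding x_def y_def B_sum ..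
  have "B (e i) w = 0" "B (f i) w = 0" if "i < r" for i
    using we[OF that] B_sym[of w] by simp_all
  then have "B v2 w = B v1 w" by (simp add: Bv2)
  also have "\<dots> = 1" using v0 B_sym[of v1 w] B_sym[of v0 w] B_scale[of "1 / B w v0" v0 w] by (simp add: v1_def)
  finally have v2w: "B v2 w = 1" .
  have v2e: "B v2 (e j) = 0" if "j < r" for j
  proof -
    have "(\<Sum>i<r. (- B v1 (f i)) * B (e i) (e j)) = 0" using gram that by simp
    moreover have "(\<Sum>i<r. (- B v1 (e i)) * B (f i) (e j)) = (\<Sum>i<r. if i = j then - B v1 (e j) else 0)"
      using gram that B_sym by (intro sum.cong) auto
    ultimately show ?thesis using that by (simp add: Bv2)
  qed
  have v2f: "B v2 (f j) = 0" if "j < r" for j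
  proof -
    have "(\<Sum>i<r. (- B v1 (e i)) * B (f i) (f j)) = 0" using gram that by simp
    moreover have "(\<Sum>i<r. (- B v1 (f i)) * B (e i) (f j)) = (\<Sum>i<r. if i = j then - B v1 (f j) else 0)"
      using gram that by (intro sum.cong) auto
    ultimately show ?thesis using that by (simp add: Bv2)
  qed
  \<comment> \<open>Since \<open>q w = 0\<close> and \<open>B v2 w = 1\<close>, adding
    \<open>c\<close> times \<open>w\<close> changes \<open>q v2\<close> by exactly \<open>c\<close>;
    this chooses \<open>c\<close> without dividing by 2.\<close>
  define g where "g = (\<lambda>k. v2 k + (- q v2) * w k)"
  have Bg: "B g u = B v2 u - q v2 * B w u" for u
    unfolding g_def B_add[of v2 "\<lambda>k. (- q v2) * w k"] B_scale by simp
  have "q g = q v2 + q (\<lambda>k. (- q v2) * w k) + B v2 (\<lambda>k. (- q v2) * w k)"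
    unfolding g_def by (rule q_add)
  also have "B v2 (\<lambda>k. (- q v2) * w k) = - q v2 * B w v2"
    unfolding B_sym[of v2] by (rule B_scale)
  finally have qg: "q g = 0" using w(3) v2w B_sym[of w v2] by (simp only: q_scale) simp
  have suppg: "g k = 0" if "k \<ge> N" for k
    using that w(2) v0(1) supp by (auto simp: g_def v2_def v1_def x_def y_def)
  have gw: "B g w = 1" using v2w B_self[OF w(3)] by (simp add: Bg)
  have ge: "B g (e j) = 0" "B g (f j) = 0" if "j < r" for j
    using that v2e v2f we by (auto simp: Bg)
  define e' where "e' = e(r := w)"
  define f' where "f' = f(r := g)"
  have "\<forall>i<Suc r. (\<forall>k\<ge>N. e' i k = 0 \<and> f' i k = 0) \<and> q (e' i) = 0 \<and> q (f' i) = 0"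
    using supp iso w qg suppg by (auto simp: e'_def f'_def less_Suc_eq)
  moreover have "\<forall>i<Suc r. \<forall>j<Suc r. B (e' i) (e' j) = 0 \<and> B (f' i) (f' j) = 0 \<and>
      B (e' i) (f' j) = (if i = j then 1 else 0)"
    using gram we ge gw B_self[OF w(3)] B_self[OF qg] B_sym
    by (auto simp: e'_def f'_def less_Suc_eq)
  ultimately have "hyperbolic_system (Suc r) e' f'" unfolding hyperbolic_system_def by blast
  then show ?case by blast
qed

text \<open>The error \<open>u\<close> of the expansion is orthogonal to all \<open>e\<close> and
  \<open>f\<close>. These \<open>2 * r\<close> vectors together with \<open>u\<close> are linearly
  dependent, and pairing the relation with the partners kills every coefficient except that of
  \<open>u\<close>, so \<open>u\<close> is zero.\<close>

lemma hyperbolic_basis: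
  assumes "N = 2 * r" and supp: "\<And>i k. \<lbrakk>i < r; k \<ge> N\<rbrakk> \<Longrightarrow> e i k = 0 \<and> f i k = 0"
    and gram: "\<And>i j. \<lbrakk>i < r; j < r\<rbrakk> \<Longrightarrow> B (e i) (e j) = 0 \<and> B (f i) (f j) = 0 \<and> B (e i) (f j) = (if i = j then 1 else 0)"
    and v: "\<And>k. k \<ge> N \<Longrightarrow> v k = 0"
  shows "v = (\<lambda>k. (\<Sum>i<r. B v (f i) * e i k) + (\<Sum>i<r. B v (e i) * f i k))"
proof -
  define x where "x = (\<lambda>k. \<Sum>i<r. (- B v (f i)) * e i k)"
  define y where "y = (\<lambda>k. \<Sum>i<r. (- B v (e i)) * f i k)"
  define u where "u = (\<lambda>k. v k + (x k + y k))"
  have Bu: "B u w = B v w + ((\<Sum>i<r. (- B v (f i)) * B (e i) w) + (\<Sum>i<r. (- B v (e i)) * B (f i) w))" for w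
    unfolding u_def B_add[of v "\<lambda>k. x k + y k"] B_add[of x y] unfolding x_def y_def B_sum ..
  have ue: "B u (e j) = 0" if "j < r" for j
  proof -
    have "(\<Sum>i<r. (- B v (f i)) * B (e i) (e j)) = 0" using gram that by simp
    moreover have "(\<Sum>i<r. (- B v (e i)) * B (f i) (e j)) = (\<Sum>i<r. if i = j then - B v (e j) else 0)"
      using gram that B_sym by (intro sum.cong) auto
    ultimately show ?thesis using that by (simp add: Bu)
  qed
  have uf: "B u (f j) = 0" if "j < r" for j
  proof -
    have "(\<Sum>i<r. (- B v (e i)) * B (f i) (f j)) = 0" using gram that by simp
    moreover have "(\<Sum>i<r. (- B v (f i)) * B (e i) (f j)) = (\<Sum>i<r. if i = j then - B v (f j) else 0)"
      using gram that by (intro sum.cong) auto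
    ultimately show ?thesis using that by (simp add: Bu)
  qed
  \<comment> \<open>The index \<open>N = 2 * r\<close> carries \<open>u\<close>, so the sums up to
    \<open>N\<close> involve \<open>N + 1\<close> vectors of an \<open>N\<close>-dimensional
    space.\<close>
  define E where "E c = (if c < r then e c else if c < 2 * r then f (c - r) else u)" for c
  have "linear_functional (\<lambda>c. \<Sum>i\<le>N. c i * E i s)" for s
    by (simp add: linear_functional_def algebra_simps sum.distrib sum_distrib_left)
  then obtain c where c: "c \<noteq> (\<lambda>_. 0)" "\<forall>j. j \<notin> {..N} \<longrightarrow> c j = 0" "\<forall>s<N. (\<Sum>i\<le>N. c i * E i s) = 0"
    using common_zero_of_functionals[of N "\<lambda>s c. \<Sum>i\<le>N. c i * E i s" "{..N}"] by auto
  have suppE: "E i s = 0" if "s \<ge> N" for i s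
    using that supp v by (auto simp: E_def u_def x_def y_def \<open>N = 2 * r\<close>)
  have zero: "(\<lambda>s. \<Sum>i\<le>N. c i * E i s) = (\<lambda>_. 0)"
  proof
    show "(\<Sum>i\<le>N. c i * E i s) = 0" for s
      using c(3) suppE by (cases "s < N") auto
  qed
  have pair: "(\<Sum>i\<le>N. c i * B (E i) w) = 0" for w
    using B_sum[of c E "{..N}" w] linear_functional_zero[OF lin] by (simp add: zero)
  have ce: "c j = 0" if "j < r" for j
  proof -
    have "(\<Sum>i\<le>N. c i * B (E i) (f j)) = (\<Sum>i\<le>N. if i = j then c j else 0)"
      using gram uf that by (intro sum.cong refl) (auto simp: E_def \<open>N = 2 * r\<close>)
    then show ?thesis using pair[of "f j"] that \<open>N = 2 * r\<close> by simp
  qed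
  have cf: "c (r + j) = 0" if "j < r" for j
  proof -
    have "(\<Sum>i\<le>N. c i * B (E i) (e j)) = (\<Sum>i\<le>N. if i = r + j then c (r + j) else 0)"
      using gram ue that B_sym by (intro sum.cong refl) (auto simp: E_def \<open>N = 2 * r\<close>)
    then show ?thesis using pair[of "e j"] that \<open>N = 2 * r\<close> by simp
  qed
  have c0: "c i = 0" if "i \<noteq> N" for i
  proof -
    consider "i < r" | "\<not> i < r" "i < 2 * r" | "\<not> i < 2 * r" by blast
    then show ?thesis
    proof cases
      case 2
      then show ?thesis using cf[of "i - r"] by simp
    qed (use ce c(2) that \<open>N = 2 * r\<close> in auto)
  qed
  then have cN: "c N \<noteq> 0" using c(1) by (metis ext)
  have "u s = 0" for s
  proof -
    have "(\<Sum>i\<le>N. c i * E i s) = (\<Sum>i\<le>N. if i = N then c N * u s else 0)"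
      using c0 by (intro sum.cong refl) (auto simp: E_def \<open>N = 2 * r\<close>)
    then show ?thesis using fun_cong[OF zero, of s] cN by simp
  qed
  then have "v k = - (x k + y k)" for k
    by (simp only: u_def eq_neg_iff_add_eq_0)
  then show ?thesis by (auto simp: x_def y_def sum_negf)
qed

end

section \<open>The polar form of a smooth quadric\<close>

definition polar_form :: "nat \<Rightarrow> (nat \<Rightarrow> nat \<Rightarrow> 'k::field) \<Rightarrow> (nat \<Rightarrow> 'k) \<Rightarrow> (nat \<Rightarrow> 'k) \<Rightarrow> 'k" where
  "polar_form n a u v = (\<Sum>j\<le>n+1. \<Sum>i\<le>j. a i j * (u i * v j + v i * u j))"

text \<open>A vector \<open>v\<close> of the radical has \<open>2 * q v = B v v = 0\<close>, so it
  represents a point of the quadric. The partial derivatives there are the values of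
  \<open>B v\<close> on the unit vectors and all vanish, against the Jacobian criterion.\<close>

lemma smooth_quadric_nondegenerate:
  fixes a :: "nat \<Rightarrow> nat \<Rightarrow> 'k::alg_closed_field"
  assumes "smooth_quadric n a" "(2::'k) \<noteq> 0"
  shows "nondegenerate_form (n + 2) (quadratic_form n a) (polar_form n a)"
proof
  let ?q = "quadratic_form n a" and ?B = "polar_form n a"
  note sum.atMost_Suc [simp del]
  show sym: "?B u v = ?B v u" for u v by (simp add: polar_form_def add.commute)
  show "linear_functional (\<lambda>u. ?B u v)" for v
    by (simp add: linear_functional_def polar_form_def algebra_simps sum.distrib sum_distrib_left)
  show add: "?q (\<lambda>i. u i + v i) = ?q u + ?q v + ?B u v" for u v
    by (simp add: quadratic_form_def polar_form_def algebra_simps sum.distrib)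
  show "?q (\<lambda>i. c * v i) = c\<^sup>2 * ?q v" for c v
    by (simp add: quadratic_form_def sum_distrib_left power2_eq_square mult_ac)
  fix v :: "nat \<Rightarrow> 'k" assume v: "v \<noteq> (\<lambda>_. 0)" "\<And>i. i \<ge> n + 2 \<Longrightarrow> v i = 0"
  have deriv: "quadratic_form_deriv n a k v = ?B v (\<lambda>i. if i = k then 1 else 0)" for k
    unfolding quadratic_form_deriv_def polar_form_def by (intro sum.cong refl) auto
  show "\<exists>w. (\<forall>i\<ge>n + 2. w i = 0) \<and> ?B v w \<noteq> 0"
  proof (rule ccontr)
    assume *: "\<nexists>w. (\<forall>i\<ge>n + 2. w i = 0) \<and> ?B v w \<noteq> 0"
    have "?B v v = 0" using * v(2) by blast
    moreover have "?B v v = 2 * ?q v"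
      by (simp add: polar_form_def quadratic_form_def sum_distrib_left algebra_simps)
    ultimately have qv: "?q v = 0" using assms(2) by simp
    define p where "p = {\<lambda>i. c * v i | c. c \<noteq> 0}"
    have "v \<in> p" unfolding p_def by (intro CollectI exI[of _ 1]) auto
    have "p \<in> quadric n a"
    proof -
      have "?q w = 0" if "w \<in> p" for w
      proof -
        obtain c where "w = (\<lambda>i. c * v i)" using \<open>w \<in> p\<close> by (auto simp: p_def)
        then have "?q w = c\<^sup>2 * ?q v"
          by (simp add: quadratic_form_def sum_distrib_left power2_eq_square mult_ac)
        then show ?thesis using qv by simp
      qed
      moreover have "p \<in> proj_space (n + 1)"
        unfolding proj_space_def p_def using v by (auto simp: coord_space_def)
      ultimately show ?thesis by (simp add: quadric_def)
    qed
    then obtain k where k: "k \<le> n + 1" "quadratic_form_deriv n a k v \<noteq> 0"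
      using assms(1) \<open>v \<in> p\<close> by (auto simp: smooth_quadric_def)
    have \<delta>: "\<forall>i\<ge>n + 2. (if i = k then 1 else (0::'k)) = 0" using k(1) by auto
    have all: "?B v w = 0" if "\<forall>i\<ge>n + 2. w i = 0" for w
      using *[unfolded not_ex, rule_format, of w] that by simp
    have "?B v (\<lambda>i. if i = k then 1 else 0) = 0" by (rule all[OF \<delta>])
    then show False using k(2) deriv[of k] by simp
  qed
qed

text \<open>Coordinate \<open>i \<le> m\<close> is the \<open>y\<^sub>i\<close> of the overview and
  coordinate \<open>m + 1 + i\<close> is \<open>x\<^sub>i\<close>. The new basis vectors are the
  \<open>E c\<close>, and \<open>l\<close> is the matrix of the inverse change of
  coordinates.\<close>

locale hyperbolic_coordinates =
  fixes m :: nat and a :: "nat \<Rightarrow> nat \<Rightarrow> 'k::alg_closed_field"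
    and E :: "nat \<Rightarrow> nat \<Rightarrow> 'k" and l :: "nat \<Rightarrow> nat \<Rightarrow> 'k"
  assumes coord_space: "(\<lambda>k. \<Sum>c\<le>2 * m + 1. u c * E c k) \<in> coord_space (2 * m + 1)"
    and inverse_left: "v \<in> coord_space (2 * m + 1) \<Longrightarrow>
      (\<lambda>k. \<Sum>c\<le>2 * m + 1. (\<Sum>i\<le>2 * m + 1. l c i * v i) * E c k) = v"
    and inverse_right: "c \<le> 2 * m + 1 \<Longrightarrow> (\<Sum>i\<le>2 * m + 1. l c i * (\<Sum>c\<le>2 * m + 1. u c * E c i)) = u c"
    and form: "quadratic_form (2 * m) a (\<lambda>k. \<Sum>c\<le>2 * m + 1. u c * E c k) = (\<Sum>i\<le>m. u i * u (m + 1 + i))"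
begin

definition lc :: "nat \<Rightarrow> (nat \<Rightarrow> 'k) \<Rightarrow> 'k" where
  "lc c v = (\<Sum>i\<le>2 * m + 1. l c i * v i)"

definition vec :: "(nat \<Rightarrow> 'k) \<Rightarrow> nat \<Rightarrow> 'k" where
  "vec u = (\<lambda>k. \<Sum>c\<le>2 * m + 1. u c * E c k)"

lemma vec_in: "vec u \<in> coord_space (2 * m + 1)"
  and vec_lc: "v \<in> coord_space (2 * m + 1) \<Longrightarrow> vec (\<lambda>c. lc c v) = v"
  and lc_vec: "c \<le> 2 * m + 1 \<Longrightarrow> lc c (vec u) = u c"
  and form_vec: "quadratic_form (2 * m) a (vec u) = (\<Sum>i\<le>m. u i * u (m + 1 + i))"
  using coord_space inverse_left inverse_right form unfolding lc_def vec_def by auto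

end

lemma hyperbolic_coordinates_exist:
  fixes a :: "nat \<Rightarrow> nat \<Rightarrow> 'k::alg_closed_field"
  assumes "smooth_quadric (2 * m) a" "(2::'k) \<noteq> 0"
  shows "\<exists>E l. hyperbolic_coordinates m a E l"
proof -
  interpret nondegenerate_form "2 * m + 2" "quadratic_form (2 * m) a" "polar_form (2 * m) a"
    using smooth_quadric_nondegenerate[OF assms] by simp
  let ?q = "quadratic_form (2 * m) a" and ?B = "polar_form (2 * m) a"
  note sum.atMost_Suc [simp del] sum.lessThan_Suc [simp del]
  define r where "r = m + 1"
  have r: "2 * m + 2 = 2 * r" by (simp add: r_def)
  obtain e f where H: "hyperbolic_system r e f"
    using hyperbolic_pairs[of r] r by (metis order_refl)
  then have supp: "\<And>i k. \<lbrakk>i < r; k \<ge> 2 * m + 2\<rbrakk> \<Longrightarrow> e i k = 0 \<and> f i k = 0"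
    and iso: "\<And>i. i < r \<Longrightarrow> ?q (e i) = 0 \<and> ?q (f i) = 0"
    and gram: "\<And>i j. \<lbrakk>i < r; j < r\<rbrakk> \<Longrightarrow> ?B (e i) (e j) = 0 \<and> ?B (f i) (f j) = 0 \<and> ?B (e i) (f j) = (if i = j then 1 else 0)"
    unfolding hyperbolic_system_def by blast+
  have gram': "?B (f i) (e j) = (if i = j then 1 else 0)" if "i < r" "j < r" for i j
    using gram[OF that(2,1)] B_sym[of "f i"] by simp
  define E where "E c = (if c < r then e c else f (c - r))" for c
  \<comment> \<open>The basis dual to \<open>E\<close> under the polar form: every vector is
    replaced by its hyperbolic partner.\<close>
  define E' where "E' c = (if c < r then f c else e (c - r))" for c
  define l where "l c i = ?B (\<lambda>k. if k = i then 1 else 0) (E' c)" for c i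
  have idx: "{..2 * m + 1} = {..<r + r}" by (auto simp: r_def)
  have split: "(\<Sum>c\<le>2 * m + 1. g c) = (\<Sum>i<r. g i) + (\<Sum>i<r. g (r + i))" for g :: "nat \<Rightarrow> 'k"
    unfolding idx by (rule sum_lessThan_add)
  have lc: "(\<Sum>i\<le>2 * m + 1. l c i * v i) = ?B v (E' c)" if "\<And>k. k \<ge> 2 * m + 2 \<Longrightarrow> v k = 0" for v c
  proof -
    have "v = (\<lambda>k. \<Sum>i\<le>2 * m + 1. v i * (if k = i then 1 else 0))"
    proof
      show "v k = (\<Sum>i\<le>2 * m + 1. v i * (if k = i then 1 else 0))" for k
        using that[of k] by (cases "k \<le> 2 * m + 1") (auto simp: if_distrib cong: if_cong)
    qed
    then have "?B v (E' c) = (\<Sum>i\<le>2 * m + 1. v i * l c i)"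
      unfolding l_def using B_sum[of v "\<lambda>i k. if k = i then 1 else 0" "{..2 * m + 1}" "E' c"] by simp
    then show ?thesis by (simp add: mult.commute)
  qed
  define vec where "vec u = (\<lambda>k. \<Sum>c\<le>2 * m + 1. u c * E c k)" for u
  define xx where "xx u = (\<lambda>k. \<Sum>i<r. u i * e i k)" for u :: "nat \<Rightarrow> 'k"
  define yy where "yy u = (\<lambda>k. \<Sum>i<r. u (r + i) * f i k)" for u :: "nat \<Rightarrow> 'k"
  have vec: "vec u = (\<lambda>k. xx u k + yy u k)" for u
    unfolding vec_def xx_def yy_def split by (simp add: E_def)
  have vec0: "vec u k = 0" if "k \<ge> 2 * m + 2" for u k
    using supp that by (simp add: vec xx_def yy_def)
  have "hyperbolic_coordinates m a E l"
  proof (unfold_locales, fold vec_def)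
    show "vec u \<in> coord_space (2 * m + 1)" for u
      using vec0 by (simp add: coord_space_def)
    show "vec (\<lambda>c. \<Sum>i\<le>2 * m + 1. l c i * v i) = v" if "v \<in> coord_space (2 * m + 1)" for v
    proof -
      have v: "v k = 0" if "k \<ge> 2 * m + 2" for k
        using \<open>v \<in> coord_space (2 * m + 1)\<close> that by (auto simp: coord_space_def)
      have "vec (\<lambda>c. \<Sum>i\<le>2 * m + 1. l c i * v i) = vec (\<lambda>c. ?B v (E' c))"
        using lc v by simp
      also have "\<dots> = (\<lambda>k. (\<Sum>i<r. ?B v (f i) * e i k) + (\<Sum>i<r. ?B v (e i) * f i k))"
        unfolding vec xx_def yy_def by (simp add: E'_def)
      also have "\<dots> = v"
        by (rule hyperbolic_basis[OF r supp gram v, symmetric])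
      finally show ?thesis .
    qed
    have lcv: "(\<Sum>i\<le>2 * m + 1. l c i * vec u i) = u c" if c: "c \<le> 2 * m + 1" for u c
    proof -
      have "(\<Sum>i\<le>2 * m + 1. l c i * vec u i) = ?B (vec u) (E' c)"
        using vec0 by (intro lc)
      also have "\<dots> = (\<Sum>i<r. u i * ?B (e i) (E' c)) + (\<Sum>i<r. u (r + i) * ?B (f i) (E' c))"
        unfolding vec B_add xx_def yy_def B_sum ..
      also have "\<dots> = u c"
      proof (cases "c < r")
        case True
        then have "(\<Sum>i<r. u i * ?B (e i) (E' c)) = (\<Sum>i<r. if i = c then u c else 0)"
          using gram by (intro sum.cong) (auto simp: E'_def)
        moreover have "(\<Sum>i<r. u (r + i) * ?B (f i) (E' c)) = 0"
          using gram True by (simp add: E'_def)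
        ultimately show ?thesis using True by simp
      next
        case False
        then have c': "c - r < r" using c r by simp
        then have "(\<Sum>i<r. u (r + i) * ?B (f i) (E' c)) = (\<Sum>i<r. if i = c - r then u c else 0)"
          using gram' False by (intro sum.cong) (auto simp: E'_def)
        moreover have "(\<Sum>i<r. u i * ?B (e i) (E' c)) = 0"
          using gram False c' by (simp add: E'_def)
        ultimately show ?thesis using c' by simp
      qed
      finally show ?thesis .
    qed
    show "(\<Sum>i\<le>2 * m + 1. l c i * (\<Sum>c\<le>2 * m + 1. u c * E c i)) = u c"
      if "c \<le> 2 * m + 1" for u c
      using lcv[OF that] by (simp only: vec_def)
    show "?q (vec u) = (\<Sum>i\<le>m. u i * u (m + 1 + i))" for u
    proof -
      \<comment> \<open>Both the span of the \<open>e\<close> and the span of the \<open>f\<close>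
        are totally isotropic, so only the cross term of the two halves contributes to the
        form.\<close>
      have iso_sum: "?q (\<lambda>k. \<Sum>i\<in>A. c i * g i k) = 0"
        if "\<And>i. i \<in> A \<Longrightarrow> ?q (g i) = 0" "\<And>i j. \<lbrakk>i \<in> A; j \<in> A\<rbrakk> \<Longrightarrow> ?B (g i) (g j) = 0" for A :: "nat set" and c g
        using that
      proof (induction A rule: infinite_finite_induct)
        case (insert x F)
        have "?B (\<lambda>k. \<Sum>i\<in>F. c i * g i k) (\<lambda>k. c x * g x k) = (\<Sum>i\<in>F. c i * ?B (g i) (\<lambda>k. c x * g x k))"
          by (rule B_sum)
        also have "\<dots> = 0"
        proof (rule sum.neutral, rule ballI)
          fix i assume "i \<in> F"
          have "?B (g i) (\<lambda>k. c x * g x k) = c x * ?B (g x) (g i)"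
            unfolding B_sym[of "g i"] by (rule B_scale)
          then show "c i * ?B (g i) (\<lambda>k. c x * g x k) = 0"
            using insert.prems \<open>i \<in> F\<close> by simp
        qed
        finally have "?q (\<lambda>k. (\<Sum>i\<in>F. c i * g i k) + c x * g x k) = 0"
          unfolding q_add q_scale using insert.IH insert.prems by simp
        then show ?case using insert.hyps by (simp add: add.commute)
      qed (simp_all add: quadratic_form_def)
      have "?q (xx u) = 0" unfolding xx_def by (rule iso_sum) (use iso gram in auto)
      moreover have "?q (yy u) = 0" unfolding yy_def by (rule iso_sum) (use iso gram in auto)
      moreover have "?B (xx u) (yy u) = (\<Sum>i<r. u i * u (r + i))"
      proof -
        have "?B (e i) (yy u) = u (r + i)" if "i < r" for i
        proof -
          have "?B (e i) (yy u) = (\<Sum>j<r. u (r + j) * ?B (f j) (e i))"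
            unfolding B_sym[of "e i"] yy_def by (rule B_sum)
          also have "\<dots> = (\<Sum>j<r. if j = i then u (r + i) else 0)"
            using gram' that by (intro sum.cong) auto
          finally show ?thesis using that by simp
        qed
        then show ?thesis unfolding xx_def B_sum by (intro sum.cong) (auto simp: xx_def)
      qed
      ultimately show ?thesis
        unfolding vec q_add by (simp add: r_def lessThan_Suc_atMost)
    qed
  qed
  then show ?thesis by blast
qed

section \<open>The ring of differential operators\<close>

text \<open>The properties of a sheaf of rings of functions, extended by zero, on which the calculus
  of differential operators is built. It keeps that calculus apart from projective geometry.\<close>

locale function_sheaf =
  fixes T :: "'p topology" and \<O> :: "'p set \<Rightarrow> ('p \<Rightarrow> 'k::field) set"
  assumes O_outside: "\<lbrakk>openin T V; f \<in> \<O> V; p \<notin> V\<rbrakk> \<Longrightarrow> f p = 0"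
    and O_const: "openin T V \<Longrightarrow> fres V (\<lambda>_. c) \<in> \<O> V"
    and O_add: "\<lbrakk>openin T V; f \<in> \<O> V; g \<in> \<O> V\<rbrakk> \<Longrightarrow> (\<lambda>p. f p + g p) \<in> \<O> V"
    and O_mult: "\<lbrakk>openin T V; f \<in> \<O> V; g \<in> \<O> V\<rbrakk> \<Longrightarrow> (\<lambda>p. f p * g p) \<in> \<O> V"
    and O_res: "\<lbrakk>openin T V; openin T W; W \<subseteq> V; f \<in> \<O> V\<rbrakk> \<Longrightarrow> fres W f \<in> \<O> W"
    and O_local: "\<lbrakk>openin T V; \<And>p. p \<notin> V \<Longrightarrow> f p = 0;
        \<And>p. p \<in> V \<Longrightarrow> \<exists>W. openin T W \<and> p \<in> W \<and> W \<subseteq> V \<and> fres W f \<in> \<O> W\<rbrakk> \<Longrightarrow> f \<in> \<O> V"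
begin

lemma O_zero: "openin T V \<Longrightarrow> (\<lambda>_. 0) \<in> \<O> V"
  using O_const[of V 0] by (simp add: fres_def)

lemma O_scale: "\<lbrakk>openin T V; f \<in> \<O> V\<rbrakk> \<Longrightarrow> (\<lambda>p. c * f p) \<in> \<O> V"
proof -
  assume V: "openin T V" "f \<in> \<O> V"
  then have "(\<lambda>p. c * f p) = (\<lambda>p. fres V (\<lambda>_. c) p * f p)"
    using O_outside[OF V] by (auto simp: fres_def)
  then show ?thesis using O_mult[OF V(1) O_const[OF V(1), of c] V(2)] by simp
qed

lemma O_uminus: "\<lbrakk>openin T V; f \<in> \<O> V\<rbrakk> \<Longrightarrow> (\<lambda>p. - f p) \<in> \<O> V"
  using O_scale[of V f "-1"] by simp

lemma O_diff: "\<lbrakk>openin T V; f \<in> \<O> V; g \<in> \<O> V\<rbrakk> \<Longrightarrow> (\<lambda>p. f p - g p) \<in> \<O> V"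
  using O_add[OF _ _ O_uminus, of V f g] by simp

lemma O_sum: "\<lbrakk>openin T V; \<And>i. i \<in> A \<Longrightarrow> f i \<in> \<O> V\<rbrakk> \<Longrightarrow> (\<lambda>p. \<Sum>i\<in>A. f i p) \<in> \<O> V"
  by (induction A rule: infinite_finite_induct) (auto intro: O_zero O_add)

lemma O_power: "\<lbrakk>openin T V; f \<in> \<O> V\<rbrakk> \<Longrightarrow> fres V (\<lambda>p. f p ^ n) \<in> \<O> V"
proof (induction n)
  case 0
  then show ?case using O_const[of V 1] by simp
next
  case (Suc n)
  have "fres V (\<lambda>p. f p ^ Suc n) = (\<lambda>p. f p * fres V (\<lambda>p. f p ^ n) p)"
    by (auto simp: fres_def)
  then show ?case using O_mult[OF Suc.prems(1,2) Suc.IH[OF Suc.prems]] by simp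
qed

lemma fres_fres: "W \<subseteq> V \<Longrightarrow> fres W (fres V f) = fres W f"
  by (auto simp: fres_def fun_eq_iff)

lemma fres_add: "fres W (\<lambda>p. f p + g p) = (\<lambda>p. fres W f p + fres W g p)"
  and fres_uminus: "fres W (\<lambda>p. - f p) = (\<lambda>p. - fres W f p)"
  by (auto simp: fres_def)

section \<open>Endomorphisms of a sheaf of functions\<close>

abbreviation E where "E \<equiv> End_sheaf T \<O>"
abbreviation opc :: "('p, 'k) oper \<Rightarrow> ('p, 'k) oper \<Rightarrow> ('p, 'k) oper" where
  "opc \<phi> \<psi> \<equiv> \<lambda>V f. \<phi> V (\<psi> V f)"
abbreviation opa :: "('p, 'k) oper \<Rightarrow> ('p, 'k) oper \<Rightarrow> ('p, 'k) oper" where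
  "opa \<phi> \<psi> \<equiv> \<lambda>V f p. \<phi> V f p + \<psi> V f p"

lemma E_outside: "\<lbrakk>\<phi> \<in> E U; \<not> (openin T V \<and> V \<subseteq> U \<and> f \<in> \<O> V)\<rbrakk> \<Longrightarrow> \<phi> V f = (\<lambda>_. 0)"
  unfolding End_sheaf_def op_ext_def mem_Collect_eq
  by (elim conjE) (drule fun_cong[of _ _ V], drule fun_cong[of _ _ f], simp only: if_False)

lemma E_in: "\<lbrakk>\<phi> \<in> E U; openin T V; V \<subseteq> U; f \<in> \<O> V\<rbrakk> \<Longrightarrow> \<phi> V f \<in> \<O> V"
  and E_add: "\<lbrakk>\<phi> \<in> E U; openin T V; V \<subseteq> U; f \<in> \<O> V; g \<in> \<O> V\<rbrakk>
      \<Longrightarrow> \<phi> V (\<lambda>p. f p + g p) = (\<lambda>p. \<phi> V f p + \<phi> V g p)"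
  and E_scale: "\<lbrakk>\<phi> \<in> E U; openin T V; V \<subseteq> U; f \<in> \<O> V\<rbrakk> \<Longrightarrow> \<phi> V (\<lambda>p. c * f p) = (\<lambda>p. c * \<phi> V f p)"
  and E_res: "\<lbrakk>\<phi> \<in> E U; openin T V; V \<subseteq> U; openin T W; W \<subseteq> V; f \<in> \<O> V\<rbrakk>
      \<Longrightarrow> \<phi> W (fres W f) = fres W (\<phi> V f)"
  unfolding End_sheaf_def by simp_all

lemma E_I:
  assumes "\<And>V f. \<not> (openin T V \<and> V \<subseteq> U \<and> f \<in> \<O> V) \<Longrightarrow> \<phi> V f = (\<lambda>_. 0)"
    and "\<And>V f. \<lbrakk>openin T V; V \<subseteq> U; f \<in> \<O> V\<rbrakk> \<Longrightarrow> \<phi> V f \<in> \<O> V"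
    and "\<And>V f g. \<lbrakk>openin T V; V \<subseteq> U; f \<in> \<O> V; g \<in> \<O> V\<rbrakk>
      \<Longrightarrow> \<phi> V (\<lambda>p. f p + g p) = (\<lambda>p. \<phi> V f p + \<phi> V g p)"
    and "\<And>V f c. \<lbrakk>openin T V; V \<subseteq> U; f \<in> \<O> V\<rbrakk> \<Longrightarrow> \<phi> V (\<lambda>p. c * f p) = (\<lambda>p. c * \<phi> V f p)"
    and "\<And>V W f. \<lbrakk>openin T V; V \<subseteq> U; openin T W; W \<subseteq> V; f \<in> \<O> V\<rbrakk> \<Longrightarrow> \<phi> W (fres W f) = fres W (\<phi> V f)"
  shows "\<phi> \<in> E U"
proof -
  have "op_ext T \<O> U \<phi> = \<phi>" using assms(1) by (auto simp: op_ext_def fun_eq_iff)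
  then show ?thesis using assms(2-) unfolding End_sheaf_def by simp
qed

lemma E_zero: "\<phi> \<in> E U \<Longrightarrow> \<phi> V (\<lambda>_. 0) = (\<lambda>_. 0)"
proof (cases "openin T V \<and> V \<subseteq> U \<and> (\<lambda>_. 0) \<in> \<O> V")
  case True
  assume "\<phi> \<in> E U"
  then show ?thesis using E_scale[of \<phi> U V "\<lambda>_. 0" 0] True by simp
qed (auto intro: E_outside)

lemma E_diff: "\<lbrakk>\<phi> \<in> E U; openin T V; V \<subseteq> U; f \<in> \<O> V; g \<in> \<O> V\<rbrakk>
    \<Longrightarrow> \<phi> V (\<lambda>p. f p - g p) = (\<lambda>p. \<phi> V f p - \<phi> V g p)"
  using E_add[of \<phi> U V f "\<lambda>p. -1 * g p"] E_scale[of \<phi> U V g "-1"] O_scale[of V g "-1"] by simp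

lemma E_sum: "\<lbrakk>\<phi> \<in> E U; openin T V; V \<subseteq> U; \<And>i. i \<in> A \<Longrightarrow> f i \<in> \<O> V\<rbrakk>
    \<Longrightarrow> \<phi> V (\<lambda>p. \<Sum>i\<in>A. f i p) = (\<lambda>p. \<Sum>i\<in>A. \<phi> V (f i) p)"
proof (induction A rule: infinite_finite_induct)
  case (insert i A)
  then show ?case
    using E_add[of \<phi> U V "f i" "\<lambda>p. \<Sum>i\<in>A. f i p"] O_sum[of V A f] by simp
qed (auto simp: E_zero)

lemma zero_op: "(\<lambda>V f p. 0) \<in> E U"
  by (rule E_I) (auto simp: O_zero fres_def)

lemma opa_E: "\<lbrakk>\<phi> \<in> E U; \<psi> \<in> E U\<rbrakk> \<Longrightarrow> opa \<phi> \<psi> \<in> E U"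
  by (rule E_I)
    (auto simp: E_outside E_add E_scale E_res E_in O_add distrib_left fres_add add_ac)

lemma opc_E: "\<lbrakk>\<phi> \<in> E U; \<psi> \<in> E U\<rbrakk> \<Longrightarrow> opc \<phi> \<psi> \<in> E U"
  by (rule E_I) (auto simp: E_outside E_add E_scale E_res E_in E_zero)

lemma opn_E: "\<phi> \<in> E U \<Longrightarrow> (\<lambda>V f p. - \<phi> V f p) \<in> E U"
  by (rule E_I) (auto simp: E_outside E_add E_scale E_res E_in O_uminus fres_uminus)

lemma op_res_E: "\<lbrakk>\<phi> \<in> E U; W \<subseteq> U\<rbrakk> \<Longrightarrow> op_res W \<phi> \<in> E W"
proof -
  assume a: "\<phi> \<in> E U" "W \<subseteq> U"
  have sub: "V \<subseteq> U" if "V \<subseteq> W" for V using that a(2) by blast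
  show ?thesis
  proof (rule E_I)
    fix V f assume "\<not> (openin T V \<and> V \<subseteq> W \<and> f \<in> \<O> V)"
    then show "op_res W \<phi> V f = (\<lambda>_. 0)"
      using E_outside[OF a(1), of V f] by (auto simp: op_res_def)
  next
    fix V W' f assume "openin T V" "V \<subseteq> W" "openin T W'" "W' \<subseteq> V" "f \<in> \<O> V"
    moreover from this have "W' \<subseteq> W" by blast
    ultimately show "op_res W \<phi> W' (fres W' f) = fres W' (op_res W \<phi> V f)"
      using sub by (simp add: op_res_def E_res[OF a(1)])
  qed (use sub in \<open>simp_all add: op_res_def E_in[OF a(1)] E_add[OF a(1)] E_scale[OF a(1)]\<close>)
qed

lemma op_scalar_eq:
  "op_scalar T \<O> U a V f = (if openin T V \<and> V \<subseteq> U \<and> f \<in> \<O> V then (\<lambda>p. a p * f p) else (\<lambda>_. 0))"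
  by (simp add: op_scalar_def op_ext_def)

lemma scalar_in: "\<lbrakk>openin T U; openin T V; V \<subseteq> U; a \<in> \<O> U; f \<in> \<O> V\<rbrakk> \<Longrightarrow> (\<lambda>p. a p * f p) \<in> \<O> V"
proof -
  assume a: "openin T U" "openin T V" "V \<subseteq> U" "a \<in> \<O> U" "f \<in> \<O> V"
  have "(\<lambda>p. a p * f p) = (\<lambda>p. fres V a p * f p)"
    using O_outside[OF a(2,5)] by (auto simp: fres_def)
  then show ?thesis using O_mult[OF a(2) O_res[OF a(1-4)] a(5)] by simp
qed

lemma op_scalar_E: "\<lbrakk>openin T U; a \<in> \<O> U\<rbrakk> \<Longrightarrow> op_scalar T \<O> U a \<in> E U"
proof (rule E_I)
  fix V W f assume "openin T U" "a \<in> \<O> U" "openin T V" "V \<subseteq> U" "openin T W" "W \<subseteq> V" "f \<in> \<O> V"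
  moreover from this have "fres W f \<in> \<O> W" "W \<subseteq> U" by (auto intro: O_res)
  ultimately show "op_scalar T \<O> U a W (fres W f) = fres W (op_scalar T \<O> U a V f)"
    by (auto simp: op_scalar_eq fres_def)
qed (auto simp: op_scalar_eq scalar_in distrib_left mult.left_commute O_add O_scale)

lemma op_res_op_res: "V \<subseteq> W \<Longrightarrow> op_res V (op_res W \<phi>) = op_res V \<phi>"
  by (auto simp: op_res_def fun_eq_iff)

lemma op_res_opa: "op_res V (opa \<phi> \<psi>) = opa (op_res V \<phi>) (op_res V \<psi>)"
  by (auto simp: op_res_def fun_eq_iff)

lemma op_res_opc: "\<phi> \<in> E U \<Longrightarrow> op_res V (opc \<phi> \<psi>) = opc (op_res V \<phi>) (op_res V \<psi>)"
  by (auto simp: op_res_def fun_eq_iff E_zero)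

section \<open>The filtration by order\<close>

lemma diffop_lt_E: "\<phi> \<in> diffop_lt T \<O> k U \<Longrightarrow> \<phi> \<in> E U"
  by (cases k) (auto simp: zero_op)

lemma zero_diffop_lt: "(\<lambda>V f p. 0) \<in> diffop_lt T \<O> k U"
proof (induction k arbitrary: U)
  case (Suc k)
  have "commutator (op_res V (\<lambda>V f p. 0)) (op_scalar T \<O> V a) = (\<lambda>V f p. 0)" for V a
    by (auto simp: commutator_def op_res_def op_scalar_eq fun_eq_iff)
  then show ?case using Suc zero_op by simp
qed simp

lemma diffop_lt_res:
  assumes "\<phi> \<in> diffop_lt T \<O> k U" "W \<subseteq> U"
  shows "op_res W \<phi> \<in> diffop_lt T \<O> k W"
proof (cases k)
  case 0
  then show ?thesis using assms by (auto simp: op_res_def fun_eq_iff)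
next
  case (Suc k')
  show ?thesis unfolding Suc diffop_lt.simps mem_Collect_eq
  proof (intro conjI allI impI ballI)
    show "op_res W \<phi> \<in> E W" using assms op_res_E diffop_lt_E by blast
    fix V a assume "openin T V \<and> V \<subseteq> W" "a \<in> \<O> V"
    then show "commutator (op_res V (op_res W \<phi>)) (op_scalar T \<O> V a) \<in> diffop_lt T \<O> k' V"
      using assms order_trans[of V W U] by (auto simp: op_res_op_res Suc)
  qed
qed

lemma opa_diffop_lt:
  "\<lbrakk>\<phi> \<in> diffop_lt T \<O> k U; \<psi> \<in> diffop_lt T \<O> k U\<rbrakk> \<Longrightarrow> opa \<phi> \<psi> \<in> diffop_lt T \<O> k U"
proof (induction k arbitrary: U \<phi> \<psi>)
  case (Suc k)
  show ?case unfolding diffop_lt.simps mem_Collect_eq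
  proof (intro conjI allI impI ballI)
    show "opa \<phi> \<psi> \<in> E U" using Suc.prems opa_E diffop_lt_E by blast
    fix V a assume V: "openin T V \<and> V \<subseteq> U" "a \<in> \<O> V"
    have E: "op_res V \<phi> \<in> E V" "op_res V \<psi> \<in> E V" "op_scalar T \<O> V a \<in> E V"
      using Suc.prems op_res_E[OF diffop_lt_E] op_scalar_E V by blast+
    have "commutator (op_res V (opa \<phi> \<psi>)) (op_scalar T \<O> V a)
      = opa (commutator (op_res V \<phi>) (op_scalar T \<O> V a)) (commutator (op_res V \<psi>) (op_scalar T \<O> V a))"
      (is "?l = ?r")
    proof (intro ext)
      fix W f p
      show "?l W f p = ?r W f p"
      proof (cases "openin T W \<and> W \<subseteq> V \<and> f \<in> \<O> W")
        case True
        then have "op_scalar T \<O> V a W (\<lambda>p. op_res V \<phi> W f p + op_res V \<psi> W f p)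
          = (\<lambda>p. op_scalar T \<O> V a W (op_res V \<phi> W f) p + op_scalar T \<O> V a W (op_res V \<psi> W f) p)"
          using E by (intro E_add) (auto intro: E_in)
        then show ?thesis by (simp add: commutator_def op_res_opa fun_eq_iff)
      next
        case False
        then show ?thesis
          using E_outside[OF E(1) False] E_outside[OF E(2) False] E_outside[OF E(3) False]
            E_zero[OF E(1)] E_zero[OF E(2)] E_zero[OF E(3)]
          by (simp add: commutator_def op_res_opa)
      qed
    qed
    then show "commutator (op_res V (opa \<phi> \<psi>)) (op_scalar T \<O> V a) \<in> diffop_lt T \<O> k V"
      using Suc.IH Suc.prems V by simp
  qed
qed auto

lemma diffop_lt_Suc: "\<phi> \<in> diffop_lt T \<O> k U \<Longrightarrow> \<phi> \<in> diffop_lt T \<O> (Suc k) U"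
proof (induction k arbitrary: U \<phi>)
  case 0
  then show ?case using zero_diffop_lt by (simp del: diffop_lt.simps(2))
next
  case (Suc k)
  show ?case unfolding diffop_lt.simps(2)[of T \<O> "Suc k"] mem_Collect_eq
  proof (intro conjI allI impI ballI)
    show "\<phi> \<in> E U" using Suc.prems diffop_lt_E by blast
    fix V a assume V: "openin T V \<and> V \<subseteq> U" "a \<in> \<O> V"
    have "commutator (op_res V \<phi>) (op_scalar T \<O> V a) \<in> diffop_lt T \<O> k V"
      using Suc.prems V by simp
    then show "commutator (op_res V \<phi>) (op_scalar T \<O> V a) \<in> diffop_lt T \<O> (Suc k) V"
      by (rule Suc.IH)
  qed
qed

lemma diffop_lt_mono: "\<lbrakk>\<phi> \<in> diffop_lt T \<O> k U; k \<le> l\<rbrakk> \<Longrightarrow> \<phi> \<in> diffop_lt T \<O> l U"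
  by (induction l) (auto simp: le_Suc_eq simp del: diffop_lt.simps intro: diffop_lt_Suc)

lemma opn_diffop_lt: "\<phi> \<in> diffop_lt T \<O> k U \<Longrightarrow> (\<lambda>V f p. - \<phi> V f p) \<in> diffop_lt T \<O> k U"
proof (induction k arbitrary: U \<phi>)
  case (Suc k)
  show ?case unfolding diffop_lt.simps mem_Collect_eq
  proof (intro conjI allI impI ballI)
    show "(\<lambda>V f p. - \<phi> V f p) \<in> E U" using Suc.prems opn_E diffop_lt_E by blast
    fix V a assume V: "openin T V \<and> V \<subseteq> U" "a \<in> \<O> V"
    have E: "op_res V \<phi> \<in> E V" "op_scalar T \<O> V a \<in> E V"
      using Suc.prems op_res_E[OF diffop_lt_E] op_scalar_E V by blast+
    have "commutator (op_res V (\<lambda>V f p. - \<phi> V f p)) (op_scalar T \<O> V a)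
      = (\<lambda>W f p. - commutator (op_res V \<phi>) (op_scalar T \<O> V a) W f p)" (is "?l = ?r")
    proof (intro ext)
      fix W f p
      have r: "op_res V (\<lambda>V f p. - \<phi> V f p) = (\<lambda>W f p. - op_res V \<phi> W f p)"
        by (auto simp: op_res_def fun_eq_iff)
      show "?l W f p = ?r W f p"
      proof (cases "openin T W \<and> W \<subseteq> V \<and> f \<in> \<O> W")
        case True
        then have "op_scalar T \<O> V a W (\<lambda>p. -1 * op_res V \<phi> W f p)
          = (\<lambda>p. -1 * op_scalar T \<O> V a W (op_res V \<phi> W f) p)"
          using E by (intro E_scale) (auto intro: E_in)
        then show ?thesis by (simp add: commutator_def r fun_eq_iff)
      next
        case False
        then show ?thesis
          using E_outside[OF E(1) False] E_outside[OF E(2) False] E_zero[OF E(1)] E_zero[OF E(2)]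
          by (simp add: commutator_def r)
      qed
    qed
    then show "commutator (op_res V (\<lambda>V f p. - \<phi> V f p)) (op_scalar T \<O> V a) \<in> diffop_lt T \<O> k V"
      using Suc.IH Suc.prems V by simp
  qed
qed auto

text \<open>The Leibniz rule. Additivity of \<phi> is available only on the domain of the operators;
  elsewhere every term is zero by the convention of extension by zero.\<close>

lemma commutator_opc:
  assumes "\<phi> \<in> E V" "\<psi> \<in> E V" "\<sigma> \<in> E V"
  shows "commutator (opc \<phi> \<psi>) \<sigma> = opa (opc \<phi> (commutator \<psi> \<sigma>)) (opc (commutator \<phi> \<sigma>) \<psi>)"
    (is "?l = ?r")
proof (intro ext)
  fix W f p
  show "?l W f p = ?r W f p"
  proof (cases "openin T W \<and> W \<subseteq> V \<and> f \<in> \<O> W")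
    case True
    then have "\<phi> W (\<lambda>p. \<psi> W (\<sigma> W f) p - \<sigma> W (\<psi> W f) p) = (\<lambda>p. \<phi> W (\<psi> W (\<sigma> W f)) p - \<phi> W (\<sigma> W (\<psi> W f)) p)"
      using assms by (intro E_diff[OF assms(1)]) (auto intro: E_in)
    then show ?thesis by (simp add: commutator_def)
  next
    case False
    then show ?thesis
      using E_outside[OF assms(1) False] E_outside[OF assms(2) False] E_outside[OF assms(3) False]
        E_zero[OF assms(1)] E_zero[OF assms(2)] E_zero[OF assms(3)]
      by (simp add: commutator_def)
  qed
qed

text \<open>Induction on \<open>k + l\<close> with the Leibniz rule, each of whose terms lowers one
  of the two orders. With strict bounds the sharp value would be \<open>k + l - 1\<close>; for
  operators of locally bounded order any bound is as good.\<close>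

lemma opc_diffop_lt:
  "\<lbrakk>\<phi> \<in> diffop_lt T \<O> k U; \<psi> \<in> diffop_lt T \<O> l U\<rbrakk> \<Longrightarrow> opc \<phi> \<psi> \<in> diffop_lt T \<O> (k + l) U"
proof (induction "k + l" arbitrary: k l U \<phi> \<psi>)
  case 0
  then show ?case by auto
next
  case (Suc n)
  show ?case
  proof (cases "k = 0 \<or> l = 0")
    case True
    then have "\<phi> = (\<lambda>V f p. 0) \<or> \<psi> = (\<lambda>V f p. 0)" using Suc.prems by auto
    then have "opc \<phi> \<psi> = (\<lambda>V f p. 0)"
      using E_zero[OF diffop_lt_E[OF Suc.prems(1)]] by auto
    then show ?thesis using zero_diffop_lt by simp
  next
    case False
    then obtain k' l' where kl: "k = Suc k'" "l = Suc l'" by (meson not0_implies_Suc)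
    have n: "n = k' + l" "n = k + l'" using Suc.hyps kl by auto
    have "opc \<phi> \<psi> \<in> diffop_lt T \<O> (Suc n) U"
      unfolding diffop_lt.simps mem_Collect_eq
    proof (intro conjI allI impI ballI)
      show "opc \<phi> \<psi> \<in> E U" using Suc.prems opc_E diffop_lt_E by blast
      fix V a assume V: "openin T V \<and> V \<subseteq> U" "a \<in> \<O> V"
      have E: "op_res V \<phi> \<in> E V" "op_res V \<psi> \<in> E V" "op_scalar T \<O> V a \<in> E V"
        using Suc.prems op_res_E[OF diffop_lt_E] op_scalar_E V by blast+
      have r: "op_res V \<phi> \<in> diffop_lt T \<O> k V" "op_res V \<psi> \<in> diffop_lt T \<O> l V"
        using Suc.prems diffop_lt_res V by blast+
      have c: "commutator (op_res V \<phi>) (op_scalar T \<O> V a) \<in> diffop_lt T \<O> k' V"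
        "commutator (op_res V \<psi>) (op_scalar T \<O> V a) \<in> diffop_lt T \<O> l' V"
        using Suc.prems V kl by auto
      have "opc (op_res V \<phi>) (commutator (op_res V \<psi>) (op_scalar T \<O> V a)) \<in> diffop_lt T \<O> n V"
        using Suc.hyps(1)[OF n(2) r(1) c(2)] unfolding n(2)[symmetric] .
      moreover have "opc (commutator (op_res V \<phi>) (op_scalar T \<O> V a)) (op_res V \<psi>) \<in> diffop_lt T \<O> n V"
        using Suc.hyps(1)[OF n(1) c(1) r(2)] unfolding n(1)[symmetric] .
      ultimately show "commutator (op_res V (opc \<phi> \<psi>)) (op_scalar T \<O> V a) \<in> diffop_lt T \<O> n V"
        unfolding op_res_opc[OF diffop_lt_E[OF Suc.prems(1)], of V \<psi>] commutator_opc[OF E]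
        by (rule opa_diffop_lt)
    qed
    then show ?thesis using Suc.hyps(2) by simp
  qed
qed

lemma op_scalar_diffop_lt:
  assumes "openin T U" "a \<in> \<O> U"
  shows "op_scalar T \<O> U a \<in> diffop_lt T \<O> 1 U"
proof -
  have "commutator (op_res V (op_scalar T \<O> U a)) (op_scalar T \<O> V b) = (\<lambda>V f p. 0)"
    if V: "openin T V" "V \<subseteq> U" "b \<in> \<O> V" for V b
  proof (intro ext)
    fix W f p
    show "commutator (op_res V (op_scalar T \<O> U a)) (op_scalar T \<O> V b) W f p = 0"
    proof (cases "openin T W \<and> W \<subseteq> V \<and> f \<in> \<O> W")
      case True
      then have "(\<lambda>p. b p * f p) \<in> \<O> W" "(\<lambda>p. a p * f p) \<in> \<O> W"
        using V assms by (auto intro: scalar_in)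
      then show ?thesis using True V by (auto simp: commutator_def op_res_def op_scalar_eq)
    next
      case False
      then show ?thesis using V by (auto simp: commutator_def op_res_def op_scalar_eq)
    qed
  qed
  then show ?thesis using op_scalar_E[OF assms] by simp
qed

section \<open>Operators of locally bounded order\<close>

lemma diffops_E: "\<phi> \<in> diffops T \<O> U \<Longrightarrow> \<phi> \<in> E U"
  by (simp add: diffops_def)

lemma diffopsI:
  assumes "\<phi> \<in> E U"
    "\<And>x. x \<in> U \<Longrightarrow> \<exists>V k. openin T V \<and> x \<in> V \<and> V \<subseteq> U \<and> op_res V \<phi> \<in> diffop_lt T \<O> k V"
  shows "\<phi> \<in> diffops T \<O> U"
  using assms by (simp add: diffops_def)

lemma diffopsD:
  "\<lbrakk>\<phi> \<in> diffops T \<O> U; x \<in> U\<rbrakk> \<Longrightarrow> \<exists>V k. openin T V \<and> x \<in> V \<and> V \<subseteq> U \<and> op_res V \<phi> \<in> diffop_lt T \<O> k V"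
  by (simp add: diffops_def)

lemma diffop_lt_diffops:
  assumes "openin T U" "\<phi> \<in> diffop_lt T \<O> k U" shows "\<phi> \<in> diffops T \<O> U"
proof (rule diffopsI)
  show "\<phi> \<in> E U" using assms diffop_lt_E by blast
  fix x assume "x \<in> U"
  then show "\<exists>V k. openin T V \<and> x \<in> V \<and> V \<subseteq> U \<and> op_res V \<phi> \<in> diffop_lt T \<O> k V"
    using assms diffop_lt_res[OF assms(2), of U] by blast
qed

lemma op_scalar_diffops: "\<lbrakk>openin T U; a \<in> \<O> U\<rbrakk> \<Longrightarrow> op_scalar T \<O> U a \<in> diffops T \<O> U"
  using op_scalar_diffop_lt diffop_lt_diffops by blast

lemma op_id_scalar: "openin T U \<Longrightarrow> op_ext T \<O> U (\<lambda>V f. f) = op_scalar T \<O> U (fres U (\<lambda>_. 1))"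
  unfolding op_scalar_def op_ext_def fres_def by (intro ext) (use O_outside in auto)

lemma op_id_diffops: "openin T U \<Longrightarrow> op_ext T \<O> U (\<lambda>V f. f) \<in> diffops T \<O> U"
  unfolding op_id_scalar by (intro op_scalar_diffops O_const)

lemma zero_diffops: "openin T U \<Longrightarrow> (\<lambda>V f p. 0) \<in> diffops T \<O> U"
  using zero_diffop_lt diffop_lt_diffops by blast

text \<open>Orders are bounded only locally, so two operators must be brought to a common
  neighbourhood and a common order before they can be combined.\<close>

lemma diffops_pair:
  assumes "\<phi> \<in> diffops T \<O> U" "\<psi> \<in> diffops T \<O> U" "x \<in> U"
  shows "\<exists>V k. openin T V \<and> x \<in> V \<and> V \<subseteq> U \<and> op_res V \<phi> \<in> diffop_lt T \<O> k V \<and> op_res V \<psi> \<in> diffop_lt T \<O> k V"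
proof -
  from diffopsD[OF assms(1,3)]
  obtain V1 k1 where 1: "openin T V1" "x \<in> V1" "V1 \<subseteq> U" "op_res V1 \<phi> \<in> diffop_lt T \<O> k1 V1"
    by (elim exE conjE) (rule that)
  from diffopsD[OF assms(2,3)]
  obtain V2 k2 where 2: "openin T V2" "x \<in> V2" "V2 \<subseteq> U" "op_res V2 \<psi> \<in> diffop_lt T \<O> k2 V2"
    by (elim exE conjE) (rule that)
  let ?V = "V1 \<inter> V2" and ?k = "max k1 k2"
  have "op_res ?V \<phi> \<in> diffop_lt T \<O> ?k ?V"
    using diffop_lt_mono[OF diffop_lt_res[OF 1(4), of ?V], of ?k]
    by (simp add: op_res_op_res)
  moreover have "op_res ?V \<psi> \<in> diffop_lt T \<O> ?k ?V"
    using diffop_lt_mono[OF diffop_lt_res[OF 2(4), of ?V], of ?k]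
    by (simp add: op_res_op_res)
  ultimately show ?thesis using 1 2 by (intro exI[of _ ?V] exI[of _ ?k]) auto
qed

lemma opa_diffops: "\<lbrakk>\<phi> \<in> diffops T \<O> U; \<psi> \<in> diffops T \<O> U\<rbrakk> \<Longrightarrow> opa \<phi> \<psi> \<in> diffops T \<O> U"
proof (rule diffopsI)
  assume a: "\<phi> \<in> diffops T \<O> U" "\<psi> \<in> diffops T \<O> U"
  then show "opa \<phi> \<psi> \<in> E U" by (intro opa_E diffops_E)
  fix x assume "x \<in> U"
  from diffops_pair[OF a this] obtain V k where V: "openin T V" "x \<in> V" "V \<subseteq> U"
    "op_res V \<phi> \<in> diffop_lt T \<O> k V" "op_res V \<psi> \<in> diffop_lt T \<O> k V"
    by (elim exE conjE) (rule that)
  have "op_res V (opa \<phi> \<psi>) \<in> diffop_lt T \<O> k V"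
    unfolding op_res_opa[of V \<phi> \<psi>] by (rule opa_diffop_lt[OF V(4,5)])
  then show "\<exists>V k. openin T V \<and> x \<in> V \<and> V \<subseteq> U \<and> op_res V (opa \<phi> \<psi>) \<in> diffop_lt T \<O> k V"
    using V(1-3) by (intro exI conjI)
qed

lemma opc_diffops: "\<lbrakk>\<phi> \<in> diffops T \<O> U; \<psi> \<in> diffops T \<O> U\<rbrakk> \<Longrightarrow> opc \<phi> \<psi> \<in> diffops T \<O> U"
proof (rule diffopsI)
  assume a: "\<phi> \<in> diffops T \<O> U" "\<psi> \<in> diffops T \<O> U"
  then show "opc \<phi> \<psi> \<in> E U" by (intro opc_E[OF diffops_E diffops_E])
  fix x assume "x \<in> U"
  from diffops_pair[OF a this] obtain V k where V: "openin T V" "x \<in> V" "V \<subseteq> U"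
    "op_res V \<phi> \<in> diffop_lt T \<O> k V" "op_res V \<psi> \<in> diffop_lt T \<O> k V"
    by (elim exE conjE) (rule that)
  have "op_res V (opc \<phi> \<psi>) \<in> diffop_lt T \<O> (k + k) V"
    unfolding op_res_opc[OF diffops_E[OF a(1)], of V \<psi>] by (rule opc_diffop_lt[OF V(4,5)])
  then show "\<exists>V k. openin T V \<and> x \<in> V \<and> V \<subseteq> U \<and> op_res V (opc \<phi> \<psi>) \<in> diffop_lt T \<O> k V"
    using V(1-3) by (intro exI conjI)
qed

lemma opn_diffops: "\<phi> \<in> diffops T \<O> U \<Longrightarrow> (\<lambda>V f p. - \<phi> V f p) \<in> diffops T \<O> U"
proof (rule diffopsI)
  assume a: "\<phi> \<in> diffops T \<O> U"
  then show "(\<lambda>V f p. - \<phi> V f p) \<in> E U" by (intro opn_E diffops_E)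
  fix x assume "x \<in> U"
  have "op_res V (\<lambda>V f p. - \<phi> V f p) = (\<lambda>W f p. - op_res V \<phi> W f p)" for V
    by (auto simp: op_res_def fun_eq_iff)
  then show "\<exists>V k. openin T V \<and> x \<in> V \<and> V \<subseteq> U \<and> op_res V (\<lambda>V f p. - \<phi> V f p) \<in> diffop_lt T \<O> k V"
    using diffopsD[OF a \<open>x \<in> U\<close>] opn_diffop_lt by (simp del: diffop_lt.simps) meson
qed

lemma diff_ring: assumes U: "openin T U" shows "ring (diff_ring T \<O> U)"
proof (rule ringI)
  let ?R = "diff_ring T \<O> U"
  \<comment> \<open>The unit is the identity cut off outside its domain; the unit laws hold because
    sections of the endomorphism sheaf are cut off in the same way.\<close>
  have id: "op_ext T \<O> U (\<lambda>V f. f) V (\<phi> V f) = \<phi> V f" if "\<phi> \<in> E U" for \<phi> V f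
  proof (cases "openin T V \<and> V \<subseteq> U \<and> f \<in> \<O> V")
    case True
    then show ?thesis using E_in[OF that] by (simp add: op_ext_def)
  next
    case False
    then show ?thesis using E_outside[OF that False] by (simp add: op_ext_def)
  qed
  have id': "\<phi> V (op_ext T \<O> U (\<lambda>V f. f) V f) = \<phi> V f" if "\<phi> \<in> E U" for \<phi> V f
  proof (cases "openin T V \<and> V \<subseteq> U \<and> f \<in> \<O> V")
    case True
    then show ?thesis by (simp add: op_ext_def)
  next
    case False
    then show ?thesis using E_outside[OF that False] E_zero[OF that] by (simp add: op_ext_def)
  qed
  show "abelian_group ?R"
  proof (rule abelian_groupI)
    fix \<phi> assume "\<phi> \<in> carrier ?R"
    then show "\<exists>\<psi>\<in>carrier ?R. \<psi> \<oplus>\<^bsub>?R\<^esub> \<phi> = \<zero>\<^bsub>?R\<^esub>"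
      using opn_diffops by (intro bexI[of _ "\<lambda>V f p. - \<phi> V f p"]) (auto simp: diff_ring_def)
  qed (use U in \<open>auto simp: diff_ring_def opa_diffops zero_diffops add_ac\<close>)
  show "Group.monoid ?R"
  proof (rule monoidI)
    fix \<phi> \<psi> assume "\<phi> \<in> carrier ?R" "\<psi> \<in> carrier ?R"
    then show "\<phi> \<otimes>\<^bsub>?R\<^esub> \<psi> \<in> carrier ?R" using opc_diffops[of \<phi> U \<psi>] by (simp add: diff_ring_def)
  next
    fix \<phi> assume "\<phi> \<in> carrier ?R"
    then have \<phi>: "\<phi> \<in> E U" by (simp add: diff_ring_def diffops_E)
    show "\<one>\<^bsub>?R\<^esub> \<otimes>\<^bsub>?R\<^esub> \<phi> = \<phi>" "\<phi> \<otimes>\<^bsub>?R\<^esub> \<one>\<^bsub>?R\<^esub> = \<phi>"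
      using id[OF \<phi>] id'[OF \<phi>] by (simp_all add: diff_ring_def)
  qed (use U in \<open>simp_all add: diff_ring_def op_id_diffops\<close>)
  fix \<phi> \<psi> \<chi> assume a: "\<phi> \<in> carrier ?R" "\<psi> \<in> carrier ?R" "\<chi> \<in> carrier ?R"
  then have E: "\<phi> \<in> E U" "\<psi> \<in> E U" "\<chi> \<in> E U" by (auto simp: diff_ring_def diffops_E)
  show "(\<phi> \<oplus>\<^bsub>?R\<^esub> \<psi>) \<otimes>\<^bsub>?R\<^esub> \<chi> = \<phi> \<otimes>\<^bsub>?R\<^esub> \<chi> \<oplus>\<^bsub>?R\<^esub> \<psi> \<otimes>\<^bsub>?R\<^esub> \<chi>"
    by (simp add: diff_ring_def)
  show "\<chi> \<otimes>\<^bsub>?R\<^esub> (\<phi> \<oplus>\<^bsub>?R\<^esub> \<psi>) = \<chi> \<otimes>\<^bsub>?R\<^esub> \<phi> \<oplus>\<^bsub>?R\<^esub> \<chi> \<otimes>\<^bsub>?R\<^esub> \<psi>"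
  proof -
    have "\<chi> V (\<lambda>p. \<phi> V f p + \<psi> V f p) = (\<lambda>p. \<chi> V (\<phi> V f) p + \<chi> V (\<psi> V f) p)" for V f
    proof (cases "openin T V \<and> V \<subseteq> U \<and> f \<in> \<O> V")
      case True
      then show ?thesis by (intro E_add[OF E(3)]) (auto intro: E_in[OF E(1)] E_in[OF E(2)])
    next
      case False
      then show ?thesis using E_outside[OF E(1) False] E_outside[OF E(2) False] E_zero[OF E(3)] by simp
    qed
    then show ?thesis by (simp add: diff_ring_def)
  qed
qed

end

section \<open>First cohomology of a sheaf\<close>

text \<open>Congruence modulo \<open>H\<close> without inverses. In this form it is carried along by
  homomorphisms without any group hypothesis on the target.\<close>

definition coset_eq :: "('c, 'm) monoid_scheme \<Rightarrow> 'c set \<Rightarrow> 'c \<Rightarrow> 'c \<Rightarrow> bool" where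
  "coset_eq G H s t \<longleftrightarrow> (\<exists>h\<in>H. s = h \<otimes>\<^bsub>G\<^esub> t)"

context comm_group
begin

lemma coset_eq_iff:
  assumes "subgroup H G" "s \<in> carrier G" "t \<in> carrier G"
  shows "s \<otimes> inv t \<in> H \<longleftrightarrow> coset_eq G H s t"
proof -
  have sub: "H \<subseteq> carrier G" using assms(1) by (rule subgroup.subset)
  show ?thesis
  proof
    assume "s \<otimes> inv t \<in> H"
    moreover have "s = (s \<otimes> inv t) \<otimes> t" using assms by (simp add: m_assoc)
    ultimately show "coset_eq G H s t" unfolding coset_eq_def by blast
  next
    assume "coset_eq G H s t"
    then obtain h where h: "h \<in> H" "s = h \<otimes> t" by (auto simp: coset_eq_def)
    then have "s \<otimes> inv t = h" using assms sub by (auto simp: m_assoc)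
    then show "s \<otimes> inv t \<in> H" using h by simp
  qed
qed

lemma coset_eq_refl: "\<lbrakk>subgroup H G; s \<in> carrier G\<rbrakk> \<Longrightarrow> coset_eq G H s s"
  unfolding coset_eq_def using subgroup.one_closed by force

lemma coset_eq_sym:
  assumes "subgroup H G" "s \<in> carrier G" "t \<in> carrier G" "coset_eq G H s t"
  shows "coset_eq G H t s"
proof -
  obtain h where h: "h \<in> H" "s = h \<otimes> t" using assms by (auto simp: coset_eq_def)
  have "h \<in> carrier G" using h(1) assms(1) subgroup.subset by blast
  then have "t = inv h \<otimes> s" using h assms by (simp flip: m_assoc)
  moreover have "inv h \<in> H" using h(1) assms(1) by (simp add: subgroup.m_inv_closed)
  ultimately show ?thesis by (auto simp: coset_eq_def)
qed

lemma coset_eq_trans: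
  assumes "subgroup H G" "s \<in> carrier G" "t \<in> carrier G" "u \<in> carrier G" "coset_eq G H s t" "coset_eq G H t u"
  shows "coset_eq G H s u"
proof -
  obtain h where h: "h \<in> H" "s = h \<otimes> t" using assms by (auto simp: coset_eq_def)
  obtain k where k: "k \<in> H" "t = k \<otimes> u" using assms by (auto simp: coset_eq_def)
  have "h \<in> carrier G" "k \<in> carrier G" using h(1) k(1) assms(1) subgroup.subset by blast+
  then have "s = (h \<otimes> k) \<otimes> u" using h k assms by (simp add: m_assoc)
  moreover have "h \<otimes> k \<in> H" using h(1) k(1) assms(1) by (simp add: subgroup.m_closed)
  ultimately show ?thesis by (auto simp: coset_eq_def)
qed

lemma coset_eq_mult:
  assumes "subgroup H G" "s \<in> carrier G" "t \<in> carrier G" "s' \<in> carrier G" "t' \<in> carrier G"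
    "coset_eq G H s s'" "coset_eq G H t t'"
  shows "coset_eq G H (s \<otimes> t) (s' \<otimes> t')"
proof -
  obtain h where h: "h \<in> H" "s = h \<otimes> s'" using assms by (auto simp: coset_eq_def)
  obtain k where k: "k \<in> H" "t = k \<otimes> t'" using assms by (auto simp: coset_eq_def)
  have "h \<in> carrier G" "k \<in> carrier G" using h(1) k(1) assms(1) subgroup.subset by blast+
  then have "s \<otimes> t = (h \<otimes> k) \<otimes> (s' \<otimes> t')" using h k assms by (simp add: m_ac)
  moreover have "h \<otimes> k \<in> H" using h(1) k(1) assms(1) by (simp add: subgroup.m_closed)
  ultimately show ?thesis by (auto simp: coset_eq_def)
qed

end

lemma coset_eq_hom:
  assumes "r \<in> hom G G'" "\<And>h. h \<in> H \<Longrightarrow> r h \<in> H'" "H \<subseteq> carrier G" "t \<in> carrier G" "coset_eq G H s t"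
  shows "coset_eq G' H' (r s) (r t)"
  using assms unfolding coset_eq_def by (force simp: hom_mult)

text \<open>The invariant of the Godement construction: a presheaf of abelian groups with a
  subpresheaf to be divided out. Gluing is left aside because passing to germs sheafifies the
  quotient.\<close>

locale stage =
  fixes T :: "'p topology" and S :: "('p, 'c) stage"
  assumes grp: "openin T U \<Longrightarrow> comm_group (grp S U)"
    and res_hom: "\<lbrakk>openin T U; openin T V; V \<subseteq> U\<rbrakk> \<Longrightarrow> res S U V \<in> hom (grp S U) (grp S V)"
    and res_id: "\<lbrakk>openin T U; s \<in> carrier (grp S U)\<rbrakk> \<Longrightarrow> res S U U s = s"
    and res_res: "\<lbrakk>openin T U; openin T V; openin T W; W \<subseteq> V; V \<subseteq> U; s \<in> carrier (grp S U)\<rbrakk>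
        \<Longrightarrow> res S V W (res S U V s) = res S U W s"
    and im_subgroup: "openin T U \<Longrightarrow> subgroup (im S U) (grp S U)"
    and im_res: "\<lbrakk>openin T U; openin T V; V \<subseteq> U; s \<in> im S U\<rbrakk> \<Longrightarrow> res S U V s \<in> im S V"
begin

section \<open>Germs and their multiplication\<close>

abbreviation "LS \<equiv> local_sections T S"

lemma LS_iff: "(V, s) \<in> LS x \<longleftrightarrow> openin T V \<and> x \<in> V \<and> s \<in> carrier (grp S V)"
  by (simp add: local_sections_def)

lemma res_closed: "\<lbrakk>openin T U; openin T V; V \<subseteq> U; s \<in> carrier (grp S U)\<rbrakk> \<Longrightarrow> res S U V s \<in> carrier (grp S V)"
  using res_hom by (rule hom_in_carrier)

lemma res_mult: "\<lbrakk>openin T U; openin T V; V \<subseteq> U; s \<in> carrier (grp S U); t \<in> carrier (grp S U)\<rbrakk>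
    \<Longrightarrow> res S U V (s \<otimes>\<^bsub>grp S U\<^esub> t) = res S U V s \<otimes>\<^bsub>grp S V\<^esub> res S U V t"
  using hom_mult[OF res_hom] by blast

lemma res_one: "\<lbrakk>openin T U; openin T V; V \<subseteq> U\<rbrakk> \<Longrightarrow> res S U V \<one>\<^bsub>grp S U\<^esub> = \<one>\<^bsub>grp S V\<^esub>"
  by (rule hom_one[OF res_hom]) (auto intro: grp comm_group.axioms)

lemma one_closed: "openin T U \<Longrightarrow> \<one>\<^bsub>grp S U\<^esub> \<in> carrier (grp S U)"
  by (intro monoid.one_closed group.is_monoid comm_group.axioms(2) grp)

lemma mult_closed: "\<lbrakk>openin T U; s \<in> carrier (grp S U); t \<in> carrier (grp S U)\<rbrakk> \<Longrightarrow> s \<otimes>\<^bsub>grp S U\<^esub> t \<in> carrier (grp S U)"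
  by (intro monoid.m_closed group.is_monoid comm_group.axioms(2) grp)

lemma germ_eq_iff:
  assumes "(V, s) \<in> LS x" "(W, t) \<in> LS x"
  shows "germ_eq T S x (V, s) (W, t) \<longleftrightarrow>
    (\<exists>N. openin T N \<and> x \<in> N \<and> N \<subseteq> V \<inter> W \<and> coset_eq (grp S N) (im S N) (res S V N s) (res S W N t))"
proof -
  have "(res S V N s \<otimes>\<^bsub>grp S N\<^esub> inv\<^bsub>grp S N\<^esub> (res S W N t) \<in> im S N)
    = coset_eq (grp S N) (im S N) (res S V N s) (res S W N t)" if "openin T N" "N \<subseteq> V \<inter> W" for N
    using assms that by (intro comm_group.coset_eq_iff grp im_subgroup res_closed) (auto simp: LS_iff)
  then show ?thesis unfolding germ_eq_def by auto
qed

lemma germ_eqI: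
  "\<lbrakk>(V, s) \<in> LS x; (W, t) \<in> LS x; openin T N; x \<in> N; N \<subseteq> V \<inter> W;
    coset_eq (grp S N) (im S N) (res S V N s) (res S W N t)\<rbrakk> \<Longrightarrow> germ_eq T S x (V, s) (W, t)"
  using germ_eq_iff by blast

lemma germ_eqE:
  assumes "germ_eq T S x (V, s) (W, t)" "(V, s) \<in> LS x" "(W, t) \<in> LS x"
  obtains N where "openin T N" "x \<in> N" "N \<subseteq> V" "N \<subseteq> W"
    "coset_eq (grp S N) (im S N) (res S V N s) (res S W N t)"
proof -
  from assms(1) obtain N where "openin T N" "x \<in> N" "N \<subseteq> V \<inter> W"
    "coset_eq (grp S N) (im S N) (res S V N s) (res S W N t)"
    unfolding germ_eq_iff[OF assms(2,3)] by blast
  then show thesis by (intro that[of N]) auto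
qed

lemma coset_eq_shrink:
  assumes "coset_eq (grp S N) (im S N) (res S V N s) (res S W N t)" "openin T N" "openin T N'" "N' \<subseteq> N"
    "N \<subseteq> V" "N \<subseteq> W" "(V, s) \<in> LS x" "(W, t) \<in> LS x"
  shows "coset_eq (grp S N') (im S N') (res S V N' s) (res S W N' t)"
proof -
  have "coset_eq (grp S N') (im S N') (res S N N' (res S V N s)) (res S N N' (res S W N t))"
    using assms by (intro coset_eq_hom[OF res_hom im_res _ _ assms(1)])
      (auto simp: LS_iff intro: res_closed im_res dest: subgroup.subset[OF im_subgroup])
  then show ?thesis using assms by (simp add: LS_iff res_res)
qed

lemma germ_eq_refl: "(V, s) \<in> LS x \<Longrightarrow> germ_eq T S x (V, s) (V, s)"
  by (rule germ_eqI[of _ _ _ _ _ V])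
    (auto simp: LS_iff res_id intro: comm_group.coset_eq_refl grp im_subgroup)

lemma germ_eq_sym:
  assumes "germ_eq T S x a b" "a \<in> LS x" "b \<in> LS x" shows "germ_eq T S x b a"
proof -
  obtain V s W t where ab: "a = (V, s)" "b = (W, t)" by fastforce
  show ?thesis
    using assms(1) unfolding ab
  proof (rule germ_eqE)
    fix N assume N: "openin T N" "x \<in> N" "N \<subseteq> V" "N \<subseteq> W"
      "coset_eq (grp S N) (im S N) (res S V N s) (res S W N t)"
    show "germ_eq T S x (W, t) (V, s)"
      by (rule germ_eqI[of _ _ _ _ _ N])
        (use assms N ab in \<open>auto simp: LS_iff intro!: comm_group.coset_eq_sym[OF grp im_subgroup] res_closed\<close>)
  qed (use assms ab in auto)
qed

lemma germ_eq_trans: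
  assumes "germ_eq T S x a b" "germ_eq T S x b c" "a \<in> LS x" "b \<in> LS x" "c \<in> LS x"
  shows "germ_eq T S x a c"
proof -
  obtain V s W t U u where abc: "a = (V, s)" "b = (W, t)" "c = (U, u)" by (metis surj_pair)
  note LS = assms(3-5)[unfolded abc]
  obtain N where N: "openin T N" "x \<in> N" "N \<subseteq> V" "N \<subseteq> W"
      "coset_eq (grp S N) (im S N) (res S V N s) (res S W N t)"
    by (rule germ_eqE[OF assms(1)[unfolded abc] LS(1,2)]) (rule that)
  obtain M where M: "openin T M" "x \<in> M" "M \<subseteq> W" "M \<subseteq> U"
      "coset_eq (grp S M) (im S M) (res S W M t) (res S U M u)"
    by (rule germ_eqE[OF assms(2)[unfolded abc] LS(2,3)]) (rule that)
  let ?K = "N \<inter> M"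
  have K: "openin T ?K" using N M by blast
  have 1: "coset_eq (grp S ?K) (im S ?K) (res S V ?K s) (res S W ?K t)"
    using K by (intro coset_eq_shrink[OF N(5) N(1) _ _ N(3,4) LS(1,2)]) auto
  have 2: "coset_eq (grp S ?K) (im S ?K) (res S W ?K t) (res S U ?K u)"
    using K by (intro coset_eq_shrink[OF M(5) M(1) _ _ M(3,4) LS(2,3)]) auto
  have "coset_eq (grp S ?K) (im S ?K) (res S V ?K s) (res S U ?K u)"
    by (rule comm_group.coset_eq_trans[OF grp im_subgroup _ _ _ 1 2])
      (use K N M LS in \<open>auto simp: LS_iff intro!: res_closed\<close>)
  then show ?thesis unfolding abc
    by (rule germ_eqI[OF LS(1,3) K, rotated 2]) (use N M in auto)
qed

lemma germ_LS: "a \<in> LS x \<Longrightarrow> germ T S x a \<in> LS x"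
  and germ_eq_germ: "a \<in> LS x \<Longrightarrow> germ_eq T S x a (germ T S x a)"
proof -
  assume a: "a \<in> LS x"
  then have "a \<in> LS x \<and> germ_eq T S x a a" using germ_eq_refl by (cases a) auto
  then have "germ T S x a \<in> LS x \<and> germ_eq T S x a (germ T S x a)"
    unfolding germ_def by (rule someI)
  then show "germ T S x a \<in> LS x" "germ_eq T S x a (germ T S x a)" by auto
qed

lemma germ_eqD:
  assumes "germ T S x a = germ T S x b" "a \<in> LS x" "b \<in> LS x" shows "germ_eq T S x a b"
proof (rule germ_eq_trans[OF germ_eq_germ[OF assms(2)]])
  show "germ_eq T S x (germ T S x a) b"
    unfolding assms(1) by (rule germ_eq_sym[OF germ_eq_germ[OF assms(3)] assms(3) germ_LS[OF assms(3)]])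
qed (use assms germ_LS in auto)

text \<open>Equivalent pairs have the same equivalence class, so \<open>SOME\<close> selects the
  same representative for both.\<close>

lemma germ_cong:
  assumes "germ_eq T S x a b" "a \<in> LS x" "b \<in> LS x" shows "germ T S x a = germ T S x b"
proof -
  have "(c \<in> LS x \<and> germ_eq T S x a c) = (c \<in> LS x \<and> germ_eq T S x b c)" for c
    using germ_eq_trans[OF assms(1) _ assms(2,3), of c]
      germ_eq_trans[OF germ_eq_sym[OF assms] _ assms(3,2), of c] by blast
  then show ?thesis by (simp add: germ_def)
qed

lemma germ_res:
  assumes "openin T V" "openin T W" "x \<in> W" "W \<subseteq> V" "s \<in> carrier (grp S V)"
  shows "germ T S x (W, res S V W s) = germ T S x (V, s)"
proof (rule germ_cong)
  show LS: "(W, res S V W s) \<in> LS x" "(V, s) \<in> LS x" using assms by (auto simp: LS_iff res_closed)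
  show "germ_eq T S x (W, res S V W s) (V, s)"
    by (rule germ_eqI[OF LS, of W])
      (use assms in \<open>auto simp: res_id res_closed intro!: comm_group.coset_eq_refl[OF grp im_subgroup]\<close>)
qed

text \<open>The product of germs before a representative is chosen. It separates compatibility with
  the equivalence from the effect of the choice.\<close>

definition lmul :: "'p set \<times> 'c \<Rightarrow> 'p set \<times> 'c \<Rightarrow> 'p set \<times> 'c" where
  "lmul = (\<lambda>(V, s) (W, t). (V \<inter> W, res S V (V \<inter> W) s \<otimes>\<^bsub>grp S (V \<inter> W)\<^esub> res S W (V \<inter> W) t))"

lemma stalk_mult_lmul: "stalk_mult T S x a b = germ T S x (lmul a b)"
  by (simp add: stalk_mult_def lmul_def split: prod.split)

lemma lmul_LS: "\<lbrakk>a \<in> LS x; b \<in> LS x\<rbrakk> \<Longrightarrow> lmul a b \<in> LS x"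
  by (cases a; cases b) (auto simp: lmul_def LS_iff intro!: mult_closed res_closed)

lemma lmul_cong:
  assumes "germ_eq T S x a a'" "germ_eq T S x b b'" "a \<in> LS x" "b \<in> LS x" "a' \<in> LS x" "b' \<in> LS x"
  shows "germ_eq T S x (lmul a b) (lmul a' b')"
proof -
  obtain V s where a: "a = (V, s)" by (cases a)
  obtain V' s' where a': "a' = (V', s')" by (cases a')
  obtain W t where b: "b = (W, t)" by (cases b)
  obtain W' t' where b': "b' = (W', t')" by (cases b')
  note ab = a a' b b'
  note LS = assms(3-6)[unfolded ab]
  obtain N where N: "openin T N" "x \<in> N" "N \<subseteq> V" "N \<subseteq> V'"
      "coset_eq (grp S N) (im S N) (res S V N s) (res S V' N s')"
    by (rule germ_eqE[OF assms(1)[unfolded ab] LS(1,3)]) (rule that)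
  obtain M where M: "openin T M" "x \<in> M" "M \<subseteq> W" "M \<subseteq> W'"
      "coset_eq (grp S M) (im S M) (res S W M t) (res S W' M t')"
    by (rule germ_eqE[OF assms(2)[unfolded ab] LS(2,4)]) (rule that)
  let ?K = "N \<inter> M"
  have K: "openin T ?K" using N M by blast
  have 1: "coset_eq (grp S ?K) (im S ?K) (res S V ?K s) (res S V' ?K s')"
    using K by (intro coset_eq_shrink[OF N(5) N(1) _ _ N(3,4) LS(1,3)]) auto
  have 2: "coset_eq (grp S ?K) (im S ?K) (res S W ?K t) (res S W' ?K t')"
    using K by (intro coset_eq_shrink[OF M(5) M(1) _ _ M(3,4) LS(2,4)]) auto
  have 3: "coset_eq (grp S ?K) (im S ?K) (res S V ?K s \<otimes>\<^bsub>grp S ?K\<^esub> res S W ?K t)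
      (res S V' ?K s' \<otimes>\<^bsub>grp S ?K\<^esub> res S W' ?K t')"
    by (rule comm_group.coset_eq_mult[OF grp im_subgroup _ _ _ _ 1 2])
      (use K N M LS in \<open>auto simp: LS_iff intro!: res_closed\<close>)
  have r: "res S (A \<inter> B) ?K (res S A (A \<inter> B) p \<otimes>\<^bsub>grp S (A \<inter> B)\<^esub> res S B (A \<inter> B) q)
      = res S A ?K p \<otimes>\<^bsub>grp S ?K\<^esub> res S B ?K q"
    if "N \<subseteq> A" "M \<subseteq> B" "(A, p) \<in> LS x" "(B, q) \<in> LS x" for A B p q
  proof -
    have o: "openin T A" "openin T B" "openin T (A \<inter> B)" "?K \<subseteq> A \<inter> B" using that by (auto simp: LS_iff)
    have c: "p \<in> carrier (grp S A)" "q \<in> carrier (grp S B)" using that by (auto simp: LS_iff)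
    show ?thesis
      using res_mult[OF o(3) K o(4) res_closed[OF o(1,3) _ c(1)] res_closed[OF o(2,3) _ c(2)]]
        res_res[OF o(1,3) K o(4) _ c(1)] res_res[OF o(2,3) K o(4) _ c(2)] by simp
  qed
  show ?thesis
  proof (cases "lmul a b"; cases "lmul a' b'")
    fix P p Q q assume e: "lmul a b = (P, p)" "lmul a' b' = (Q, q)"
    show ?thesis unfolding e
    proof (rule germ_eqI[of _ _ _ _ _ ?K])
      show "(P, p) \<in> LS x" "(Q, q) \<in> LS x" using lmul_LS assms e by metis+
      show "openin T ?K" "x \<in> ?K" "?K \<subseteq> P \<inter> Q" using K N M e by (auto simp: lmul_def ab)
      show "coset_eq (grp S ?K) (im S ?K) (res S P ?K p) (res S Q ?K q)"
        using 3 e r[OF N(3) M(3) LS(1,2)] r[OF N(4) M(4) LS(3,4)] by (auto simp: lmul_def ab)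
    qed
  qed
qed

lemma germ_lmul_germ:
  assumes "a \<in> LS x" "b \<in> LS x"
  shows "germ T S x (lmul (germ T S x a) b) = germ T S x (lmul a b)"
    "germ T S x (lmul a (germ T S x b)) = germ T S x (lmul a b)"
    "germ T S x (lmul (germ T S x a) (germ T S x b)) = germ T S x (lmul a b)"
proof -
  have a: "germ_eq T S x (germ T S x a) a" "germ_eq T S x (germ T S x b) b"
    "germ_eq T S x a a" "germ_eq T S x b b"
    using germ_eq_sym[OF germ_eq_germ[OF assms(1)] assms(1) germ_LS[OF assms(1)]]
      germ_eq_sym[OF germ_eq_germ[OF assms(2)] assms(2) germ_LS[OF assms(2)]]
      germ_eq_refl assms by (cases a; cases b; simp)+
  show "germ T S x (lmul (germ T S x a) b) = germ T S x (lmul a b)"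
    "germ T S x (lmul a (germ T S x b)) = germ T S x (lmul a b)"
    "germ T S x (lmul (germ T S x a) (germ T S x b)) = germ T S x (lmul a b)"
    using assms a by (auto intro!: germ_cong lmul_cong lmul_LS germ_LS)
qed

lemma germ_mult:
  assumes "(V, s) \<in> LS x" "(W, t) \<in> LS x" "openin T N" "x \<in> N" "N \<subseteq> V" "N \<subseteq> W"
  shows "stalk_mult T S x (germ T S x (V, s)) (germ T S x (W, t))
    = germ T S x (N, res S V N s \<otimes>\<^bsub>grp S N\<^esub> res S W N t)"
proof -
  have o: "openin T V" "openin T W" "openin T (V \<inter> W)" "N \<subseteq> V \<inter> W" using assms by (auto simp: LS_iff)
  have c: "s \<in> carrier (grp S V)" "t \<in> carrier (grp S W)" using assms by (auto simp: LS_iff)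
  have c': "res S V (V \<inter> W) s \<in> carrier (grp S (V \<inter> W))" "res S W (V \<inter> W) t \<in> carrier (grp S (V \<inter> W))"
    using o c by (auto intro: res_closed)
  have "stalk_mult T S x (germ T S x (V, s)) (germ T S x (W, t))
    = germ T S x (V \<inter> W, res S V (V \<inter> W) s \<otimes>\<^bsub>grp S (V \<inter> W)\<^esub> res S W (V \<inter> W) t)"
    unfolding stalk_mult_lmul germ_lmul_germ(3)[OF assms(1,2)] by (simp add: lmul_def)
  also have "\<dots> = germ T S x (N, res S (V \<inter> W) N (res S V (V \<inter> W) s \<otimes>\<^bsub>grp S (V \<inter> W)\<^esub> res S W (V \<inter> W) t))"
    using germ_res[OF o(3) assms(3,4) o(4) mult_closed[OF o(3) c']] by simp
  also have "res S (V \<inter> W) N (res S V (V \<inter> W) s \<otimes>\<^bsub>grp S (V \<inter> W)\<^esub> res S W (V \<inter> W) t)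
    = res S V N s \<otimes>\<^bsub>grp S N\<^esub> res S W N t"
    using res_mult[OF o(3) assms(3) o(4) c'] res_res[OF o(1,3) assms(3) o(4) _ c(1)]
      res_res[OF o(2,3) assms(3) o(4) _ c(2)] by simp
  finally show ?thesis .
qed

lemma germ_mult_same:
  assumes "openin T N" "x \<in> N" "s \<in> carrier (grp S N)" "t \<in> carrier (grp S N)"
  shows "stalk_mult T S x (germ T S x (N, s)) (germ T S x (N, t)) = germ T S x (N, s \<otimes>\<^bsub>grp S N\<^esub> t)"
  using germ_mult[of N s x N t N] assms by (simp add: LS_iff res_id)

text \<open>Three germs are treated at once because associativity needs three; the other group laws
  use it with a germ repeated.\<close>

lemma common_nbhd:
  assumes "a \<in> germ T S x ` LS x" "b \<in> germ T S x ` LS x" "c \<in> germ T S x ` LS x"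
  obtains N s t u where "openin T N" "x \<in> N" "s \<in> carrier (grp S N)" "t \<in> carrier (grp S N)" "u \<in> carrier (grp S N)"
    "a = germ T S x (N, s)" "b = germ T S x (N, t)" "c = germ T S x (N, u)"
proof -
  obtain A s B t C u where abc: "(A, s) \<in> LS x" "(B, t) \<in> LS x" "(C, u) \<in> LS x"
    "a = germ T S x (A, s)" "b = germ T S x (B, t)" "c = germ T S x (C, u)"
    using assms by (elim imageE) (metis surj_pair)
  let ?N = "A \<inter> B \<inter> C"
  have N: "openin T ?N" "x \<in> ?N" "openin T A" "openin T B" "openin T C"
    "s \<in> carrier (grp S A)" "t \<in> carrier (grp S B)" "u \<in> carrier (grp S C)"
    using abc by (auto simp: LS_iff)
  show thesis
    by (rule that[of ?N "res S A ?N s" "res S B ?N t" "res S C ?N u"])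
      (use N in \<open>auto simp: abc(4-6) intro!: res_closed germ_res[symmetric]\<close>)
qed

lemma next_stage_simps:
  "carrier (grp (next_stage T S') U) = Fam ` (\<Pi>\<^sub>E x\<in>U. germ T S' x ` local_sections T S' x)"
  "f \<otimes>\<^bsub>grp (next_stage T S') U\<^esub> g = Fam (\<lambda>x\<in>U. stalk_mult T S' x (the_fam f x) (the_fam g x))"
  "\<one>\<^bsub>grp (next_stage T S') U\<^esub> = germ_family T S' U \<one>\<^bsub>grp S' U\<^esub>"
  "res (next_stage T S') U V f = Fam (restrict (the_fam f) V)"
  "im (next_stage T S') U = germ_family T S' U ` carrier (grp S' U)"
  by (simp_all add: next_stage_def)

end

section \<open>The Godement construction preserves stages\<close>

lemma group_hom_of_hom: "\<lbrakk>group G; group H; h \<in> hom G H\<rbrakk> \<Longrightarrow> group_hom G H h"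
  by (simp add: group_hom_def group_hom_axioms_def)

text \<open>The group laws are checked point by point: the germs involved have representatives over
  one neighbourhood, where the laws of the previous stage apply.\<close>

lemma stage_next:
  assumes "stage T S" shows "stage T (next_stage T S)"
proof -
  interpret stage T S by fact
  let ?S = "next_stage T S"
  have fam: "germ_family T S U s \<in> carrier (grp ?S U)" if "openin T U" "s \<in> carrier (grp S U)" for U s
    unfolding next_stage_simps germ_family_def using that by (auto simp: LS_iff)
  have comm: "comm_group (grp ?S U)" if U: "openin T U" for U
  proof (rule comm_groupI)
    show "\<one>\<^bsub>grp ?S U\<^esub> \<in> carrier (grp ?S U)"
      unfolding next_stage_simps(3) using U by (intro fam one_closed)
    fix f g assume f: "f \<in> carrier (grp ?S U)" and g: "g \<in> carrier (grp ?S U)"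
    obtain f' where f': "f = Fam f'" "f' \<in> (\<Pi>\<^sub>E x\<in>U. germ T S x ` LS x)" using f by (auto simp: next_stage_simps)
    obtain g' where g': "g = Fam g'" "g' \<in> (\<Pi>\<^sub>E x\<in>U. germ T S x ` LS x)" using g by (auto simp: next_stage_simps)
    have st: "f' x \<in> germ T S x ` LS x" "g' x \<in> germ T S x ` LS x" if "x \<in> U" for x
      using f' g' that by auto
    have cl: "stalk_mult T S x (f' x) (g' x) \<in> germ T S x ` LS x" if x: "x \<in> U" for x
    proof (rule common_nbhd[OF st[OF x] st(2)[OF x]])
      fix N s t u assume "openin T N" "x \<in> N" "s \<in> carrier (grp S N)" "t \<in> carrier (grp S N)"
        "f' x = germ T S x (N, s)" "g' x = germ T S x (N, t)"
      then show ?thesis by (auto simp: germ_mult_same LS_iff mult_closed)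
    qed
    then show "f \<otimes>\<^bsub>grp ?S U\<^esub> g \<in> carrier (grp ?S U)"
      unfolding next_stage_simps f' g' by auto
    show "f \<otimes>\<^bsub>grp ?S U\<^esub> g = g \<otimes>\<^bsub>grp ?S U\<^esub> f"
    proof -
      have "stalk_mult T S x (f' x) (g' x) = stalk_mult T S x (g' x) (f' x)" if x: "x \<in> U" for x
      proof (rule common_nbhd[OF st[OF x] st(2)[OF x]])
        fix N s t u assume N: "openin T N" "x \<in> N" "s \<in> carrier (grp S N)" "t \<in> carrier (grp S N)"
          "f' x = germ T S x (N, s)" "g' x = germ T S x (N, t)"
        interpret N: comm_group "grp S N" using N grp by blast
        show ?thesis using N by (simp add: germ_mult_same N.m_comm)
      qed
      then show ?thesis unfolding next_stage_simps f' g' by auto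
    qed
    show "\<one>\<^bsub>grp ?S U\<^esub> \<otimes>\<^bsub>grp ?S U\<^esub> f = f"
    proof -
      have "stalk_mult T S x (germ T S x (U, \<one>\<^bsub>grp S U\<^esub>)) (f' x) = f' x" if x: "x \<in> U" for x
      proof (rule common_nbhd[OF st[OF x] st(2)[OF x]])
        fix N s t u assume N: "openin T N" "x \<in> N" "s \<in> carrier (grp S N)" "t \<in> carrier (grp S N)"
          "f' x = germ T S x (N, s)"
        interpret N: comm_group "grp S N" using N grp by blast
        let ?M = "N \<inter> U"
        have M: "openin T ?M" "x \<in> ?M" using N U x by auto
        interpret M: comm_group "grp S ?M" using M grp by blast
        have "stalk_mult T S x (germ T S x (U, \<one>\<^bsub>grp S U\<^esub>)) (f' x)
          = germ T S x (?M, res S U ?M \<one>\<^bsub>grp S U\<^esub> \<otimes>\<^bsub>grp S ?M\<^esub> res S N ?M s)"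
          unfolding N(5) using N U x M by (intro germ_mult) (auto simp: LS_iff one_closed)
        also have "res S U ?M \<one>\<^bsub>grp S U\<^esub> \<otimes>\<^bsub>grp S ?M\<^esub> res S N ?M s = res S N ?M s"
          using res_one[OF U M(1)] res_closed[OF N(1) M(1) _ N(3)] by simp
        also have "germ T S x (?M, res S N ?M s) = f' x"
          unfolding N(5) using N M by (intro germ_res) auto
        finally show ?thesis .
      qed
      then have "(\<lambda>x\<in>U. stalk_mult T S x (germ T S x (U, \<one>\<^bsub>grp S U\<^esub>)) (f' x)) = f'"
        using f'(2) by (auto simp: fun_eq_iff PiE_def extensional_def)
      then show ?thesis unfolding next_stage_simps f' germ_family_def by (auto cong: restrict_cong)
    qed
    show "\<exists>h\<in>carrier (grp ?S U). h \<otimes>\<^bsub>grp ?S U\<^esub> f = \<one>\<^bsub>grp ?S U\<^esub>"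
    proof -
      have "\<exists>b. b \<in> germ T S x ` LS x \<and> stalk_mult T S x b (f' x) = germ T S x (U, \<one>\<^bsub>grp S U\<^esub>)"
        if x: "x \<in> U" for x
      proof (rule common_nbhd[OF st[OF x] st(2)[OF x]])
        fix N s t u assume N: "openin T N" "x \<in> N" "s \<in> carrier (grp S N)" "t \<in> carrier (grp S N)"
          "f' x = germ T S x (N, s)"
        interpret N: comm_group "grp S N" using N grp by blast
        let ?M = "N \<inter> U"
        have M: "openin T ?M" "x \<in> ?M" using N U x by auto
        have "germ T S x (N, \<one>\<^bsub>grp S N\<^esub>) = germ T S x (?M, \<one>\<^bsub>grp S ?M\<^esub>)"
          using germ_res[OF N(1) M, of "\<one>\<^bsub>grp S N\<^esub>"] res_one[OF N(1) M(1)] by simp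
        also have "\<dots> = germ T S x (U, \<one>\<^bsub>grp S U\<^esub>)"
          using germ_res[OF U M, of "\<one>\<^bsub>grp S U\<^esub>"] res_one[OF U M(1)] one_closed[OF U] by simp
        finally have 1: "germ T S x (N, \<one>\<^bsub>grp S N\<^esub>) = germ T S x (U, \<one>\<^bsub>grp S U\<^esub>)" .
        have "stalk_mult T S x (germ T S x (N, inv\<^bsub>grp S N\<^esub> s)) (f' x) = germ T S x (N, \<one>\<^bsub>grp S N\<^esub>)"
          using N by (simp add: germ_mult_same)
        then show ?thesis using N 1
          by (intro exI[of _ "germ T S x (N, inv\<^bsub>grp S N\<^esub> s)"]) (auto simp: LS_iff)
      qed
      then obtain b where b: "\<And>x. x \<in> U \<Longrightarrow> b x \<in> germ T S x ` LS x \<and>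
          stalk_mult T S x (b x) (f' x) = germ T S x (U, \<one>\<^bsub>grp S U\<^esub>)" by metis
      then show ?thesis unfolding next_stage_simps germ_family_def f'
        by (intro bexI[of _ "Fam (restrict b U)"]) (auto cong: restrict_cong)
    qed
    fix h assume h: "h \<in> carrier (grp ?S U)"
    obtain h' where h': "h = Fam h'" "h' \<in> (\<Pi>\<^sub>E x\<in>U. germ T S x ` LS x)" using h by (auto simp: next_stage_simps)
    show "f \<otimes>\<^bsub>grp ?S U\<^esub> g \<otimes>\<^bsub>grp ?S U\<^esub> h = f \<otimes>\<^bsub>grp ?S U\<^esub> (g \<otimes>\<^bsub>grp ?S U\<^esub> h)"
    proof -
      have "stalk_mult T S x (stalk_mult T S x (f' x) (g' x)) (h' x)
        = stalk_mult T S x (f' x) (stalk_mult T S x (g' x) (h' x))" if x: "x \<in> U" for x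
      proof -
        have "h' x \<in> germ T S x ` LS x" using h'(2) x by auto
        then show ?thesis
        proof (rule common_nbhd[OF st[OF x]])
          fix N s t u assume N: "openin T N" "x \<in> N" "s \<in> carrier (grp S N)" "t \<in> carrier (grp S N)"
            "u \<in> carrier (grp S N)"
            "f' x = germ T S x (N, s)" "g' x = germ T S x (N, t)" "h' x = germ T S x (N, u)"
          interpret N: comm_group "grp S N" using N grp by blast
          show ?thesis using N by (simp add: germ_mult_same N.m_assoc)
        qed
      qed
      then show ?thesis unfolding next_stage_simps f' g' h' by (auto cong: restrict_cong)
    qed
  qed
  have fam_hom: "germ_family T S U \<in> hom (grp S U) (grp ?S U)" if U: "openin T U" for U
  proof (rule homI)
    fix s t assume st: "s \<in> carrier (grp S U)" "t \<in> carrier (grp S U)"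
    then show "germ_family T S U (s \<otimes>\<^bsub>grp S U\<^esub> t) = germ_family T S U s \<otimes>\<^bsub>grp ?S U\<^esub> germ_family T S U t"
      unfolding next_stage_simps germ_family_def using U by (auto simp: germ_mult_same cong: restrict_cong)
  qed (use fam U in auto)
  have sub: "openin T U" "\<And>x. x \<in> U \<Longrightarrow> x \<in> V" if "openin T U" "U \<subseteq> V" for U V using that by auto
  show ?thesis
  proof (rule stage.intro)
    fix U V assume UV: "openin T U" "openin T V" "V \<subseteq> U"
    show "res ?S U V \<in> hom (grp ?S U) (grp ?S V)"
    proof (rule homI)
      fix f g assume f: "f \<in> carrier (grp ?S U)" and g: "g \<in> carrier (grp ?S U)"
      then show "res ?S U V f \<in> carrier (grp ?S V)"
        unfolding next_stage_simps using UV(3)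
        by (elim imageE, hypsubst, unfold cochain.sel, intro imageI) (auto simp: PiE_iff extensional_def)
      show "res ?S U V (f \<otimes>\<^bsub>grp ?S U\<^esub> g) = res ?S U V f \<otimes>\<^bsub>grp ?S V\<^esub> res ?S U V g"
        unfolding next_stage_simps using UV(3) by (auto simp: fun_eq_iff)
    qed
    fix s assume "s \<in> im ?S U"
    then obtain s' where s': "s = germ_family T S U s'" "s' \<in> carrier (grp S U)"
      unfolding next_stage_simps by blast
    have "res ?S U V s = germ_family T S V (res S U V s')"
      unfolding next_stage_simps s' germ_family_def using UV s'(2)
      by (auto simp: fun_eq_iff germ_res)
    then show "res ?S U V s \<in> im ?S V"
      unfolding next_stage_simps(5) using res_closed[OF UV s'(2)] by blast
  next
    fix U s assume "openin T U" "s \<in> carrier (grp ?S U)"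
    then show "res ?S U U s = s" unfolding next_stage_simps by (auto simp: PiE_def extensional_restrict)
  next
    fix U V W s assume "openin T U" "openin T V" "openin T W" "W \<subseteq> V" "V \<subseteq> U" "s \<in> carrier (grp ?S U)"
    then show "res ?S V W (res ?S U V s) = res ?S U W s"
      unfolding next_stage_simps by (auto simp: restrict_restrict Int_absorb1)
  next
    fix U assume U: "openin T U"
    show "comm_group (grp ?S U)" by (rule comm[OF U])
    show "subgroup (im ?S U) (grp ?S U)"
      unfolding next_stage_simps(5)
      by (intro group_hom.img_is_subgroup group_hom_of_hom fam_hom[OF U] comm_group.axioms(2) grp[OF U] comm[OF U])
  qed
qed

lemma stage_base:
  assumes "ab_sheaf T F r" shows "stage T (base_stage F r)"
proof -
  interpret F: ab_sheaf T F r by fact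
  let ?S = "base_stage F r"
  have simps: "carrier (grp ?S U) = Base ` carrier (F U)"
    "a \<otimes>\<^bsub>grp ?S U\<^esub> b = Base (the_base a \<otimes>\<^bsub>F U\<^esub> the_base b)" "\<one>\<^bsub>grp ?S U\<^esub> = Base \<one>\<^bsub>F U\<^esub>"
    "res ?S U V a = Base (r U V (the_base a))" "im ?S U = {\<one>\<^bsub>grp ?S U\<^esub>}" for U V a b
    by (simp_all add: base_stage_def)
  have comm: "comm_group (grp ?S U)" if "openin T U" for U
  proof -
    interpret U: comm_group "F U" using F.comm_group_sections[OF that] .
    show ?thesis
    proof (rule comm_groupI)
      fix a assume "a \<in> carrier (grp ?S U)"
      then obtain a' where "a = Base a'" "a' \<in> carrier (F U)" by (auto simp: simps)
      then show "\<exists>b\<in>carrier (grp ?S U). b \<otimes>\<^bsub>grp ?S U\<^esub> a = \<one>\<^bsub>grp ?S U\<^esub>"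
        by (intro bexI[of _ "Base (inv\<^bsub>F U\<^esub> a')"]) (auto simp: simps)
    qed (auto simp: simps U.m_ac)
  qed
  have one: "r U V \<one>\<^bsub>F U\<^esub> = \<one>\<^bsub>F V\<^esub>" if "openin T U" "openin T V" "V \<subseteq> U" for U V
    using that by (intro hom_one[OF F.res_hom] comm_group.axioms(2) F.comm_group_sections)
  show ?thesis
  proof (rule stage.intro)
    fix U assume U: "openin T U"
    show "comm_group (grp ?S U)" by (rule comm[OF U])
    show "subgroup (im ?S U) (grp ?S U)"
      unfolding simps(5) by (intro group.triv_subgroup comm_group.axioms(2) comm[OF U])
  next
    fix U V assume UV: "openin T U" "openin T V" "V \<subseteq> U"
    show "res ?S U V \<in> hom (grp ?S U) (grp ?S V)"
      using F.res_hom[OF UV] by (auto simp: hom_def simps)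
    show "res ?S U V s \<in> im ?S V" if "s \<in> im ?S U" for s
      using one[OF UV] that by (simp add: simps)
  qed (auto simp: simps F.res_id F.res_res)
qed

text \<open>The uniqueness half of gluing, for the cover by all open sets on which \<open>s\<close>
  and \<open>t\<close> already agree.\<close>

lemma (in ab_sheaf) locally_eq:
  assumes U: "openin T U" and s: "s \<in> carrier (F U)" and t: "t \<in> carrier (F U)"
    and loc: "\<And>x. x \<in> U \<Longrightarrow> \<exists>N. openin T N \<and> x \<in> N \<and> N \<subseteq> U \<and> r U N s = r U N t"
  shows "s = t"
proof -
  define \<U> where "\<U> = {N. openin T N \<and> N \<subseteq> U \<and> r U N s = r U N t}"
  have un: "\<Union>\<U> = U" using loc by (fastforce simp: \<U>_def)
  have op: "openin T V" "V \<subseteq> U" "r U V s = r U V t" if "V \<in> \<U>" for V using that by (auto simp: \<U>_def)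
  have "\<exists>!u. u \<in> carrier (F (\<Union>\<U>)) \<and> (\<forall>V\<in>\<U>. r (\<Union>\<U>) V u = r U V s)"
  proof (rule gluing)
    fix V W assume V: "V \<in> \<U>" and W: "W \<in> \<U>"
    have "r V (V \<inter> W) (r U V s) = r U (V \<inter> W) s"
      using op[OF V] op[OF W] by (intro res_res[OF U _ _ _ _ s]) auto
    moreover have "r W (V \<inter> W) (r U W s) = r U (V \<inter> W) s"
      using op[OF V] op[OF W] by (intro res_res[OF U _ _ _ _ s]) auto
    ultimately show "r V (V \<inter> W) (r U V s) = r W (V \<inter> W) (r U W s)" by simp
    show "r U V s \<in> carrier (F V)" by (rule hom_in_carrier[OF res_hom[OF U op(1)[OF V] op(2)[OF V]] s])
  qed (rule op(1))
  moreover have "s \<in> carrier (F (\<Union>\<U>)) \<and> (\<forall>V\<in>\<U>. r (\<Union>\<U>) V s = r U V s)" using s un by simp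
  moreover have "t \<in> carrier (F (\<Union>\<U>)) \<and> (\<forall>V\<in>\<U>. r (\<Union>\<U>) V t = r U V s)" using t un op by simp
  ultimately show ?thesis by blast
qed

text \<open>The cocycle \<open>c\<close> is turned into the Godement cocycle whose value at \<open>x\<close> is the germ of the family
  \<open>z \<mapsto> c x z\<close> of germs.\<close>

theorem (in ab_sheaf) cocycle_splits:
  assumes H1: "trivial_group (cohomology T F r 1)"
    and V: "\<And>x. x \<in> topspace T \<Longrightarrow> openin T (V x) \<and> x \<in> V x"
    and c: "\<And>x y. \<lbrakk>x \<in> topspace T; y \<in> topspace T\<rbrakk> \<Longrightarrow> c x y \<in> carrier (F (V x \<inter> V y))"
    and cocycle: "\<And>x y z. \<lbrakk>x \<in> topspace T; y \<in> topspace T; z \<in> topspace T\<rbrakk> \<Longrightarrow>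
       r (V x \<inter> V z) (V x \<inter> V y \<inter> V z) (c x z) =
       r (V x \<inter> V y) (V x \<inter> V y \<inter> V z) (c x y) \<otimes>\<^bsub>F (V x \<inter> V y \<inter> V z)\<^esub> r (V y \<inter> V z) (V x \<inter> V y \<inter> V z) (c y z)"
  shows "\<exists>W n. (\<forall>x\<in>topspace T. openin T (W x) \<and> x \<in> W x \<and> W x \<subseteq> V x \<and> n x \<in> carrier (F (W x))) \<and>
    (\<forall>x\<in>topspace T. \<forall>y\<in>topspace T. r (W x) (W x \<inter> W y) (n x) \<otimes>\<^bsub>F (W x \<inter> W y)\<^esub> r (V x \<inter> V y) (W x \<inter> W y) (c x y)
       = r (W y) (W x \<inter> W y) (n y))"
proof -
  let ?X = "topspace T"
  define S0 where "S0 = base_stage F r"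
  define S1 where "S1 = next_stage T S0"
  define S2 where "S2 = next_stage T S1"
  define S3 where "S3 = next_stage T S2"
  interpret S0: stage T S0 unfolding S0_def by (rule stage_base) unfold_locales
  interpret S1: stage T S1 unfolding S1_def by (rule stage_next) unfold_locales
  interpret S2: stage T S2 unfolding S2_def by (rule stage_next) unfold_locales
  interpret S3: stage T S3 unfolding S3_def by (rule stage_next) unfold_locales
  \<comment> \<open>Degree \<open>n\<close> of the resolution is stage \<open>n + 1\<close>:
    \<open>S1\<close>, \<open>S2\<close>, \<open>S3\<close> are the terms of degree 0, 1, 2, and
    \<open>im S2\<close> is the image of degree 0.\<close>
  have god: "godement T F r (Suc 0) = S2" "godement T F r (Suc (Suc 0)) = S3"
    by (simp_all add: godement_def S0_def S1_def S2_def S3_def)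
  note simps1 = S0.next_stage_simps[of S0, folded S1_def]
  note simps2 = S0.next_stage_simps[of S1, folded S2_def]
  note simps3 = S0.next_stage_simps[of S2, folded S3_def]
  have X: "openin T ?X" by simp
  have VV: "openin T (V x \<inter> V y)" if "x \<in> ?X" "y \<in> ?X" for x y using V that by blast
  have inX: "z \<in> ?X" if "z \<in> V x" "x \<in> ?X" for x z using that V openin_subset by blast
  have S0_simps: "carrier (grp S0 U) = Base ` carrier (F U)"
    "Base a \<otimes>\<^bsub>grp S0 U\<^esub> Base b = Base (a \<otimes>\<^bsub>F U\<^esub> b)"
    "res S0 U W (Base a) = Base (r U W a)" "im S0 U = {Base \<one>\<^bsub>F U\<^esub>}" for U W a b
    by (simp_all add: S0_def base_stage_def)
  have LS0: "(U, Base a) \<in> S0.LS z \<longleftrightarrow> openin T U \<and> z \<in> U \<and> a \<in> carrier (F U)" for U a z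
    by (auto simp: S0.LS_iff S0_simps)
  \<comment> \<open>The subpresheaf of the base stage is trivial, so equality of germs means actual
    equality of sections on a neighbourhood.\<close>
  have germ0: "germ T S0 z (U, Base a) = germ T S0 z (U', Base a') \<longleftrightarrow>
      (\<exists>N. openin T N \<and> z \<in> N \<and> N \<subseteq> U \<inter> U' \<and> r U N a = r U' N a')"
    if a: "openin T U" "z \<in> U" "a \<in> carrier (F U)" "openin T U'" "z \<in> U'" "a' \<in> carrier (F U')" for z U a U' a'
  proof -
    have "coset_eq (grp S0 N) (im S0 N) (res S0 U N (Base a)) (res S0 U' N (Base a')) \<longleftrightarrow> r U N a = r U' N a'"
      if N: "openin T N" "N \<subseteq> U \<inter> U'" for N
    proof -
      interpret N: comm_group "F N" using comm_group_sections[OF N(1)] .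
      have "r U' N a' \<in> carrier (F N)" using a N by (intro hom_in_carrier[OF res_hom]) auto
      then show ?thesis by (auto simp: coset_eq_def S0_simps)
    qed
    then have "germ_eq T S0 z (U, Base a) (U', Base a') \<longleftrightarrow>
      (\<exists>N. openin T N \<and> z \<in> N \<and> N \<subseteq> U \<inter> U' \<and> r U N a = r U' N a')"
      using a S0.germ_eq_iff[of U "Base a" z U' "Base a'"] unfolding LS0 by blast
    moreover have "germ T S0 z (U, Base a) = germ T S0 z (U', Base a') \<longleftrightarrow> germ_eq T S0 z (U, Base a) (U', Base a')"
    proof -
      have LS: "(U, Base a) \<in> S0.LS z" "(U', Base a') \<in> S0.LS z" using a by (auto simp: LS0)
      show ?thesis using S0.germ_cong[OF _ LS] S0.germ_eqD[OF _ LS] by blast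
    qed
    ultimately show ?thesis by simp
  qed
  define t where "t x = Fam (\<lambda>z\<in>V x. germ T S0 z (V x \<inter> V z, Base (c x z)))" for x
  have t: "t x \<in> carrier (grp S1 (V x))" if x: "x \<in> ?X" for x
    unfolding simps1 t_def using V c inX x VV by (auto simp: LS0 intro!: imageI)
  have LS1: "(V x, t x) \<in> S1.LS z" if "x \<in> ?X" "z \<in> V x" for x z
    using that t V by (simp add: S1.LS_iff)
  define \<xi> where "\<xi> = Fam (\<lambda>x\<in>?X. germ T S1 x (V x, t x))"
  have \<xi>: "\<xi> \<in> carrier (grp S2 ?X)"
    unfolding simps2 \<xi>_def using LS1 V by auto
  \<comment> \<open>By the cocycle identity \<open>t z\<close> and \<open>t x\<close> differ on the
    overlap by the image of the section \<open>c z x\<close>, which is divided out in the next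
    stage. Hence \<xi> restricts on \<open>V x\<close> to the image of \<open>t x\<close>.\<close>
  have local: "germ T S1 z (V z, t z) = germ T S1 z (V x, t x)" if x: "x \<in> ?X" and z: "z \<in> V x" for x z
  proof (rule S1.germ_cong)
    have zX: "z \<in> ?X" using inX x z by blast
    show LS: "(V z, t z) \<in> S1.LS z" "(V x, t x) \<in> S1.LS z" using LS1 V x z zX by auto
    let ?N = "V z \<inter> V x"
    have N: "openin T ?N" "z \<in> ?N" using V x z zX by auto
    let ?h = "germ_family T S0 ?N (Base (c z x))"
    have h: "?h \<in> im S1 ?N" unfolding simps1 S0_simps using c[OF zX x] by blast
    have "res S1 (V z) ?N (t z) = ?h \<otimes>\<^bsub>grp S1 ?N\<^esub> res S1 (V x) ?N (t x)"
    proof -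
      have "germ T S0 w (V z \<inter> V w, Base (c z w)) = stalk_mult T S0 w (germ T S0 w (?N, Base (c z x)))
          (germ T S0 w (V x \<inter> V w, Base (c x w)))" if w: "w \<in> ?N" for w
      proof -
        have wX: "w \<in> ?X" using inX zX w by blast
        let ?M = "V z \<inter> V x \<inter> V w"
        have M: "openin T ?M" "w \<in> ?M" using V x zX wX w by auto
        have "stalk_mult T S0 w (germ T S0 w (?N, Base (c z x))) (germ T S0 w (V x \<inter> V w, Base (c x w)))
          = germ T S0 w (?M, res S0 ?N ?M (Base (c z x)) \<otimes>\<^bsub>grp S0 ?M\<^esub> res S0 (V x \<inter> V w) ?M (Base (c x w)))"
          using M c zX x wX VV by (intro S0.germ_mult) (auto simp: LS0)
        also have "res S0 ?N ?M (Base (c z x)) \<otimes>\<^bsub>grp S0 ?M\<^esub> res S0 (V x \<inter> V w) ?M (Base (c x w))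
          = res S0 (V z \<inter> V w) ?M (Base (c z w))"
          unfolding S0_simps using cocycle[OF zX x wX] by simp
        also have "germ T S0 w (?M, res S0 (V z \<inter> V w) ?M (Base (c z w))) = germ T S0 w (V z \<inter> V w, Base (c z w))"
          using M c zX x wX VV by (intro S0.germ_res) (auto simp: S0_simps)
        finally show ?thesis by simp
      qed
      then show ?thesis unfolding simps1 t_def germ_family_def by (auto simp: fun_eq_iff)
    qed
    then show "germ_eq T S1 z (V z, t z) (V x, t x)"
      using h by (intro S1.germ_eqI[OF LS N]) (auto simp: coset_eq_def)
  qed
  have ker: "germ_family T S2 ?X \<xi> = \<one>\<^bsub>grp S3 ?X\<^esub>"
  proof -
    have "germ T S2 x (?X, \<xi>) = germ T S2 x (?X, \<one>\<^bsub>grp S2 ?X\<^esub>)" if x: "x \<in> ?X" for x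
    proof (rule S2.germ_cong)
      show LS: "(?X, \<xi>) \<in> S2.LS x" "(?X, \<one>\<^bsub>grp S2 ?X\<^esub>) \<in> S2.LS x"
        using \<xi> x S2.one_closed[OF X] by (auto simp: S2.LS_iff)
      have Vx: "openin T (V x)" "x \<in> V x" "V x \<subseteq> ?X" using V x openin_subset by auto
      interpret Vx: comm_group "grp S2 (V x)" using S2.grp Vx by blast
      have "res S2 ?X (V x) \<xi> = germ_family T S1 (V x) (t x)"
        unfolding simps2 \<xi>_def germ_family_def using local[OF x] Vx by (auto simp: fun_eq_iff)
      then have "res S2 ?X (V x) \<xi> \<in> im S2 (V x)" unfolding simps2 using t[OF x] by auto
      moreover have "im S2 (V x) \<subseteq> carrier (grp S2 (V x))"
        using S2.im_subgroup[OF Vx(1)] by (rule subgroup.subset)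
      ultimately show "germ_eq T S2 x (?X, \<xi>) (?X, \<one>\<^bsub>grp S2 ?X\<^esub>)"
        using S2.res_one[OF X Vx(1,3)] Vx
        by (intro S2.germ_eqI[OF LS Vx(1,2)]) (auto simp: coset_eq_def intro!: bexI[of _ "res S2 ?X (V x) \<xi>"])
    qed
    then show ?thesis unfolding simps3 germ_family_def by (auto cong: restrict_cong)
  qed
  define Z where "Z = kernel (grp S2 ?X) (grp S3 ?X) (germ_family T S2 ?X)"
  have \<xi>Z: "\<xi> \<in> Z" using \<xi> ker by (simp add: Z_def kernel_def)
  interpret C: comm_group "grp S2 ?X" using S2.grp X by blast
  have imsub: "subgroup (im S2 ?X) (grp S2 ?X)" by (rule S2.im_subgroup[OF X])
  \<comment> \<open>Triviality of the quotient says that the coset of the cocycle \<xi> is the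
    subgroup of coboundaries itself, and a coset contains its representative.\<close>
  have "\<xi> \<in> im S2 ?X"
  proof -
    have "carrier ((grp S2 ?X)\<lparr>carrier := Z\<rparr> Mod im S2 ?X) = {\<one>\<^bsub>(grp S2 ?X)\<lparr>carrier := Z\<rparr> Mod im S2 ?X\<^esub>}"
      using H1 unfolding cohomology_def Let_def trivial_group_def by (simp add: god Z_def)
    then have "(\<Union>a\<in>Z. {im S2 ?X #>\<^bsub>(grp S2 ?X)\<lparr>carrier := Z\<rparr>\<^esub> a}) = {im S2 ?X}"
      by (simp add: FactGroup_def RCOSETS_def)
    then have "im S2 ?X #>\<^bsub>(grp S2 ?X)\<lparr>carrier := Z\<rparr>\<^esub> \<xi> = im S2 ?X" using \<xi>Z by blast
    then have "(\<Union>h\<in>im S2 ?X. {h \<otimes>\<^bsub>grp S2 ?X\<^esub> \<xi>}) = im S2 ?X" by (simp add: r_coset_def)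
    moreover have "\<one>\<^bsub>grp S2 ?X\<^esub> \<otimes>\<^bsub>grp S2 ?X\<^esub> \<xi> \<in> (\<Union>h\<in>im S2 ?X. {h \<otimes>\<^bsub>grp S2 ?X\<^esub> \<xi>})"
      using subgroup.one_closed[OF imsub] by blast
    ultimately show ?thesis using \<xi> by simp
  qed
  then obtain \<tau> where \<tau>: "\<tau> \<in> carrier (grp S1 ?X)" "\<xi> = germ_family T S1 ?X \<tau>"
    unfolding simps2 by blast
  obtain \<tau>' where \<tau>': "\<tau> = Fam \<tau>'" "\<tau>' \<in> (\<Pi>\<^sub>E x\<in>?X. germ T S0 x ` S0.LS x)"
    using \<tau>(1) unfolding simps1 by blast
  \<comment> \<open>Near \<open>x\<close> the cochains \<tau> and \<open>t x\<close> have the same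
    germ modulo sections of \<open>F\<close>, so they differ by some section \<open>n\<close>. These
    sections split the cocycle.\<close>
  have ex: "\<exists>N n. openin T N \<and> x \<in> N \<and> N \<subseteq> V x \<and> n \<in> carrier (F N) \<and>
    (\<forall>z\<in>N. \<tau>' z = stalk_mult T S0 z (germ T S0 z (N, Base n)) (germ T S0 z (V x \<inter> V z, Base (c x z))))" if x: "x \<in> ?X" for x
  proof -
    have "(\<lambda>x\<in>?X. germ T S1 x (V x, t x)) x = (\<lambda>x\<in>?X. germ T S1 x (?X, \<tau>)) x"
      using \<tau>(2) unfolding \<xi>_def germ_family_def by simp
    then have eq: "germ T S1 x (?X, \<tau>) = germ T S1 x (V x, t x)" using x by simp
    have LS: "(?X, \<tau>) \<in> S1.LS x" "(V x, t x) \<in> S1.LS x" using \<tau>(1) x LS1 V by (auto simp: S1.LS_iff)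
    obtain N where N: "openin T N" "x \<in> N" "N \<subseteq> V x"
      "coset_eq (grp S1 N) (im S1 N) (res S1 ?X N \<tau>) (res S1 (V x) N (t x))"
      by (rule S1.germ_eqE[OF S1.germ_eqD[OF eq LS] LS]) (rule that)
    then obtain n where n: "n \<in> carrier (F N)"
      "res S1 ?X N \<tau> = germ_family T S0 N (Base n) \<otimes>\<^bsub>grp S1 N\<^esub> res S1 (V x) N (t x)"
      unfolding coset_eq_def simps1(5) S0_simps(1) by blast
    have "\<tau>' z = stalk_mult T S0 z (germ T S0 z (N, Base n)) (germ T S0 z (V x \<inter> V z, Base (c x z)))"
      if z: "z \<in> N" for z
    proof -
      have "restrict \<tau>' N z = (\<lambda>z\<in>N. stalk_mult T S0 z (germ T S0 z (N, Base n))
          (restrict (\<lambda>z\<in>V x. germ T S0 z (V x \<inter> V z, Base (c x z))) N z)) z"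
        using n(2) z unfolding simps1 \<tau>'(1) t_def germ_family_def
        by (auto simp: fun_eq_iff split: if_splits)
      then show ?thesis using z N(3) by auto
    qed
    then show ?thesis using N n by blast
  qed
  then obtain W n where W: "\<And>x. x \<in> ?X \<Longrightarrow> openin T (W x) \<and> x \<in> W x \<and> W x \<subseteq> V x \<and> n x \<in> carrier (F (W x)) \<and>
    (\<forall>z\<in>W x. \<tau>' z = stalk_mult T S0 z (germ T S0 z (W x, Base (n x))) (germ T S0 z (V x \<inter> V z, Base (c x z))))"
    by metis
  have "r (W x) (W x \<inter> W y) (n x) \<otimes>\<^bsub>F (W x \<inter> W y)\<^esub> r (V x \<inter> V y) (W x \<inter> W y) (c x y)
       = r (W y) (W x \<inter> W y) (n y)" (is "?a = ?b") if x: "x \<in> ?X" and y: "y \<in> ?X" for x y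
  proof (rule locally_eq)
    let ?U = "W x \<inter> W y"
    show U: "openin T ?U" using W x y by blast
    interpret U: comm_group "F ?U" using comm_group_sections[OF U] .
    have c1: "r (W x) ?U (n x) \<in> carrier (F ?U)" "r (W y) ?U (n y) \<in> carrier (F ?U)"
      using W x y U by (auto intro!: hom_in_carrier[OF res_hom])
    have c2: "r (V x \<inter> V y) ?U (c x y) \<in> carrier (F ?U)"
      using W[OF x] W[OF y] U by (intro hom_in_carrier[OF res_hom[OF VV[OF x y]] c[OF x y]]) auto
    show "?a \<in> carrier (F ?U)" "?b \<in> carrier (F ?U)" using c1 c2 by auto
    fix z assume z: "z \<in> ?U"
    have zX: "z \<in> ?X" using z W[OF x] V x openin_subset by blast
    have zV: "z \<in> V x" "z \<in> V y" "z \<in> V z" using z W[OF x] W[OF y] V[OF zX] by auto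
    let ?M = "W x \<inter> W y \<inter> V z"
    have M: "openin T ?M" "z \<in> ?M" "?M \<subseteq> ?U" using U V[OF zX] z by auto
    have sub: "?M \<subseteq> W x" "?M \<subseteq> W y" "?M \<subseteq> V x \<inter> V z" "?M \<subseteq> V y \<inter> V z" "?M \<subseteq> V x \<inter> V y" "?M \<subseteq> V x \<inter> V y \<inter> V z"
      using W[OF x] W[OF y] by auto
    \<comment> \<open>The germ of \<tau> at \<open>z\<close> is computed through the neighbourhood
      of \<open>x\<close> and through that of \<open>y\<close>. Comparison gives
      \<open>n x + c x z = n y + c y z\<close> near \<open>z\<close>, in additive notation;
      inserting the cocycle identity, \<open>c y z\<close> cancels.\<close>
    have \<tau>z: "\<tau>' z = germ T S0 z (?M, Base (r (W u) ?M (n u) \<otimes>\<^bsub>F ?M\<^esub> r (V u \<inter> V z) ?M (c u z)))"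
      if u: "u \<in> ?X" "z \<in> W u" "?M \<subseteq> W u" "?M \<subseteq> V u \<inter> V z" for u
    proof -
      have "\<tau>' z = stalk_mult T S0 z (germ T S0 z (W u, Base (n u))) (germ T S0 z (V u \<inter> V z, Base (c u z)))"
        using W u by blast
      also have "\<dots> = germ T S0 z (?M, res S0 (W u) ?M (Base (n u)) \<otimes>\<^bsub>grp S0 ?M\<^esub> res S0 (V u \<inter> V z) ?M (Base (c u z)))"
        using M W[OF u(1)] u c[OF u(1) zX] VV[OF u(1) zX] by (intro S0.germ_mult) (auto simp: LS0)
      finally show ?thesis by (simp add: S0_simps)
    qed
    interpret M: comm_group "F ?M" using comm_group_sections[OF M(1)] .
    have cM: "r (W x) ?M (n x) \<in> carrier (F ?M)" "r (W y) ?M (n y) \<in> carrier (F ?M)"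
      "r (V x \<inter> V y) ?M (c x y) \<in> carrier (F ?M)"
      "r (V x \<inter> V z) ?M (c x z) \<in> carrier (F ?M)" "r (V y \<inter> V z) ?M (c y z) \<in> carrier (F ?M)"
      using W[OF x] W[OF y] M(1) sub x y zX c VV by (auto intro!: hom_in_carrier[OF res_hom] simp del: Int_subset_iff)
    obtain N where N: "openin T N" "z \<in> N" "N \<subseteq> ?M"
      "r ?M N (r (W x) ?M (n x) \<otimes>\<^bsub>F ?M\<^esub> r (V x \<inter> V z) ?M (c x z)) =
       r ?M N (r (W y) ?M (n y) \<otimes>\<^bsub>F ?M\<^esub> r (V y \<inter> V z) ?M (c y z))"
    proof -
      have "germ T S0 z (?M, Base (r (W x) ?M (n x) \<otimes>\<^bsub>F ?M\<^esub> r (V x \<inter> V z) ?M (c x z)))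
          = germ T S0 z (?M, Base (r (W y) ?M (n y) \<otimes>\<^bsub>F ?M\<^esub> r (V y \<inter> V z) ?M (c y z)))"
        using \<tau>z[OF x _ sub(1,3)] \<tau>z[OF y _ sub(2,4)] z by simp
      then show thesis using that M cM
        by (subst (asm) germ0) auto
    qed
    interpret N: comm_group "F N" using comm_group_sections[OF N(1)] .
    define nx ny cxy cxz cyz where "nx = r (W x) N (n x)" and "ny = r (W y) N (n y)"
      and "cxy = r (V x \<inter> V y) N (c x y)" and "cxz = r (V x \<inter> V z) N (c x z)" and "cyz = r (V y \<inter> V z) N (c y z)"
    have rN: "r ?M N (r (W x) ?M (n x)) = nx" "r ?M N (r (W y) ?M (n y)) = ny"
      "r ?M N (r (V x \<inter> V z) ?M (c x z)) = cxz" "r ?M N (r (V y \<inter> V z) ?M (c y z)) = cyz"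
      unfolding nx_def ny_def cxz_def cyz_def
      using W[OF x] W[OF y] VV c x y zX M(1) N(1,3) sub by (auto intro!: res_res simp del: Int_subset_iff)
    have cN: "nx \<in> carrier (F N)" "ny \<in> carrier (F N)" "cxz \<in> carrier (F N)" "cyz \<in> carrier (F N)" "cxy \<in> carrier (F N)"
      unfolding nx_def ny_def cxz_def cyz_def cxy_def
      using W[OF x] W[OF y] VV c x y zX N(1,3) sub by (auto intro!: hom_in_carrier[OF res_hom])
    have eq1: "nx \<otimes>\<^bsub>F N\<^esub> cxz = ny \<otimes>\<^bsub>F N\<^esub> cyz"
      using N(4) hom_mult[OF res_hom[OF M(1) N(1,3)] cM(1) cM(4)]
        hom_mult[OF res_hom[OF M(1) N(1,3)] cM(2) cM(5)] by (simp add: rN)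
    have eq2: "cxz = cxy \<otimes>\<^bsub>F N\<^esub> cyz"
    proof -
      let ?K = "V x \<inter> V y \<inter> V z"
      have K: "openin T ?K" "N \<subseteq> ?K" using V x y zX N sub by (auto simp del: Int_subset_iff)
      have cK: "r (V x \<inter> V y) ?K (c x y) \<in> carrier (F ?K)" "r (V y \<inter> V z) ?K (c y z) \<in> carrier (F ?K)"
        using VV c x y zX K by (auto intro!: hom_in_carrier[OF res_hom])
      have "cxz = r ?K N (r (V x \<inter> V z) ?K (c x z))"
        unfolding cxz_def using VV c x y zX K N by (intro res_res[symmetric]) auto
      also have "\<dots> = r ?K N (r (V x \<inter> V y) ?K (c x y)) \<otimes>\<^bsub>F N\<^esub> r ?K N (r (V y \<inter> V z) ?K (c y z))"
        unfolding cocycle[OF x y zX] by (rule hom_mult[OF res_hom[OF K(1) N(1) K(2)] cK])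
      also have "r ?K N (r (V x \<inter> V y) ?K (c x y)) = cxy"
        unfolding cxy_def using VV c x y zX K N by (intro res_res) auto
      also have "r ?K N (r (V y \<inter> V z) ?K (c y z)) = cyz"
        unfolding cyz_def using VV c x y zX K N by (intro res_res) auto
      finally show ?thesis .
    qed
    have "nx \<otimes>\<^bsub>F N\<^esub> cxy = ny"
    proof -
      have "(nx \<otimes>\<^bsub>F N\<^esub> cxy) \<otimes>\<^bsub>F N\<^esub> cyz = ny \<otimes>\<^bsub>F N\<^esub> cyz"
        using eq1 eq2 cN by (simp add: N.m_assoc)
      then show ?thesis using cN by (subst (asm) N.right_cancel) auto
    qed
    moreover have "N \<subseteq> ?U" using N M by blast
    moreover have "r ?U N ?a = nx \<otimes>\<^bsub>F N\<^esub> cxy"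
    proof -
      have "r ?U N ?a = r ?U N (r (W x) ?U (n x)) \<otimes>\<^bsub>F N\<^esub> r ?U N (r (V x \<inter> V y) ?U (c x y))"
        by (rule hom_mult[OF res_hom[OF U N(1) \<open>N \<subseteq> ?U\<close>] c1(1) c2])
      also have "r ?U N (r (W x) ?U (n x)) = nx"
        unfolding nx_def using W[OF x] U N(1) \<open>N \<subseteq> ?U\<close> by (intro res_res) auto
      also have "r ?U N (r (V x \<inter> V y) ?U (c x y)) = cxy"
        unfolding cxy_def using W[OF x] W[OF y] U N(1) \<open>N \<subseteq> ?U\<close> VV[OF x y] c[OF x y] by (intro res_res) auto
      finally show ?thesis .
    qed
    moreover have "r ?U N ?b = ny"
      unfolding ny_def using W[OF y] U N(1) \<open>N \<subseteq> ?U\<close> by (intro res_res) auto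
    ultimately show "\<exists>N. openin T N \<and> z \<in> N \<and> N \<subseteq> ?U \<and> r ?U N ?a = r ?U N ?b" using N(1,2) by metis
  qed
  then show ?thesis using W by blast
qed

section \<open>Sheaves of fractions and their syzygies\<close>

locale fraction_sheaf = function_sheaf T \<O>
  for T :: "'p topology" and \<O> :: "'p set \<Rightarrow> ('p \<Rightarrow> 'k::field) set" +
  fixes I :: "nat set" and Ui :: "nat \<Rightarrow> 'p set" and Den :: "nat \<Rightarrow> 'p set \<Rightarrow> ('p \<Rightarrow> 'k) set"
    and chart :: "'p set \<Rightarrow> bool"
  assumes finI: "finite I" and I_ne: "I \<noteq> {}" and Ui_open: "openin T (Ui i)"
    and Den_O: "\<lbrakk>openin T W; i \<in> I; t \<in> Den i W\<rbrakk> \<Longrightarrow> t \<in> \<O> W"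
    and Den_nz: "\<lbrakk>openin T W; i \<in> I; t \<in> Den i W; p \<in> W; p \<in> Ui i\<rbrakk> \<Longrightarrow> t p \<noteq> 0"
    and Den_one: "\<lbrakk>openin T W; i \<in> I\<rbrakk> \<Longrightarrow> fres W (\<lambda>_. 1) \<in> Den i W"
    and Den_mult: "\<lbrakk>openin T W; i \<in> I; t \<in> Den i W; t' \<in> Den i W\<rbrakk> \<Longrightarrow> (\<lambda>p. t p * t' p) \<in> Den i W"
    and Den_res: "\<lbrakk>openin T W; i \<in> I; t \<in> Den i W; openin T W'; W' \<subseteq> W\<rbrakk> \<Longrightarrow> fres W' t \<in> Den i W'"
    and chart_open: "chart B \<Longrightarrow> openin T B"
    and chart_cover: "x \<in> topspace T \<Longrightarrow> \<exists>B. chart B \<and> x \<in> B"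
    and chart_extend: "\<lbrakk>chart B; openin T V; V \<subseteq> B; y \<in> V; f \<in> \<O> V\<rbrakk> \<Longrightarrow>
      \<exists>h\<in>\<O> B. \<exists>g\<in>\<O> B. h y \<noteq> 0 \<and> {p\<in>B. h p \<noteq> 0} \<subseteq> V \<and> (\<forall>p\<in>B. h p \<noteq> 0 \<longrightarrow> h p * f p = g p)"
    and open_nonzero: "\<lbrakk>openin T V; h \<in> \<O> V\<rbrakk> \<Longrightarrow> openin T {p\<in>V. h p \<noteq> 0}"
    and O_inverse: "\<lbrakk>openin T V; h \<in> \<O> V; \<And>p. p \<in> V \<Longrightarrow> h p \<noteq> 0\<rbrakk> \<Longrightarrow> (\<lambda>p. inverse (h p)) \<in> \<O> V"
    and Den_extend: "\<lbrakk>chart B; openin T W; W \<subseteq> B; y \<in> W; i \<in> I; t \<in> Den i W\<rbrakk> \<Longrightarrow>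
      \<exists>t0\<in>Den i B. \<exists>u\<in>\<O> W. \<forall>p\<in>W. t0 p = u p * t p"
begin

section \<open>The localized sheaves and the action of operators on them\<close>

definition Uall :: "'p set" where "Uall = (\<Inter>i\<in>I. Ui i)"

text \<open>A denominator is required near every point of \<open>V\<close>, also near those outside
  \<open>Ui i\<close>. The action of operators and the extension of sections to charts are both
  computed with these denominators.\<close>

definition C :: "nat \<Rightarrow> 'p set \<Rightarrow> ('p \<Rightarrow> 'k) set" where
  "C i V = {f \<in> \<O> (V \<inter> Ui i). \<forall>x\<in>V. \<exists>W. openin T W \<and> x \<in> W \<and> W \<subseteq> V \<and>
     (\<exists>t\<in>Den i W. \<exists>g\<in>\<O> W. \<forall>p\<in>W \<inter> Ui i. f p * t p = g p)}"

lemma VUi: "openin T V \<Longrightarrow> openin T (V \<inter> Ui i)"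
  using Ui_open by blast

lemma Uall_open: "openin T Uall"
  unfolding Uall_def using finI I_ne Ui_open by auto

lemma C_O: "f \<in> C i V \<Longrightarrow> f \<in> \<O> (V \<inter> Ui i)"
  by (simp add: C_def)

lemma C_local_fraction:
  assumes "f \<in> C i V" "x \<in> V"
  obtains W t g where "openin T W" "x \<in> W" "W \<subseteq> V" "t \<in> Den i W" "g \<in> \<O> W"
    "\<And>p. \<lbrakk>p \<in> W; p \<in> Ui i\<rbrakk> \<Longrightarrow> f p * t p = g p"
proof -
  have "\<exists>W. openin T W \<and> x \<in> W \<and> W \<subseteq> V \<and> (\<exists>t\<in>Den i W. \<exists>g\<in>\<O> W. \<forall>p\<in>W \<inter> Ui i. f p * t p = g p)"
    using assms by (simp add: C_def)
  then show thesis by (elim exE conjE bexE) (rule that, assumption+, simp)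
qed

lemma C_I:
  assumes "f \<in> \<O> (V \<inter> Ui i)"
    and "\<And>x. x \<in> V \<Longrightarrow> \<exists>W t g. openin T W \<and> x \<in> W \<and> W \<subseteq> V \<and> t \<in> Den i W \<and> g \<in> \<O> W \<and>
      (\<forall>p\<in>W \<inter> Ui i. f p * t p = g p)"
  shows "f \<in> C i V"
  using assms unfolding C_def by (simp add: Bex_def) 

lemma C_zero: assumes "openin T V" "i \<in> I" shows "(\<lambda>_. 0) \<in> C i V"
proof (rule C_I)
  show "(\<lambda>_. 0) \<in> \<O> (V \<inter> Ui i)" using assms by (intro O_zero VUi)
  fix x assume "x \<in> V"
  then show "\<exists>W t g. openin T W \<and> x \<in> W \<and> W \<subseteq> V \<and> t \<in> Den i W \<and> g \<in> \<O> W \<and>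
      (\<forall>p\<in>W \<inter> Ui i. 0 * t p = g p)"
    using assms by (intro exI[of _ V] exI[of _ "fres V (\<lambda>_. 1)"] exI[of _ "\<lambda>_. 0"]) (auto intro: Den_one O_zero)
qed

lemma C_add: assumes V: "openin T V" "i \<in> I" and f: "f \<in> C i V" and f': "f' \<in> C i V"
  shows "(\<lambda>p. f p + f' p) \<in> C i V"
proof (rule C_I)
  show "(\<lambda>p. f p + f' p) \<in> \<O> (V \<inter> Ui i)" using V f f' by (intro O_add VUi C_O)
  fix x assume x: "x \<in> V"
  obtain W t g where W: "openin T W" "x \<in> W" "W \<subseteq> V" "t \<in> Den i W" "g \<in> \<O> W"
    "\<And>p. \<lbrakk>p \<in> W; p \<in> Ui i\<rbrakk> \<Longrightarrow> f p * t p = g p"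
    by (rule C_local_fraction[OF f x]) (rule that)
  obtain W' t' g' where W': "openin T W'" "x \<in> W'" "W' \<subseteq> V" "t' \<in> Den i W'" "g' \<in> \<O> W'"
    "\<And>p. \<lbrakk>p \<in> W'; p \<in> Ui i\<rbrakk> \<Longrightarrow> f' p * t' p = g' p"
    by (rule C_local_fraction[OF f' x]) (rule that)
  let ?N = "W \<inter> W'"
  have N: "openin T ?N" "?N \<subseteq> W" "?N \<subseteq> W'" using W W' by auto
  have 1: "fres ?N t \<in> Den i ?N" "fres ?N g \<in> \<O> ?N"
    "\<And>p. \<lbrakk>p \<in> ?N; p \<in> Ui i\<rbrakk> \<Longrightarrow> f p * fres ?N t p = fres ?N g p"
    using Den_res[OF W(1) V(2) W(4) N(1) N(2)] O_res[OF W(1) N(1) N(2) W(5)] W(6) by (auto simp: fres_def)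
  have 2: "fres ?N t' \<in> Den i ?N" "fres ?N g' \<in> \<O> ?N"
    "\<And>p. \<lbrakk>p \<in> ?N; p \<in> Ui i\<rbrakk> \<Longrightarrow> f' p * fres ?N t' p = fres ?N g' p"
    using Den_res[OF W'(1) V(2) W'(4) N(1) N(3)] O_res[OF W'(1) N(1) N(3) W'(5)] W'(6) by (auto simp: fres_def)
  let ?t = "\<lambda>p. fres ?N t p * fres ?N t' p"
  let ?g = "\<lambda>p. fres ?N g p * fres ?N t' p + fres ?N g' p * fres ?N t p"
  have "?t \<in> Den i ?N" using N V 1(1) 2(1) by (intro Den_mult)
  moreover have "?g \<in> \<O> ?N" using N(1) Den_O[OF N(1) V(2)] 1(1,2) 2(1,2) by (intro O_add O_mult) auto
  moreover have "(f p + f' p) * ?t p = ?g p" if "p \<in> ?N \<inter> Ui i" for p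
  proof -
    have "f p * fres ?N t p = fres ?N g p" "f' p * fres ?N t' p = fres ?N g' p" using 1(3) 2(3) that by auto
    then show ?thesis by (simp add: algebra_simps flip: \<open>f p * fres ?N t p = fres ?N g p\<close>)
  qed
  ultimately show "\<exists>W t g. openin T W \<and> x \<in> W \<and> W \<subseteq> V \<and> t \<in> Den i W \<and> g \<in> \<O> W \<and>
      (\<forall>p\<in>W \<inter> Ui i. (f p + f' p) * t p = g p)"
    using N W(2,3) W'(2) by (intro exI[of _ ?N] exI[of _ ?t] exI[of _ ?g]) auto
qed

lemma C_scale: assumes V: "openin T V" "i \<in> I" and f: "f \<in> C i V" shows "(\<lambda>p. c * f p) \<in> C i V"
proof (rule C_I)
  show "(\<lambda>p. c * f p) \<in> \<O> (V \<inter> Ui i)" using V f by (intro O_scale VUi C_O)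
  fix x assume x: "x \<in> V"
  obtain W t g where W: "openin T W" "x \<in> W" "W \<subseteq> V" "t \<in> Den i W" "g \<in> \<O> W"
    "\<And>p. \<lbrakk>p \<in> W; p \<in> Ui i\<rbrakk> \<Longrightarrow> f p * t p = g p"
    by (rule C_local_fraction[OF f x]) (rule that)
  then show "\<exists>W t g. openin T W \<and> x \<in> W \<and> W \<subseteq> V \<and> t \<in> Den i W \<and> g \<in> \<O> W \<and>
      (\<forall>p\<in>W \<inter> Ui i. (c * f p) * t p = g p)"
    by (intro exI[of _ W] exI[of _ t] exI[of _ "\<lambda>p. c * g p"]) (auto simp: mult.assoc intro: O_scale)
qed

lemma fres_VUi:
  assumes "openin T V" "f \<in> \<O> (V \<inter> Ui i)" "W \<subseteq> V" shows "fres (W \<inter> Ui i) f = fres W f"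
  using O_outside[OF VUi[OF assms(1)] assms(2)] by (auto simp: fres_def fun_eq_iff)

lemma C_res: assumes V: "openin T V" "i \<in> I" and f: "f \<in> C i V" and V': "openin T V'" "V' \<subseteq> V"
  shows "fres V' f \<in> C i V'"
proof (rule C_I)
  have "fres (V' \<inter> Ui i) f \<in> \<O> (V' \<inter> Ui i)"
    using V f V' by (intro O_res[OF VUi[OF V(1)] VUi[OF V'(1)] _ C_O]) auto
  then show "fres V' f \<in> \<O> (V' \<inter> Ui i)" using fres_VUi[OF V(1) C_O[OF f] V'(2)] by simp
  fix x assume x: "x \<in> V'"
  then have "x \<in> V" using V' by blast
  obtain W t g where W: "openin T W" "x \<in> W" "W \<subseteq> V" "t \<in> Den i W" "g \<in> \<O> W"
    "\<And>p. \<lbrakk>p \<in> W; p \<in> Ui i\<rbrakk> \<Longrightarrow> f p * t p = g p"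
    by (rule C_local_fraction[OF f \<open>x \<in> V\<close>]) (rule that)
  let ?N = "W \<inter> V'"
  have N: "openin T ?N" "?N \<subseteq> W" using W V' by auto
  have 1: "fres ?N t \<in> Den i ?N" "fres ?N g \<in> \<O> ?N"
    "\<And>p. \<lbrakk>p \<in> ?N; p \<in> Ui i\<rbrakk> \<Longrightarrow> f p * fres ?N t p = fres ?N g p"
    using Den_res[OF W(1) V(2) W(4) N(1) N(2)] O_res[OF W(1) N(1) N(2) W(5)] W(6) by (auto simp: fres_def)
  show "\<exists>W t g. openin T W \<and> x \<in> W \<and> W \<subseteq> V' \<and> t \<in> Den i W \<and> g \<in> \<O> W \<and>
      (\<forall>p\<in>W \<inter> Ui i. fres V' f p * t p = g p)"
    using N x W(2) 1 by (intro exI[of _ ?N] exI[of _ "fres ?N t"] exI[of _ "fres ?N g"]) (auto simp: fres_def)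
qed

lemma C_glue:
  assumes V: "openin T V" "i \<in> I" and out: "\<And>p. p \<notin> V \<inter> Ui i \<Longrightarrow> f p = 0"
    and loc: "\<And>x. x \<in> V \<Longrightarrow> \<exists>W. openin T W \<and> x \<in> W \<and> W \<subseteq> V \<and> fres W f \<in> C i W"
  shows "f \<in> C i V"
proof (rule C_I)
  show "f \<in> \<O> (V \<inter> Ui i)"
  proof (rule O_local[OF VUi[OF V(1)] out])
    fix p assume p: "p \<in> V \<inter> Ui i"
    then obtain W where W: "openin T W" "p \<in> W" "W \<subseteq> V" "fres W f \<in> C i W" using loc by blast
    have "fres (W \<inter> Ui i) f = fres W f" using out by (auto simp: fres_def fun_eq_iff)
    then have "fres (W \<inter> Ui i) f \<in> \<O> (W \<inter> Ui i)" using C_O[OF W(4)] by simp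
    then show "\<exists>W. openin T W \<and> p \<in> W \<and> W \<subseteq> V \<inter> Ui i \<and> fres W f \<in> \<O> W"
      using W p VUi by (intro exI[of _ "W \<inter> Ui i"]) auto
  qed
  fix x assume "x \<in> V"
  then obtain V' where V': "openin T V'" "x \<in> V'" "V' \<subseteq> V" "fres V' f \<in> C i V'" using loc by blast
  obtain W t g where W: "openin T W" "x \<in> W" "W \<subseteq> V'" "t \<in> Den i W" "g \<in> \<O> W"
    "\<And>p. \<lbrakk>p \<in> W; p \<in> Ui i\<rbrakk> \<Longrightarrow> fres V' f p * t p = g p"
    by (rule C_local_fraction[OF V'(4,2)]) (rule that)
  have "f p * t p = g p" if "p \<in> W \<inter> Ui i" for p
    using W(3) W(6)[of p] that by (auto simp: fres_def)
  then show "\<exists>W t g. openin T W \<and> x \<in> W \<and> W \<subseteq> V \<and> t \<in> Den i W \<and> g \<in> \<O> W \<and>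
      (\<forall>p\<in>W \<inter> Ui i. f p * t p = g p)"
    using W V' by (intro exI[of _ W] exI[of _ t] exI[of _ g]) auto
qed

text \<open>If \<open>t u = g\<close>, then \<open>t \<phi>(u) = \<phi>(g) - [\<phi>, t](u)\<close>, and the commutator has smaller order.\<close>

lemma diffop_fraction:
  assumes "\<phi> \<in> diffop_lt T \<O> k W" "openin T W" "i \<in> I" "f \<in> \<O> (W \<inter> Ui i)" "t \<in> Den i W" "g \<in> \<O> W"
    "\<And>p. p \<in> W \<inter> Ui i \<Longrightarrow> f p * t p = g p"
  shows "\<exists>t'\<in>Den i W. \<exists>g'\<in>\<O> W. \<forall>p\<in>W \<inter> Ui i. \<phi> (W \<inter> Ui i) f p * t' p = g' p"
  using assms(1)
proof (induction k arbitrary: \<phi>)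
  case 0
  then show ?case using Den_one[OF assms(2,3)] O_zero[OF assms(2)] by (auto intro!: bexI)
next
  case (Suc k)
  let ?U = "W \<inter> Ui i"
  let ?c = "commutator (op_res W \<phi>) (op_scalar T \<O> W t)"
  have U: "openin T ?U" "?U \<subseteq> W" using VUi assms by auto
  have \<phi>: "\<phi> \<in> E W" using Suc.prems by (rule diffop_lt_E)
  have tO: "t \<in> \<O> W" using assms Den_O by blast
  have c: "?c \<in> diffop_lt T \<O> k W" using Suc.prems assms(2) tO by simp
  obtain t1 g1 where 1: "t1 \<in> Den i W" "g1 \<in> \<O> W" "\<And>p. p \<in> ?U \<Longrightarrow> ?c ?U f p * t1 p = g1 p"
    using Suc.IH[OF c] by blast
  have tf: "(\<lambda>p. t p * f p) = fres ?U g"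
    using assms(7) O_outside[OF U(1) assms(4)] by (auto simp: fres_def fun_eq_iff mult.commute)
  have key: "\<phi> ?U f p * t p = \<phi> W g p - ?c ?U f p" if p: "p \<in> ?U" for p
  proof -
    have "?c ?U f p = \<phi> ?U (fres ?U g) p - t p * \<phi> ?U f p"
      using assms(4) U E_in[OF \<phi> U assms(4)] by (simp add: commutator_def op_res_def op_scalar_eq tf)
    also have "\<phi> ?U (fres ?U g) p = \<phi> W g p"
      using E_res[OF \<phi> assms(2) _ U assms(6)] p by (simp add: fres_def)
    finally show ?thesis by (simp add: mult.commute)
  qed
  let ?t = "\<lambda>p. t p * t1 p" and ?g = "\<lambda>p. \<phi> W g p * t1 p - g1 p"
  have "?t \<in> Den i W" using assms 1 by (intro Den_mult)
  moreover have "?g \<in> \<O> W"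
    using assms 1 E_in[OF \<phi> assms(2) _ assms(6)] by (intro O_diff O_mult Den_O[of W i t1]) auto
  moreover have "\<phi> ?U f p * ?t p = ?g p" if "p \<in> ?U" for p
  proof -
    have "\<phi> ?U f p * ?t p = (\<phi> ?U f p * t p) * t1 p" by simp
    also have "\<dots> = \<phi> W g p * t1 p - ?c ?U f p * t1 p" unfolding key[OF that] by (rule left_diff_distrib)
    finally show ?thesis using 1(3)[OF that] by simp
  qed
  ultimately show ?case by (intro bexI[of _ ?t] bexI[of _ ?g]) auto
qed

lemma C_diffop:
  assumes V: "openin T V" "i \<in> I" and f: "f \<in> C i V" and P: "P \<in> diffops T \<O> V"
  shows "P (V \<inter> Ui i) f \<in> C i V"
proof (rule C_I)
  have PE: "P \<in> E V" using P by (rule diffops_E)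
  show "P (V \<inter> Ui i) f \<in> \<O> (V \<inter> Ui i)"
    using V by (intro E_in[OF PE] VUi C_O[OF f]) auto
  fix x assume x: "x \<in> V"
  obtain W t g where W: "openin T W" "x \<in> W" "W \<subseteq> V" "t \<in> Den i W" "g \<in> \<O> W"
    "\<And>p. \<lbrakk>p \<in> W; p \<in> Ui i\<rbrakk> \<Longrightarrow> f p * t p = g p"
    by (rule C_local_fraction[OF f x]) (rule that)
  from diffopsD[OF P x] obtain W' k where W': "openin T W'" "x \<in> W'" "W' \<subseteq> V" "op_res W' P \<in> diffop_lt T \<O> k W'"
    by (elim exE conjE) (rule that)
  let ?N = "W \<inter> W'"
  have N: "openin T ?N" "?N \<subseteq> W" "?N \<subseteq> W'" using W W' by auto
  have NV: "?N \<subseteq> V" "?N \<inter> Ui i \<subseteq> V \<inter> Ui i" using W by auto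
  have 1: "fres ?N t \<in> Den i ?N" "fres ?N g \<in> \<O> ?N"
    "\<And>p. \<lbrakk>p \<in> ?N; p \<in> Ui i\<rbrakk> \<Longrightarrow> f p * fres ?N t p = fres ?N g p"
    using Den_res[OF W(1) V(2) W(4) N(1) N(2)] O_res[OF W(1) N(1) N(2) W(5)] W(6) by (auto simp: fres_def)
  have fN: "fres (?N \<inter> Ui i) f \<in> \<O> (?N \<inter> Ui i)"
    by (rule O_res[OF VUi[OF V(1)] VUi[OF N(1)] NV(2) C_O[OF f]])
  have "op_res ?N (op_res W' P) \<in> diffop_lt T \<O> k ?N" using W'(4) N(3) by (rule diffop_lt_res)
  then have "op_res ?N P \<in> diffop_lt T \<O> k ?N" by (simp add: op_res_op_res)
  from diffop_fraction[OF this N(1) V(2) fN 1(1,2)]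
  have "\<exists>t'\<in>Den i ?N. \<exists>g'\<in>\<O> ?N. \<forall>p\<in>?N \<inter> Ui i. op_res ?N P (?N \<inter> Ui i) (fres (?N \<inter> Ui i) f) p * t' p = g' p"
    using 1(3) by (simp add: fres_def)
  moreover have "op_res ?N P (?N \<inter> Ui i) (fres (?N \<inter> Ui i) f) p = P (V \<inter> Ui i) f p" if "p \<in> ?N \<inter> Ui i" for p
    using E_res[OF PE VUi[OF V(1)] _ VUi[OF N(1)] NV(2) C_O[OF f]] that by (auto simp: op_res_def fres_def)
  ultimately show "\<exists>W t g. openin T W \<and> x \<in> W \<and> W \<subseteq> V \<and> t \<in> Den i W \<and> g \<in> \<O> W \<and>
      (\<forall>p\<in>W \<inter> Ui i. P (V \<inter> Ui i) f p * t p = g p)"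
    using N W(2) W'(2) NV by (intro exI[of _ ?N]) auto
qed

section \<open>The kernel of the sum map\<close>

definition N :: "'p set \<Rightarrow> (nat \<Rightarrow> 'p \<Rightarrow> 'k) set" where
  "N V = {s. (\<forall>i\<in>I. s i \<in> C i V) \<and> (\<forall>i. i \<notin> I \<longrightarrow> s i = (\<lambda>_. 0)) \<and> (\<forall>p\<in>V \<inter> Uall. (\<Sum>i\<in>I. s i p) = 0)}"

definition nres :: "'p set \<Rightarrow> (nat \<Rightarrow> 'p \<Rightarrow> 'k) \<Rightarrow> nat \<Rightarrow> 'p \<Rightarrow> 'k" where
  "nres W s = (\<lambda>i. fres W (s i))"

definition nadd :: "(nat \<Rightarrow> 'p \<Rightarrow> 'k) \<Rightarrow> (nat \<Rightarrow> 'p \<Rightarrow> 'k) \<Rightarrow> nat \<Rightarrow> 'p \<Rightarrow> 'k" where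
  "nadd s t = (\<lambda>i p. s i p + t i p)"

text \<open>A section over \<open>V\<close> of the sheaf of operators contains a map for every
  smaller open set, so it also acts on functions that are defined only on
  \<open>V \<inter> Ui i\<close>.\<close>

definition nact :: "'p set \<Rightarrow> ('p, 'k) oper \<Rightarrow> (nat \<Rightarrow> 'p \<Rightarrow> 'k) \<Rightarrow> nat \<Rightarrow> 'p \<Rightarrow> 'k" where
  "nact V P s = (\<lambda>i. P (V \<inter> Ui i) (s i))"

lemma N_C: "s \<in> N V \<Longrightarrow> i \<in> I \<Longrightarrow> s i \<in> C i V"
  and N_out: "s \<in> N V \<Longrightarrow> i \<notin> I \<Longrightarrow> s i = (\<lambda>_. 0)"
  and N_sum: "s \<in> N V \<Longrightarrow> p \<in> V \<Longrightarrow> p \<in> Uall \<Longrightarrow> (\<Sum>i\<in>I. s i p) = 0"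
  by (auto simp: N_def)

lemma N_I: "\<lbrakk>\<And>i. i \<in> I \<Longrightarrow> s i \<in> C i V; \<And>i. i \<notin> I \<Longrightarrow> s i = (\<lambda>_. 0);
    \<And>p. \<lbrakk>p \<in> V; p \<in> Uall\<rbrakk> \<Longrightarrow> (\<Sum>i\<in>I. s i p) = 0\<rbrakk> \<Longrightarrow> s \<in> N V"
  by (auto simp: N_def)

lemma N_O: assumes "openin T V" "s \<in> N V" shows "s i \<in> \<O> (V \<inter> Ui i)"
proof (cases "i \<in> I")
  case True
  then show ?thesis using C_O N_C assms by blast
next
  case False
  then show ?thesis using N_out[OF assms(2)] O_zero[OF VUi[OF assms(1)]] by simp
qed

lemma N_outside:
  assumes "openin T V" "s \<in> N V" "p \<notin> V \<or> p \<notin> Ui i" shows "s i p = 0"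
  using O_outside[OF VUi[OF assms(1)] N_O[OF assms(1,2)]] assms(3) by blast

lemma N_zero: "openin T V \<Longrightarrow> (\<lambda>_ _. 0) \<in> N V"
  by (rule N_I) (auto intro: C_zero)

lemma N_add: "\<lbrakk>openin T V; s \<in> N V; t \<in> N V\<rbrakk> \<Longrightarrow> nadd s t \<in> N V"
  by (rule N_I) (auto simp: nadd_def N_out N_sum sum.distrib intro: C_add N_C)

lemma N_uminus: "\<lbrakk>openin T V; s \<in> N V\<rbrakk> \<Longrightarrow> (\<lambda>i p. - s i p) \<in> N V"
proof (rule N_I)
  fix i assume "openin T V" "s \<in> N V" "i \<in> I"
  then show "(\<lambda>p. - s i p) \<in> C i V" using C_scale[of V i "s i" "-1"] N_C by simp
qed (auto simp: N_out N_sum sum_negf)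

lemma N_sum_closed: "\<lbrakk>openin T V; \<And>g. g \<in> A \<Longrightarrow> \<phi> g \<in> N V\<rbrakk> \<Longrightarrow> (\<lambda>i p. \<Sum>g\<in>A. \<phi> g i p) \<in> N V"
proof (induction A rule: infinite_finite_induct)
  case (insert x F)
  then show ?case using N_add[of V "\<phi> x" "\<lambda>i p. \<Sum>g\<in>F. \<phi> g i p"] by (simp add: nadd_def)
qed (auto intro: N_zero)

lemma N_res: "\<lbrakk>openin T V; s \<in> N V; openin T W; W \<subseteq> V\<rbrakk> \<Longrightarrow> nres W s \<in> N W"
proof (rule N_I)
  fix i assume "openin T V" "s \<in> N V" "openin T W" "W \<subseteq> V"
  then show "i \<in> I \<Longrightarrow> nres W s i \<in> C i W" unfolding nres_def by (intro C_res[OF _ _ N_C])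
  show "i \<notin> I \<Longrightarrow> nres W s i = (\<lambda>_. 0)" using \<open>s \<in> N V\<close> by (auto simp: nres_def N_out fres_def)
  show "(\<Sum>i\<in>I. nres W s i p) = 0" if "p \<in> W" "p \<in> Uall" for p
    using that \<open>s \<in> N V\<close> \<open>W \<subseteq> V\<close> N_sum[of s V p] by (auto simp: nres_def fres_def)
qed

text \<open>The relation is tested on \<open>V \<inter> Uall\<close>, to which all components
  restrict; there operators commute with restriction and are additive, so they map a vanishing sum
  to a vanishing sum.\<close>

lemma N_act: assumes V: "openin T V" and s: "s \<in> N V" and P: "P \<in> diffops T \<O> V" shows "nact V P s \<in> N V"
proof (rule N_I)
  have PE: "P \<in> E V" using P by (rule diffops_E)
  show "nact V P s i \<in> C i V" if "i \<in> I" for i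
    unfolding nact_def by (rule C_diffop[OF V that N_C[OF s that] P])
  show "i \<notin> I \<Longrightarrow> nact V P s i = (\<lambda>_. 0)" for i
    unfolding nact_def by (simp add: N_out[OF s] E_zero[OF PE])
  fix p assume p: "p \<in> V" "p \<in> Uall"
  let ?U = "V \<inter> Uall"
  have U: "openin T ?U" "?U \<subseteq> V" using V Uall_open by auto
  have sub: "?U \<subseteq> V \<inter> Ui i" if "i \<in> I" for i using that by (auto simp: Uall_def)
  have "(\<Sum>i\<in>I. nact V P s i p) = (\<Sum>i\<in>I. P ?U (fres ?U (s i)) p)"
  proof (rule sum.cong[OF refl])
    fix i assume i: "i \<in> I"
    show "nact V P s i p = P ?U (fres ?U (s i)) p"
      using E_res[OF PE VUi[OF V] Int_lower1 U(1) sub[OF i] N_O[OF V s]] p by (simp add: nact_def fres_def)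
  qed
  also have "\<dots> = P ?U (\<lambda>p. \<Sum>i\<in>I. fres ?U (s i) p) p"
    using E_sum[OF PE U O_res[OF VUi[OF V] U(1) sub N_O[OF V s]], of I] by simp
  also have "(\<lambda>p. \<Sum>i\<in>I. fres ?U (s i) p) = (\<lambda>_. 0)"
  proof
    fix p show "(\<Sum>i\<in>I. fres ?U (s i) p) = 0"
      using N_sum[OF s, of p] by (cases "p \<in> ?U") (auto simp: fres_def)
  qed
  finally show "(\<Sum>i\<in>I. nact V P s i p) = 0" by (simp add: E_zero[OF PE])
qed

lemma nres_act:
  assumes V: "openin T V" and s: "s \<in> N V" and P: "P \<in> diffops T \<O> V" and W: "openin T W" "W \<subseteq> V"
  shows "nres W (nact V P s) = nact W (op_res W P) (nres W s)"
proof
  fix i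
  have PE: "P \<in> E V" using P by (rule diffops_E)
  have sub: "W \<inter> Ui i \<subseteq> V \<inter> Ui i" "V \<inter> Ui i \<subseteq> V" using W by auto
  have "fres W (P (V \<inter> Ui i) (s i)) = fres (W \<inter> Ui i) (P (V \<inter> Ui i) (s i))"
    using fres_VUi[OF V _ W(2)] E_in[OF PE VUi[OF V] sub(2) N_O[OF V s]] by simp
  also have "\<dots> = P (W \<inter> Ui i) (fres (W \<inter> Ui i) (s i))"
    using E_res[OF PE VUi[OF V] sub(2) VUi[OF W(1)] sub(1) N_O[OF V s]] by simp
  also have "fres (W \<inter> Ui i) (s i) = fres W (s i)"
    by (rule fres_VUi[OF V N_O[OF V s] W(2)])
  finally show "nres W (nact V P s) i = nact W (op_res W P) (nres W s) i"
    by (simp add: nres_def nact_def op_res_def)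
qed

lemma nact_scalar:
  assumes "openin T V" "s \<in> N V"
  shows "nact V (op_scalar T \<O> V a) s = (\<lambda>i p. a p * s i p)"
  using VUi[OF assms(1)] N_O[OF assms] by (simp add: nact_def op_scalar_eq)

lemma N_glue:
  assumes op: "\<And>V. V \<in> \<U> \<Longrightarrow> openin T V" and s: "\<And>V. V \<in> \<U> \<Longrightarrow> s V \<in> N V"
    and comp: "\<And>V W. \<lbrakk>V \<in> \<U>; W \<in> \<U>\<rbrakk> \<Longrightarrow> nres (V \<inter> W) (s V) = nres (V \<inter> W) (s W)"
  shows "\<exists>G\<in>N (\<Union>\<U>). \<forall>V\<in>\<U>. nres V G = s V"
proof -
  define G where "G i p = (if \<exists>V\<in>\<U>. p \<in> V then s (SOME V. V \<in> \<U> \<and> p \<in> V) i p else 0)" for i p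
  have G: "G i p = s V i p" if "V \<in> \<U>" "p \<in> V" for V i p
  proof -
    let ?V = "SOME V. V \<in> \<U> \<and> p \<in> V"
    have V: "?V \<in> \<U> \<and> p \<in> ?V" using that by (intro someI[of "\<lambda>V. V \<in> \<U> \<and> p \<in> V" V]) auto
    then have "nres (?V \<inter> V) (s ?V) i p = nres (?V \<inter> V) (s V) i p" using comp that by simp
    then show ?thesis using V that by (auto simp: nres_def fres_def G_def)
  qed
  have G0: "G i p = 0" if "p \<notin> \<Union>\<U>" for i p using that by (auto simp: G_def)
  have res: "nres V G = s V" if "V \<in> \<U>" for V
    using G[OF that] N_outside[OF op[OF that] s[OF that]] by (auto simp: nres_def fres_def fun_eq_iff)
  have "G \<in> N (\<Union>\<U>)"
  proof (rule N_I)
    fix i assume i: "i \<in> I"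
    show "G i \<in> C i (\<Union>\<U>)"
    proof (rule C_glue[OF _ i])
      show "openin T (\<Union>\<U>)" using op by blast
      show "G i p = 0" if "p \<notin> \<Union>\<U> \<inter> Ui i" for p
      proof (cases "p \<in> \<Union>\<U>")
        case True
        then obtain V where "V \<in> \<U>" "p \<in> V" by blast
        then show ?thesis using G N_outside[OF op[of V] s[of V], of p i] that by auto
      qed (rule G0)
      fix x assume "x \<in> \<Union>\<U>"
      then obtain V where V: "V \<in> \<U>" "x \<in> V" by blast
      moreover have "fres V (G i) \<in> C i V" using res[OF V(1)] N_C[OF s[OF V(1)] i] by (metis nres_def)
      ultimately show "\<exists>W. openin T W \<and> x \<in> W \<and> W \<subseteq> \<Union>\<U> \<and> fres W (G i) \<in> C i W"
        using op by (intro exI[of _ V]) auto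
    qed
  next
    fix i assume "i \<notin> I"
    then show "G i = (\<lambda>_. 0)"
      using G G0 N_out[OF s] by (metis UnionE ext)
  next
    fix p assume "p \<in> \<Union>\<U>" "p \<in> Uall"
    then obtain V where V: "V \<in> \<U>" "p \<in> V" by blast
    then show "(\<Sum>i\<in>I. G i p) = 0" using N_sum[OF s[OF V(1)] V(2) \<open>p \<in> Uall\<close>] G by simp
  qed
  then show ?thesis using res by blast
qed

section \<open>Extension of sections to charts\<close>

text \<open>The product of the individual multipliers works for all functions of a finite nonempty
  family at once.\<close>

lemma chart_multiplier:
  assumes B: "chart B" and "finite A" "A \<noteq> {}"
    and "\<And>a. a \<in> A \<Longrightarrow> openin T (V a) \<and> V a \<subseteq> B \<and> y \<in> V a \<and> f a \<in> \<O> (V a)"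
  shows "\<exists>h\<in>\<O> B. h y \<noteq> 0 \<and> (\<forall>a\<in>A. {p\<in>B. h p \<noteq> 0} \<subseteq> V a \<and> (\<exists>g\<in>\<O> B. \<forall>p\<in>B. h p \<noteq> 0 \<longrightarrow> h p * f a p = g p))"
  using assms(2-)
proof (induction A rule: finite_ne_induct)
  case (singleton a)
  then show ?case using chart_extend[OF B, of "V a" y "f a"] by auto
next
  case (insert a A)
  have o: "openin T B" using B by (rule chart_open)
  obtain h where h: "h \<in> \<O> B" "h y \<noteq> 0"
    "\<And>a. a \<in> A \<Longrightarrow> {p\<in>B. h p \<noteq> 0} \<subseteq> V a \<and> (\<exists>g\<in>\<O> B. \<forall>p\<in>B. h p \<noteq> 0 \<longrightarrow> h p * f a p = g p)"
    using insert.IH insert.prems by auto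
  obtain h' g' where h': "h' \<in> \<O> B" "g' \<in> \<O> B" "h' y \<noteq> 0" "{p\<in>B. h' p \<noteq> 0} \<subseteq> V a"
    "\<And>p. \<lbrakk>p \<in> B; h' p \<noteq> 0\<rbrakk> \<Longrightarrow> h' p * f a p = g' p"
    using chart_extend[OF B, of "V a" y "f a"] insert.prems[of a] by auto
  show ?case
  proof (rule bexI[of _ "\<lambda>p. h p * h' p"], intro conjI ballI)
    show "(\<lambda>p. h p * h' p) \<in> \<O> B" using o h h' by (intro O_mult)
    show "h y * h' y \<noteq> 0" using h h' by simp
    fix b assume b: "b \<in> insert a A"
    show "{p\<in>B. h p * h' p \<noteq> 0} \<subseteq> V b" using b h(3) h'(4) by auto
    show "\<exists>g\<in>\<O> B. \<forall>p\<in>B. h p * h' p \<noteq> 0 \<longrightarrow> h p * h' p * f b p = g p"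
    proof (cases "b = a")
      case True
      have "h p * h' p * f b p = h p * g' p" if "p \<in> B" "h p * h' p \<noteq> 0" for p
        using h'(5)[of p] that True by (simp add: mult.assoc)
      then show ?thesis using O_mult[OF o h(1) h'(2)] by (intro bexI[of _ "\<lambda>p. h p * g' p"]) auto
    next
      case False
      then have "\<exists>g\<in>\<O> B. \<forall>p\<in>B. h p \<noteq> 0 \<longrightarrow> h p * f b p = g p" using b h(3) by auto
      then obtain g where g: "g \<in> \<O> B" "\<And>p. \<lbrakk>p \<in> B; h p \<noteq> 0\<rbrakk> \<Longrightarrow> h p * f b p = g p" by blast
      have "h p * h' p * f b p = h' p * g p" if "p \<in> B" "h p * h' p \<noteq> 0" for p
        using g(2)[of p] that by (simp add: mult.left_commute flip: g(2))
      then show ?thesis using O_mult[OF o h'(1) g(1)] by (intro bexI[of _ "\<lambda>p. h' p * g p"]) auto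
    qed
  qed
qed

text \<open>The local denominators are first replaced by denominators over the whole chart, and then
  one multiplier turns all numerators into functions on the chart. This is the substance of
  quasi-coherence.\<close>

lemma N_extend:
  assumes B: "chart B" and V: "openin T V" "V \<subseteq> B" and s: "s \<in> N V" and y: "y \<in> V"
  shows "\<exists>h\<in>\<O> B. \<exists>s'\<in>N B. h y \<noteq> 0 \<and> {p\<in>B. h p \<noteq> 0} \<subseteq> V \<and> (\<forall>i p. p \<in> B \<longrightarrow> h p \<noteq> 0 \<longrightarrow> s' i p = h p * s i p)"
proof -
  have o: "openin T B" using B by (rule chart_open)
  have "\<exists>W t g. openin T W \<and> W \<subseteq> V \<and> y \<in> W \<and> t \<in> Den i B \<and> g \<in> \<O> W \<and> (\<forall>p\<in>W \<inter> Ui i. s i p * t p = g p)"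
    if i: "i \<in> I" for i
  proof -
    obtain W t g where W: "openin T W" "y \<in> W" "W \<subseteq> V" "t \<in> Den i W" "g \<in> \<O> W"
      "\<And>p. \<lbrakk>p \<in> W; p \<in> Ui i\<rbrakk> \<Longrightarrow> s i p * t p = g p"
      by (rule C_local_fraction[OF N_C[OF s i] y]) (rule that)
    have "W \<subseteq> B" using W V by blast
    from Den_extend[OF B W(1) this W(2) i W(4)] obtain t0 u where
      t0: "t0 \<in> Den i B" "u \<in> \<O> W" "\<forall>p\<in>W. t0 p = u p * t p" by (elim bexE) (rule that)
    have "s i p * t0 p = u p * g p" if "p \<in> W \<inter> Ui i" for p
      using t0(3) W(6)[of p] that by (simp add: mult.left_commute)
    then show ?thesis using W t0 O_mult[OF W(1) t0(2) W(5)]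
      by (intro exI[of _ W] exI[of _ t0] exI[of _ "\<lambda>p. u p * g p"]) auto
  qed
  then obtain W t g where W: "\<And>i. i \<in> I \<Longrightarrow> openin T (W i) \<and> W i \<subseteq> V \<and> y \<in> W i \<and> t i \<in> Den i B \<and> g i \<in> \<O> (W i) \<and>
      (\<forall>p\<in>W i \<inter> Ui i. s i p * t i p = g i p)" by metis
  have "\<exists>h\<in>\<O> B. h y \<noteq> 0 \<and> (\<forall>i\<in>I. {p\<in>B. h p \<noteq> 0} \<subseteq> W i \<and> (\<exists>G\<in>\<O> B. \<forall>p\<in>B. h p \<noteq> 0 \<longrightarrow> h p * g i p = G p))"
    by (rule chart_multiplier[OF B finI I_ne]) (use W V in auto)
  then obtain h where h: "h \<in> \<O> B" "h y \<noteq> 0"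
    "\<And>i. i \<in> I \<Longrightarrow> {p\<in>B. h p \<noteq> 0} \<subseteq> W i"
    "\<And>i. i \<in> I \<Longrightarrow> \<exists>G\<in>\<O> B. \<forall>p\<in>B. h p \<noteq> 0 \<longrightarrow> h p * g i p = G p" by auto
  obtain G where G: "\<And>i. i \<in> I \<Longrightarrow> G i \<in> \<O> B \<and> (\<forall>p\<in>B. h p \<noteq> 0 \<longrightarrow> h p * g i p = G i p)" using h(4) by metis
  \<comment> \<open>The multiplier occurs twice: inside \<open>G i\<close> it makes the numerator
    regular on the chart, and the extra factor \<open>h p\<close> makes \<open>s'\<close> vanish
    where \<open>h\<close> does, so that the components also sum to zero there.\<close>
  define s' where "s' i p = (if i \<in> I \<and> p \<in> B \<inter> Ui i then h p * G i p * inverse (t i p) else 0)" for i p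
  have s'_eq: "s' i p = h p * h p * s i p" if p: "p \<in> B" "h p \<noteq> 0" for i p
  proof (cases "i \<in> I \<and> p \<in> Ui i")
    case True
    then have i: "i \<in> I" "p \<in> Ui i" by auto
    have t: "t i p \<noteq> 0" using Den_nz[OF o i(1)] W[OF i(1)] p i by blast
    have "p \<in> W i" using h(3)[OF i(1)] p by blast
    then have "s i p * t i p = g i p" using W[OF i(1)] i by blast
    moreover have "h p * g i p = G i p" using G[OF i(1)] p by blast
    ultimately have "G i p = h p * (s i p * t i p)" by simp
    then show ?thesis using i p t by (simp add: s'_def)
  next
    case False
    then have "s i p = 0" using N_outside[OF V(1) s, of p i] N_out[OF s, of i] by (cases "i \<in> I") auto
    then show ?thesis using False by (auto simp: s'_def)
  qed
  have s'0: "s' i p = 0" if "h p = 0" for i p using that by (simp add: s'_def)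
  have hV: "{p\<in>B. h p \<noteq> 0} \<subseteq> V" using I_ne h(3) W by blast
  have "s' \<in> N B"
  proof (rule N_I)
    show "s' i = (\<lambda>_. 0)" if "i \<notin> I" for i using that by (auto simp: s'_def)
    fix i assume i: "i \<in> I"
    have BU: "openin T (B \<inter> Ui i)" "B \<inter> Ui i \<subseteq> B" using VUi[OF o] by auto
    have t: "t i \<in> \<O> B" "\<And>p. p \<in> B \<inter> Ui i \<Longrightarrow> t i p \<noteq> 0"
      using Den_O[OF o i] Den_nz[OF o i] W[OF i] by auto
    have "(\<lambda>p. inverse (fres (B \<inter> Ui i) (t i) p)) \<in> \<O> (B \<inter> Ui i)"
      using t by (intro O_inverse BU O_res[OF o BU]) (auto simp: fres_def)
    then have "(\<lambda>p. fres (B \<inter> Ui i) (\<lambda>p. h p * G i p) p * inverse (fres (B \<inter> Ui i) (t i) p)) \<in> \<O> (B \<inter> Ui i)"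
      using G[OF i] h(1) o by (intro O_mult BU O_res[OF o BU]) auto
    moreover have "s' i = (\<lambda>p. fres (B \<inter> Ui i) (\<lambda>p. h p * G i p) p * inverse (fres (B \<inter> Ui i) (t i) p))"
      using i by (auto simp: s'_def fres_def)
    ultimately have sO: "s' i \<in> \<O> (B \<inter> Ui i)" by simp
    have "s' i p * t i p = h p * G i p" if "p \<in> B \<inter> Ui i" for p
      using i that t(2)[OF that] by (simp add: s'_def)
    moreover have "(\<lambda>p. h p * G i p) \<in> \<O> B" using G[OF i] h(1) o by (intro O_mult) auto
    ultimately show "s' i \<in> C i B" using sO o W[OF i]
      by (intro C_I exI[of _ B] exI[of _ "t i"] exI[of _ "\<lambda>p. h p * G i p"]) auto
  next
    fix p assume p: "p \<in> B" "p \<in> Uall"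
    show "(\<Sum>i\<in>I. s' i p) = 0"
    proof (cases "h p = 0")
      case False
      then have "(\<Sum>i\<in>I. s i p) = 0" using hV p N_sum[OF s] by blast
      then show ?thesis using s'_eq[OF p(1) False] by (simp flip: sum_distrib_left)
    qed (simp add: s'0)
  qed
  moreover have "(\<lambda>p. h p * h p) \<in> \<O> B" using h(1) o by (intro O_mult)
  ultimately show ?thesis using h(2) hV s'_eq
    by (intro bexI[of _ "\<lambda>p. h p * h p"] bexI[of _ s']) auto
qed

end

text \<open>D-modules must have their sections in a prescribed type, while sections of
  \<open>N\<close> are families of functions. The whole structure is therefore transported along
  maps \<open>enc V\<close> that are injective on the sections over \<open>V\<close>.\<close>

locale encoded_fraction_sheaf = fraction_sheaf +
  fixes enc :: "'a set \<Rightarrow> (nat \<Rightarrow> 'a \<Rightarrow> 'b) \<Rightarrow> 'c"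
  assumes enc_inj: "openin T V \<Longrightarrow> inj_on (enc V) (N V)"
begin

definition dec where "dec V = inv_into (N V) (enc V)"

definition M :: "'a set \<Rightarrow> (('a, 'b) oper, 'c) module" where
  "M V = \<lparr>carrier = enc V ` N V, monoid.mult = (\<lambda>a b. a), one = enc V (\<lambda>_ _. 0),
     zero = enc V (\<lambda>_ _. 0), add = (\<lambda>a b. enc V (nadd (dec V a) (dec V b))),
     smult = (\<lambda>P a. enc V (nact V P (dec V a)))\<rparr>"

definition rr :: "'a set \<Rightarrow> 'a set \<Rightarrow> 'c \<Rightarrow> 'c" where
  "rr V W a = enc W (nres W (dec V a))"

lemma M_simps:
  "carrier (M V) = enc V ` N V" "\<zero>\<^bsub>M V\<^esub> = enc V (\<lambda>_ _. 0)"
  "a \<oplus>\<^bsub>M V\<^esub> b = enc V (nadd (dec V a) (dec V b))" "P \<odot>\<^bsub>M V\<^esub> a = enc V (nact V P (dec V a))"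
  by (simp_all add: M_def)

lemma dec_enc: "\<lbrakk>openin T V; s \<in> N V\<rbrakk> \<Longrightarrow> dec V (enc V s) = s"
  unfolding dec_def by (rule inv_into_f_f[OF enc_inj])

lemma dec_N: "a \<in> carrier (M V) \<Longrightarrow> dec V a \<in> N V"
  unfolding dec_def M_simps by (rule inv_into_into)

lemma enc_dec: "a \<in> carrier (M V) \<Longrightarrow> enc V (dec V a) = a"
  using f_inv_into_f[of a "enc V" "N V"] by (simp add: dec_def M_simps(1))

lemma enc_eq_iff: "\<lbrakk>openin T V; s \<in> N V; t \<in> N V\<rbrakk> \<Longrightarrow> enc V s = enc V t \<longleftrightarrow> s = t"
  using enc_inj by (rule inj_on_eq_iff)

section \<open>The transported sheaf of modules\<close>

lemma comm_group_M: assumes V: "openin T V" shows "comm_group (add_monoid (M V))"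
proof (rule comm_groupI)
  fix a b assume a: "a \<in> carrier (add_monoid (M V))" and b: "b \<in> carrier (add_monoid (M V))"
  then obtain s t where s: "a = enc V s" "s \<in> N V" and t: "b = enc V t" "t \<in> N V" by (auto simp: M_simps)
  show "a \<otimes>\<^bsub>add_monoid (M V)\<^esub> b \<in> carrier (add_monoid (M V))"
    using s t V by (simp add: M_simps dec_enc N_add)
  show "a \<otimes>\<^bsub>add_monoid (M V)\<^esub> b = b \<otimes>\<^bsub>add_monoid (M V)\<^esub> a"
    by (simp add: M_simps nadd_def add.commute)
  show "\<one>\<^bsub>add_monoid (M V)\<^esub> \<otimes>\<^bsub>add_monoid (M V)\<^esub> a = a"
    using s V by (simp add: M_simps dec_enc N_zero nadd_def)
  show "\<exists>y\<in>carrier (add_monoid (M V)). y \<otimes>\<^bsub>add_monoid (M V)\<^esub> a = \<one>\<^bsub>add_monoid (M V)\<^esub>"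
    using s V N_uminus[OF V s(2)]
    by (intro bexI[of _ "enc V (\<lambda>i p. - s i p)"]) (auto simp: M_simps dec_enc nadd_def)
  fix c assume "c \<in> carrier (add_monoid (M V))"
  then obtain u where u: "c = enc V u" "u \<in> N V" by (auto simp: M_simps)
  show "a \<otimes>\<^bsub>add_monoid (M V)\<^esub> b \<otimes>\<^bsub>add_monoid (M V)\<^esub> c = a \<otimes>\<^bsub>add_monoid (M V)\<^esub> (b \<otimes>\<^bsub>add_monoid (M V)\<^esub> c)"
    using s t u V by (simp add: M_simps dec_enc N_add) (simp add: nadd_def add.assoc)
qed (use V in \<open>auto simp: M_simps N_zero\<close>)

lemma abelian_group_M: assumes "openin T V" shows "abelian_group (M V)"
proof -
  interpret G: comm_group "add_monoid (M V)" by (rule comm_group_M[OF assms])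
  show ?thesis
    by (intro abelian_group.intro abelian_monoid.intro abelian_group_axioms.intro) unfold_locales
qed

lemma rr_enc: "\<lbrakk>openin T V; s \<in> N V\<rbrakk> \<Longrightarrow> rr V W (enc V s) = enc W (nres W s)"
  by (simp add: rr_def dec_enc)

lemma nres_nres: "W \<subseteq> V \<Longrightarrow> nres W (nres V s) = nres W s"
  by (simp add: nres_def fres_fres)

lemma nres_self: "\<lbrakk>openin T V; s \<in> N V\<rbrakk> \<Longrightarrow> nres V s = s"
  using N_outside[of V s] by (auto simp: nres_def fres_def fun_eq_iff)

lemma nres_add: "nres W (nadd s t) = nadd (nres W s) (nres W t)"
  by (auto simp: nres_def nadd_def fres_def fun_eq_iff)

lemma sheaf_M: "ab_sheaf T (\<lambda>U. add_monoid (M U)) rr"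
proof (rule ab_sheaf.intro)
  fix U assume "openin T U" then show "comm_group (add_monoid (M U))" by (rule comm_group_M)
next
  fix U V assume UV: "openin T U" "openin T V" "V \<subseteq> U"
  show "rr U V \<in> hom (add_monoid (M U)) (add_monoid (M V))"
    unfolding hom_def using UV by (auto simp: M_simps rr_enc dec_enc N_add N_res nres_add)
next
  fix U s assume "openin T U" "s \<in> carrier (add_monoid (M U))"
  then show "rr U U s = s" by (auto simp: M_simps rr_enc nres_self)
next
  fix U V W s assume "openin T U" "openin T V" "openin T W" "W \<subseteq> V" "V \<subseteq> U" "s \<in> carrier (add_monoid (M U))"
  then show "rr V W (rr U V s) = rr U W s" by (auto simp: M_simps rr_enc N_res nres_nres)
next
  fix \<U> \<sigma>
  assume op: "\<And>V. V \<in> \<U> \<Longrightarrow> openin T V" and \<sigma>: "\<And>V. V \<in> \<U> \<Longrightarrow> \<sigma> V \<in> carrier (add_monoid (M V))"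
    and comp: "\<And>V W. \<lbrakk>V \<in> \<U>; W \<in> \<U>\<rbrakk> \<Longrightarrow> rr V (V \<inter> W) (\<sigma> V) = rr W (V \<inter> W) (\<sigma> W)"
  define s where "s V = dec V (\<sigma> V)" for V
  have s: "s V \<in> N V" "\<sigma> V = enc V (s V)" if "V \<in> \<U>" for V
    using \<sigma>[OF that] by (auto simp: s_def dec_N enc_dec)
  have un: "openin T (\<Union>\<U>)" using op by blast
  have comp': "nres (V \<inter> W) (s V) = nres (V \<inter> W) (s W)" if V: "V \<in> \<U>" and W: "W \<in> \<U>" for V W
  proof -
    have "nres (V \<inter> W) (s V) \<in> N (V \<inter> W)" "nres (V \<inter> W) (s W) \<in> N (V \<inter> W)"
      using N_res[OF op[OF V] s(1)[OF V], of "V \<inter> W"] N_res[OF op[OF W] s(1)[OF W], of "V \<inter> W"] op[OF V] op[OF W] by auto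
    moreover have "enc (V \<inter> W) (nres (V \<inter> W) (s V)) = enc (V \<inter> W) (nres (V \<inter> W) (s W))"
      using comp[OF V W] s[OF V] s[OF W] op V W by (simp add: rr_enc)
    ultimately show ?thesis using enc_eq_iff[of "V \<inter> W"] op[OF V] op[OF W] by blast
  qed
  have "\<exists>G\<in>N (\<Union>\<U>). \<forall>V\<in>\<U>. nres V G = s V" by (rule N_glue[OF op s(1) comp'])
  then obtain G where G: "G \<in> N (\<Union>\<U>)" "\<And>V. V \<in> \<U> \<Longrightarrow> nres V G = s V" by auto
  show "\<exists>!a. a \<in> carrier (add_monoid (M (\<Union>\<U>))) \<and> (\<forall>V\<in>\<U>. rr (\<Union>\<U>) V a = \<sigma> V)"
  proof (rule ex1I[of _ "enc (\<Union>\<U>) G"])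
    show "enc (\<Union>\<U>) G \<in> carrier (add_monoid (M (\<Union>\<U>))) \<and> (\<forall>V\<in>\<U>. rr (\<Union>\<U>) V (enc (\<Union>\<U>) G) = \<sigma> V)"
      using G un s by (auto simp: M_simps rr_enc)
    fix a assume a: "a \<in> carrier (add_monoid (M (\<Union>\<U>))) \<and> (\<forall>V\<in>\<U>. rr (\<Union>\<U>) V a = \<sigma> V)"
    then obtain G' where G': "a = enc (\<Union>\<U>) G'" "G' \<in> N (\<Union>\<U>)" by (auto simp: M_simps)
    have "nres V G' = s V" if V: "V \<in> \<U>" for V
    proof -
      have "enc V (nres V G') = enc V (s V)" using a G' un V s(2)[OF V] by (simp add: rr_enc)
      moreover have "nres V G' \<in> N V" using N_res[OF un G'(2) op[OF V]] V by auto
      ultimately show ?thesis using enc_eq_iff[OF op[OF V]] s(1)[OF V] by blast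
    qed
    then have eq: "fres V (G' i) p = fres V (G i) p" if "V \<in> \<U>" for V i p using G(2)[OF that] that by (metis nres_def)
    have "G' i p = G i p" for i p
    proof (cases "p \<in> \<Union>\<U>")
      case True
      then obtain V where "V \<in> \<U>" "p \<in> V" by blast
      then show ?thesis using eq[of V i p] by (simp add: fres_def)
    next
      case False
      then show ?thesis using N_outside[OF un G(1), of p i] N_outside[OF un G'(2), of p i] by auto
    qed
    then have "G' = G" by blast
    then show "a = enc (\<Union>\<U>) G" using G' by simp
  qed
qed

lemma left_module_M: assumes V: "openin T V" shows "left_module (diff_ring T \<O> V) (M V)"
proof (rule left_module.intro)
  show "ring (diff_ring T \<O> V)" by (rule diff_ring[OF V])
  show "abelian_group (M V)" by (rule abelian_group_M[OF V])
  have R: "carrier (diff_ring T \<O> V) = diffops T \<O> V" by (simp add: diff_ring_def)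
  have VU: "openin T (V \<inter> Ui i)" "V \<inter> Ui i \<subseteq> V" for i using VUi[OF V] by auto
  show "\<one>\<^bsub>diff_ring T \<O> V\<^esub> \<odot>\<^bsub>M V\<^esub> s = s" if sM: "s \<in> carrier (M V)" for s
  proof -
    obtain s' where s: "s = enc V s'" "s' \<in> N V" using sM by (auto simp: M_simps)
    have "nact V (op_ext T \<O> V (\<lambda>V f. f)) s' = s'"
      using VU N_O[OF V s(2)] by (simp add: nact_def op_ext_def)
    then show ?thesis using s V by (simp add: M_simps dec_enc diff_ring_def)
  qed
  fix P s assume P: "P \<in> carrier (diff_ring T \<O> V)" and "s \<in> carrier (M V)"
  then obtain s' where s: "s = enc V s'" "s' \<in> N V" by (auto simp: M_simps)
  have PD: "P \<in> diffops T \<O> V" and PE: "P \<in> E V" using P R diffops_E by auto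
  show "P \<odot>\<^bsub>M V\<^esub> s \<in> carrier (M V)" using s V PD by (simp add: M_simps dec_enc N_act)
  {
    fix Q assume Q: "Q \<in> carrier (diff_ring T \<O> V)"
    then have QD: "Q \<in> diffops T \<O> V" using R by simp
    show "(P \<oplus>\<^bsub>diff_ring T \<O> V\<^esub> Q) \<odot>\<^bsub>M V\<^esub> s = P \<odot>\<^bsub>M V\<^esub> s \<oplus>\<^bsub>M V\<^esub> Q \<odot>\<^bsub>M V\<^esub> s"
      using s V PD QD by (simp add: M_simps dec_enc N_act) (simp add: nact_def nadd_def diff_ring_def)
    show "(P \<otimes>\<^bsub>diff_ring T \<O> V\<^esub> Q) \<odot>\<^bsub>M V\<^esub> s = P \<odot>\<^bsub>M V\<^esub> (Q \<odot>\<^bsub>M V\<^esub> s)"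
      using s V PD QD by (simp add: M_simps dec_enc N_act) (simp add: nact_def diff_ring_def)
  next
    fix t assume "t \<in> carrier (M V)"
    then obtain t' where t: "t = enc V t'" "t' \<in> N V" by (auto simp: M_simps)
    have "nact V P (nadd s' t') = nadd (nact V P s') (nact V P t')"
      unfolding nact_def nadd_def using E_add[OF PE VU N_O[OF V s(2)] N_O[OF V t(2)]] by simp
    then show "P \<odot>\<^bsub>M V\<^esub> (s \<oplus>\<^bsub>M V\<^esub> t) = P \<odot>\<^bsub>M V\<^esub> s \<oplus>\<^bsub>M V\<^esub> P \<odot>\<^bsub>M V\<^esub> t"
      using s t V PD by (simp add: M_simps dec_enc N_act N_add)
  }
qed

lemma finsum_M:
  assumes V: "openin T V" and "finite A" "\<And>g. g \<in> A \<Longrightarrow> \<phi> g \<in> N V"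
  shows "(\<Oplus>\<^bsub>M V\<^esub>g\<in>A. enc V (\<phi> g)) = enc V (\<lambda>i p. \<Sum>g\<in>A. \<phi> g i p)"
  using assms(2,3)
proof (induction A rule: finite_induct)
  interpret M: abelian_group "M V" by (rule abelian_group_M[OF V])
  case empty
  show ?case by (simp add: M_simps)
next
  interpret M: abelian_group "M V" by (rule abelian_group_M[OF V])
  case (insert x F)
  have "(\<Oplus>\<^bsub>M V\<^esub>g\<in>insert x F. enc V (\<phi> g)) = enc V (\<phi> x) \<oplus>\<^bsub>M V\<^esub> (\<Oplus>\<^bsub>M V\<^esub>g\<in>F. enc V (\<phi> g))"
    using insert.hyps insert.prems by (intro M.finsum_insert) (auto simp: M_simps)
  also have "\<dots> = enc V (nadd (\<phi> x) (\<lambda>i p. \<Sum>g\<in>F. \<phi> g i p))"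
    using insert V by (simp add: M_simps(3) dec_enc N_sum_closed)
  finally show ?case using insert.hyps by (simp add: nadd_def)
qed

lemma lincomb_M:
  assumes B: "openin T B" and V: "openin T V" "V \<subseteq> B" and a: "a \<in> free_sections \<O> (carrier (M B)) V"
  shows "lincomb T \<O> M rr B V a = enc V (\<lambda>i p. \<Sum>g\<in>{g. a g \<noteq> (\<lambda>_. 0)}. a g p * dec B g i p)"
    "(\<lambda>i p. \<Sum>g\<in>{g. a g \<noteq> (\<lambda>_. 0)}. a g p * dec B g i p) \<in> N V"
proof -
  let ?A = "{g. a g \<noteq> (\<lambda>_. 0)}"
  have A: "finite ?A" "?A \<subseteq> carrier (M B)" "\<And>g. g \<in> ?A \<Longrightarrow> a g \<in> \<O> V" using a by (auto simp: free_sections_def)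
  have *: "op_scalar T \<O> V (a g) \<odot>\<^bsub>M V\<^esub> rr B V g = enc V (\<lambda>i p. a g p * dec B g i p)"
    "(\<lambda>i p. a g p * dec B g i p) \<in> N V" if g: "g \<in> ?A" for g
  proof -
    have d: "dec B g \<in> N B" using g A dec_N by blast
    then have r: "nres V (dec B g) \<in> N V" using N_res[OF B d V] by blast
    have "nact V (op_scalar T \<O> V (a g)) (nres V (dec B g)) = (\<lambda>i p. a g p * nres V (dec B g) i p)"
      by (rule nact_scalar[OF V(1) r])
    also have "\<dots> = (\<lambda>i p. a g p * dec B g i p)"
      using O_outside[OF V(1) A(3)[OF g]] by (auto simp: nres_def fres_def fun_eq_iff)
    finally have e: "nact V (op_scalar T \<O> V (a g)) (nres V (dec B g)) = (\<lambda>i p. a g p * dec B g i p)" .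
    then show "op_scalar T \<O> V (a g) \<odot>\<^bsub>M V\<^esub> rr B V g = enc V (\<lambda>i p. a g p * dec B g i p)"
      using r V by (simp add: M_simps rr_def dec_enc)
    show "(\<lambda>i p. a g p * dec B g i p) \<in> N V"
      using N_act[OF V(1) r op_scalar_diffops[OF V(1) A(3)[OF g]]] e by simp
  qed
  interpret M: abelian_group "M V" by (rule abelian_group_M[OF V(1)])
  have "lincomb T \<O> M rr B V a = (\<Oplus>\<^bsub>M V\<^esub>g\<in>?A. enc V (\<lambda>i p. a g p * dec B g i p))"
    unfolding lincomb_def by (rule M.finsum_cong') (use * in \<open>auto simp: M_simps(1)\<close>)
  also have "\<dots> = enc V (\<lambda>i p. \<Sum>g\<in>?A. a g p * dec B g i p)"
    by (rule finsum_M[OF V(1) A(1) *(2)])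
  finally show "lincomb T \<O> M rr B V a = enc V (\<lambda>i p. \<Sum>g\<in>?A. a g p * dec B g i p)" .
  show "(\<lambda>i p. \<Sum>g\<in>?A. a g p * dec B g i p) \<in> N V" by (rule N_sum_closed[OF V(1) *(2)])
qed

section \<open>Quasi-coherence\<close>

lemma single_support:
  assumes "u \<noteq> (\<lambda>_. 0 :: 'b)"
  shows "{g. (if g = x then u else (\<lambda>_. 0)) \<noteq> (\<lambda>_. 0)} = {x}"
  using assms by auto

text \<open>By \<open>N_extend\<close> a single generator suffices locally: the extended section
  \<open>s'\<close> with the coefficient \<open>1 / h\<close>.\<close>

lemma generators_M:
  assumes B: "chart B" and V: "openin T V" "V \<subseteq> B" and s: "s \<in> carrier (M V)" and y: "y \<in> V"
  shows "\<exists>W a. openin T W \<and> y \<in> W \<and> W \<subseteq> V \<and> a \<in> free_sections \<O> (carrier (M B)) W \<and>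
           rr V W s = lincomb T \<O> M rr B W a"
proof -
  have o: "openin T B" using B by (rule chart_open)
  have \<sigma>: "dec V s \<in> N V" using s by (rule dec_N)
  obtain h s' where h: "h \<in> \<O> B" "s' \<in> N B" "h y \<noteq> 0" "{p\<in>B. h p \<noteq> 0} \<subseteq> V"
    "\<And>i p. \<lbrakk>p \<in> B; h p \<noteq> 0\<rbrakk> \<Longrightarrow> s' i p = h p * dec V s i p"
    using N_extend[OF B V \<sigma> y] by auto
  let ?W = "{p\<in>B. h p \<noteq> 0}"
  have W: "openin T ?W" "y \<in> ?W" "?W \<subseteq> B" using open_nonzero[OF o h(1)] h(3) y V by auto
  have hW: "(\<lambda>p. inverse (fres ?W h p)) \<in> \<O> ?W"
    using h(1) W by (intro O_inverse O_res[OF o W(1,3)]) (auto simp: fres_def)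
  define a where "a g = (if g = enc B s' then (\<lambda>p. inverse (fres ?W h p)) else (\<lambda>_. 0))" for g
  have nz: "(\<lambda>p. inverse (fres ?W h p)) \<noteq> (\<lambda>_. 0)"
    using W(2) by (auto simp: fun_eq_iff fres_def)
  have supp: "{g. a g \<noteq> (\<lambda>_. 0)} = {enc B s'}" unfolding a_def by (rule single_support[OF nz])
  have a: "a \<in> free_sections \<O> (carrier (M B)) ?W"
    unfolding free_sections_def mem_Collect_eq supp
    using hW h(2) O_zero[OF W(1)] by (auto simp: a_def M_simps)
  have "lincomb T \<O> M rr B ?W a = enc ?W (\<lambda>i p. inverse (fres ?W h p) * s' i p)"
    unfolding lincomb_M(1)[OF o W(1,3) a] supp using h(2) o by (simp add: a_def dec_enc)
  also have "(\<lambda>i p. inverse (fres ?W h p) * s' i p) = nres ?W (dec V s)"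
    using h(5) by (auto simp: nres_def fres_def fun_eq_iff)
  also have "enc ?W (nres ?W (dec V s)) = rr V ?W s" by (simp add: rr_def)
  finally show ?thesis using W h(4) a by (intro exI[of _ ?W] exI[of _ a]) auto
qed

text \<open>The square of a multiplier \<open>h\<close> times the given relation is a relation
  \<open>c\<close> over the whole chart, and the coefficient \<open>1 / h\<^sup>2\<close> recovers
  the original one where \<open>h\<close> is nonzero.\<close>

lemma relations_M:
  assumes B: "chart B" and V: "openin T V" "V \<subseteq> B" and a: "a \<in> free_sections \<O> (carrier (M B)) V"
    and z: "lincomb T \<O> M rr B V a = \<zero>\<^bsub>M V\<^esub>" and y: "y \<in> V"
  defines "R \<equiv> {c \<in> free_sections \<O> (carrier (M B)) B. lincomb T \<O> M rr B B c = \<zero>\<^bsub>M B\<^esub>}"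
  shows "\<exists>W b. openin T W \<and> y \<in> W \<and> W \<subseteq> V \<and> b \<in> free_sections \<O> R W \<and>
           (\<forall>g. fres W (a g) = (\<lambda>p. \<Sum>c\<in>{c. b c \<noteq> (\<lambda>_. 0)}. b c p * c g p))"
proof -
  have o: "openin T B" using B by (rule chart_open)
  let ?A = "{g. a g \<noteq> (\<lambda>_. 0)}"
  have A: "finite ?A" "?A \<subseteq> carrier (M B)" "\<And>g. g \<in> ?A \<Longrightarrow> a g \<in> \<O> V" using a by (auto simp: free_sections_def)
  show ?thesis
  proof (cases "?A = {}")
    case True
    then have "a g = (\<lambda>_. 0)" for g by auto
    then show ?thesis using V y
      by (intro exI[of _ V] exI[of _ "\<lambda>_ _. 0"]) (auto simp: free_sections_def O_zero fres_def)
  next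
    case False
    have "\<exists>h\<in>\<O> B. h y \<noteq> 0 \<and> (\<forall>g\<in>?A. {p\<in>B. h p \<noteq> 0} \<subseteq> V \<and> (\<exists>b\<in>\<O> B. \<forall>p\<in>B. h p \<noteq> 0 \<longrightarrow> h p * a g p = b p))"
      by (rule chart_multiplier[OF B A(1) False]) (use A V y in auto)
    then obtain h where h: "h \<in> \<O> B" "h y \<noteq> 0" "{p\<in>B. h p \<noteq> 0} \<subseteq> V"
      "\<And>g. g \<in> ?A \<Longrightarrow> \<exists>b\<in>\<O> B. \<forall>p\<in>B. h p \<noteq> 0 \<longrightarrow> h p * a g p = b p" using False by auto
    obtain b where b: "\<And>g. g \<in> ?A \<Longrightarrow> b g \<in> \<O> B \<and> (\<forall>p\<in>B. h p \<noteq> 0 \<longrightarrow> h p * a g p = b g p)" using h(4) by metis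
    \<comment> \<open>As for sections, one factor \<open>h\<close> makes the coefficients regular on
      the chart and the other makes them vanish together with \<open>h\<close>, so the relation
      holds everywhere.\<close>
    define c where "c g = (if g \<in> ?A then (\<lambda>p. h p * b g p) else (\<lambda>_. 0))" for g
    have c_eq: "c g p = h p * h p * a g p" if "p \<in> B" "h p \<noteq> 0" for g p
    proof (cases "g \<in> ?A")
      case True
      then have "b g p = h p * a g p" using b that by simp
      then show ?thesis using True by (simp add: c_def)
    next
      case False
      then have "a g p = 0" by auto
      then show ?thesis unfolding c_def using False by simp
    qed
    have c0: "c g p = 0" if "h p = 0 \<or> p \<notin> B" for g p
      using that O_outside[OF o h(1), of p] by (auto simp: c_def)
    have csupp: "{g. c g \<noteq> (\<lambda>_. 0)} \<subseteq> ?A" by (auto simp: c_def)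
    have cO: "c g \<in> \<O> B" for g using O_mult[OF o h(1)] b[of g] O_zero[OF o] by (auto simp: c_def)
    have cf: "c \<in> free_sections \<O> (carrier (M B)) B"
      unfolding free_sections_def mem_Collect_eq using cO csupp A(1,2) finite_subset by blast
    have rel: "(\<Sum>g\<in>?A. a g p * dec B g i p) = 0" for i p
    proof -
      have "enc V (\<lambda>i p. \<Sum>g\<in>?A. a g p * dec B g i p) = enc V (\<lambda>_ _. 0)"
        using z lincomb_M(1)[OF o V a] by (simp add: M_simps)
      then have "(\<lambda>i p. \<Sum>g\<in>?A. a g p * dec B g i p) = (\<lambda>_ _. 0)"
        using enc_eq_iff[OF V(1) lincomb_M(2)[OF o V a] N_zero[OF V(1)]] by simp
      then show ?thesis by meson
    qed
    have "(\<Sum>g\<in>{g. c g \<noteq> (\<lambda>_. 0)}. c g p * dec B g i p) = 0" for i p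
    proof (cases "h p = 0 \<or> p \<notin> B")
      case True
      then show ?thesis using c0 by simp
    next
      case F: False
      have "(\<Sum>g\<in>{g. c g \<noteq> (\<lambda>_. 0)}. c g p * dec B g i p) = (\<Sum>g\<in>?A. c g p * dec B g i p)"
        using A(1) csupp by (intro sum.mono_neutral_left) auto
      also have "\<dots> = h p * h p * (\<Sum>g\<in>?A. a g p * dec B g i p)"
        using F c_eq by (simp add: sum_distrib_left mult.assoc)
      finally show ?thesis using rel by simp
    qed
    then have "lincomb T \<O> M rr B B c = \<zero>\<^bsub>M B\<^esub>"
      unfolding lincomb_M(1)[OF o o order_refl cf] M_simps by simp
    then have cR: "c \<in> R" using cf by (simp add: R_def)
    let ?W = "{p\<in>B. h p \<noteq> 0}"
    have W: "openin T ?W" "y \<in> ?W" "?W \<subseteq> B" using open_nonzero[OF o h(1)] h(2) y V by auto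
    let ?u = "\<lambda>p. inverse (fres ?W h p) * inverse (fres ?W h p)"
    have "(\<lambda>p. inverse (fres ?W h p)) \<in> \<O> ?W"
      using h(1) W by (intro O_inverse O_res[OF o W(1,3)]) (auto simp: fres_def)
    then have u: "?u \<in> \<O> ?W" using W(1) by (intro O_mult)
    have nz: "?u \<noteq> (\<lambda>_. 0)"
      using W(2) by (auto simp: fun_eq_iff fres_def)
    define d where "d c' = (if c' = c then ?u else (\<lambda>_. 0))" for c'
    have supp: "{c'. d c' \<noteq> (\<lambda>_. 0)} = {c}" unfolding d_def by (rule single_support[OF nz])
    have d: "d \<in> free_sections \<O> R ?W"
      unfolding free_sections_def mem_Collect_eq supp
      using u cR O_zero[OF W(1)] by (auto simp: d_def)
    have "inverse (h p) * inverse (h p) * c g p = a g p" if "p \<in> B" "h p \<noteq> 0" for g p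
      using c_eq[OF that, of g] that(2) by (simp add: field_simps)
    then have "fres ?W (a g) = (\<lambda>p. \<Sum>c'\<in>{c'. d c' \<noteq> (\<lambda>_. 0)}. d c' p * c' g p)" for g
      unfolding supp by (auto simp: d_def fres_def fun_eq_iff)
    then show ?thesis using W h(3) d by (intro exI[of _ ?W] exI[of _ d]) auto
  qed
qed

text \<open>The presentation over a chart takes all sections as generators and all relations among
  them, so exactness reduces to local existence, given by \<open>generators_M\<close> and
  \<open>relations_M\<close>.\<close>

lemma D_module_M: "D_module T \<O> M rr"
proof (rule D_module.intro)
  show "ab_sheaf T (\<lambda>U. add_monoid (M U)) rr" by (rule sheaf_M)
  show "left_module (diff_ring T \<O> U) (M U)" if "openin T U" for U by (rule left_module_M[OF that])
  fix U V P s assume UV: "openin T U" "openin T V" "V \<subseteq> U" and P: "P \<in> diffops T \<O> U" and s: "s \<in> carrier (M U)"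
  have d: "dec U s \<in> N U" using s by (rule dec_N)
  show "rr U V (P \<odot>\<^bsub>M U\<^esub> s) = op_res V P \<odot>\<^bsub>M V\<^esub> rr U V s"
    using UV P d by (simp add: M_simps rr_def dec_enc N_act N_res nres_act)
next
  show "quasi_coherent T \<O> M rr"
    unfolding quasi_coherent_def
  proof
    fix x assume "x \<in> topspace T"
    then obtain B where B: "chart B" "x \<in> B" using chart_cover by blast
    let ?R = "{c \<in> free_sections \<O> (carrier (M B)) B. lincomb T \<O> M rr B B c = \<zero>\<^bsub>M B\<^esub>}"
    show "\<exists>U. openin T U \<and> x \<in> U \<and> (\<exists>S R. S \<subseteq> carrier (M U) \<and> R \<subseteq> free_sections \<O> S U \<and>
          (\<forall>c\<in>R. lincomb T \<O> M rr U U c = \<zero>\<^bsub>M U\<^esub>) \<and>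
          (\<forall>V s y. openin T V \<and> V \<subseteq> U \<and> s \<in> carrier (M V) \<and> y \<in> V \<longrightarrow>
             (\<exists>W a. openin T W \<and> y \<in> W \<and> W \<subseteq> V \<and> a \<in> free_sections \<O> S W \<and>
                rr V W s = lincomb T \<O> M rr U W a)) \<and>
          (\<forall>V a y. openin T V \<and> V \<subseteq> U \<and> a \<in> free_sections \<O> S V \<and>
                   lincomb T \<O> M rr U V a = \<zero>\<^bsub>M V\<^esub> \<and> y \<in> V \<longrightarrow>
             (\<exists>W b. openin T W \<and> y \<in> W \<and> W \<subseteq> V \<and> b \<in> free_sections \<O> R W \<and>
                (\<forall>g. fres W (a g) = (\<lambda>p. \<Sum>c\<in>{c. b c \<noteq> (\<lambda>_. 0)}. b c p * c g p)))))"
    proof (rule exI[of _ B], intro conjI, rule chart_open[OF B(1)], rule B(2),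
        rule exI[of _ "carrier (M B)"], rule exI[of _ ?R], intro conjI allI impI ballI)
      fix V s y assume "openin T V \<and> V \<subseteq> B \<and> s \<in> carrier (M V) \<and> y \<in> V"
      then show "\<exists>W a. openin T W \<and> y \<in> W \<and> W \<subseteq> V \<and> a \<in> free_sections \<O> (carrier (M B)) W \<and>
                rr V W s = lincomb T \<O> M rr B W a"
        by (elim conjE) (rule generators_M[OF B(1)])
    next
      fix V a y assume "openin T V \<and> V \<subseteq> B \<and> a \<in> free_sections \<O> (carrier (M B)) V \<and>
                   lincomb T \<O> M rr B V a = \<zero>\<^bsub>M V\<^esub> \<and> y \<in> V"
      then show "\<exists>W b. openin T W \<and> y \<in> W \<and> W \<subseteq> V \<and> b \<in> free_sections \<O> ?R W \<and>
                (\<forall>g. fres W (a g) = (\<lambda>p. \<Sum>c\<in>{c. b c \<noteq> (\<lambda>_. 0)}. b c p * c g p))"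
        by (elim conjE) (rule relations_M[OF B(1)])
    qed auto
  qed
qed

text \<open>This is the connecting homomorphism made explicit. Local decompositions of
  \<open>F\<close> differ on overlaps by sections of the kernel \<open>N\<close>; these form a
  cocycle, and the sections that split it correct the decompositions so that they agree.\<close>

lemma lift_global:
  assumes H1: "trivial_group (cohomology T (\<lambda>U. add_monoid (M U)) rr 1)"
    and loc: "\<And>x. x \<in> topspace T \<Longrightarrow> \<exists>V s. openin T V \<and> x \<in> V \<and> (\<forall>i\<in>I. s i \<in> C i V) \<and>
      (\<forall>p\<in>V \<inter> Uall. (\<Sum>i\<in>I. s i p) = F p)"
  shows "\<exists>G. (\<forall>i\<in>I. G i \<in> C i (topspace T)) \<and> (\<forall>p\<in>topspace T \<inter> Uall. (\<Sum>i\<in>I. G i p) = F p)"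
proof -
  interpret ab_sheaf T "\<lambda>U. add_monoid (M U)" rr by (rule sheaf_M)
  let ?X = "topspace T"
  obtain V s0 where s0: "\<And>x. x \<in> ?X \<Longrightarrow> openin T (V x) \<and> x \<in> V x \<and> (\<forall>i\<in>I. s0 x i \<in> C i (V x)) \<and>
      (\<forall>p\<in>V x \<inter> Uall. (\<Sum>i\<in>I. s0 x i p) = F p)"
    using loc by metis
  define s where "s x i = (if i \<in> I then s0 x i else (\<lambda>_. 0))" for x i
  have V: "openin T (V x)" "x \<in> V x" if "x \<in> ?X" for x using s0[OF that] by auto
  have s: "s x i \<in> C i (V x)" if "x \<in> ?X" "i \<in> I" for x i using s0[OF that(1)] that(2) by (simp add: s_def)
  have s_sum: "(\<Sum>i\<in>I. s x i p) = F p" if "x \<in> ?X" "p \<in> V x" "p \<in> Uall" for x p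
    using s0[OF that(1)] that by (simp add: s_def)
  define c0 where "c0 x y = (\<lambda>i p. fres (V x \<inter> V y) (s x i) p + (- 1) * fres (V x \<inter> V y) (s y i) p)" for x y
  have VV: "openin T (V x \<inter> V y)" if "x \<in> ?X" "y \<in> ?X" for x y using V that by blast
  have c0: "c0 x y \<in> N (V x \<inter> V y)" if x: "x \<in> ?X" and y: "y \<in> ?X" for x y
  proof (rule N_I)
    fix i assume i: "i \<in> I"
    show "c0 x y i \<in> C i (V x \<inter> V y)"
      unfolding c0_def
      by (rule C_add[OF VV[OF x y] i C_res[OF V(1)[OF x] i s[OF x i] VV[OF x y] Int_lower1]
            C_scale[OF VV[OF x y] i C_res[OF V(1)[OF y] i s[OF y i] VV[OF x y] Int_lower2]]])
  next
    show "c0 x y i = (\<lambda>_. 0)" if "i \<notin> I" for i using that by (simp add: c0_def s_def fres_def)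
  next
    fix p assume p: "p \<in> V x \<inter> V y" "p \<in> Uall"
    then have "(\<Sum>i\<in>I. s x i p) = (\<Sum>i\<in>I. s y i p)" using s_sum[OF x] s_sum[OF y] by simp
    then show "(\<Sum>i\<in>I. c0 x y i p) = 0" using p by (simp add: c0_def fres_def sum_subtractf)
  qed
  define c where "c x y = enc (V x \<inter> V y) (c0 x y)" for x y
  have "\<exists>W n. (\<forall>x\<in>?X. openin T (W x) \<and> x \<in> W x \<and> W x \<subseteq> V x \<and> n x \<in> carrier (add_monoid (M (W x)))) \<and>
    (\<forall>x\<in>?X. \<forall>y\<in>?X. rr (W x) (W x \<inter> W y) (n x) \<otimes>\<^bsub>add_monoid (M (W x \<inter> W y))\<^esub> rr (V x \<inter> V y) (W x \<inter> W y) (c x y)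
       = rr (W y) (W x \<inter> W y) (n y))"
  proof (rule cocycle_splits[OF H1])
    show "openin T (V x) \<and> x \<in> V x" if "x \<in> ?X" for x using V[OF that] by blast
    show "c x y \<in> carrier (add_monoid (M (V x \<inter> V y)))" if "x \<in> ?X" "y \<in> ?X" for x y
      using c0[OF that] by (simp add: c_def M_simps)
    fix x y z assume x: "x \<in> ?X" and y: "y \<in> ?X" and z: "z \<in> ?X"
    let ?U = "V x \<inter> V y \<inter> V z"
    have U: "openin T ?U" using V x y z by blast
    have N: "nres ?U (c0 x y) \<in> N ?U" "nres ?U (c0 y z) \<in> N ?U"
      using N_res[OF VV[OF x y] c0[OF x y] U] N_res[OF VV[OF y z] c0[OF y z] U] by auto
    have "nres ?U (c0 x z) = nadd (nres ?U (c0 x y)) (nres ?U (c0 y z))"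
      by (auto simp: nres_def nadd_def c0_def fres_def fun_eq_iff)
    then show "rr (V x \<inter> V z) ?U (c x z) =
       rr (V x \<inter> V y) ?U (c x y) \<otimes>\<^bsub>add_monoid (M ?U)\<^esub> rr (V y \<inter> V z) ?U (c y z)"
      using N U by (simp add: c_def rr_enc VV c0 x y z M_simps dec_enc)
  qed
  then obtain W n where
    Wn: "\<forall>x\<in>?X. openin T (W x) \<and> x \<in> W x \<and> W x \<subseteq> V x \<and> n x \<in> carrier (add_monoid (M (W x)))"
      "\<forall>x\<in>?X. \<forall>y\<in>?X. rr (W x) (W x \<inter> W y) (n x) \<otimes>\<^bsub>add_monoid (M (W x \<inter> W y))\<^esub> rr (V x \<inter> V y) (W x \<inter> W y) (c x y)
       = rr (W y) (W x \<inter> W y) (n y)"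
    by (elim exE conjE) (rule that)
  have W: "openin T (W x) \<and> x \<in> W x \<and> W x \<subseteq> V x \<and> n x \<in> carrier (M (W x))" if "x \<in> ?X" for x
    using Wn(1) that by simp
  have eq: "rr (W x) (W x \<inter> W y) (n x) \<oplus>\<^bsub>M (W x \<inter> W y)\<^esub> rr (V x \<inter> V y) (W x \<inter> W y) (c x y)
       = rr (W y) (W x \<inter> W y) (n y)" if "x \<in> ?X" "y \<in> ?X" for x y
    using Wn(2) that by simp
  define \<nu> where "\<nu> x = dec (W x) (n x)" for x
  have \<nu>: "\<nu> x \<in> N (W x)" "n x = enc (W x) (\<nu> x)" if "x \<in> ?X" for x
    using W[OF that] by (simp_all add: \<nu>_def dec_N enc_dec)
  have agree: "\<nu> x i p + s x i p = \<nu> y i p + s y i p" if x: "x \<in> ?X" and y: "y \<in> ?X" and p: "p \<in> W x \<inter> W y" for x y i p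
  proof -
    let ?U = "W x \<inter> W y"
    have U: "openin T ?U" "?U \<subseteq> V x \<inter> V y" "openin T (W x)" "openin T (W y)" using W[OF x] W[OF y] by auto
    have N: "nres ?U (\<nu> x) \<in> N ?U" "nres ?U (\<nu> y) \<in> N ?U" "nres ?U (c0 x y) \<in> N ?U"
      using N_res[OF U(3) \<nu>(1)[OF x] U(1)] N_res[OF U(4) \<nu>(1)[OF y] U(1)] N_res[OF VV[OF x y] c0[OF x y] U(1,2)] by auto
    have "enc ?U (nadd (nres ?U (\<nu> x)) (nres ?U (c0 x y))) = enc ?U (nres ?U (\<nu> y))"
      using eq[OF x y] N U \<nu>[OF x] \<nu>[OF y] by (simp add: c_def rr_enc VV c0 x y M_simps dec_enc)
    then have "nadd (nres ?U (\<nu> x)) (nres ?U (c0 x y)) = nres ?U (\<nu> y)"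
      using enc_eq_iff[OF U(1) N_add[OF U(1) N(1,3)] N(2)] by simp
    then have "nadd (nres ?U (\<nu> x)) (nres ?U (c0 x y)) i p = nres ?U (\<nu> y) i p" by simp
    moreover have "p \<in> V x" "p \<in> V y" using p U(2) by auto
    ultimately show ?thesis using p by (simp add: nadd_def nres_def c0_def fres_def algebra_simps)
  qed
  \<comment> \<open>At each point the corrected decomposition belonging to that very point is
    evaluated; by \<open>agree\<close> every other admissible choice gives the same value.\<close>
  define G where "G i p = (if p \<in> ?X then \<nu> p i p + s p i p else 0)" for i p
  have G: "G i p = \<nu> x i p + s x i p" if "x \<in> ?X" "p \<in> W x" for i p x
  proof -
    have "p \<in> ?X" using that W openin_subset by blast
    then show ?thesis using agree[OF _ that(1), of p p i] W that by (simp add: G_def)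
  qed
  have GC: "G i \<in> C i ?X" if i: "i \<in> I" for i
  proof (rule C_glue[OF openin_topspace i])
    fix p assume p: "p \<notin> ?X \<inter> Ui i"
    show "G i p = 0"
    proof (cases "p \<in> ?X")
      case True
      then have "p \<notin> Ui i" using p by blast
      then show ?thesis
        using N_outside[of "W p" "\<nu> p" p i] W[OF True] \<nu>(1)[OF True]
          O_outside[OF VUi[OF V(1)[OF True]] C_O[OF s[OF True i]], of p] by (simp add: G_def)
    qed (simp add: G_def)
  next
    fix x assume x: "x \<in> ?X"
    have Wx: "openin T (W x)" "x \<in> W x" "W x \<subseteq> V x" using W[OF x] by auto
    have "(\<lambda>p. \<nu> x i p + fres (W x) (s x i) p) \<in> C i (W x)"
      by (rule C_add[OF Wx(1) i N_C[OF \<nu>(1)[OF x] i] C_res[OF V(1)[OF x] i s[OF x i] Wx(1,3)]])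
    moreover have "fres (W x) (G i) = (\<lambda>p. \<nu> x i p + fres (W x) (s x i) p)"
      using G[OF x] N_outside[OF Wx(1) \<nu>(1)[OF x]] by (auto simp: fres_def fun_eq_iff)
    ultimately show "\<exists>W. openin T W \<and> x \<in> W \<and> W \<subseteq> ?X \<and> fres W (G i) \<in> C i W"
      using Wx openin_subset by (intro exI[of _ "W x"]) auto
  qed
  have "(\<Sum>i\<in>I. G i p) = F p" if "p \<in> ?X \<inter> Uall" for p
  proof -
    have p: "p \<in> ?X" "p \<in> Uall" using that by auto
    have "(\<Sum>i\<in>I. G i p) = (\<Sum>i\<in>I. \<nu> p i p) + (\<Sum>i\<in>I. s p i p)" using p by (simp add: G_def sum.distrib)
    then show ?thesis using N_sum[OF \<nu>(1)[OF p(1)], of p] s_sum[OF p(1) _ p(2)] W[OF p(1)] p V(2)[OF p(1)] by simp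
  qed
  then show ?thesis using GC by blast
qed

end

section \<open>Projective sets\<close>

abbreviation hmonom :: "nat \<Rightarrow> (nat \<Rightarrow> nat) \<Rightarrow> (nat \<Rightarrow> 'k::field) \<Rightarrow> 'k" where
  "hmonom n \<alpha> v \<equiv> \<Prod>i\<le>n. v i ^ \<alpha> i"

lemma homogeneous_polys_lspan:
  "homogeneous_polys n d = lspan (hmonom n) {\<alpha>. (\<Sum>i\<le>n. \<alpha> i) = d} UNIV"
  unfolding homogeneous_polys_def lspan_def by (auto simp: fun_eq_iff subset_eq; metis)

section \<open>Closure properties of homogeneous polynomials\<close>

lemma hom_add: "\<lbrakk>f \<in> homogeneous_polys n d; g \<in> homogeneous_polys n d\<rbrakk>
    \<Longrightarrow> (\<lambda>v. f v + g v) \<in> homogeneous_polys n d"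
  unfolding homogeneous_polys_lspan by (rule lspan_add)

lemma hom_scale: "f \<in> homogeneous_polys n d \<Longrightarrow> (\<lambda>v. c * f v) \<in> homogeneous_polys n d"
  unfolding homogeneous_polys_lspan by (rule lspan_scale)

lemma hom_sum: "(\<And>i. i \<in> A \<Longrightarrow> f i \<in> homogeneous_polys n d) \<Longrightarrow> (\<lambda>v. \<Sum>i\<in>A. f i v) \<in> homogeneous_polys n d"
  unfolding homogeneous_polys_lspan by (rule lspan_sum)

lemma hom_const: "(\<lambda>_. c) \<in> homogeneous_polys n 0"
  using lspan_base[of "\<lambda>_. 0" "{\<alpha>. (\<Sum>i\<le>n. \<alpha> i) = 0}" c "hmonom n" UNIV]
  by (simp add: homogeneous_polys_lspan)

lemma hom_coord:
  assumes i: "i \<le> n" shows "(\<lambda>v :: nat \<Rightarrow> 'k::field. v i) \<in> homogeneous_polys n 1"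
proof -
  define \<alpha> where "\<alpha> j = (if j = i then 1 else 0::nat)" for j
  have "(\<lambda>v :: nat \<Rightarrow> 'k. 1 * hmonom n \<alpha> v) \<in> homogeneous_polys n 1"
    unfolding homogeneous_polys_lspan using i by (intro lspan_base) (auto simp: \<alpha>_def)
  moreover have "1 * hmonom n \<alpha> v = v i" for v :: "nat \<Rightarrow> 'k"
  proof -
    have "hmonom n \<alpha> v = (\<Prod>j\<le>n. if j = i then v i else 1)" by (intro prod.cong) (auto simp: \<alpha>_def)
    then show ?thesis using i by simp
  qed
  ultimately show ?thesis by (simp only:)
qed

lemma hom_mult:
  assumes "f \<in> homogeneous_polys n d" "g \<in> homogeneous_polys n e"
  shows "(\<lambda>v. f v * g v) \<in> homogeneous_polys n (d + e)"
proof -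
  obtain A c where A: "finite A" "A \<subseteq> {\<alpha>. (\<Sum>i\<le>n. \<alpha> i) = d}"
    "\<And>v. v \<in> UNIV \<Longrightarrow> f v = (\<Sum>\<alpha>\<in>A. c \<alpha> * hmonom n \<alpha> v)"
    by (rule lspanE[OF assms(1)[unfolded homogeneous_polys_lspan]]) (rule that)
  obtain B b where B: "finite B" "B \<subseteq> {\<alpha>. (\<Sum>i\<le>n. \<alpha> i) = e}"
    "\<And>v. v \<in> UNIV \<Longrightarrow> g v = (\<Sum>\<alpha>\<in>B. b \<alpha> * hmonom n \<alpha> v)"
    by (rule lspanE[OF assms(2)[unfolded homogeneous_polys_lspan]]) (rule that)
  have "(\<lambda>v. \<Sum>\<alpha>\<in>A. \<Sum>\<beta>\<in>B. (c \<alpha> * b \<beta>) * hmonom n (\<lambda>i. \<alpha> i + \<beta> i) v) \<in> homogeneous_polys n (d + e)"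
    unfolding homogeneous_polys_lspan
    using A(2) B(2) by (intro lspan_sum lspan_base) (auto simp: sum.distrib)
  moreover have "f v * g v = (\<Sum>\<alpha>\<in>A. \<Sum>\<beta>\<in>B. (c \<alpha> * b \<beta>) * hmonom n (\<lambda>i. \<alpha> i + \<beta> i) v)" for v
    unfolding A(3)[OF UNIV_I] B(3)[OF UNIV_I] sum_product
    by (intro sum.cong refl) (simp add: power_add prod.distrib mult_ac)
  ultimately show ?thesis by presburger
qed

lemma hom_power: "f \<in> homogeneous_polys n d \<Longrightarrow> (\<lambda>v. f v ^ k) \<in> homogeneous_polys n (d * k)"
proof (induction k)
  case 0
  then show ?case using hom_const[of 1] by simp
next
  case (Suc k)
  then show ?case using hom_mult[of f n d "\<lambda>v. f v ^ k" "d * k"] by simp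
qed

lemma hom_prod: "\<lbrakk>finite A; \<And>i. i \<in> A \<Longrightarrow> f i \<in> homogeneous_polys n 1\<rbrakk>
    \<Longrightarrow> (\<lambda>v. \<Prod>i\<in>A. f i v) \<in> homogeneous_polys n (card A)"
proof (induction A rule: finite_induct)
  case empty
  then show ?case using hom_const[of 1] by simp
next
  case (insert x F)
  then show ?case using hom_mult[of "f x" n 1 "\<lambda>v. \<Prod>i\<in>F. f i v" "card F"] by simp
qed

lemma hom_homogeneous:
  assumes "f \<in> homogeneous_polys n d" shows "f (\<lambda>i. c * v i) = c ^ d * f v"
proof -
  obtain A b where A: "finite A" "A \<subseteq> {\<alpha>. (\<Sum>i\<le>n. \<alpha> i) = d}"
    "\<And>v. v \<in> UNIV \<Longrightarrow> f v = (\<Sum>\<alpha>\<in>A. b \<alpha> * hmonom n \<alpha> v)"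
    by (rule lspanE[OF assms[unfolded homogeneous_polys_lspan]]) (rule that)
  have "hmonom n \<alpha> (\<lambda>i. c * v i) = c ^ d * hmonom n \<alpha> v" if "\<alpha> \<in> A" for \<alpha>
    using A(2) that by (auto simp: power_mult_distrib prod.distrib simp flip: power_sum)
  then show ?thesis by (simp add: A(3) sum_distrib_left mult.left_commute)
qed

lemma hom_polyfun: "f \<in> homogeneous_polys n d \<Longrightarrow> f \<in> polyfun"
  unfolding homogeneous_polys_def by (auto intro!: polyfun_sum polyfun.mult polyfun_prod polyfun_power)

section \<open>Points and their coordinate vectors\<close>

definition pt :: "(nat \<Rightarrow> 'k::field) \<Rightarrow> (nat \<Rightarrow> 'k) set" where
  "pt v = {\<lambda>i. c * v i | c. c \<noteq> 0}"

text \<open>Quotients of homogeneous polynomials of equal degree have the same value at every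
  coordinate vector of a point, so one chosen vector can stand for the point throughout.\<close>

definition rep :: "(nat \<Rightarrow> 'k::field) set \<Rightarrow> nat \<Rightarrow> 'k" where
  "rep p = (SOME v. v \<in> p)"

lemma pt_self: "v \<in> pt v"
  unfolding pt_def by (intro CollectI exI[of _ 1]) simp

lemma rep_pt: "\<exists>c. c \<noteq> 0 \<and> rep (pt v) = (\<lambda>i. c * v i)"
proof -
  have "rep (pt v) \<in> pt v" unfolding rep_def by (rule someI[of "\<lambda>w. w \<in> pt v", OF pt_self])
  then show ?thesis by (auto simp: pt_def)
qed

lemma pt_scale: "c \<noteq> 0 \<Longrightarrow> pt (\<lambda>i. c * v i) = pt v"
proof (intro equalityI subsetI)
  assume c: "c \<noteq> 0"
  fix w
  show "w \<in> pt v" if w: "w \<in> pt (\<lambda>i. c * v i)"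
  proof -
    obtain b where "b \<noteq> 0" "w = (\<lambda>i. b * (c * v i))" using w by (auto simp: pt_def)
    then show ?thesis unfolding pt_def using c by (intro CollectI exI[of _ "b * c"]) (auto simp: mult.assoc)
  qed
  show "w \<in> pt (\<lambda>i. c * v i)" if w: "w \<in> pt v"
  proof -
    obtain b where "b \<noteq> 0" "w = (\<lambda>i. b * v i)" using w by (auto simp: pt_def)
    then show ?thesis unfolding pt_def using c by (intro CollectI exI[of _ "b / c"]) auto
  qed
qed

locale proj_set =
  fixes n :: nat and X :: "(nat \<Rightarrow> 'k::field) set set"
  assumes X_sub: "X \<subseteq> proj_space n"
begin

abbreviation "T \<equiv> zariski n X"
abbreviation "\<O> \<equiv> regular_functions n X"
abbreviation "H \<equiv> homogeneous_polys n"

definition D :: "((nat \<Rightarrow> 'k) \<Rightarrow> 'k) \<Rightarrow> (nat \<Rightarrow> 'k) set set" where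
  "D f = {p \<in> X. f (rep p) \<noteq> 0}"

lemma X_pt: "p \<in> X \<Longrightarrow> \<exists>v. v \<in> coord_space n \<and> v \<noteq> (\<lambda>_. 0) \<and> p = pt v"
  using X_sub by (auto simp: proj_space_def pt_def)

lemma X_rep:
  assumes "p \<in> X"
  shows "rep p \<in> p" "p = pt (rep p)" "rep p \<in> coord_space n" "rep p \<noteq> (\<lambda>_. 0)"
proof -
  obtain v where v: "v \<in> coord_space n" "v \<noteq> (\<lambda>_. 0)" "p = pt v" using X_pt[OF assms] by blast
  obtain c where c: "c \<noteq> 0" "rep p = (\<lambda>i. c * v i)" using rep_pt[of v] v(3) by blast
  show "p = pt (rep p)" unfolding c(2) using pt_scale[OF c(1)] v(3) by simp
  then show "rep p \<in> p" using pt_self by metis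
  show "rep p \<in> coord_space n" using v(1) by (simp add: c coord_space_def)
  show "rep p \<noteq> (\<lambda>_. 0)" using v(2) c by (auto simp: fun_eq_iff)
qed

lemma X_in_rep: "\<lbrakk>p \<in> X; v \<in> p\<rbrakk> \<Longrightarrow> \<exists>c. c \<noteq> 0 \<and> v = (\<lambda>i. c * rep p i)"
  using X_rep(2)[of p] by (auto simp: pt_def)

lemma hom_nz_iff: "\<lbrakk>f \<in> H d; p \<in> X\<rbrakk> \<Longrightarrow> (\<forall>v\<in>p. f v \<noteq> 0) \<longleftrightarrow> f (rep p) \<noteq> 0"
  using X_in_rep[of p] X_rep(1)[of p] by (fastforce simp: hom_homogeneous)

lemma hom_quot: "\<lbrakk>g \<in> H d; h \<in> H d; p \<in> X; v \<in> p\<rbrakk> \<Longrightarrow> g v / h v = g (rep p) / h (rep p)"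
  using X_in_rep[of p v] by (fastforce simp: hom_homogeneous)

lemma D_open: "f \<in> H d \<Longrightarrow> openin T (D f)"
proof -
  assume f: "f \<in> H d"
  then have "D f = {p \<in> X. \<exists>f\<in>{f}. \<forall>v\<in>p. f v \<noteq> 0}" using hom_nz_iff[OF f] by (auto simp: D_def)
  then show ?thesis unfolding openin_zariski zariski_open_def using f by (intro exI[of _ "{f}"]) auto
qed

lemma D_basis: "\<lbrakk>openin T U; p \<in> U\<rbrakk> \<Longrightarrow> \<exists>d. \<exists>f\<in>H d. p \<in> D f \<and> D f \<subseteq> U"
proof -
  assume U: "openin T U" "p \<in> U"
  then obtain S where S: "S \<subseteq> (\<Union>d. H d)" "U = {p \<in> X. \<exists>f\<in>S. \<forall>v\<in>p. f v \<noteq> 0}"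
    unfolding openin_zariski zariski_open_def by blast
  then obtain f where f: "f \<in> S" "\<forall>v\<in>p. f v \<noteq> 0" "p \<in> X" using U by auto
  then obtain d where d: "f \<in> H d" using S by auto
  have "p \<in> D f" using f hom_nz_iff[OF d] by (auto simp: D_def)
  moreover have "D f \<subseteq> U" using f(1) S(2) hom_nz_iff[OF d] by (auto simp: D_def)
  ultimately show ?thesis using d by blast
qed

lemma T_sub: "openin T U \<Longrightarrow> U \<subseteq> X"
  unfolding openin_zariski zariski_open_def by auto

lemma T_X: "openin T X"
proof -
  have "D (\<lambda>_. 1) = X" by (auto simp: D_def)
  then show ?thesis using D_open[OF hom_const[of 1]] by simp
qed

lemma topspace_T: "topspace T = X"
  using T_X T_sub openin_subset by (metis openin_topspace subset_antisym)

lemma D_mult: "D (\<lambda>v. f v * g v) = D f \<inter> D g"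
  by (auto simp: D_def)

lemma O_I:
  assumes "\<And>p. p \<notin> U \<Longrightarrow> f p = 0"
    and "\<And>p. p \<in> U \<Longrightarrow> \<exists>V d g h. openin T V \<and> p \<in> V \<and> V \<subseteq> U \<and> g \<in> H d \<and> h \<in> H d \<and>
      (\<forall>q\<in>V. h (rep q) \<noteq> 0 \<and> f q = g (rep q) / h (rep q))"
  shows "f \<in> \<O> U"
  unfolding regular_functions_def mem_Collect_eq
proof (intro conjI allI impI ballI)
  fix p assume "p \<in> U"
  from assms(2)[OF this] obtain V d g h where V: "openin T V" "p \<in> V" "V \<subseteq> U" "g \<in> H d" "h \<in> H d"
    "\<forall>q\<in>V. h (rep q) \<noteq> 0 \<and> f q = g (rep q) / h (rep q)"
    by (elim exE conjE) (rule that)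
  have "\<forall>q\<in>V. \<forall>v\<in>q. h v \<noteq> 0 \<and> f q = g v / h v"
    using V(6) hom_nz_iff[OF V(5)] hom_quot[OF V(4,5)] T_sub[OF V(1)] by (metis subsetD)
  then show "\<exists>V d. \<exists>g\<in>H d. \<exists>h\<in>H d. openin T V \<and> p \<in> V \<and> V \<subseteq> U \<and> (\<forall>q\<in>V. \<forall>v\<in>q. h v \<noteq> 0 \<and> f q = g v / h v)"
    using V(1-3) by (intro exI[of _ V] exI[of _ d] bexI[OF _ V(4)] bexI[OF _ V(5)]) auto
qed (rule assms(1))

text \<open>Multiplying numerator and denominator by a form \<open>w\<close> that cuts out a small
  basic open set makes the neighbourhood equal to the nonvanishing locus of the denominator.\<close>

lemma O_E:
  assumes "f \<in> \<O> U" "p \<in> U"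
  obtains d g h where "g \<in> H d" "h \<in> H d" "p \<in> D h" "D h \<subseteq> U" "\<And>q. q \<in> D h \<Longrightarrow> f q = g (rep q) / h (rep q)"
proof -
  have "\<exists>V d. \<exists>g\<in>H d. \<exists>h\<in>H d. openin T V \<and> p \<in> V \<and> V \<subseteq> U \<and> (\<forall>q\<in>V. \<forall>v\<in>q. h v \<noteq> 0 \<and> f q = g v / h v)"
    using assms unfolding regular_functions_def by simp
  then obtain V d g h where V: "g \<in> H d" "h \<in> H d" "openin T V" "p \<in> V" "V \<subseteq> U"
    "\<forall>q\<in>V. \<forall>v\<in>q. h v \<noteq> 0 \<and> f q = g v / h v" by (elim exE bexE conjE) (rule that)
  obtain e w where w: "w \<in> H e" "p \<in> D w" "D w \<subseteq> V" using D_basis[OF V(3,4)] by blast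
  have VX: "V \<subseteq> X" by (rule T_sub[OF V(3)])
  have q: "h (rep q) \<noteq> 0" "f q = g (rep q) / h (rep q)" if "q \<in> V" for q
    using V(6) that X_rep(1) VX by blast+
  show thesis
  proof (rule that[of "\<lambda>v. g v * w v" "d + e" "\<lambda>v. h v * w v"])
    show "p \<in> D (\<lambda>v. h v * w v)" unfolding D_mult using w(2) q(1)[OF V(4)] V(4) VX by (auto simp: D_def)
    show "D (\<lambda>v. h v * w v) \<subseteq> U" unfolding D_mult using w(3) V(5) by blast
    show "f q' = (\<lambda>v. g v * w v) (rep q') / (\<lambda>v. h v * w v) (rep q')" if "q' \<in> D (\<lambda>v. h v * w v)" for q'
    proof -
      have "q' \<in> V" "w (rep q') \<noteq> 0" using that w(3) by (auto simp: D_def)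
      then show ?thesis using q by simp
    qed
  qed (use V w in \<open>auto intro: hom_mult\<close>)
qed

lemma O_quot:
  assumes "openin T V" "g \<in> H d" "h \<in> H d" "\<And>q. q \<in> V \<Longrightarrow> h (rep q) \<noteq> 0"
  shows "fres V (\<lambda>q. g (rep q) / h (rep q)) \<in> \<O> V"
proof (rule O_I)
  fix p assume "p \<in> V"
  then show "\<exists>V' d g' h'. openin T V' \<and> p \<in> V' \<and> V' \<subseteq> V \<and> g' \<in> H d \<and> h' \<in> H d \<and>
      (\<forall>q\<in>V'. h' (rep q) \<noteq> 0 \<and> fres V (\<lambda>q. g (rep q) / h (rep q)) q = g' (rep q) / h' (rep q))"
    using assms by (intro exI[of _ V] exI[of _ d] exI[of _ g] exI[of _ h]) (auto simp: fres_def)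
qed (simp add: fres_def)

sublocale function_sheaf T \<O>
proof (rule function_sheaf.intro)
  fix V f p assume "openin T V" "f \<in> \<O> V" "p \<notin> V"
  then show "f p = 0" by (simp add: regular_functions_def)
next
  fix V :: "(nat \<Rightarrow> 'k) set set" and c :: 'k assume V: "openin T V"
  show "fres V (\<lambda>_. c) \<in> \<O> V" using O_quot[OF V hom_const[of c] hom_const[of 1]] by simp
next
  fix V f g assume V: "openin T V" and f: "f \<in> \<O> V" and g: "g \<in> \<O> V"
  have both: "\<exists>d1 g1 h1 d2 g2 h2. g1 \<in> H d1 \<and> h1 \<in> H d1 \<and> g2 \<in> H d2 \<and> h2 \<in> H d2 \<and> p \<in> D h1 \<and> p \<in> D h2 \<and>
     D h1 \<subseteq> V \<and> (\<forall>q\<in>D h1. f q = g1 (rep q) / h1 (rep q)) \<and> (\<forall>q\<in>D h2. g q = g2 (rep q) / h2 (rep q))" if p: "p \<in> V" for p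
  proof -
    obtain d1 g1 h1 where 1: "g1 \<in> H d1" "h1 \<in> H d1" "p \<in> D h1" "D h1 \<subseteq> V" "\<And>q. q \<in> D h1 \<Longrightarrow> f q = g1 (rep q) / h1 (rep q)"
      by (rule O_E[OF f p]) (rule that)
    obtain d2 g2 h2 where 2: "g2 \<in> H d2" "h2 \<in> H d2" "p \<in> D h2" "D h2 \<subseteq> V" "\<And>q. q \<in> D h2 \<Longrightarrow> g q = g2 (rep q) / h2 (rep q)"
      by (rule O_E[OF g p]) (rule that)
    show ?thesis using 1 2
      by (intro exI[of _ d1] exI[of _ g1] exI[of _ h1] exI[of _ d2] exI[of _ g2] exI[of _ h2]) auto
  qed
  have out: "f p = 0" "g p = 0" if "p \<notin> V" for p using f g that by (simp_all add: regular_functions_def)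
  show "(\<lambda>p. f p + g p) \<in> \<O> V"
  proof (rule O_I)
    fix p assume "p \<in> V"
    from both[OF this] obtain d1 g1 h1 d2 g2 h2 where a: "g1 \<in> H d1" "h1 \<in> H d1" "g2 \<in> H d2" "h2 \<in> H d2" "p \<in> D h1" "p \<in> D h2"
     "D h1 \<subseteq> V" "\<forall>q\<in>D h1. f q = g1 (rep q) / h1 (rep q)" "\<forall>q\<in>D h2. g q = g2 (rep q) / h2 (rep q)"
      by (elim exE conjE) (rule that)
    show "\<exists>V' d g' h. openin T V' \<and> p \<in> V' \<and> V' \<subseteq> V \<and> g' \<in> H d \<and> h \<in> H d \<and>
      (\<forall>q\<in>V'. h (rep q) \<noteq> 0 \<and> f q + g q = g' (rep q) / h (rep q))"
      using a hom_mult[OF a(1,4)] hom_mult[OF a(3,2)] hom_mult[OF a(2,4)] D_open[OF a(2)] D_open[OF a(4)]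
      by (intro exI[of _ "D h1 \<inter> D h2"] exI[of _ "d1 + d2"] exI[of _ "\<lambda>v. g1 v * h2 v + g2 v * h1 v"]
          exI[of _ "\<lambda>v. h1 v * h2 v"])
        (auto simp: D_def add.commute add_frac_eq intro!: hom_add)
  qed (simp add: out)
  show "(\<lambda>p. f p * g p) \<in> \<O> V"
  proof (rule O_I)
    fix p assume "p \<in> V"
    from both[OF this] obtain d1 g1 h1 d2 g2 h2 where a: "g1 \<in> H d1" "h1 \<in> H d1" "g2 \<in> H d2" "h2 \<in> H d2" "p \<in> D h1" "p \<in> D h2"
     "D h1 \<subseteq> V" "\<forall>q\<in>D h1. f q = g1 (rep q) / h1 (rep q)" "\<forall>q\<in>D h2. g q = g2 (rep q) / h2 (rep q)"
      by (elim exE conjE) (rule that)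
    show "\<exists>V' d g' h. openin T V' \<and> p \<in> V' \<and> V' \<subseteq> V \<and> g' \<in> H d \<and> h \<in> H d \<and>
      (\<forall>q\<in>V'. h (rep q) \<noteq> 0 \<and> f q * g q = g' (rep q) / h (rep q))"
      using a hom_mult[OF a(1,3)] hom_mult[OF a(2,4)] D_open[OF a(2)] D_open[OF a(4)]
      by (intro exI[of _ "D h1 \<inter> D h2"] exI[of _ "d1 + d2"] exI[of _ "\<lambda>v. g1 v * g2 v"]
          exI[of _ "\<lambda>v. h1 v * h2 v"]) (auto simp: D_def)
  qed (simp add: out)
next
  fix V W f assume VW: "openin T V" "openin T W" "W \<subseteq> V" and f: "f \<in> \<O> V"
  show "fres W f \<in> \<O> W"
  proof (rule O_I)
    fix p assume p: "p \<in> W"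
    then have "p \<in> V" using VW by blast
    obtain d g h where 1: "g \<in> H d" "h \<in> H d" "p \<in> D h" "D h \<subseteq> V" "\<And>q. q \<in> D h \<Longrightarrow> f q = g (rep q) / h (rep q)"
      by (rule O_E[OF f \<open>p \<in> V\<close>]) (rule that)
    show "\<exists>V' d g h. openin T V' \<and> p \<in> V' \<and> V' \<subseteq> W \<and> g \<in> H d \<and> h \<in> H d \<and>
      (\<forall>q\<in>V'. h (rep q) \<noteq> 0 \<and> fres W f q = g (rep q) / h (rep q))"
      using 1 p VW D_open[OF 1(2)]
      by (intro exI[of _ "D h \<inter> W"] exI[of _ d] exI[of _ g] exI[of _ h]) (auto simp: fres_def D_def)
  qed (simp add: fres_def)
next
  fix V f assume V: "openin T V" and out: "\<And>p. p \<notin> V \<Longrightarrow> f p = (0::'k)"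
    and loc: "\<And>p. p \<in> V \<Longrightarrow> \<exists>W. openin T W \<and> p \<in> W \<and> W \<subseteq> V \<and> fres W f \<in> \<O> W"
  show "f \<in> \<O> V"
  proof (rule O_I[OF out])
    fix p assume "p \<in> V"
    then obtain W where W: "openin T W" "p \<in> W" "W \<subseteq> V" "fres W f \<in> \<O> W" using loc by blast
    obtain d g h where 1: "g \<in> H d" "h \<in> H d" "p \<in> D h" "D h \<subseteq> W" "\<And>q. q \<in> D h \<Longrightarrow> fres W f q = g (rep q) / h (rep q)"
      by (rule O_E[OF W(4,2)]) (rule that)
    have "h (rep q) \<noteq> 0 \<and> f q = g (rep q) / h (rep q)" if "q \<in> D h" for q
      using 1(4) 1(5)[OF that] that by (auto simp: fres_def D_def)
    then show "\<exists>V' d g h. openin T V' \<and> p \<in> V' \<and> V' \<subseteq> V \<and> g \<in> H d \<and> h \<in> H d \<and>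
      (\<forall>q\<in>V'. h (rep q) \<noteq> 0 \<and> f q = g (rep q) / h (rep q))"
      using 1 W D_open[OF 1(2)]
      by (intro exI[of _ "D h"] exI[of _ d] exI[of _ g] exI[of _ h]) auto
  qed
qed

lemma O_inverse:
  assumes V: "openin T V" and f: "f \<in> \<O> V" and nz: "\<And>p. p \<in> V \<Longrightarrow> f p \<noteq> 0"
  shows "(\<lambda>p. inverse (f p)) \<in> \<O> V"
proof (rule O_I)
  fix p assume p: "p \<in> V"
  obtain d g h where 1: "g \<in> H d" "h \<in> H d" "p \<in> D h" "D h \<subseteq> V" "\<And>q. q \<in> D h \<Longrightarrow> f q = g (rep q) / h (rep q)"
    by (rule O_E[OF f p]) (rule that)
  have "g (rep q) \<noteq> 0 \<and> inverse (f q) = h (rep q) / g (rep q)" if "q \<in> D h" for q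
  proof -
    have "f q \<noteq> 0" using nz 1(4) that by blast
    then show ?thesis using 1(5)[OF that] by auto
  qed
  then show "\<exists>V' d g h. openin T V' \<and> p \<in> V' \<and> V' \<subseteq> V \<and> g \<in> H d \<and> h \<in> H d \<and>
      (\<forall>q\<in>V'. h (rep q) \<noteq> 0 \<and> inverse (f q) = g (rep q) / h (rep q))"
    using 1 D_open[OF 1(2)] by (intro exI[of _ "D h"] exI[of _ d] exI[of _ h] exI[of _ g]) auto
qed (use O_outside[OF V f] in simp)

lemma open_nonzero: assumes V: "openin T V" and f: "f \<in> \<O> V" shows "openin T {p\<in>V. f p \<noteq> 0}"
proof (subst openin_subopen, rule ballI)
  fix p assume "p \<in> {p\<in>V. f p \<noteq> 0}"
  then have p: "p \<in> V" "f p \<noteq> 0" by auto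
  obtain d g h where 1: "g \<in> H d" "h \<in> H d" "p \<in> D h" "D h \<subseteq> V" "\<And>q. q \<in> D h \<Longrightarrow> f q = g (rep q) / h (rep q)"
    by (rule O_E[OF f p(1)]) (rule that)
  have "p \<in> D g" using 1(5)[OF 1(3)] p(2) 1(3) by (auto simp: D_def)
  moreover have "D h \<inter> D g \<subseteq> {p\<in>V. f p \<noteq> 0}" using 1(4,5) by (auto simp: D_def)
  ultimately show "\<exists>W. openin T W \<and> p \<in> W \<and> W \<subseteq> {p\<in>V. f p \<noteq> 0}"
    using 1 D_open[OF 1(1)] D_open[OF 1(2)] by (intro exI[of _ "D h \<inter> D g"]) auto
qed

definition chart :: "(nat \<Rightarrow> 'k) set set \<Rightarrow> bool" where
  "chart B \<longleftrightarrow> (\<exists>c\<le>n. B = D (\<lambda>v. v c))"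

lemma chart_open: "chart B \<Longrightarrow> openin T B"
  using D_open[OF hom_coord] by (auto simp: chart_def)

lemma chart_cover: "p \<in> X \<Longrightarrow> \<exists>B. chart B \<and> p \<in> B"
proof -
  assume p: "p \<in> X"
  obtain c where c: "rep p c \<noteq> 0" using X_rep(4)[OF p] by (auto simp: fun_eq_iff)
  then have "c \<le> n" using X_rep(3)[OF p] by (auto simp: coord_space_def not_le[symmetric])
  then show ?thesis using c p by (intro exI[of _ "D (\<lambda>v. v c)"]) (auto simp: chart_def D_def)
qed

text \<open>On the affine piece where coordinate \<open>c\<close> is nonzero, the numerator and the
  denominator of a local quotient become functions after division by the \<open>d\<close>-th power
  of that coordinate.\<close>

lemma chart_extend:
  assumes "chart B" "openin T V" "V \<subseteq> B" "y \<in> V" "f \<in> \<O> V"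
  shows "\<exists>h\<in>\<O> B. \<exists>g\<in>\<O> B. h y \<noteq> 0 \<and> {p\<in>B. h p \<noteq> 0} \<subseteq> V \<and> (\<forall>p\<in>B. h p \<noteq> 0 \<longrightarrow> h p * f p = g p)"
proof -
  obtain c where c: "c \<le> n" "B = D (\<lambda>v. v c)" using assms(1) by (auto simp: chart_def)
  obtain d g h where 1: "g \<in> H d" "h \<in> H d" "y \<in> D h" "D h \<subseteq> V" "\<And>q. q \<in> D h \<Longrightarrow> f q = g (rep q) / h (rep q)"
    by (rule O_E[OF assms(5,4)]) (rule that)
  let ?F = "\<lambda>w. fres B (\<lambda>q. w (rep q) / rep q c ^ d)"
  have xc: "(\<lambda>v. v c ^ d) \<in> H d" using hom_power[OF hom_coord[OF c(1)], of d] by simp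
  have F: "?F w \<in> \<O> B" if "w \<in> H d" for w
    using O_quot[OF chart_open[OF assms(1)] that xc] c(2) by (simp add: D_def)
  have eq: "?F w p = w (rep p) / rep p c ^ d" "rep p c \<noteq> 0" "p \<in> X" if "p \<in> B" for w p
    using that c(2) by (auto simp: fres_def D_def)
  have yB: "y \<in> B" using assms by blast
  have "?F h y \<noteq> 0" using eq[OF yB] 1(3) by (simp add: D_def)
  moreover have "{p\<in>B. ?F h p \<noteq> 0} \<subseteq> D h" using eq by (auto simp: D_def)
  moreover have "?F h p * f p = ?F g p" if "p \<in> B" "?F h p \<noteq> 0" for p
  proof -
    have "p \<in> D h" using that eq by (auto simp: D_def)
    then show ?thesis using 1(5)[of p] eq[OF that(1)] by (simp add: D_def)
  qed
  ultimately show ?thesis using F[OF 1(1)] F[OF 1(2)] 1(4)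
    by (intro bexI[of _ "?F h"] bexI[of _ "?F g"]) auto
qed

end

section \<open>Cardinality of polynomial functions\<close>

text \<open>A pairing of the infinite type with itself is folded over the list. The length is stored
  separately, because the fold is injective only among lists of equal length.\<close>

lemma lists_lepoll_infinite:
  assumes inf: "infinite (UNIV :: 'k set)" shows "(UNIV :: 'k list set) \<lesssim> (UNIV :: 'k set)"
proof -
  obtain pr where "bij_betw pr ((UNIV :: 'k set) \<times> (UNIV :: 'k set)) (UNIV :: 'k set)"
    using card_of_Times_same_infinite[OF inf] unfolding card_of_ordIso[symmetric] by blast
  then have pr: "inj pr" by (simp add: bij_betw_def)
  obtain nt :: "nat \<Rightarrow> 'k" where nt: "inj nt" using infinite_countable_subset[OF inf] by blast
  define en where "en = foldr (\<lambda>x y. pr (x, y)) "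
  have en: "xs = ys" if "length xs = length ys" "en xs b = en ys b" for xs ys :: "'k list" and b
    using that
  proof (induction xs ys rule: list_induct2)
    case (Cons x xs y ys)
    then have "(x, en xs b) = (y, en ys b)" unfolding inj_eq[OF pr, symmetric] by (simp add: en_def)
    then show ?case using Cons.IH by simp
  qed simp
  have "inj (\<lambda>xs. pr (nt (length xs), en xs (nt 0)))"
  proof (rule injI)
    fix xs ys :: "'k list" assume "pr (nt (length xs), en xs (nt 0)) = pr (nt (length ys), en ys (nt 0))"
    then have "nt (length xs) = nt (length ys)" "en xs (nt 0) = en ys (nt 0)" unfolding inj_eq[OF pr] by auto
    then show "xs = ys" using en injD[OF nt] by blast
  qed
  then show ?thesis unfolding lepoll_def by blast
qed

text \<open>A polynomial is evaluated from a list of monomials, so the polynomials are covered by an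
  image of the lists of lists over the field.\<close>

lemma homogeneous_polys_lepoll:
  assumes inf: "infinite (UNIV :: 'k::field set)"
  shows "(\<Union>d. homogeneous_polys n d :: ((nat \<Rightarrow> 'k) \<Rightarrow> 'k) set) \<lesssim> (UNIV :: 'k set)"
proof -
  obtain nt :: "nat \<Rightarrow> 'k" where nt: "inj nt" using infinite_countable_subset[OF inf] by blast
  \<comment> \<open>A monomial is coded by its coefficient followed by its exponents, which the
    injection \<open>nt\<close> places in the field.\<close>
  define mono :: "'k list \<Rightarrow> (nat \<Rightarrow> 'k) \<Rightarrow> 'k" where
    "mono e v = hd e * (\<Prod>i\<le>n. v i ^ inv_into UNIV nt (tl e ! i))" for e v
  define ev :: "'k list list \<Rightarrow> (nat \<Rightarrow> 'k) \<Rightarrow> 'k" where "ev L v = (\<Sum>e\<leftarrow>L. mono e v)" for L v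
  have "(\<Union>d. homogeneous_polys n d) \<subseteq> ev ` UNIV"
  proof
    fix f :: "(nat \<Rightarrow> 'k) \<Rightarrow> 'k" assume "f \<in> (\<Union>d. homogeneous_polys n d)"
    then obtain A c where A: "f = (\<lambda>v. \<Sum>\<alpha>\<in>A. c \<alpha> * (\<Prod>i\<le>n. v i ^ \<alpha> i))" "finite A"
      unfolding homogeneous_polys_def by blast
    obtain L where L: "set L = A" "distinct L" using finite_distinct_list[OF A(2)] by blast
    define K where "K \<alpha> = c \<alpha> # map (\<lambda>i. nt (\<alpha> i)) [0..<Suc n]" for \<alpha>
    have "mono (K \<alpha>) v = c \<alpha> * (\<Prod>i\<le>n. v i ^ \<alpha> i)" for \<alpha> v
    proof -
      have "tl (K \<alpha>) ! i = nt (\<alpha> i)" if "i \<le> n" for i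
        using that by (simp add: K_def nth_append del: upt_Suc)
      then show ?thesis unfolding mono_def by (simp add: K_def inv_into_f_f[OF nt] del: upt_Suc)
    qed
    then have "ev (map K L) v = f v" for v
      unfolding ev_def A(1) using L by (simp add: o_def sum_list_distinct_conv_sum_set)
    then show "f \<in> ev ` UNIV" by (intro image_eqI[of _ _ "map K L"]) auto
  qed
  then have "(\<Union>d. homogeneous_polys n d :: ((nat \<Rightarrow> 'k) \<Rightarrow> 'k) set) \<lesssim> (UNIV :: 'k list list set)"
    by (rule subset_image_lepoll)
  also have "(UNIV :: 'k list list set) = lists (UNIV :: 'k list set)" by auto
  also have "\<dots> \<lesssim> lists (UNIV :: 'k set)" by (rule lists_lepoll_mono[OF lists_lepoll_infinite[OF inf]])
  also have "lists (UNIV :: 'k set) = UNIV" by auto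
  also have "(UNIV :: 'k list set) \<lesssim> (UNIV :: 'k set)" by (rule lists_lepoll_infinite[OF inf])
  finally show ?thesis .
qed

section \<open>Charts and irreducibility of the quadric\<close>

text \<open>For \<open>m = 0\<close> the quadric would be a pair of points and not
  irreducible.\<close>

locale even_quadric = hyperbolic_coordinates m a E l
  for m :: nat and a :: "nat \<Rightarrow> nat \<Rightarrow> 'k::alg_closed_field" and E l +
  assumes m_pos: "m \<ge> 1"
begin

section \<open>Hyperbolic coordinates of points and affine charts\<close>

abbreviation "n \<equiv> 2 * m + 1"
abbreviation "X \<equiv> quadric (2 * m) a"

sublocale proj_set "2 * m + 1" "quadric (2 * m) a"
  by unfold_locales (auto simp: quadric_def)

lemma lc_hom: "(\<lambda>v. lc c v) \<in> H 1"
  unfolding lc_def by (intro hom_sum hom_scale hom_coord) simp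

lemma lc_scale: "lc c (\<lambda>i. b * v i) = b * lc c v"
  by (simp add: lc_def sum_distrib_left mult.left_commute del: sum.atMost_Suc)

lemma vec_scale: "vec (\<lambda>i. b * u i) = (\<lambda>k. b * vec u k)"
  by (simp add: vec_def sum_distrib_left mult.assoc del: sum.atMost_Suc)

lemma vec_cong: "(\<And>c. c \<le> n \<Longrightarrow> u c = u' c) \<Longrightarrow> vec u = vec u'"
  unfolding vec_def by (intro ext sum.cong) auto

lemma pt_vec_in_X:
  assumes "(\<Sum>i\<le>m. u i * u (m + 1 + i)) = 0" "c \<le> n" "u c \<noteq> 0"
  shows "pt (vec u) \<in> X"
proof -
  have "lc c (vec u) \<noteq> 0" using lc_vec assms by simp
  then have "vec u \<noteq> (\<lambda>_. 0)" by (auto simp: lc_def)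
  then have "pt (vec u) \<in> proj_space n"
    unfolding proj_space_def pt_def using vec_in by blast
  moreover have "quadratic_form (2 * m) a w = 0" if "w \<in> pt (vec u)" for w
  proof -
    obtain b where "w = (\<lambda>i. b * vec u i)" using \<open>w \<in> pt (vec u)\<close> by (auto simp: pt_def)
    then have "quadratic_form (2 * m) a w = quadratic_form (2 * m) a (vec (\<lambda>i. b * u i))" by (simp add: vec_scale)
    also have "\<dots> = b * b * (\<Sum>i\<le>m. u i * u (m + 1 + i))"
      unfolding form_vec by (simp only: sum_distrib_left mult_ac)
    finally show ?thesis using assms(1) by simp
  qed
  ultimately show ?thesis by (simp add: quadric_def)
qed

lemma X_form:
  assumes "p \<in> X" shows "(\<Sum>i\<le>m. lc i (rep p) * lc (m + 1 + i) (rep p)) = 0"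
proof -
  have "quadratic_form (2 * m) a (rep p) = 0" using assms X_rep(1)[OF assms] by (auto simp: quadric_def)
  then show ?thesis using form_vec[of "\<lambda>c. lc c (rep p)"] vec_lc[OF X_rep(3)[OF assms]] by simp
qed

lemma X_lc_nz: assumes "p \<in> X" shows "\<exists>c\<le>n. lc c (rep p) \<noteq> 0"
proof (rule ccontr)
  assume "\<not> ?thesis"
  then have "vec (\<lambda>c. lc c (rep p)) = vec (\<lambda>_. 0)" by (intro vec_cong) auto
  then have "rep p = (\<lambda>_. 0)" using vec_lc[OF X_rep(3)[OF assms]] by (simp add: vec_def)
  then show False using X_rep(4)[OF assms] by simp
qed

lemma D_pt: "\<lbrakk>pt w \<in> X; f \<in> H d\<rbrakk> \<Longrightarrow> pt w \<in> D f \<longleftrightarrow> f w \<noteq> 0"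
  using rep_pt[of w] by (auto simp: D_def hom_homogeneous)

text \<open>The \<open>c\<close>-th coordinate is \<open>y\<^sub>i\<close> or
  \<open>x\<^sub>i\<close> for \<open>i = pair c\<close>, and \<open>conj c\<close> is the index of
  the other one.\<close>

definition pair :: "nat \<Rightarrow> nat" where "pair c = (if c \<le> m then c else c - (m + 1))"
definition conj :: "nat \<Rightarrow> nat" where "conj c = (if c \<le> m then m + 1 + c else c - (m + 1))"

text \<open>The points whose \<open>c\<close>-th coordinate is 1: the equation of the quadric is solved for the
  coordinate paired with the \<open>c\<close>-th one.\<close>

definition cu :: "nat \<Rightarrow> (nat \<Rightarrow> 'k) \<Rightarrow> nat \<Rightarrow> 'k" where
  "cu c z j = (if j = c then 1 else if j = conj c then - (\<Sum>i\<in>{..m} - {pair c}. z i * z (m + 1 + i)) else z j)"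

definition P :: "nat \<Rightarrow> (nat \<Rightarrow> 'k) \<Rightarrow> (nat \<Rightarrow> 'k) set" where
  "P c z = pt (vec (cu c z))"

lemma split_pair:
  fixes u :: "nat \<Rightarrow> 'k"
  assumes "c \<le> n"
  shows "(\<Sum>i\<le>m. u i * u (m + 1 + i)) = u c * u (conj c) + (\<Sum>i\<in>{..m} - {pair c}. u i * u (m + 1 + i))"
proof -
  have "pair c \<in> {..m}" using assms by (auto simp: pair_def)
  then have "(\<Sum>i\<le>m. u i * u (m + 1 + i))
    = u (pair c) * u (m + 1 + pair c) + (\<Sum>i\<in>{..m} - {pair c}. u i * u (m + 1 + i))"
    by (intro sum.remove) auto
  also have "u (pair c) * u (m + 1 + pair c) = u c * u (conj c)"
    using assms by (cases "c \<le> m") (auto simp: pair_def conj_def intro: mult.commute)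
  finally show ?thesis .
qed

lemma not_pair:
  assumes "c \<le> n" "i \<in> {..m} - {pair c}"
  shows "i \<noteq> c" "i \<noteq> conj c" "m + 1 + i \<noteq> c" "m + 1 + i \<noteq> conj c"
  using assms by (auto simp: pair_def conj_def split: if_splits)

lemma cu_form: assumes "c \<le> n" shows "(\<Sum>i\<le>m. cu c z i * cu c z (m + 1 + i)) = 0"
proof -
  have "(\<Sum>i\<in>{..m} - {pair c}. cu c z i * cu c z (m + 1 + i)) = (\<Sum>i\<in>{..m} - {pair c}. z i * z (m + 1 + i))"
    using not_pair[OF assms] by (intro sum.cong refl) (simp add: cu_def)
  moreover have "cu c z c * cu c z (conj c) = - (\<Sum>i\<in>{..m} - {pair c}. z i * z (m + 1 + i))"
    using assms by (auto simp: cu_def conj_def)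
  ultimately show ?thesis unfolding split_pair[OF assms] by simp
qed

lemma P_in_X: "c \<le> n \<Longrightarrow> P c z \<in> X"
  unfolding P_def by (rule pt_vec_in_X[OF cu_form, of c c]) (auto simp: cu_def)

lemma P_in_D: "\<lbrakk>c \<le> n; f \<in> H d\<rbrakk> \<Longrightarrow> P c z \<in> D f \<longleftrightarrow> f (vec (cu c z)) \<noteq> 0"
  using D_pt P_in_X unfolding P_def by blast

lemma lc_cu: "j \<le> n \<Longrightarrow> lc j (vec (cu c z)) = cu c z j"
  by (rule lc_vec)

text \<open>After division by the \<open>c\<close>-th coordinate, all coordinates except the
  conjugate one are prescribed by \<open>z\<close>, and the equation of the quadric determines that
  one. So \<open>P c\<close> parametrises the whole affine piece.\<close>

lemma point_in_chart:
  assumes p: "p \<in> X" and c: "c \<le> n" and nz: "lc c (rep p) \<noteq> 0"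
    and z: "\<And>j. \<lbrakk>j \<le> n; j \<noteq> c; j \<noteq> conj c\<rbrakk> \<Longrightarrow> z j = lc j (rep p) / lc c (rep p)"
  shows "P c z = p"
proof -
  define b where "b = lc c (rep p)"
  have "cu c z j = (1 / b) * lc j (rep p)" if j: "j \<le> n" for j
  proof -
    consider "j = c" | "j \<noteq> c" "j = conj c" | "j \<noteq> c" "j \<noteq> conj c" by blast
    then show ?thesis
    proof cases
      case 1
      then show ?thesis using nz by (simp add: cu_def b_def)
    next
      case 2
      have zj: "z i * z (m + 1 + i) = lc i (rep p) * lc (m + 1 + i) (rep p) / (b * b)" if i: "i \<in> {..m} - {pair c}" for i
      proof -
        have "z i = lc i (rep p) / b" "z (m + 1 + i) = lc (m + 1 + i) (rep p) / b"
          unfolding b_def using i not_pair[OF c i] by (intro z; simp)+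
        then show ?thesis by simp
      qed
      have "b * lc (conj c) (rep p) + (\<Sum>i\<in>{..m} - {pair c}. lc i (rep p) * lc (m + 1 + i) (rep p)) = 0"
        using X_form[OF p] split_pair[OF c, of "\<lambda>i. lc i (rep p)"] by (simp add: b_def)
      then have S: "(\<Sum>i\<in>{..m} - {pair c}. lc i (rep p) * lc (m + 1 + i) (rep p)) = - (b * lc (conj c) (rep p))"
        by (simp add: eq_neg_iff_add_eq_0 add.commute)
      have "cu c z j = - (\<Sum>i\<in>{..m} - {pair c}. lc i (rep p) * lc (m + 1 + i) (rep p) / (b * b))"
        using 2 zj by (simp add: cu_def)
      also have "\<dots> = b * lc (conj c) (rep p) / (b * b)"
        unfolding sum_divide_distrib[symmetric] S by simp
      also have "\<dots> = (1 / b) * lc j (rep p)" using 2 nz by (simp add: b_def)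
      finally show ?thesis .
    next
      case 3
      then show ?thesis using z[OF j] by (simp add: cu_def b_def)
    qed
  qed
  then have "vec (cu c z) = vec (\<lambda>j. (1 / b) * lc j (rep p))" by (intro vec_cong)
  also have "\<dots> = (\<lambda>k. (1 / b) * rep p k)" unfolding vec_scale vec_lc[OF X_rep(3)[OF p]] ..
  finally show ?thesis unfolding P_def using pt_scale[of "1 / b" "rep p"] nz X_rep(2)[OF p] by (simp add: b_def)
qed

lemma polyfun_cu: "(\<lambda>z. cu c z j) \<in> polyfun"
  unfolding cu_def
  by (cases "j = c"; cases "j = conj c") (auto intro!: polyfun_uminus polyfun_sum polyfun.mult)

lemma polyfun_vec: "(\<lambda>z. vec (cu c z) k) \<in> polyfun"
  unfolding vec_def by (intro polyfun_sum polyfun.mult polyfun_cu polyfun.const)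

lemma hom_vec_polyfun: "f \<in> H d \<Longrightarrow> (\<lambda>z. f (vec (cu c z))) \<in> polyfun"
  by (rule polyfun_subst[OF hom_polyfun polyfun_vec])

section \<open>Irreducibility\<close>

lemma D_in_chart:
  assumes "c \<le> n" "f \<in> H d" "D f \<inter> D (lc c) \<noteq> {}"
  shows "\<exists>z. f (vec (cu c z)) \<noteq> 0"
proof -
  obtain p where p: "p \<in> X" "f (rep p) \<noteq> 0" "lc c (rep p) \<noteq> 0" "p \<in> D f" using assms(3) by (auto simp: D_def)
  have "P c (\<lambda>j. lc j (rep p) / lc c (rep p)) = p" by (rule point_in_chart[OF p(1) assms(1) p(3)]) simp
  then show ?thesis using P_in_D[OF assms(1,2)] p(4) by metis
qed

text \<open>The map \<open>P c\<close> parametrises the piece by an affine space, where the loci of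
  nonvanishing of two nonzero polynomials always meet.\<close>

lemma chart_meet:
  assumes c: "c \<le> n" and f: "f \<in> H d" "D f \<inter> D (lc c) \<noteq> {}" and g: "g \<in> H e" "D g \<inter> D (lc c) \<noteq> {}"
  shows "D f \<inter> D g \<inter> D (lc c) \<noteq> {}"
proof -
  obtain z y where "f (vec (cu c z)) \<noteq> 0" "g (vec (cu c y)) \<noteq> 0"
    using D_in_chart[OF c f] D_in_chart[OF c g] by blast
  then have "\<exists>x. (\<forall>j. j \<notin> UNIV \<longrightarrow> x j = 0) \<and> f (vec (cu c x)) \<noteq> 0 \<and> g (vec (cu c x)) \<noteq> 0"
    by (intro polyfun_mult_nonzero[OF infinite_alg_closed hom_vec_polyfun[OF f(1)] hom_vec_polyfun[OF g(1)], of UNIV z y]) auto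
  then obtain x where "f (vec (cu c x)) \<noteq> 0" "g (vec (cu c x)) \<noteq> 0" by blast
  moreover have "lc c (vec (cu c x)) \<noteq> 0" using lc_cu[OF c] by (simp add: cu_def)
  ultimately have "P c x \<in> D f \<inter> D g \<inter> D (lc c)"
    using P_in_D[OF c f(1)] P_in_D[OF c g(1)] P_in_D[OF c lc_hom] by blast
  then show ?thesis by blast
qed

text \<open>The point with coordinates 1 at \<open>c\<close> and \<open>d\<close> and 0 elsewhere
  lies on the quadric, since no hyperbolic pair has both coordinates nonzero.\<close>

lemma lc_meet:
  assumes "c \<le> n" "d \<le> n" "d \<noteq> conj c" shows "D (lc c) \<inter> D (lc d) \<noteq> {}"
proof -
  define u where "u j = (if j = c \<or> j = d then 1 else 0::'k)" for j
  have "(\<Sum>i\<le>m. u i * u (m + 1 + i)) = 0"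
  proof (rule sum.neutral, rule ballI)
    fix i assume "i \<in> {..m}"
    then show "u i * u (m + 1 + i) = 0" using assms by (auto simp: u_def conj_def split: if_splits)
  qed
  then have X: "pt (vec u) \<in> X" by (rule pt_vec_in_X[of _ c]) (use assms in \<open>auto simp: u_def\<close>)
  have "lc c (vec u) \<noteq> 0" "lc d (vec u) \<noteq> 0" using lc_vec assms by (auto simp: u_def)
  then have "pt (vec u) \<in> D (lc c) \<inter> D (lc d)" using D_pt[OF X lc_hom] by blast
  then show ?thesis by blast
qed

lemma meets_chart_0:
  assumes "f \<in> H d" "D f \<noteq> {}" shows "D f \<inter> D (lc 0) \<noteq> {}"
proof -
  have step: "D f \<inter> D (lc d) \<noteq> {}" if "D f \<inter> D (lc c) \<noteq> {}" "c \<le> n" "d \<le> n" "d \<noteq> conj c" for c d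
  proof -
    have "D (lc d) \<inter> D (lc c) \<noteq> {}" using lc_meet[OF that(2-4)] by blast
    from chart_meet[OF that(2) assms(1) that(1) lc_hom this] show ?thesis by blast
  qed
  obtain p where p: "p \<in> D f" "p \<in> X" using assms(2) by (auto simp: D_def)
  obtain c where c: "c \<le> n" "lc c (rep p) \<noteq> 0" using X_lc_nz[OF p(2)] by blast
  have "D f \<inter> D (lc c) \<noteq> {}" using p c by (auto simp: D_def)
  show ?thesis
  proof (cases "c = m + 1")
    case False
    then have "0 \<noteq> conj c" using c by (auto simp: conj_def)
    then show ?thesis using step[of c 0] \<open>D f \<inter> D (lc c) \<noteq> {}\<close> c by simp
  next
    \<comment> \<open>The index \<open>m + 1\<close> is conjugate to 0, so \<open>lc_meet\<close>
      gives no direct passage; chart 1 serves as an intermediate step.\<close>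
    case True
    then have "D f \<inter> D (lc 1) \<noteq> {}" using step[of c 1] \<open>D f \<inter> D (lc c) \<noteq> {}\<close> c m_pos by (simp add: conj_def)
    then show ?thesis using step[of 1 0] m_pos by (simp add: conj_def)
  qed
qed

lemma irreducible:
  assumes "openin T U" "openin T V" "U \<noteq> {}" "V \<noteq> {}" shows "U \<inter> V \<noteq> {}"
proof -
  obtain p q where "p \<in> U" "q \<in> V" using assms by blast
  then obtain d f e g where f: "f \<in> H d" "p \<in> D f" "D f \<subseteq> U" and g: "g \<in> H e" "q \<in> D g" "D g \<subseteq> V"
    using D_basis[OF assms(1)] D_basis[OF assms(2)] by metis
  then have "D f \<noteq> {}" "D g \<noteq> {}" by auto
  then have "D f \<inter> D g \<inter> D (lc 0) \<noteq> {}"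
    by (intro chart_meet[OF _ f(1) _ g(1)] meets_chart_0[OF f(1)] meets_chart_0[OF g(1)]) auto
  then show ?thesis using f g by blast
qed

text \<open>The locus where \<open>f\<close> is nonzero is open; if nonempty it would meet
  \<open>W\<close> by irreducibility.\<close>

lemma identity_principle:
  assumes "openin T V" "f \<in> \<O> V" "openin T W" "W \<noteq> {}" "W \<subseteq> V" "\<And>p. p \<in> W \<Longrightarrow> f p = 0"
  shows "f = (\<lambda>_. 0)"
proof (rule ccontr)
  assume "f \<noteq> (\<lambda>_. 0)"
  then obtain p where "f p \<noteq> 0" by (auto simp: fun_eq_iff)
  then have "{p\<in>V. f p \<noteq> 0} \<noteq> {}" using O_outside[OF assms(1,2)] by blast
  from irreducible[OF open_nonzero[OF assms(1,2)] assms(3) this assms(4)]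
  show False using assms(6) by auto
qed

section \<open>The localizations along products of coordinates\<close>

definition Yi :: "nat \<Rightarrow> (nat \<Rightarrow> 'k) \<Rightarrow> 'k" where
  "Yi i v = (\<Prod>j\<in>{..m} - {i}. lc j v)"

definition Ui :: "nat \<Rightarrow> (nat \<Rightarrow> 'k) set set" where "Ui i = D (Yi i)"

text \<open>Powers of the form \<open>Yi i\<close>, turned into functions by division by a nowhere
  vanishing form of the same degree. Leaving this form arbitrary makes the notion stable under
  restriction and independent of a chart.\<close>

definition Den :: "nat \<Rightarrow> (nat \<Rightarrow> 'k) set set \<Rightarrow> ((nat \<Rightarrow> 'k) set \<Rightarrow> 'k) set" where
  "Den i W = {t \<in> \<O> W. \<exists>k. \<exists>h\<in>H (m * k). \<forall>q\<in>W. h (rep q) \<noteq> 0 \<and> t q = Yi i (rep q) ^ k / h (rep q)}"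

lemma Yi_hom': "Yi i \<in> H (card ({..m} - {i}))"
  unfolding Yi_def[abs_def] by (intro hom_prod lc_hom) auto

lemma Yi_hom: "i \<le> m \<Longrightarrow> Yi i \<in> H m"
  using Yi_hom'[of i] by simp

lemma Ui_open: "openin T (Ui i)"
  unfolding Ui_def by (rule D_open[OF Yi_hom'])

lemma Ui_iff: "p \<in> Ui i \<longleftrightarrow> p \<in> X \<and> (\<forall>j\<le>m. j \<noteq> i \<longrightarrow> lc j (rep p) \<noteq> 0)"
  by (auto simp: Ui_def D_def Yi_def)

lemma Den_I:
  assumes "openin T W" "i \<le> m" "h \<in> H (m * k)" "\<And>q. q \<in> W \<Longrightarrow> h (rep q) \<noteq> 0"
  shows "fres W (\<lambda>q. Yi i (rep q) ^ k / h (rep q)) \<in> Den i W"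
proof -
  have "(\<lambda>v. Yi i v ^ k) \<in> H (m * k)" by (rule hom_power[OF Yi_hom[OF assms(2)]])
  from O_quot[OF assms(1) this assms(3,4)] show ?thesis
    unfolding Den_def using assms(3,4) by (auto simp: fres_def intro!: exI[of _ k] bexI[of _ h])
qed

lemma Den_E:
  assumes "t \<in> Den i W"
  obtains k h where "t \<in> \<O> W" "h \<in> H (m * k)" "\<And>q. q \<in> W \<Longrightarrow> h (rep q) \<noteq> 0"
    "\<And>q. q \<in> W \<Longrightarrow> t q = Yi i (rep q) ^ k / h (rep q)"
  using assms unfolding Den_def by blast

sublocale fraction_sheaf T \<O> "{..m}" Ui Den chart
proof (intro fraction_sheaf.intro fraction_sheaf_axioms.intro)
  show "function_sheaf T \<O>" by (rule function_sheaf_axioms)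
  show "finite {..m}" "{..m} \<noteq> {}" by auto
  show "openin T (Ui i)" for i by (rule Ui_open)
  show "openin T B" if "chart B" for B by (rule chart_open[OF that])
  show "\<exists>B. chart B \<and> x \<in> B" if x: "x \<in> topspace T" for x
    using chart_cover x unfolding topspace_T by blast
  show "\<exists>h\<in>\<O> B. \<exists>g\<in>\<O> B. h y \<noteq> 0 \<and> {p\<in>B. h p \<noteq> 0} \<subseteq> V \<and> (\<forall>p\<in>B. h p \<noteq> 0 \<longrightarrow> h p * f p = g p)"
    if "chart B" "openin T V" "V \<subseteq> B" "y \<in> V" "f \<in> \<O> V" for B V y f
    by (rule chart_extend[OF that])
  show "openin T {p\<in>V. h p \<noteq> 0}" if "openin T V" "h \<in> \<O> V" for V h by (rule open_nonzero[OF that])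
  show "(\<lambda>p. inverse (h p)) \<in> \<O> V" if "openin T V" "h \<in> \<O> V" "\<And>p. p \<in> V \<Longrightarrow> h p \<noteq> 0" for V h
    by (rule O_inverse[OF that])
next
  fix W i t assume W: "openin T W" and "i \<in> {..m}" and t: "t \<in> Den i W"
  then have i: "i \<le> m" by simp
  show "t \<in> \<O> W" using t by (simp add: Den_def)
  obtain k h where h: "h \<in> H (m * k)" "\<And>q. q \<in> W \<Longrightarrow> h (rep q) \<noteq> 0"
    "\<And>q. q \<in> W \<Longrightarrow> t q = Yi i (rep q) ^ k / h (rep q)" by (rule Den_E[OF t]) (rule that)
  show "t p \<noteq> 0" if p: "p \<in> W" "p \<in> Ui i" for p
    using h(2,3)[OF p(1)] p(2) by (simp add: Ui_def D_def)
  have fres_t: "t = fres W (\<lambda>q. Yi i (rep q) ^ k / h (rep q))"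
    using h(3) O_outside[OF W \<open>t \<in> \<O> W\<close>] by (auto simp: fres_def fun_eq_iff)
  {
    fix t' assume t': "t' \<in> Den i W"
    obtain k' h' where h': "h' \<in> H (m * k')" "\<And>q. q \<in> W \<Longrightarrow> h' (rep q) \<noteq> 0"
      "\<And>q. q \<in> W \<Longrightarrow> t' q = Yi i (rep q) ^ k' / h' (rep q)" by (rule Den_E[OF t']) (rule that)
    have "(\<lambda>v. h v * h' v) \<in> H (m * (k + k'))"
      unfolding distrib_left by (rule hom_mult[OF h(1) h'(1)])
    then have "fres W (\<lambda>q. Yi i (rep q) ^ (k + k') / (h (rep q) * h' (rep q))) \<in> Den i W"
      using h(2) h'(2) by (intro Den_I[OF W i]) auto
    moreover have "(\<lambda>p. t p * t' p) = fres W (\<lambda>q. Yi i (rep q) ^ (k + k') / (h (rep q) * h' (rep q)))"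
      using h(3) h'(3) O_outside[OF W \<open>t \<in> \<O> W\<close>] by (auto simp: fres_def fun_eq_iff power_add)
    ultimately show "(\<lambda>p. t p * t' p) \<in> Den i W" by simp
  next
    fix W' assume W': "openin T W'" "W' \<subseteq> W"
    have "fres W' t = fres W' (\<lambda>q. Yi i (rep q) ^ k / h (rep q))"
      using h(3) W'(2) by (auto simp: fres_def fun_eq_iff)
    then show "fres W' t \<in> Den i W'" using Den_I[OF W'(1) i h(1)] h(2) W'(2) by auto
  }
  fix B y assume B: "chart B" "W \<subseteq> B"
  obtain c where c: "c \<le> n" "B = D (\<lambda>v. v c)" using B(1) unfolding chart_def by blast
  have xc: "(\<lambda>v. v c ^ (m * k)) \<in> H (m * k)" using hom_power[OF hom_coord[OF c(1)], of "m * k"] by simp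
  have B0: "rep q c \<noteq> 0" if "q \<in> B" for q using that c by (auto simp: D_def)
  \<comment> \<open>The form \<open>h\<close>, known to be nonvanishing only on \<open>W\<close>, is
    exchanged for a power of the coordinate that is invertible on the chart; the ratio
    \<open>?u\<close> of the two is regular on \<open>W\<close>.\<close>
  let ?t0 = "fres B (\<lambda>q. Yi i (rep q) ^ k / rep q c ^ (m * k))"
  let ?u = "fres W (\<lambda>q. h (rep q) / rep q c ^ (m * k))"
  have "?t0 \<in> Den i B" using B0 by (intro Den_I[OF chart_open[OF B(1)] i xc]) auto
  moreover have "?u \<in> \<O> W" using B0 B(2) by (intro O_quot[OF W h(1) xc]) auto
  moreover have "\<forall>p\<in>W. ?t0 p = ?u p * t p" using h(2,3) B(2) by (auto simp: fres_def)
  ultimately show "\<exists>t0\<in>Den i B. \<exists>u\<in>\<O> W. \<forall>p\<in>W. t0 p = u p * t p" by blast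
next
  fix W i assume W: "openin T W" and i: "i \<in> {..m}"
  have h: "(\<lambda>_. 1 :: 'k) \<in> H (m * 0)" using hom_const[of "1 :: 'k"] by simp
  have "i \<le> m" using i by simp
  from Den_I[OF W this h] show "fres W (\<lambda>_. 1) \<in> Den i W" by simp
qed

text \<open>On \<open>Ui i\<close> alone \<open>y\<^sub>i\<close> may still vanish, but there are at
  least two indices and any other one forbids it.\<close>

lemma Uall_iff: "p \<in> Uall \<longleftrightarrow> p \<in> X \<and> (\<forall>j\<le>m. lc j (rep p) \<noteq> 0)"
proof -
  have "\<exists>i\<le>m. i \<noteq> j" for j using m_pos by (cases "j = 0") (auto intro: exI[of _ 1] exI[of _ 0])
  moreover have "p \<in> Uall \<longleftrightarrow> (\<forall>i\<le>m. p \<in> Ui i)" by (auto simp: Uall_def)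
  ultimately show ?thesis unfolding Ui_iff by blast
qed

lemma Uall_ne: "Uall \<noteq> {}"
proof -
  define z where "z j = (1::'k)" for j :: nat
  have "P 0 z \<in> X" by (rule P_in_X) simp
  moreover have "lc j (rep (P 0 z)) \<noteq> 0" if "j \<le> m" for j
  proof -
    have "lc j (vec (cu 0 z)) \<noteq> 0" using lc_cu[of j 0 z] that by (auto simp: cu_def conj_def z_def)
    then have "P 0 z \<in> D (lc j)" using P_in_D[OF _ lc_hom] by simp
    then show ?thesis by (simp add: D_def)
  qed
  ultimately show ?thesis using Uall_iff by blast
qed

end

section \<open>Local decompositions\<close>

text \<open>Induction on \<open>A\<close>: in the binomial expansion of
  \<open>(b x + y) ^ (M + e)\<close>, where \<open>y\<close> is the sum of the other functions, each
  term contains either \<open>b x ^ e\<close> or \<open>y ^ M\<close>, and the latter is covered by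
  the induction hypothesis.\<close>

lemma (in function_sheaf) power_sum_in_ideal:
  assumes V: "openin T V" and A: "finite A" and b: "\<And>j. j \<in> A \<Longrightarrow> b j \<in> \<O> V"
  shows "\<exists>M c. (\<forall>j\<in>A. c j \<in> \<O> V) \<and> (\<forall>p\<in>V. (\<Sum>j\<in>A. b j p) ^ M = (\<Sum>j\<in>A. c j p * b j p ^ e))"
  using A b
proof (induction A rule: finite_induct)
  case empty
  show ?case by (intro exI[of _ 1]) simp
next
  case (insert x A)
  have "\<exists>M c. (\<forall>j\<in>A. c j \<in> \<O> V) \<and> (\<forall>p\<in>V. (\<Sum>j\<in>A. b j p) ^ M = (\<Sum>j\<in>A. c j p * b j p ^ e))"
    using insert.prems by (intro insert.IH) simp
  then obtain M c where "\<forall>j\<in>A. c j \<in> \<O> V"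
    "\<forall>p\<in>V. (\<Sum>j\<in>A. b j p) ^ M = (\<Sum>j\<in>A. c j p * b j p ^ e)"
    by (elim exE conjE) (rule that)
  then have c: "\<And>j. j \<in> A \<Longrightarrow> c j \<in> \<O> V"
    "\<And>p. p \<in> V \<Longrightarrow> (\<Sum>j\<in>A. b j p) ^ M = (\<Sum>j\<in>A. c j p * b j p ^ e)" by simp_all
  define y where "y p = (\<Sum>j\<in>A. b j p)" for p
  have y: "y \<in> \<O> V" unfolding y_def using insert.prems V by (intro O_sum) auto
  have x: "b x \<in> \<O> V" using insert.prems by simp
  let ?f = "\<lambda>k p. of_nat (M + e choose k) * b x p ^ k * y p ^ (M + e - k)"
  define P where "P p = (\<Sum>k=e..M+e. fres V (\<lambda>_. of_nat (M + e choose k)) p * fres V (\<lambda>p. b x p ^ (k - e)) p * fres V (\<lambda>p. y p ^ (M + e - k)) p)" for p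
  define Q where "Q p = (\<Sum>k<e. fres V (\<lambda>_. of_nat (M + e choose k)) p * fres V (\<lambda>p. b x p ^ k) p * fres V (\<lambda>p. y p ^ (e - k)) p)" for p
  have PQ: "P \<in> \<O> V" "Q \<in> \<O> V"
    unfolding P_def Q_def using x y V by (intro O_sum O_mult O_const O_power; simp)+
  define c' where "c' j = (if j = x then P else (\<lambda>p. Q p * c j p))" for j
  have "\<forall>j\<in>insert x A. c' j \<in> \<O> V" using PQ c(1) V by (auto simp: c'_def intro: O_mult)
  moreover have "(\<Sum>j\<in>insert x A. b j p) ^ (M + e) = (\<Sum>j\<in>insert x A. c' j p * b j p ^ e)" if p: "p \<in> V" for p
  proof -
    have idx: "{..M + e} = {e..M + e} \<union> {..<e}" by auto
    have "(b x p + y p) ^ (M + e) = (\<Sum>k\<le>M + e. ?f k p)" by (rule binomial_ring)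
    also have "\<dots> = (\<Sum>k=e..M+e. ?f k p) + (\<Sum>k<e. ?f k p)"
      unfolding idx by (intro sum.union_disjoint) auto
    also have "(\<Sum>k=e..M+e. ?f k p) = P p * b x p ^ e"
      unfolding P_def sum_distrib_right
    proof (intro sum.cong refl)
      fix k assume "k \<in> {e..M + e}"
      then have "b x p ^ k = b x p ^ (k - e) * b x p ^ e" by (simp flip: power_add)
      then show "?f k p = fres V (\<lambda>_. of_nat (M + e choose k)) p * fres V (\<lambda>p. b x p ^ (k - e)) p * fres V (\<lambda>p. y p ^ (M + e - k)) p * b x p ^ e"
        using p by (simp add: fres_def mult_ac)
    qed
    also have "(\<Sum>k<e. ?f k p) = Q p * y p ^ M"
      unfolding Q_def sum_distrib_right
    proof (intro sum.cong refl)
      fix k assume "k \<in> {..<e}"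
      then have "M + e - k = (e - k) + M" by simp
      then have "y p ^ (M + e - k) = y p ^ (e - k) * y p ^ M" by (simp only: power_add)
      then show "?f k p = fres V (\<lambda>_. of_nat (M + e choose k)) p * fres V (\<lambda>p. b x p ^ k) p * fres V (\<lambda>p. y p ^ (e - k)) p * y p ^ M"
        using p by (simp add: fres_def mult_ac)
    qed
    also have "y p ^ M = (\<Sum>j\<in>A. c j p * b j p ^ e)" unfolding y_def by (rule c(2)[OF p])
    also have "Q p * \<dots> = (\<Sum>j\<in>A. c' j p * b j p ^ e)"
      unfolding sum_distrib_left using insert.hyps by (intro sum.cong refl) (auto simp: c'_def mult.assoc)
    finally have "(b x p + y p) ^ (M + e) = P p * b x p ^ e + (\<Sum>j\<in>A. c' j p * b j p ^ e)" .
    then show ?thesis using insert.hyps by (simp add: y_def c'_def)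
  qed
  ultimately show ?case by blast
qed

context even_quadric
begin

text \<open>By irreducibility a section is determined near one point \<open>p\<close>, and taking
  \<open>p\<close> in \<open>Uall\<close> makes all components defined there. So
  \<open>m + 1\<close> numerators and \<open>m + 1\<close> denominators determine it.\<close>

lemma sections_lepoll:
  assumes V: "openin T V" shows "N V \<lesssim> (UNIV :: 'k set)"
proof (cases "V = {}")
  case True
  have "N V \<subseteq> {\<lambda>_ _. 0}"
    using N_outside[OF V] True by (auto simp: fun_eq_iff)
  then have "finite (N V)" using finite_subset by blast
  then show ?thesis by (rule finite_lepoll_infinite[OF infinite_alg_closed])
next
  case False
  have "V \<inter> Uall \<noteq> {}" by (rule irreducible[OF V Uall_open False Uall_ne])
  then obtain p where p: "p \<in> V" "p \<in> Uall" by blast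
  let ?Hs = "\<Union>d. H d :: ((nat \<Rightarrow> 'k) \<Rightarrow> 'k) set"
  have "\<exists>g h. g \<in> ?Hs \<and> h \<in> ?Hs \<and> p \<in> D h \<and> openin T (D h) \<and> D h \<subseteq> V \<inter> Ui i \<and>
      (\<forall>q\<in>D h. s i q = g (rep q) / h (rep q))" if s: "s \<in> N V" and i: "i \<le> m" for s i
  proof -
    have "s i \<in> \<O> (V \<inter> Ui i)" "p \<in> V \<inter> Ui i" using N_O[OF V s] p i by (auto simp: Uall_def)
    then obtain d g h where "g \<in> H d" "h \<in> H d" "p \<in> D h" "D h \<subseteq> V \<inter> Ui i" "\<And>q. q \<in> D h \<Longrightarrow> s i q = g (rep q) / h (rep q)"
      by (rule O_E) (rule that)
    then show ?thesis using D_open[of h d] by (intro exI[of _ g] exI[of _ h]) auto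
  qed
  then obtain g h where gh: "\<And>s i. \<lbrakk>s \<in> N V; i \<le> m\<rbrakk> \<Longrightarrow> g s i \<in> ?Hs \<and> h s i \<in> ?Hs \<and> p \<in> D (h s i) \<and>
      openin T (D (h s i)) \<and> D (h s i) \<subseteq> V \<inter> Ui i \<and> (\<forall>q\<in>D (h s i). s i q = g s i (rep q) / h s i (rep q))" by metis
  define \<kappa> where "\<kappa> s = map (g s) [0..<Suc m] @ map (h s) [0..<Suc m]" for s
  have "inj_on \<kappa> (N V)"
  proof (rule inj_onI)
    fix s t assume s: "s \<in> N V" and t: "t \<in> N V" and eq: "\<kappa> s = \<kappa> t"
    have gh_eq: "g s i = g t i" "h s i = h t i" if "i \<le> m" for i
    proof -
      have "map (g s) [0..<Suc m] = map (g t) [0..<Suc m]" "map (h s) [0..<Suc m] = map (h t) [0..<Suc m]"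
        using eq unfolding \<kappa>_def by (subst (asm) append_eq_append_conv; simp)+
      then show "g s i = g t i" "h s i = h t i" using that by (auto simp del: upt_Suc simp: map_eq_conv)
    qed
    have "s i = t i" for i
    proof (cases "i \<le> m")
      case True
      have "(\<lambda>q. s i q - t i q) = (\<lambda>_. 0)"
      proof (rule identity_principle[OF VUi[OF V, of i]])
        show "(\<lambda>q. s i q - t i q) \<in> \<O> (V \<inter> Ui i)" by (intro O_diff VUi[OF V] N_O[OF V] s t)
        show "openin T (D (h s i))" "D (h s i) \<noteq> {}" "D (h s i) \<subseteq> V \<inter> Ui i" using gh[OF s True] by auto
        fix q assume "q \<in> D (h s i)"
        then show "s i q - t i q = 0" using gh[OF s True] gh[OF t True] gh_eq[OF True] by simp
      qed
      then show ?thesis by (auto simp: fun_eq_iff)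
    next
      case False
      then show ?thesis using N_out[OF s] N_out[OF t] by simp
    qed
    then show "s = t" by blast
  qed
  moreover have "\<kappa> ` N V \<subseteq> lists ?Hs"
  proof
    fix xs assume "xs \<in> \<kappa> ` N V"
    then obtain s where s: "s \<in> N V" "xs = \<kappa> s" by blast
    have set: "set (\<kappa> s) = g s ` {..m} \<union> h s ` {..m}"
      unfolding \<kappa>_def set_append set_map set_upt atLeast0LessThan lessThan_Suc_atMost ..
    have "f \<in> ?Hs" if "f \<in> set (\<kappa> s)" for f
      using that unfolding set
    proof (elim UnE imageE)
      fix i assume i: "f = g s i" "i \<in> {..m}"
      then have "i \<le> m" by simp
      from gh[OF s(1) this, THEN conjunct1] show ?thesis unfolding i(1) .
    next
      fix i assume i: "f = h s i" "i \<in> {..m}"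
      then have "i \<le> m" by simp
      from gh[OF s(1) this, THEN conjunct2, THEN conjunct1] show ?thesis unfolding i(1) .
    qed
    then have "set xs \<subseteq> ?Hs" unfolding s(2) by (rule subsetI)
    then show "xs \<in> lists ?Hs" unfolding lists_eq_set by (rule CollectI)
  qed
  ultimately have "N V \<lesssim> lists ?Hs" unfolding lepoll_def by blast
  also have "lists ?Hs \<lesssim> lists (UNIV :: 'k set)"
    by (rule lists_lepoll_mono[OF homogeneous_polys_lepoll[OF infinite_alg_closed]])
  also have "lists (UNIV :: 'k set) = UNIV" by auto
  also have "(UNIV :: 'k list set) \<lesssim> (UNIV :: 'k set)" by (rule lists_lepoll_infinite[OF infinite_alg_closed])
  finally show ?thesis .
qed

lemma encoding_exists:
  assumes "inj (emb :: 'k \<Rightarrow> 'b)"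
  shows "\<exists>enc :: _ \<Rightarrow> _ \<Rightarrow> 'b. \<forall>V. openin T V \<longrightarrow> inj_on (enc V) (N V)"
proof -
  have "\<exists>f :: _ \<Rightarrow> 'k. openin T V \<longrightarrow> inj_on f (N V)" for V
    using sections_lepoll[of V] unfolding lepoll_def by blast
  then obtain f :: "_ \<Rightarrow> _ \<Rightarrow> 'k" where f: "\<And>V. openin T V \<longrightarrow> inj_on (f V) (N V)" by metis
  have "inj_on (emb \<circ> f V) (N V)" if "openin T V" for V
    using f[of V] that assms by (intro comp_inj_on) (auto intro: inj_on_subset)
  then show ?thesis by (intro exI[of _ "\<lambda>V. emb \<circ> f V"]) auto
qed

text \<open>A linear form \<open>L\<close> without zeros on \<open>V\<close> turns the
  \<open>y\<^sub>j\<close> into functions there, and the \<open>k\<close>-th power of their product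
  is then a member of \<open>Den i V\<close>.\<close>

lemma fraction_in_C:
  assumes V: "openin T V" "i \<le> m" and L: "L \<in> H 1" "\<And>q. q \<in> V \<Longrightarrow> L (rep q) \<noteq> 0" and w: "w \<in> \<O> V"
  shows "fres (V \<inter> Ui i) (\<lambda>q. w q / (\<Prod>j\<in>{..m} - {i}. lc j (rep q) / L (rep q)) ^ k) \<in> C i V"
    (is "fres _ ?f \<in> _")
proof (rule C_I)
  define t where "t = fres V (\<lambda>q. Yi i (rep q) ^ k / L (rep q) ^ (m * k))"
  have "(\<lambda>v. L v ^ (m * k)) \<in> H (m * k)" using hom_power[OF L(1), of "m * k"] by simp
  then have t: "t \<in> Den i V" unfolding t_def using L(2) by (intro Den_I V) auto
  have prod: "(\<Prod>j\<in>{..m} - {i}. lc j (rep q) / L (rep q)) = Yi i (rep q) / L (rep q) ^ m" for q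
    using V(2) by (simp add: Yi_def prod_dividef)
  have teq: "t q = (\<Prod>j\<in>{..m} - {i}. lc j (rep q) / L (rep q)) ^ k" if "q \<in> V" for q
    using that by (simp add: t_def fres_def prod power_divide power_mult)
  have i: "i \<in> {..m}" using V by simp
  have t0: "t q \<noteq> 0" if "q \<in> V \<inter> Ui i" for q using Den_nz[OF V(1) i t] that by blast
  have VU: "openin T (V \<inter> Ui i)" "V \<inter> Ui i \<subseteq> V" using VUi[OF V(1)] by auto
  have tO: "t \<in> \<O> V" by (rule Den_O[OF V(1) i t])
  have "(\<lambda>q. inverse (fres (V \<inter> Ui i) t q)) \<in> \<O> (V \<inter> Ui i)"
    using t0 by (intro O_inverse VU O_res[OF V(1) VU tO]) (auto simp: fres_def)
  then have "(\<lambda>q. fres (V \<inter> Ui i) w q * inverse (fres (V \<inter> Ui i) t q)) \<in> \<O> (V \<inter> Ui i)"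
    by (intro O_mult VU O_res[OF V(1) VU w])
  moreover have "fres (V \<inter> Ui i) ?f = (\<lambda>q. fres (V \<inter> Ui i) w q * inverse (fres (V \<inter> Ui i) t q))"
    using teq by (auto simp: fres_def fun_eq_iff divide_inverse)
  ultimately show "fres (V \<inter> Ui i) ?f \<in> \<O> (V \<inter> Ui i)" by simp
  fix x assume x: "x \<in> V"
  have "fres (V \<inter> Ui i) ?f q * t q = w q" if "q \<in> V \<inter> Ui i" for q
    using t0[OF that] teq[of q] that by (simp add: fres_def)
  then show "\<exists>W t g. openin T W \<and> x \<in> W \<and> W \<subseteq> V \<and> t \<in> Den i W \<and> g \<in> \<O> W \<and>
      (\<forall>q\<in>W \<inter> Ui i. fres (V \<inter> Ui i) ?f q * t q = g q)"
    using V t w x by (intro exI[of _ V] exI[of _ t] exI[of _ w]) auto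
qed

text \<open>In the case where all \<open>y\<^sub>i\<close> vanish at \<open>x\<close>, the fraction
  is expanded by the \<open>M\<close>-th power of one \<open>y\<^sub>i\<close>. The
  \<open>j\<close>-th term of that power contains the \<open>e\<close>-th power of
  \<open>y\<^sub>j\<close>, which cancels \<open>y\<^sub>j\<close> from the denominator. The
  \<open>M\<close> additional factors \<open>y\<^sub>i\<close> below do no harm, as
  \<open>C j\<close> inverts \<open>y\<^sub>i\<close>.\<close>

lemma local_lift:
  assumes x: "x \<in> X" and G: "G \<in> H ((m + 1) * e)"
  shows "\<exists>V s. openin T V \<and> x \<in> V \<and> (\<forall>i\<in>{..m}. s i \<in> C i V) \<and>
    (\<forall>q\<in>V \<inter> Uall. (\<Sum>i\<in>{..m}. s i q) = G (rep q) / (\<Prod>j\<le>m. lc j (rep q)) ^ e)"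
proof -
  \<comment> \<open>Both cases are reduced to an identity between the functions
    \<open>lc j / L\<close>, for a linear form \<open>L\<close> that does not vanish at
    \<open>x\<close>, with all denominators raised to one common exponent \<open>k\<close>.\<close>
  have gen: ?thesis
    if L: "L \<in> H 1" "L (rep x) \<noteq> 0" and w: "\<And>i. i \<le> m \<Longrightarrow> w i \<in> \<O> (D L)"
      and sum: "\<And>q. \<lbrakk>q \<in> D L; q \<in> Uall\<rbrakk> \<Longrightarrow>
        (\<Sum>i\<le>m. w i q / (\<Prod>j\<in>{..m} - {i}. lc j (rep q) / L (rep q)) ^ k)
          = G (rep q) / L (rep q) ^ ((m + 1) * e) / (\<Prod>j\<le>m. lc j (rep q) / L (rep q)) ^ e" for L w k
  proof -
    have V: "openin T (D L)" by (rule D_open[OF L(1)])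
    define s where "s i = fres (D L \<inter> Ui i) (\<lambda>q. w i q / (\<Prod>j\<in>{..m} - {i}. lc j (rep q) / L (rep q)) ^ k)" for i
    have "s i \<in> C i (D L)" if "i \<le> m" for i
      unfolding s_def using L w[OF that] by (intro fraction_in_C V that) (auto simp: D_def)
    moreover have "(\<Sum>i\<in>{..m}. s i q) = G (rep q) / (\<Prod>j\<le>m. lc j (rep q)) ^ e" if q: "q \<in> D L \<inter> Uall" for q
    proof -
      have L0: "L (rep q) \<noteq> 0" using q by (auto simp: D_def)
      have "(\<Sum>i\<in>{..m}. s i q) = (\<Sum>i\<le>m. w i q / (\<Prod>j\<in>{..m} - {i}. lc j (rep q) / L (rep q)) ^ k)"
        using q by (intro sum.cong) (auto simp: s_def fres_def Uall_def)
      also have "\<dots> = G (rep q) / L (rep q) ^ ((m + 1) * e) / (\<Prod>j\<le>m. lc j (rep q) / L (rep q)) ^ e"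
        using sum q by blast
      also have "(\<Prod>j\<le>m. lc j (rep q) / L (rep q)) = (\<Prod>j\<le>m. lc j (rep q)) / L (rep q) ^ (m + 1)"
        by (simp add: prod_dividef)
      also have "\<dots> ^ e = (\<Prod>j\<le>m. lc j (rep q)) ^ e / L (rep q) ^ ((m + 1) * e)"
        by (simp only: power_divide power_mult)
      finally show ?thesis using L0 by simp
    qed
    ultimately show ?thesis using V x L(2) by (intro exI[of _ "D L"] exI[of _ s]) (auto simp: D_def)
  qed
  show ?thesis
  proof (cases "\<exists>i\<le>m. lc i (rep x) \<noteq> 0")
    case True
    then obtain i0 where i0: "i0 \<le> m" "lc i0 (rep x) \<noteq> 0" by blast
    let ?V = "D (lc i0)"
    have V: "openin T ?V" by (rule D_open[OF lc_hom])
    define w where "w i = (if i = i0 then fres ?V (\<lambda>q. G (rep q) / lc i0 (rep q) ^ ((m + 1) * e)) else (\<lambda>_. 0))" for i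
    show ?thesis
    proof (rule gen[of "lc i0" w e])
      show "lc i0 \<in> H 1" "lc i0 (rep x) \<noteq> 0" using lc_hom i0 by auto
      have "(\<lambda>v. lc i0 v ^ ((m + 1) * e)) \<in> H ((m + 1) * e)" using hom_power[OF lc_hom, of i0 "(m + 1) * e"] by simp
      from O_quot[OF V G this] have "fres ?V (\<lambda>q. G (rep q) / lc i0 (rep q) ^ ((m + 1) * e)) \<in> \<O> ?V"
        by (simp add: D_def)
      then show "w i \<in> \<O> ?V" for i using O_zero[OF V] by (simp add: w_def)
      fix q assume q: "q \<in> ?V" "q \<in> Uall"
      then have L0: "lc i0 (rep q) \<noteq> 0" by (simp add: D_def)
      let ?\<eta> = "\<lambda>j. lc j (rep q) / lc i0 (rep q)"
      have "(\<Prod>j\<le>m. ?\<eta> j) = ?\<eta> i0 * (\<Prod>j\<in>{..m} - {i0}. ?\<eta> j)" using i0 by (intro prod.remove) auto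
      then have "(\<Prod>j\<le>m. ?\<eta> j) = (\<Prod>j\<in>{..m} - {i0}. ?\<eta> j)" using L0 by simp
      moreover have "(\<Sum>i\<le>m. w i q / (\<Prod>j\<in>{..m} - {i}. ?\<eta> j) ^ e)
        = (\<Sum>i\<le>m. if i = i0 then G (rep q) / lc i0 (rep q) ^ ((m + 1) * e) / (\<Prod>j\<in>{..m} - {i0}. ?\<eta> j) ^ e else 0)"
        using q by (intro sum.cong) (auto simp: w_def fres_def)
      ultimately show "(\<Sum>i\<le>m. w i q / (\<Prod>j\<in>{..m} - {i}. ?\<eta> j) ^ e)
        = G (rep q) / lc i0 (rep q) ^ ((m + 1) * e) / (\<Prod>j\<le>m. ?\<eta> j) ^ e"
        using i0 by simp
    qed
  next
    case False
    obtain c where c: "c \<le> n" "lc c (rep x) \<noteq> 0" using X_lc_nz[OF x] by blast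
    then have "c > m" using False by (meson not_le)
    define i0 where "i0 = c - (m + 1)"
    have i0: "i0 \<le> m" "c = m + 1 + i0" using c \<open>c > m\<close> by (auto simp: i0_def)
    let ?V = "D (lc c)"
    have V: "openin T ?V" by (rule D_open[OF lc_hom])
    define \<eta> where "\<eta> j = fres ?V (\<lambda>q. lc j (rep q) / lc c (rep q))" for j
    have \<eta>O: "\<eta> j \<in> \<O> ?V" for j using O_quot[OF V lc_hom lc_hom, of c j] unfolding \<eta>_def by (simp add: D_def)
    have \<eta>: "\<eta> j q = lc j (rep q) / lc c (rep q)" if "q \<in> ?V" for j q using that by (simp add: \<eta>_def fres_def)
    \<comment> \<open>Divided by the square of coordinate \<open>c\<close>, the equation of the
      quadric expresses \<open>\<eta> i0\<close> as the sum of these \<open>b j\<close> over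
      \<open>j \<noteq> i0\<close>.\<close>
    define b where "b j p = - (\<eta> (m + 1 + j) p * \<eta> j p)" for j p
    have bO: "b j \<in> \<O> ?V" for j unfolding b_def by (intro O_uminus O_mult V \<eta>O)
    have "\<exists>M cc. (\<forall>j\<in>{..m} - {i0}. cc j \<in> \<O> ?V) \<and>
        (\<forall>q\<in>?V. (\<Sum>j\<in>{..m} - {i0}. b j q) ^ M = (\<Sum>j\<in>{..m} - {i0}. cc j q * b j q ^ e))"
      using bO by (intro power_sum_in_ideal[OF V]) auto
    then obtain M cc where "\<forall>j\<in>{..m} - {i0}. cc j \<in> \<O> ?V"
      "\<forall>q\<in>?V. (\<Sum>j\<in>{..m} - {i0}. b j q) ^ M = (\<Sum>j\<in>{..m} - {i0}. cc j q * b j q ^ e)"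
      by (elim exE conjE) (rule that)
    then have cc: "\<And>j. j \<in> {..m} - {i0} \<Longrightarrow> cc j \<in> \<O> ?V"
      "\<And>q. q \<in> ?V \<Longrightarrow> (\<Sum>j\<in>{..m} - {i0}. b j q) ^ M = (\<Sum>j\<in>{..m} - {i0}. cc j q * b j q ^ e)"
      by simp_all
    have rel: "\<eta> i0 q = (\<Sum>j\<in>{..m} - {i0}. b j q)" if q: "q \<in> ?V" for q
    proof -
      have L0: "lc c (rep q) \<noteq> 0" and qX: "q \<in> X" using q by (auto simp: D_def)
      have "0 = (\<Sum>i\<le>m. lc i (rep q) * lc (m + 1 + i) (rep q)) / (lc c (rep q) * lc c (rep q))"
        using X_form[OF qX] by simp
      also have "\<dots> = (\<Sum>i\<le>m. \<eta> i q * \<eta> (m + 1 + i) q)"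
        unfolding sum_divide_distrib using \<eta>[OF q] by simp
      also have "\<dots> = \<eta> i0 q * \<eta> (m + 1 + i0) q + (\<Sum>i\<in>{..m} - {i0}. \<eta> i q * \<eta> (m + 1 + i) q)"
        using i0 by (intro sum.remove) auto
      also have "\<eta> (m + 1 + i0) q = 1" using \<eta>[OF q] i0 L0 by simp
      finally show ?thesis by (simp add: b_def sum_negf eq_neg_iff_add_eq_0 mult.commute)
    qed
    define \<gamma> where "\<gamma> = fres ?V (\<lambda>q. G (rep q) / lc c (rep q) ^ ((m + 1) * e))"
    have "(\<lambda>v. lc c v ^ ((m + 1) * e)) \<in> H ((m + 1) * e)" using hom_power[OF lc_hom, of c "(m + 1) * e"] by simp
    from O_quot[OF V G this] have \<gamma>O: "\<gamma> \<in> \<O> ?V" unfolding \<gamma>_def by (simp add: D_def)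
    \<comment> \<open>Only \<open>\<eta> i0\<close> needs the exponent \<open>e + M\<close>. The
      product over the indices other than \<open>j\<close> and \<open>i0\<close> compensates for
      raising those coordinates to it as well.\<close>
    define w where "w j q = (if j = i0 then 0 else
       \<gamma> q * cc j q * fres ?V (\<lambda>q. (- \<eta> (m + 1 + j) q) ^ e) q * fres ?V (\<lambda>q. (\<Prod>l\<in>{..m} - {j, i0}. \<eta> l q) ^ M) q)" for j q
    have prodO: "fres ?V (\<lambda>q. (\<Prod>l\<in>A. \<eta> l q) ^ M) \<in> \<O> ?V" for A
    proof -
      have "fres ?V (\<lambda>q. \<Prod>l\<in>A. \<eta> l q) \<in> \<O> ?V"
      proof (induction A rule: infinite_finite_induct)
        case (insert a A)
        have "fres ?V (\<lambda>q. \<Prod>l\<in>insert a A. \<eta> l q) = (\<lambda>q. \<eta> a q * fres ?V (\<lambda>q. \<Prod>l\<in>A. \<eta> l q) q)"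
          using insert.hyps by (auto simp: fres_def \<eta>_def)
        then show ?case using O_mult[OF V \<eta>O insert.IH] by simp
      qed (use O_const[OF V, of 1] in auto)
      from O_power[OF V this, of M] show ?thesis by (simp add: fres_def cong: if_cong)
    qed
    show ?thesis
    proof (rule gen[of "lc c" w "e + M"])
      show "lc c \<in> H 1" "lc c (rep x) \<noteq> 0" using lc_hom c by auto
      fix i assume i: "i \<le> m"
      show "w i \<in> \<O> ?V"
      proof (cases "i = i0")
        case True
        then show ?thesis using O_zero[OF V] by (simp add: w_def[abs_def])
      next
        case False
        then have "cc i \<in> \<O> ?V" using cc(1) i by simp
        then have "(\<lambda>q. \<gamma> q * cc i q * fres ?V (\<lambda>q. (- \<eta> (m + 1 + i) q) ^ e) q *
            fres ?V (\<lambda>q. (\<Prod>l\<in>{..m} - {i, i0}. \<eta> l q) ^ M) q) \<in> \<O> ?V"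
          by (intro O_mult V \<gamma>O O_power[OF V O_uminus[OF V \<eta>O]] prodO)
        then show ?thesis using False by (simp add: w_def[abs_def])
      qed
    next
      fix q assume q: "q \<in> ?V" "q \<in> Uall"
      have L0: "lc c (rep q) \<noteq> 0" and qX: "q \<in> X" using q by (auto simp: D_def)
      have nz: "\<eta> j q \<noteq> 0" if "j \<le> m" for j using \<eta>[OF q(1)] q(2) that L0 by (simp add: Uall_iff)
      let ?\<Pi> = "\<Prod>j\<le>m. \<eta> j q"
      have \<Pi>0: "?\<Pi> \<noteq> 0" using nz by simp
      have summand: "w j q / (\<Prod>l\<in>{..m} - {j}. \<eta> l q) ^ (e + M) = \<gamma> q * (cc j q * b j q ^ e) / (?\<Pi> ^ e * \<eta> i0 q ^ M)"
        if j: "j \<in> {..m} - {i0}" for j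
      proof -
        define A where "A = (\<Prod>l\<in>{..m} - {j, i0}. \<eta> l q)"
        have "(\<Prod>l\<in>{..m} - {j}. \<eta> l q) = \<eta> i0 q * (\<Prod>l\<in>{..m} - {j} - {i0}. \<eta> l q)"
          using j i0 by (intro prod.remove) auto
        also have "{..m} - {j} - {i0} = {..m} - {j, i0}" by auto
        finally have 1: "(\<Prod>l\<in>{..m} - {j}. \<eta> l q) = \<eta> i0 q * A" by (simp add: A_def)
        have 2: "?\<Pi> = \<eta> j q * (\<eta> i0 q * A)"
          unfolding 1[symmetric] using j by (intro prod.remove) auto
        have A0: "A \<noteq> 0" using \<Pi>0 2 by auto
        have n0: "\<eta> i0 q \<noteq> 0" "\<eta> j q \<noteq> 0" using nz i0 j by auto
        have b: "b j q ^ e = (- \<eta> (m + 1 + j) q) ^ e * \<eta> j q ^ e" by (simp add: b_def flip: power_mult_distrib)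
        have "w j q = \<gamma> q * cc j q * (- \<eta> (m + 1 + j) q) ^ e * A ^ M"
          using j q by (simp add: w_def A_def fres_def)
        then show ?thesis unfolding 1 2 b using A0 n0
          by (simp add: power_add power_mult_distrib field_simps)
      qed
      have "(\<Sum>i\<le>m. w i q / (\<Prod>j\<in>{..m} - {i}. lc j (rep q) / lc c (rep q)) ^ (e + M))
        = (\<Sum>i\<le>m. w i q / (\<Prod>j\<in>{..m} - {i}. \<eta> j q) ^ (e + M))" using \<eta>[OF q(1)] by simp
      also have "\<dots> = (\<Sum>i\<in>{..m} - {i0}. w i q / (\<Prod>j\<in>{..m} - {i}. \<eta> j q) ^ (e + M))"
        by (intro sum.mono_neutral_right) (auto simp: w_def)
      also have "\<dots> = (\<Sum>i\<in>{..m} - {i0}. \<gamma> q * (cc i q * b i q ^ e) / (?\<Pi> ^ e * \<eta> i0 q ^ M))"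
        by (intro sum.cong refl summand)
      also have "\<dots> = \<gamma> q * (\<Sum>i\<in>{..m} - {i0}. cc i q * b i q ^ e) / (?\<Pi> ^ e * \<eta> i0 q ^ M)"
        by (simp only: sum_distrib_left sum_divide_distrib)
      also have "(\<Sum>i\<in>{..m} - {i0}. cc i q * b i q ^ e) = \<eta> i0 q ^ M"
        using cc(2)[OF q(1)] rel[OF q(1)] by simp
      also have "\<gamma> q * \<eta> i0 q ^ M / (?\<Pi> ^ e * \<eta> i0 q ^ M) = \<gamma> q / ?\<Pi> ^ e" using nz[OF i0(1)] by simp
      also have "\<dots> = G (rep q) / lc c (rep q) ^ ((m + 1) * e) / (\<Prod>j\<le>m. lc j (rep q) / lc c (rep q)) ^ e"
        using q \<eta>[OF q(1)] by (simp add: \<gamma>_def fres_def)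
      finally show "(\<Sum>i\<le>m. w i q / (\<Prod>j\<in>{..m} - {i}. lc j (rep q) / lc c (rep q)) ^ (e + M))
        = G (rep q) / lc c (rep q) ^ ((m + 1) * e) / (\<Prod>j\<le>m. lc j (rep q) / lc c (rep q)) ^ e" .
    qed
  qed
qed

end

section \<open>Laurent expansions in two charts\<close>

text \<open>Vandermonde's identity for \<open>k = q + (k - q)\<close>: the binomials
  \<open>q choose j\<close> with \<open>0 < j < q\<close> are divisible by the characteristic, and
  the term \<open>j = 0\<close> vanishes because \<open>k - q < q - 1\<close>.\<close>

lemma choose_prime_power_eq_0:
  assumes p: "prime CHAR('k::field)" and q: "q = CHAR('k) ^ s" and r: "q \<le> k" "k \<le> 2 * q - 2"
  shows "of_nat (k choose (q - 1)) = (0 :: 'k)"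
proof -
  let ?p = "CHAR('k)"
  have q0: "q > 0" using p q by (simp add: prime_gt_0_nat)
  have dvd: "?p dvd (q choose j)" if j: "0 < j" "j < q" for j
  proof (rule ccontr)
    assume "\<not> ?p dvd (q choose j)"
    then have "coprime (?p ^ s) (q choose j)" using p by (simp add: prime_imp_coprime)
    \<comment> \<open>From \<open>j * (q choose j) = q * ((q - 1) choose (j - 1))\<close>.\<close>
    moreover have "?p ^ s dvd j * (q choose j)"
      using times_binomial_minus1_eq[OF j(1), of q] q by simp
    ultimately have "?p ^ s dvd j" by (simp add: coprime_dvd_mult_left_iff)
    then show False using j q by (auto dest: dvd_imp_le)
  qed
  have "k choose (q - 1) = (\<Sum>j\<le>q - 1. (q choose j) * ((k - q) choose (q - 1 - j)))"
    using vandermonde[of q "k - q" "q - 1"] r by simp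
  moreover have "?p dvd (\<Sum>j\<le>q - 1. (q choose j) * ((k - q) choose (q - 1 - j)))"
  proof (rule dvd_sum)
    fix j assume "j \<in> {..q - 1}"
    then have j: "j < q" using q0 by auto
    show "?p dvd (q choose j) * ((k - q) choose (q - 1 - j))"
    proof (cases "j = 0")
      case True
      have "(k - q) choose (q - 1) = 0" using r q0 by (intro binomial_eq_0) linarith
      then show ?thesis by (simp only: True diff_zero mult_zero_right dvd_0_right)
    next
      case False
      then show ?thesis using dvd[of j] j by simp
    qed
  qed
  ultimately have "?p dvd (k choose (q - 1))" by (simp only:)
  then show ?thesis by (simp only: of_nat_eq_0_iff_char_dvd)
qed

lemma powi_sum: "(x::'k::field) \<noteq> 0 \<Longrightarrow> x powi (\<Sum>j\<in>A. f j) = (\<Prod>j\<in>A. x powi f j)"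
  by (induction A rule: infinite_finite_induct) (auto simp: power_int_add)

context even_quadric
begin

section \<open>Restriction of regular functions to coordinate charts\<close>

text \<open>The vector behind \<open>P c z\<close> is polynomial in \<open>z\<close>, so quotients
  of forms pull back to quotients of polynomials; the scalar by which \<open>rep\<close> may differ
  from that vector cancels by homogeneity.\<close>

lemma regular_chart:
  assumes c: "c \<le> n" and f: "f \<in> \<O> V" and V: "\<And>z. z \<in> box J B \<Longrightarrow> P c z \<in> V"
  shows "regular_on_box J B (\<lambda>z. f (P c z))"
  unfolding regular_on_box_def
proof
  fix z :: "nat \<Rightarrow> 'k" assume z: "z \<in> box J B"
  obtain d g h where gh: "g \<in> H d" "h \<in> H d" "P c z \<in> D h" "D h \<subseteq> V"
    "\<And>q. q \<in> D h \<Longrightarrow> f q = g (rep q) / h (rep q)"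
    by (rule O_E[OF f V[OF z]]) (rule that)
  have "f (P c y) * h (vec (cu c y)) = g (vec (cu c y))" if y: "h (vec (cu c y)) \<noteq> 0" for y
  proof -
    have "P c y \<in> D h" using P_in_D[OF c gh(2)] y by simp
    then have eq: "f (P c y) = g (rep (P c y)) / h (rep (P c y))" by (rule gh(5))
    obtain b where b: "b \<noteq> 0" "rep (P c y) = (\<lambda>i. b * vec (cu c y) i)"
      using rep_pt[of "vec (cu c y)"] by (elim exE conjE) (rule that, simp_all add: P_def)
    show ?thesis unfolding eq using y b(1)
      by (simp add: b(2) hom_homogeneous[OF gh(1)] hom_homogeneous[OF gh(2)])
  qed
  moreover have "h (vec (cu c z)) \<noteq> 0" using P_in_D[OF c gh(2)] gh(3) by simp
  ultimately show "\<exists>g\<in>polyfun. \<exists>h\<in>polyfun. h z \<noteq> 0 \<and> (\<forall>y\<in>box J B. h y \<noteq> 0 \<longrightarrow> f (P c y) * h y = g y)"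
    by (intro bexI[of _ "\<lambda>z. g (vec (cu c z))"] bexI[of _ "\<lambda>z. h (vec (cu c z))"]
        hom_vec_polyfun[OF gh(1)] hom_vec_polyfun[OF gh(2)]) simp
qed

lemma rep_P:
  obtains b where "b \<noteq> 0" "rep (P c z) = (\<lambda>i. b * vec (cu c z) i)"
    "\<And>j. j \<le> n \<Longrightarrow> lc j (rep (P c z)) = b * cu c z j"
proof -
  obtain b where b: "b \<noteq> 0" "rep (P c z) = (\<lambda>i. b * vec (cu c z) i)"
    using rep_pt[of "vec (cu c z)"] by (elim exE conjE) (rule that, simp_all add: P_def)
  show ?thesis by (rule that[OF b]) (simp only: b(2) lc_scale lc_cu)
qed

lemma P_in_Ui:
  assumes "c \<le> n" "\<And>j. \<lbrakk>j \<le> m; j \<noteq> i\<rbrakk> \<Longrightarrow> cu c z j \<noteq> 0" shows "P c z \<in> Ui i"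
proof -
  obtain b where b: "b \<noteq> 0" "rep (P c z) = (\<lambda>i. b * vec (cu c z) i)"
    "\<And>j. j \<le> n \<Longrightarrow> lc j (rep (P c z)) = b * cu c z j" by (rule rep_P) (rule that)
  then show ?thesis unfolding Ui_iff using P_in_X[OF assms(1)] assms(2) by simp
qed

text \<open>Free coordinates in the charts \<open>y\<^sub>0 = 1\<close> and
  \<open>y\<^sub>1 = 1\<close>, on the slice where \<open>x\<^sub>3, ..., x\<^sub>m\<close> vanish.
  For \<open>Ja\<close> they are \<open>y\<^sub>1, ..., y\<^sub>m, x\<^sub>1, x\<^sub>2\<close>,
  with \<open>x\<^sub>0\<close> determined by the equation; for \<open>Jb\<close> they are
  \<open>y\<^sub>0, y\<^sub>2, ..., y\<^sub>m, x\<^sub>0, x\<^sub>2\<close>, with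
  \<open>x\<^sub>1\<close> determined.\<close>

definition Ja :: "nat set" where "Ja = {1..m} \<union> {m + 2, m + 3}"
definition Jb :: "nat set" where "Jb = {0} \<union> {2..m} \<union> {m + 1, m + 3}"

lemma prod_Ja: "m \<ge> 2 \<Longrightarrow> (\<Prod>j\<in>Ja. f j :: 'a::comm_monoid_mult) = f 1 * (f 2 * ((\<Prod>j=3..m. f j) * (f (m + 2) * f (m + 3))))"
proof -
  assume m: "m \<ge> 2"
  have "Ja = insert 1 (insert 2 ({3..m} \<union> {m + 2, m + 3}))" using m by (auto simp: Ja_def)
  moreover have "(\<Prod>j\<in>{3..m} \<union> {m + 2, m + 3}. f j) = (\<Prod>j=3..m. f j) * (\<Prod>j\<in>{m + 2, m + 3}. f j)"
    by (intro prod.union_disjoint) auto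
  ultimately show ?thesis using m by simp
qed

lemma prod_Jb: "m \<ge> 2 \<Longrightarrow> (\<Prod>j\<in>Jb. f j :: 'a::comm_monoid_mult) = f 0 * (f 2 * ((\<Prod>j=3..m. f j) * (f (m + 1) * f (m + 3))))"
proof -
  assume m: "m \<ge> 2"
  have "Jb = insert 0 (insert 2 ({3..m} \<union> {m + 1, m + 3}))" using m by (auto simp: Jb_def)
  moreover have "(\<Prod>j\<in>{3..m} \<union> {m + 1, m + 3}. f j) = (\<Prod>j=3..m. f j) * (\<Prod>j\<in>{m + 1, m + 3}. f j)"
    by (intro prod.union_disjoint) auto
  ultimately show ?thesis using m by simp
qed

lemma sum_Jb: "m \<ge> 2 \<Longrightarrow> (\<Sum>j\<in>Jb. f j :: int) = f 0 + (f 2 + ((\<Sum>j=3..m. f j) + (f (m + 1) + f (m + 3))))"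
proof -
  assume m: "m \<ge> 2"
  have "Jb = insert 0 (insert 2 ({3..m} \<union> {m + 1, m + 3}))" using m by (auto simp: Jb_def)
  moreover have "(\<Sum>j\<in>{3..m} \<union> {m + 1, m + 3}. f j) = (\<Sum>j=3..m. f j) + (\<Sum>j\<in>{m + 1, m + 3}. f j)"
    by (intro sum.union_disjoint) auto
  ultimately show ?thesis using m by simp
qed

lemma cu_0:
  assumes m: "m \<ge> 2" and z: "z \<in> box Ja Ja"
  shows "cu 0 z 0 = 1" "\<And>j. \<lbrakk>j \<noteq> 0; j \<noteq> m + 1\<rbrakk> \<Longrightarrow> cu 0 z j = z j"
    "cu 0 z (m + 1) = - (z 1 * z (m + 2) + z 2 * z (m + 3))"
proof -
  have "(\<Sum>i\<in>{..m} - {0}. z i * z (m + 1 + i)) = (\<Sum>i\<in>{1, 2}. z i * z (m + 1 + i))"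
  proof (rule sum.mono_neutral_right)
    show "\<forall>i\<in>{..m} - {0} - {1, 2}. z i * z (m + 1 + i) = 0"
    proof
      fix i assume "i \<in> {..m} - {0} - {1, 2}"
      then have "m + 1 + i \<notin> Ja" by (auto simp: Ja_def)
      then have "z (m + 1 + i) = 0" using z by (simp add: box_def)
      then show "z i * z (m + 1 + i) = 0" by simp
    qed
  qed (use m in auto)
  then show "cu 0 z (m + 1) = - (z 1 * z (m + 2) + z 2 * z (m + 3))"
    by (simp add: cu_def conj_def pair_def numeral_2_eq_2 numeral_3_eq_3)
qed (auto simp: cu_def conj_def)

text \<open>The exponent of \<open>F\<close> as a Laurent monomial in the chart
  \<open>y\<^sub>0 = 1\<close>.\<close>

definition \<beta> :: "nat \<Rightarrow> nat \<Rightarrow> int" where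
  "\<beta> q j = (if j \<in> {1..m} then -1 else if j = m + 2 \<or> j = m + 3 then int (q - 1) else 0)"

text \<open>The transition from the chart \<open>y\<^sub>0 = 1\<close> to the chart
  \<open>y\<^sub>1 = 1\<close>: all coordinates are divided by \<open>y\<^sub>1\<close>.\<close>

definition \<zeta> :: "(nat \<Rightarrow> 'k) \<Rightarrow> nat \<Rightarrow> 'k" where
  "\<zeta> z j = (if j \<in> Jb then cu 0 z j / z 1 else 0)"

lemma \<zeta>_chart:
  assumes m: "m \<ge> 2" and z: "z \<in> box Ja Ja"
  shows "P 1 (\<zeta> z) = P 0 z" "\<zeta> z \<in> box Jb {2..m}"
proof -
  have z1: "z j \<noteq> 0" if "j \<in> Ja" for j using z that by (simp add: box_def)
  obtain b where b: "b \<noteq> 0" "rep (P 0 z) = (\<lambda>i. b * vec (cu 0 z) i)"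
    "\<And>j. j \<le> n \<Longrightarrow> lc j (rep (P 0 z)) = b * cu 0 z j" by (rule rep_P) (rule that)
  have lc1: "lc 1 (rep (P 0 z)) = b * z 1" using b(3)[of 1] cu_0(2)[OF m z, of 1] m by simp
  have "z 1 \<noteq> 0" using z1 m by (simp add: Ja_def)
  show "P 1 (\<zeta> z) = P 0 z"
  proof (rule point_in_chart)
    show "P 0 z \<in> X" by (rule P_in_X) simp
    show "lc 1 (rep (P 0 z)) \<noteq> 0" unfolding lc1 using b(1) \<open>z 1 \<noteq> 0\<close> by simp
    fix j assume j: "j \<le> n" "j \<noteq> 1" "j \<noteq> conj 1"
    show "\<zeta> z j = lc j (rep (P 0 z)) / lc 1 (rep (P 0 z))"
    proof (cases "j \<in> Jb")
      case True
      then show ?thesis unfolding lc1 b(3)[OF j(1)] using b(1) by (simp add: \<zeta>_def)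
    next
      case False
      \<comment> \<open>The indices that remain here belong to
        \<open>x\<^sub>3, ..., x\<^sub>m\<close>, which are zero in both descriptions of the
        point.\<close>
      have "j \<noteq> m + 2" using j(3) m by (simp add: conj_def)
      then have "j \<notin> Ja" "j \<noteq> 0" "j \<noteq> m + 1" using False j(2) by (auto simp: Ja_def Jb_def)
      then have "cu 0 z j = 0" using cu_0(2)[OF m z] z by (simp add: box_def)
      then show ?thesis unfolding b(3)[OF j(1)] using False by (simp add: \<zeta>_def)
    qed
  qed simp
  have "\<zeta> z j \<noteq> 0" if "j \<in> {2..m}" for j
  proof -
    have "j \<in> Ja" "j \<in> Jb" "j \<noteq> 0" "j \<noteq> m + 1" using that by (auto simp: Ja_def Jb_def)
    then show ?thesis using cu_0(2)[OF m z, of j] z1 \<open>z 1 \<noteq> 0\<close> by (simp add: \<zeta>_def)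
  qed
  then show "\<zeta> z \<in> box Jb {2..m}" by (auto simp: box_def \<zeta>_def)
qed

text \<open>Re-expanding a Laurent monomial of the chart \<open>y\<^sub>1 \<noteq> 0\<close> in the coordinates of the chart
  \<open>y\<^sub>0 \<noteq> 0\<close>, the exponent \<open>\<beta> q\<close> can only occur with the coefficient \<open>a choose (q - 1)\<close> for some
  \<open>a\<close> between \<open>q\<close> and \<open>2 q - 2\<close>, which vanishes in \<open>K\<close>.\<close>

lemma monomial_transition:
  assumes m: "m \<ge> 2" and p: "prime CHAR('k)" and q: "q = CHAR('k) ^ s" "q \<ge> m + 2"
    and \<alpha>: "\<alpha> \<in> exponents Jb {2..m}"
  shows "(\<lambda>z. zpow Jb \<alpha> (\<zeta> z)) \<in> lspan (zpow Ja) (exponents Ja Ja - {\<beta> q}) (box Ja Ja)"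
proof -
  \<comment> \<open>The exponents of \<open>x\<^sub>0\<close> and \<open>x\<^sub>2\<close> and the
    total degree; only \<open>x\<^sub>0\<close> becomes a sum of two terms in the other chart, so
    \<open>a\<close> is the exponent of the binomial.\<close>
  define a where "a = nat (\<alpha> (m + 1))"
  define b where "b = nat (\<alpha> (m + 3))"
  define S where "S = (\<Sum>j\<in>Jb. \<alpha> j)"
  have ge0: "\<alpha> 0 \<ge> 0" "\<alpha> (m + 1) \<ge> 0" "\<alpha> (m + 3) \<ge> 0" using \<alpha> by (auto simp: exponents_def Jb_def)
  then have ab: "\<alpha> (m + 1) = int a" "\<alpha> (m + 3) = int b" by (simp_all add: a_def b_def)
  \<comment> \<open>The exponent of the \<open>k\<close>-th term of the expansion of
    \<open>(y\<^sub>1 x\<^sub>1 + y\<^sub>2 x\<^sub>2)\<^sup>a\<close>; the summand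
    \<open>- S\<close> at \<open>y\<^sub>1\<close> comes from dividing all coordinates by
    \<open>y\<^sub>1\<close>.\<close>
  define \<gamma> where "\<gamma> k j = (if j = 1 then int k - S else if j = 2 then \<alpha> 2 + int (a - k)
     else if j \<in> {3..m} then \<alpha> j else if j = m + 2 then int k else if j = m + 3 then int (a - k) + int b else 0)" for k j
  have \<gamma>: "\<gamma> k \<in> exponents Ja Ja" for k
    using m by (auto simp: exponents_def \<gamma>_def Ja_def)
  have coeff: "of_nat (a choose k) = (0 :: 'k)" if k: "k \<le> a" "\<gamma> k = \<beta> q" for k
  proof -
    have q2: "q \<ge> 2" using q(2) by simp
    have "\<gamma> k (m + 2) = \<beta> q (m + 2)" "\<gamma> k (m + 3) = \<beta> q (m + 3)" "\<gamma> k 1 = \<beta> q 1" "\<gamma> k 2 = \<beta> q 2"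
      using k(2) by simp_all
    then have 1: "int k = int (q - 1)" "int (a - k) + int b = int (q - 1)" "int k - S = -1" "\<alpha> 2 + int (a - k) = -1"
      using m by (simp_all add: \<gamma>_def \<beta>_def)
    have "\<alpha> j = -1" if "j \<in> {3..m}" for j
    proof -
      have "\<gamma> k j = \<beta> q j" using k(2) by simp
      then show ?thesis using that by (simp add: \<gamma>_def \<beta>_def)
    qed
    then have "(\<Sum>j=3..m. \<alpha> j) = - (int m - 2)" using m by simp
    then have "S = \<alpha> 0 + (\<alpha> 2 + (- (int m - 2) + (int a + int b)))" unfolding S_def sum_Jb[OF m] ab by simp
    \<comment> \<open>The comparison of exponents gives \<open>k = q - 1\<close>,
      \<open>a + b = 2 * q - 2\<close> and \<open>\<alpha> 0 + b = m\<close>. As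
      \<open>\<alpha> 0\<close> and \<open>b\<close> are nonnegative, \<open>b\<close> lies between
      0 and \<open>m\<close>, and \<open>q \<ge> m + 2\<close> then yields
      \<open>q \<le> a\<close>.\<close>
    then have "q \<le> a" "a \<le> 2 * q - 2" "k = q - 1" using 1 k(1) q(2) q2 ge0(1) by linarith+
    then show ?thesis using choose_prime_power_eq_0[OF p q(1)] by simp
  qed
  have expand: "zpow Jb \<alpha> (\<zeta> z) = (\<Sum>k\<le>a. ((-1) ^ a * of_nat (a choose k)) * zpow Ja (\<gamma> k) z)"
    if z: "z \<in> box Ja Ja" for z
  proof -
    have nz: "z 1 \<noteq> 0" "z 2 \<noteq> 0" using z m by (auto simp: box_def Ja_def)
    define R where "R = (\<Prod>j=3..m. z j powi \<alpha> j)"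
    have cuR: "(\<Prod>j=3..m. cu 0 z j powi \<alpha> j) = R" unfolding R_def using cu_0(2)[OF m z] by (intro prod.cong) auto
    have "zpow Jb \<alpha> (\<zeta> z) = (\<Prod>j\<in>Jb. cu 0 z j powi \<alpha> j * z 1 powi (- \<alpha> j))"
      unfolding zpow_def
      by (intro prod.cong refl) (simp add: \<zeta>_def power_int_divide_distrib power_int_minus divide_inverse power_int_mult_distrib power_int_inverse)
    also have "\<dots> = (\<Prod>j\<in>Jb. cu 0 z j powi \<alpha> j) * z 1 powi (- S)"
      unfolding prod.distrib S_def using nz(1)
      by (simp add: sum_negf flip: powi_sum)
    also have "(\<Prod>j\<in>Jb. cu 0 z j powi \<alpha> j) = z 2 powi \<alpha> 2 * (R * ((- (z 1 * z (m + 2) + z 2 * z (m + 3))) ^ a * z (m + 3) ^ b))"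
    proof -
      have "cu 0 z 2 = z 2" "cu 0 z (m + 3) = z (m + 3)" using cu_0(2)[OF m z] m by auto
      then show ?thesis
        unfolding prod_Jb[OF m] cuR ab cu_0(1)[OF m z] cu_0(3)[OF m z]
        by (simp only: power_int_of_nat power_int_1_left mult_1)
    qed
    also have "(- (z 1 * z (m + 2) + z 2 * z (m + 3))) ^ a
       = (\<Sum>k\<le>a. (-1) ^ a * of_nat (a choose k) * (z 1 * z (m + 2)) ^ k * (z 2 * z (m + 3)) ^ (a - k))"
      unfolding power_minus[of "z 1 * z (m + 2) + z 2 * z (m + 3)"] binomial_ring by (simp only: sum_distrib_left mult.assoc)
    also have "z 2 powi \<alpha> 2 * (R * (\<dots> * z (m + 3) ^ b)) * z 1 powi (- S)
       = (\<Sum>k\<le>a. z 2 powi \<alpha> 2 * (R * (((-1) ^ a * of_nat (a choose k) * (z 1 * z (m + 2)) ^ k * (z 2 * z (m + 3)) ^ (a - k)) * z (m + 3) ^ b)) * z 1 powi (- S))"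
      by (simp only: sum_distrib_left sum_distrib_right)
    also have "\<dots> = (\<Sum>k\<le>a. ((-1) ^ a * of_nat (a choose k)) * zpow Ja (\<gamma> k) z)"
    proof (intro sum.cong refl)
      fix k
      have "(\<Prod>j=3..m. z j powi \<gamma> k j) = R" unfolding R_def by (intro prod.cong) (auto simp: \<gamma>_def)
      moreover have "\<gamma> k 1 = - S + int k" "\<gamma> k 2 = \<alpha> 2 + int (a - k)" "\<gamma> k (m + 2) = int k" "\<gamma> k (m + 3) = int (a - k + b)"
        using m by (auto simp: \<gamma>_def)
      ultimately have "zpow Ja (\<gamma> k) z = z 1 powi (- S + int k) * (z 2 powi (\<alpha> 2 + int (a - k)) * (R * (z (m + 2) powi int k * z (m + 3) powi (int (a - k + b)))))"
        unfolding zpow_def prod_Ja[OF m] by (simp only:)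
      also have "\<dots> = (z 1 powi (- S) * z 1 ^ k) * ((z 2 powi \<alpha> 2 * z 2 ^ (a - k)) * (R * (z (m + 2) ^ k * (z (m + 3) ^ (a - k) * z (m + 3) ^ b))))"
        using nz by (simp only: power_int_add power_int_of_nat power_add simp_thms)
      finally show "z 2 powi \<alpha> 2 * (R * (((-1) ^ a * of_nat (a choose k) * (z 1 * z (m + 2)) ^ k * (z 2 * z (m + 3)) ^ (a - k)) * z (m + 3) ^ b)) * z 1 powi (- S)
          = ((-1) ^ a * of_nat (a choose k)) * zpow Ja (\<gamma> k) z"
        by (simp only: power_mult_distrib mult_ac)
    qed
    finally show ?thesis .
  qed
  show ?thesis
  proof (rule lspan_cong[OF lspan_sum expand])
    fix k assume k: "k \<in> {..a}"
    show "(\<lambda>z :: nat \<Rightarrow> 'k. ((-1) ^ a * of_nat (a choose k)) * zpow Ja (\<gamma> k) z) \<in> lspan (zpow Ja) (exponents Ja Ja - {\<beta> q}) (box Ja Ja)"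
    proof (cases "\<gamma> k = \<beta> q")
      case True
      then have "of_nat (a choose k) = (0 :: 'k)" using coeff k by simp
      then show ?thesis by (simp add: lspan_zero)
    next
      case False
      then show ?thesis using \<gamma> by (intro lspan_base) simp
    qed
  qed
qed

section \<open>The function without a global decomposition\<close>

text \<open>The numerator of \<open>F\<close> over the common denominator
  \<open>(y\<^sub>0 ... y\<^sub>m)\<^sup>e\<close>, the shape that \<open>local_lift\<close>
  expects; hence the factors \<open>y\<^sub>j\<close> with exponent \<open>e - 1\<close> for
  \<open>j > 0\<close>.\<close>

definition numer :: "nat \<Rightarrow> nat \<Rightarrow> (nat \<Rightarrow> 'k) \<Rightarrow> 'k" where
  "numer q e v = (lc (m + 2) v * lc (m + 3) v) ^ (q - 1) * (\<Prod>j=1..m. lc j v) ^ (e - 1)"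

lemma numer_hom:
  assumes "q \<ge> m + 2" "e = 2 * q - m - 2" shows "numer q e \<in> H ((m + 1) * e)"
proof -
  have "(\<lambda>v. (lc (m + 2) v * lc (m + 3) v) ^ (q - 1) * (\<Prod>j=1..m. lc j v) ^ (e - 1)) \<in> H ((1 + 1) * (q - 1) + card {1..m} * (e - 1))"
    by (intro hom_mult hom_power hom_prod lc_hom) simp
  \<comment> \<open>This equality of degrees is the condition that determines
    \<open>e\<close>.\<close>
  moreover have "(1 + 1) * (q - 1) + card {1..m} * (e - 1) = (m + 1) * e"
  proof -
    define e' where "e' = e - 1"
    have e': "e = Suc e'" using assms unfolding e'_def by linarith
    then show ?thesis using assms by simp
  qed
  ultimately show ?thesis unfolding numer_def[abs_def] by (simp only:)
qed

text \<open>Everything is compared on the torus \<open>box Ja Ja\<close> of the chart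
  \<open>y\<^sub>0 = 1\<close>. There the total is the single monomial with exponent
  \<open>\<beta> q\<close>, whereas each summand is a combination of other Laurent monomials,
  against their independence.\<close>

lemma no_decomposition:
  assumes m: "m \<ge> 2" and p: "prime CHAR('k)" and q: "q = CHAR('k) ^ s" "q \<ge> m + 2" and e: "e = 2 * q - m - 2"
    and G: "\<And>i. i \<le> m \<Longrightarrow> G i \<in> \<O> (Ui i)"
    and F: "\<And>p. p \<in> Uall \<Longrightarrow> (\<Sum>i\<le>m. G i p) = numer q e (rep p) / (\<Prod>j\<le>m. lc j (rep p)) ^ e"
  shows False
proof -
  let ?S = "lspan (zpow Ja) (exponents Ja Ja - {\<beta> q}) (box Ja Ja) :: ((nat \<Rightarrow> 'k) \<Rightarrow> 'k) set"
  have e1: "e = Suc (e - 1)" using q(2) e by simp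
  have zpow_eq: "zpow Ja (\<beta> q) z = (\<Sum>i\<le>m. G i (P 0 z))" if z: "z \<in> box Ja Ja" for z
  proof -
    have nz: "z j \<noteq> 0" if "j \<in> Ja" for j using z that by (simp add: box_def)
    obtain b where b: "b \<noteq> 0" "rep (P 0 z) = (\<lambda>i. b * vec (cu 0 z) i)"
      "\<And>j. j \<le> n \<Longrightarrow> lc j (rep (P 0 z)) = b * cu 0 z j" by (rule rep_P) (rule that)
    have cu: "cu 0 z j \<noteq> 0" if "j \<le> m" for j
      using cu_0[OF m z] nz that by (cases "j = 0") (auto simp: Ja_def)
    have X0: "P 0 z \<in> X" by (rule P_in_X) simp
    have U: "P 0 z \<in> Uall" unfolding Uall_iff using X0 b cu by simp
    let ?Y = "\<Prod>j=1..m. z j"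
    have Y0: "?Y \<noteq> 0" using nz by (auto simp: Ja_def)
    have "(\<Prod>j\<le>m. lc j (rep (P 0 z))) = (\<Prod>j\<le>m. b * cu 0 z j)" using b(3) by (intro prod.cong) auto
    also have "\<dots> = b ^ (m + 1) * (\<Prod>j\<le>m. cu 0 z j)" by (simp add: prod.distrib)
    also have "(\<Prod>j\<le>m. cu 0 z j) = (\<Prod>j\<in>insert 0 {1..m}. cu 0 z j)" by (intro prod.cong) auto
    also have "\<dots> = (\<Prod>j=1..m. cu 0 z j)" using cu_0(1)[OF m z] by simp
    also have "\<dots> = ?Y" using cu_0(2)[OF m z] by (intro prod.cong) auto
    finally have den: "(\<Prod>j\<le>m. lc j (rep (P 0 z))) = b ^ (m + 1) * ?Y" .
    have "numer q e (vec (cu 0 z)) = (z (m + 2) * z (m + 3)) ^ (q - 1) * ?Y ^ (e - 1)"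
    proof -
      have "lc (m + 2) (vec (cu 0 z)) = z (m + 2)" "lc (m + 3) (vec (cu 0 z)) = z (m + 3)"
        using lc_cu cu_0(2)[OF m z] m by simp_all
      moreover have "(\<Prod>j=1..m. lc j (vec (cu 0 z))) = ?Y"
        using lc_cu cu_0(2)[OF m z] by (intro prod.cong) auto
      ultimately show ?thesis by (simp only: numer_def)
    qed
    then have num: "numer q e (rep (P 0 z)) = b ^ ((m + 1) * e) * ((z (m + 2) * z (m + 3)) ^ (q - 1) * ?Y ^ (e - 1))"
      unfolding b(2) hom_homogeneous[OF numer_hom[OF q(2) e]] by simp
    have "(\<Sum>i\<le>m. G i (P 0 z)) = b ^ ((m + 1) * e) * ((z (m + 2) * z (m + 3)) ^ (q - 1) * ?Y ^ (e - 1)) / (b ^ (m + 1) * ?Y) ^ e"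
      unfolding F[OF U] num den ..
    also have "\<dots> = (z (m + 2) * z (m + 3)) ^ (q - 1) * ?Y ^ (e - 1) / ?Y ^ Suc (e - 1)"
      unfolding power_mult_distrib power_mult[symmetric] e1[symmetric] using b(1) by simp
    also have "\<dots> = inverse ?Y * (z (m + 2) * z (m + 3)) ^ (q - 1)" using Y0 by (simp add: field_simps)
    also have "\<dots> = zpow Ja (\<beta> q) z"
    proof -
      have "zpow Ja (\<beta> q) z = (\<Prod>j=1..m. z j powi \<beta> q j) * (\<Prod>j\<in>{m + 2, m + 3}. z j powi \<beta> q j)"
        unfolding zpow_def Ja_def by (intro prod.union_disjoint) auto
      also have "(\<Prod>j=1..m. z j powi \<beta> q j) = (\<Prod>j=1..m. inverse (z j))"
        by (intro prod.cong) (auto simp: \<beta>_def power_int_minus)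
      also have "(\<Prod>j\<in>{m + 2, m + 3}. z j powi \<beta> q j) = (z (m + 2) * z (m + 3)) ^ (q - 1)"
        by (simp add: \<beta>_def power_mult_distrib)
      finally show ?thesis using prod_inversef[of z "{1..m}"] by (simp add: o_def)
    qed
    finally show ?thesis by simp
  qed
  have Ja: "finite Ja" by (simp add: Ja_def)
  \<comment> \<open>Because \<open>y\<^sub>i\<close> may vanish on \<open>Ui i\<close>, it is not
    among the inverted coordinates of the box, which excludes \<open>\<beta> q\<close> with its
    exponent -1 at \<open>i\<close>.\<close>
  have pos: "(\<lambda>z. G i (P 0 z)) \<in> ?S" if i: "i \<in> {1..m}" for i
  proof -
    have "P 0 z \<in> Ui i" if z: "z \<in> box Ja ({1..m} - {i})" for z
    proof (rule P_in_Ui)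
      fix j assume j: "j \<le> m" "j \<noteq> i"
      show "cu 0 z j \<noteq> 0" using z j by (cases "j = 0") (auto simp: box_def cu_def conj_def)
    qed simp
    from regular_chart[OF _ G this] have "regular_on_box Ja ({1..m} - {i}) (\<lambda>z. G i (P 0 z))" using i by simp
    from regular_on_box_laurent[OF Ja _ this]
    have "(\<lambda>z. G i (P 0 z)) \<in> lspan (zpow Ja) (exponents Ja ({1..m} - {i})) (box Ja ({1..m} - {i}))"
      by (auto simp: Ja_def)
    then show ?thesis
    proof (rule lspan_mono)
      have iJ: "i \<in> Ja - ({1..m} - {i})" using i by (simp add: Ja_def)
      have "\<beta> q \<notin> exponents Ja ({1..m} - {i})"
      proof
        assume "\<beta> q \<in> exponents Ja ({1..m} - {i})"
        then have "\<beta> q i \<ge> 0" unfolding exponents_def using iJ by blast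
        then show False using i by (simp add: \<beta>_def)
      qed
      then show "exponents Ja ({1..m} - {i}) \<subseteq> exponents Ja Ja - {\<beta> q}" by (auto simp: exponents_def)
      show "box Ja Ja \<subseteq> (box Ja ({1..m} - {i}) :: (nat \<Rightarrow> 'k) set)" by (auto simp: box_def Ja_def)
    qed
  qed
  \<comment> \<open>The chart \<open>y\<^sub>0 = 1\<close> does not see that \<open>G 0\<close> is
    regular along \<open>y\<^sub>0 = 0\<close>. The chart \<open>y\<^sub>1 = 1\<close> does: there
    the exponent of \<open>y\<^sub>0\<close> is nonnegative, which
    \<open>monomial_transition\<close> exploits.\<close>
  have zero: "(\<lambda>z. G 0 (P 0 z)) \<in> ?S"
  proof -
    have c: "(1::nat) \<le> n" by simp
    have "P 1 z \<in> Ui 0" if z: "z \<in> box Jb {2..m}" for z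
    proof (rule P_in_Ui[OF c])
      fix j assume j: "j \<le> m" "j \<noteq> 0"
      show "cu 1 z j \<noteq> 0" using z j m by (cases "j = 1") (auto simp: box_def cu_def conj_def)
    qed
    from regular_chart[OF c G this] have "regular_on_box Jb {2..m} (\<lambda>z. G 0 (P 1 z))" by simp
    from regular_on_box_laurent[OF _ _ this]
    have "(\<lambda>z. G 0 (P 1 z)) \<in> lspan (zpow Jb) (exponents Jb {2..m}) (box Jb {2..m})"
      by (auto simp: Jb_def)
    then obtain A cc where A: "finite A" "A \<subseteq> exponents Jb {2..m}"
      "\<And>z. z \<in> box Jb {2..m} \<Longrightarrow> G 0 (P 1 z) = (\<Sum>\<alpha>\<in>A. cc \<alpha> * zpow Jb \<alpha> z)"
      by (rule lspanE) (rule that)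
    have "(\<lambda>z. \<Sum>\<alpha>\<in>A. cc \<alpha> * zpow Jb \<alpha> (\<zeta> z)) \<in> ?S"
      using A(2) by (intro lspan_sum lspan_scale monomial_transition[OF m p q]) auto
    then show ?thesis
    proof (rule lspan_cong)
      fix z :: "nat \<Rightarrow> 'k" assume z: "z \<in> box Ja Ja"
      show "G 0 (P 0 z) = (\<Sum>\<alpha>\<in>A. cc \<alpha> * zpow Jb \<alpha> (\<zeta> z))"
        using A(3)[OF \<zeta>_chart(2)[OF m z]] unfolding \<zeta>_chart(1)[OF m z] .
    qed
  qed
  have "(\<lambda>z. G i (P 0 z)) \<in> ?S" if "i \<in> {..m}" for i
    using pos[of i] zero that by (cases "i = 0") auto
  then have "(\<lambda>z. \<Sum>i\<le>m. G i (P 0 z)) \<in> ?S" by (rule lspan_sum)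
  then have "zpow Ja (\<beta> q) \<in> ?S" by (rule lspan_cong) (rule zpow_eq)
  moreover have "\<beta> q \<in> exponents Ja Ja" by (auto simp: exponents_def \<beta>_def Ja_def)
  ultimately show False using zpow_notin_span[OF infinite_alg_closed Ja, of "\<beta> q"] by blast
qed

end

section \<open>Contradiction with the vanishing of the first cohomology\<close>

theorem theorem1p1:
  fixes m :: nat
    and a :: "nat \<Rightarrow> nat \<Rightarrow> 'k::alg_closed_field"
    and emb :: "'k \<Rightarrow> 'b"
  assumes "CHAR('k) \<ge> 3"
    and "m \<ge> 2"
    and "smooth_quadric (2 * m) a"
    and "inj emb"
  shows "\<not> D_affine TYPE('b) (zariski (2 * m + 1) (quadric (2 * m) a))
           (regular_functions (2 * m + 1) (quadric (2 * m) a))"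
proof
  assume affine: "D_affine TYPE('b) (zariski (2 * m + 1) (quadric (2 * m) a))
           (regular_functions (2 * m + 1) (quadric (2 * m) a))"
  have p: "prime CHAR('k)" using assms(1) by (intro prime_CHAR_semidom) simp
  have "(of_nat 2 :: 'k) \<noteq> 0"
    unfolding of_nat_eq_0_iff_char_dvd using assms(1) by (auto dest: dvd_imp_le)
  then have "(2::'k) \<noteq> 0" by simp
  from hyperbolic_coordinates_exist[OF assms(3) this]
  obtain E l where hyp: "hyperbolic_coordinates m a E l" by (elim exE)
  interpret even_quadric m a E l
    by (rule even_quadric.intro[OF hyp], rule even_quadric_axioms.intro) (use assms(2) in simp)
  from encoding_exists[OF assms(4)]
  obtain enc :: "_ \<Rightarrow> _ \<Rightarrow> 'b" where enc: "\<forall>V. openin T V \<longrightarrow> inj_on (enc V) (N V)" by (elim exE)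
  interpret encoded_fraction_sheaf T \<O> "{..m}" Ui Den chart enc
    by (rule encoded_fraction_sheaf.intro[OF fraction_sheaf_axioms], rule encoded_fraction_sheaf_axioms.intro)
      (use enc in blast)
  have H1: "trivial_group (cohomology T (\<lambda>U. add_monoid (M U)) rr 1)"
    using affine D_module_M unfolding D_affine_def by simp
  \<comment> \<open>Large enough for \<open>q \<ge> m + 2\<close>, because already
    \<open>2 ^ (m + 2) > m + 2\<close>.\<close>
  define s where "s = m + 2"
  define q where "q = CHAR('k) ^ s"
  define e where "e = 2 * q - m - 2"
  have "m + 2 < 2 ^ s" unfolding s_def by (rule less_exp)
  also have "2 ^ s \<le> q" unfolding q_def using assms(1) by (intro power_mono) auto
  finally have q: "q \<ge> m + 2" by simp
  note numer = numer_hom[OF q e_def]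
  have "\<exists>G. (\<forall>i\<in>{..m}. G i \<in> C i (topspace T)) \<and>
    (\<forall>p\<in>topspace T \<inter> Uall. (\<Sum>i\<in>{..m}. G i p) = numer q e (rep p) / (\<Prod>j\<le>m. lc j (rep p)) ^ e)"
    by (rule lift_global[OF H1 local_lift[OF _ numer]]) (simp only: topspace_T)
  then obtain G where G: "\<forall>i\<in>{..m}. G i \<in> C i (topspace T)"
    "\<forall>p\<in>topspace T \<inter> Uall. (\<Sum>i\<in>{..m}. G i p) = numer q e (rep p) / (\<Prod>j\<le>m. lc j (rep p)) ^ e"
    by (elim exE conjE) (rule that)
  show False
  proof (rule no_decomposition[OF assms(2) p q_def q e_def])
    fix i assume "i \<le> m"
    then have "G i \<in> \<O> (topspace T \<inter> Ui i)" using G(1) C_O by simp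
    moreover have "topspace T \<inter> Ui i = Ui i" using openin_subset[OF Ui_open] by blast
    ultimately show "G i \<in> \<O> (Ui i)" by simp
  next
    fix x assume x: "x \<in> Uall"
    then have "x \<in> topspace T" using openin_subset[OF Uall_open] by blast
    then show "(\<Sum>i\<le>m. G i x) = numer q e (rep x) / (\<Prod>j\<le>m. lc j (rep x)) ^ e" using G(2) x by blast
  qed
qed

end
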